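(* Let $\mathsf N,\mathsf T,\mathsf S,\mathsf q,\mathsf k$ and the probability measures $\mathbb P_\varepsilon$, $\varepsilon\in(0,1)$, on lozenge tilings be as in the context, and let $h$ be the random height function of a tiling distributed according to $\mathbb P_\varepsilon$. Let $\mathcal P$ be the limiting hexagon and $\hat h:\mathcal P\to\mathbb R$ the function defined in the context. Then for any $(x,y)\in\mathcal P$ and $\eta>0$ $$\lim_{\varepsilon\to0^+}\mathbb P_\varepsilon\Big(\big|\varepsilon\,h\big(\lfloor x\varepsilon^{-1}\rfloor,\lfloor y\varepsilon^{-1}\rfloor+1/2\big)-\hat h(x,y)\big|>\eta\Big)=0.$$
   Context: Tiling model. For integers $a,b,c\ge1$ put $N=a$, $T=b+c$, $S=c$. Consider the hexagon on the unit triangular lattice with vertices $(0,0)$, $(0,a)$, $(\tfrac{\sqrt3}2c,a+\tfrac c2)$, $(\tfrac{\sqrt3}2(b+c),a+\tfrac{c-b}2)$, $(\tfrac{\sqrt3}2(b+c),\tfrac{c-b}2)$, $(\tfrac{\sqrt3}2b,-\tfrac b2)$. A lozenge is a union of two adjacent unit triangles; it is horizontal if it has no vertical side. For $q\in(0,1)$ and $\kappa\in[0,q^{(b+c-1)/2})$ the probability of a lozenge tiling of the hexagon is proportional to $$\prod_{\text{horizontal lozenges}}\left(\kappa^2q^{\,j-(c+1)/2}-q^{-j+(c+1)/2}\right),$$ where $j$ is the ordinate of the topmost point of the lozenge. Particles. Tilings are in bijection with families of integers $x^t_1<\dots<x^t_N$, $0\le t\le T$, with $\{x^0_k\}=\{0,\dots,N-1\}$,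 $\{x^T_k\}=\{S,\dots,S+N-1\}$ and $x^{t+1}_k-x^t_k\in\{0,1\}$ (the intersections with vertical lines of the $N$ non-intersecting paths formed by the non-horizontal lozenges). The horizontal lozenges correspond to the holes, i.e. pairs of integers $(t,y)$ with $1\le t\le T-1$, $\max(0,t+S-T)\le y\le\min(t,S)+N-1$, $y\notin\{x^t_k\}$; the corresponding lozenge has $j=y+1-t/2$. The height function is $h(t,s)=|\{k\in\{1,\dots,N\}:x^t_k<s\}|$ for $s\in\mathbb Z+\frac12$ (with $h(t,\cdot)=h(T,\cdot)$ if $t>T$). Scaling. Fixed reals $\mathsf N,\mathsf T,\mathsf S,\mathsf q>0$, $\mathsf k\ge0$ with $\mathsf q<1$, $\mathsf N<\mathsf T$, $\mathsf S<\mathsf T$, $\mathsf k^2\mathsf q^{-\mathsf T}<1$. $\mathbb P_\varepsilon$ is the probability measure on lozenge tilings of the hexagon with $a=N$, $b=T-S$, $c=S$ under which the probability of a tiling is proportional to $\prod_{\text{horizontal lozenges}}\left(\kappa^2q^{\,j-(S+1)/2}-q^{-j+(S+1)/2}\right)$ ($j$ being the ordinate of the topmost point of the lozenge), with parameters (depending on $\varepsilon$) $q=\mathsf q^\varepsilon+O(\varepsilon^2)$, $N=\mathsf N\varepsilon^{-1}+O(1)$, $T=\mathsf T\varepsilon^{-1}+O(1)$, $S=\mathsf S\varepsilon^{-1}+O(1)$, $\kappa=\mathsf k+O(\varepsilon)$. Limit shape. $\mathcal P=\{(x,y):0\le x\le\mathsf T,\ \max(0,x+\mathsf S-\mathsf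 T)\le y\le\min(x,\mathsf S)+\mathsf N\}$. For $(x,y)$ in the interior of $\mathcal P$, and for a.e. $y$ in each vertical slice of $\mathcal P$, $$\phi(x,y)=\arccos\left(\frac{(\mathsf q^{-\mathsf N}-1)(1-\mathsf q^{-\mathsf N-\mathsf T})(\mathsf q^{-2y}-\mathsf k^2\mathsf q^{-x-\mathsf S})^2+A+B}{2\sqrt{AB}}\right),$$ $$A=(\mathsf q^{-y}-\mathsf q^{-\mathsf S-\mathsf N})(\mathsf q^{-y}-\mathsf k^2\mathsf q^{-\mathsf T})(\mathsf q^{-y}-\mathsf q^{-x-\mathsf N})(\mathsf q^{-y}-\mathsf k^2\mathsf q^{-x-\mathsf S}),$$ $$B=\mathsf q^{-2\mathsf N-\mathsf T}(\mathsf q^{-y}-1)(\mathsf q^{-y}-\mathsf k^2\mathsf q^{-x+\mathsf N})(\mathsf q^{-y}-\mathsf q^{-x-\mathsf S+\mathsf T})(\mathsf q^{-y}-\mathsf k^2\mathsf q^{-\mathsf S+\mathsf N}),$$ with the convention $\phi=0$ if the argument of $\arccos$ exceeds $1$ and $\phi=\pi$ if it is less than $-1$; $\phi=0$ outside $\mathcal P$. Then $\hat h(x,y)=\frac1\pi\int_0^y\phi(x,r)\,dr$. *)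

theory Defs
  imports "HOL-Analysis.Analysis" "HOL-Library.Landau_Symbols"
begin

(* Vertices of the unit triangular lattice that has vertical lattice lines.  The second index is
   sheared: the vertex lattice_pt t y lies on the t-th vertical line and has ordinate y - t/2. *)
definition lattice_pt :: "int \<Rightarrow> int \<Rightarrow> real \<times> real" where
  "lattice_pt t y = (sqrt 3 / 2 * real_of_int t, real_of_int y - real_of_int t / 2)"

definition tri_lattice :: "(real \<times> real) set" where
  "tri_lattice = {lattice_pt t y | t y. True}"

(* Two adjacent unit triangles are spanned by a common side u v and by distinct apexes w and z. *)
definition lozenges :: "(real \<times> real) set set" where
  "lozenges = {convex hull {u, v, w} \<union> convex hull {u, v, z} | u v w z.
     {u, v, w, z} \<subseteq> tri_lattice \<and> w \<noteq> z \<and> dist u v = 1 \<and>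
     dist u w = 1 \<and> dist v w = 1 \<and> dist u z = 1 \<and> dist v z = 1}"

definition horizontal :: "(real \<times> real) set \<Rightarrow> bool" where
  "horizontal L \<longleftrightarrow> \<not> (\<exists>e s. e edge_of L \<and> e \<subseteq> {p. fst p = s})"

definition hexagon :: "nat \<Rightarrow> nat \<Rightarrow> nat \<Rightarrow> (real \<times> real) set" where
  "hexagon a b c = convex hull
     {(0, 0),
      (0, real a),
      (sqrt 3 / 2 * real c, real a + real c / 2),
      (sqrt 3 / 2 * (real b + real c), real a + (real c - real b) / 2),
      (sqrt 3 / 2 * (real b + real c), (real c - real b) / 2),
      (sqrt 3 / 2 * real b, - real b / 2)}"

definition lozenge_tilings :: "nat \<Rightarrow> nat \<Rightarrow> nat \<Rightarrow> (real \<times> real) set set set" where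
  "lozenge_tilings a b c = {\<T>. \<T> \<subseteq> lozenges \<and> \<Union>\<T> = hexagon a b c \<and>
     pairwise (\<lambda>L L'. interior L \<inter> interior L' = {}) \<T>}"

definition top_ordinate :: "(real \<times> real) set \<Rightarrow> real" where
  "top_ordinate L = Sup (snd ` L)"

definition tiling_weight :: "nat \<Rightarrow> real \<Rightarrow> real \<Rightarrow> (real \<times> real) set set \<Rightarrow> real" where
  "tiling_weight c q \<kappa> \<T> =
     (\<Prod>L\<in>{L \<in> \<T>. horizontal L}.
        \<kappa>\<^sup>2 * q powr (top_ordinate L - (real c + 1) / 2) - q powr (- top_ordinate L + (real c + 1) / 2))"

(* For 0 < q < 1 and 0 \<le> \<kappa> < q powr ((b + c - 1) / 2) every factor of every weight is negative.
   All tilings of the hexagon have the same number of horizontal lozenges, so all weights have the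
   same sign, the quotient below is positive, and the coercion to ennreal truncates nothing. *)
definition tiling_measure ::
    "nat \<Rightarrow> nat \<Rightarrow> nat \<Rightarrow> real \<Rightarrow> real \<Rightarrow> (real \<times> real) set set measure" where
  "tiling_measure a b c q \<kappa> = point_measure (lozenge_tilings a b c)
     (\<lambda>\<T>. ennreal (tiling_weight c q \<kappa> \<T> / (\<Sum>\<T>'\<in>lozenge_tilings a b c. tiling_weight c q \<kappa> \<T>')))"

(* The non-horizontal lozenges form non-intersecting paths that cross the vertical lattice lines
   through the vertical sides of these lozenges.  Such a side on the t-th line is recorded by the
   sheared index y of its lower end, so on line 0 the positions are 0, ..., a - 1; a horizontal
   lozenge whose vertical diagonal starts at index y has topmost ordinate y + 1 - t/2. *)
definition particles :: "(real \<times> real) set set \<Rightarrow> int \<Rightarrow> int set" where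
  "particles \<T> t = {y. \<exists>L\<in>\<T>. \<not> horizontal L \<and>
     closed_segment (lattice_pt t y) (lattice_pt t (y + 1)) edge_of L}"

(* T = b + c is the index of the right side of the hexagon. *)
definition height :: "nat \<Rightarrow> (real \<times> real) set set \<Rightarrow> int \<Rightarrow> real \<Rightarrow> nat" where
  "height T \<T> t s = card {y \<in> particles \<T> (min t (int T)). real_of_int y < s}"

definition limit_hexagon :: "real \<Rightarrow> real \<Rightarrow> real \<Rightarrow> (real \<times> real) set" where
  "limit_hexagon N T S =
     {(x, y). 0 \<le> x \<and> x \<le> T \<and> max 0 (x + S - T) \<le> y \<and> y \<le> min x S + N}"

definition arccos_clamped :: "real \<Rightarrow> real" where
  "arccos_clamped u = (if u > 1 then 0 else if u < - 1 then pi else arccos u)"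

definition shape_A :: "real \<Rightarrow> real \<Rightarrow> real \<Rightarrow> real \<Rightarrow> real \<Rightarrow> real \<Rightarrow> real \<Rightarrow> real" where
  "shape_A N T S q k x y =
     (q powr (-y) - q powr (-S - N)) * (q powr (-y) - k\<^sup>2 * q powr (-T)) *
     (q powr (-y) - q powr (-x - N)) * (q powr (-y) - k\<^sup>2 * q powr (-x - S))"

definition shape_B :: "real \<Rightarrow> real \<Rightarrow> real \<Rightarrow> real \<Rightarrow> real \<Rightarrow> real \<Rightarrow> real \<Rightarrow> real" where
  "shape_B N T S q k x y =
     q powr (-2 * N - T) *
     (q powr (-y) - 1) * (q powr (-y) - k\<^sup>2 * q powr (-x + N)) *
     (q powr (-y) - q powr (-x - S + T)) * (q powr (-y) - k\<^sup>2 * q powr (-S + N))"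

(* Under 0 < q < 1 and k\<^sup>2 * q powr (-T) < 1 the product A * B is positive in the limiting hexagon
   except possibly at the two ends of each vertical slice.  At these ends A * B can vanish, and the
   value of the formula there is irrelevant, since only integrals over slices are used. *)
definition shape_phi :: "real \<Rightarrow> real \<Rightarrow> real \<Rightarrow> real \<Rightarrow> real \<Rightarrow> real \<Rightarrow> real \<Rightarrow> real" where
  "shape_phi N T S q k x y =
     (if (x, y) \<in> limit_hexagon N T S then
        arccos_clamped
          (((q powr (-N) - 1) * (1 - q powr (-N - T)) *
              (q powr (-2 * y) - k\<^sup>2 * q powr (-x - S))\<^sup>2
            + shape_A N T S q k x y + shape_B N T S q k x y)
           / (2 * sqrt (shape_A N T S q k x y * shape_B N T S q k x y)))
      else 0)"

definition limit_height :: "real \<Rightarrow> real \<Rightarrow> real \<Rightarrow> real \<Rightarrow> real \<Rightarrow> real \<Rightarrow> real \<Rightarrow> real" where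
  "limit_height N T S q k x y = 1 / pi * integral {0..y} (shape_phi N T S q k x)"

end

theory Submission
  imports Defs "Jordan_Normal_Form.Determinant" "HOL-Computational_Algebra.Polynomial"
begin

text \<open>On the \<open>t\<close>-th vertical line the particles form a determinantal projection ensemble: their law is a squared
  Vandermonde determinant in \<open>\<sigma>(y) = q\<^sup>-\<^sup>y + \<kappa>\<^sup>2 q\<^sup>1\<^sup>-\<^sup>t\<^sup>-\<^sup>S q\<^sup>y\<close> times a product of weights \<open>W(y)\<close>. This is obtained by summing over the paths
  one line at a time, since one step maps such a determinant (times single particle weights) to a determinant of the
  same form. Hence the number of particles in a set \<open>B\<close> has mean \<open>\<Sum>\<^sub>k\<^sub><\<^sub>N \<Sum>\<^sub>y\<^sub>\<in>\<^sub>B P\<^sub>k(\<sigma>(y))\<^sup>2 W(y)\<close>, where \<open>P\<^sub>k\<close> are the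
  polynomials orthonormal for \<open>W\<close>, and its variance is at most its mean, so that the height concentrates by Chebyshev's
  inequality. Composing two polynomial shift operators gives a tridiagonal operator that has \<open>P\<^sub>k\<close> as its eigenvectors with
  explicit eigenvalues, increasing in \<open>k\<close>. Therefore \<open>\<Sum>\<^sub>k\<^sub><\<^sub>N P\<^sub>k\<^sup>2 W\<close> is the diagonal of a spectral projection. In the
  limit the operator is locally the Toeplitz operator with symbol \<open>a + b - 2 sqrt(a b) cos \<theta>\<close>, and approximating the
  indicator of the spectral interval by polynomials shows that the local density of particles is the proportion
  of \<open>\<theta> \<in> [0, \<pi>]\<close> for which the symbol lies below the limiting \<open>N\<close>-th eigenvalue. This proportion is \<open>\<phi> / \<pi>\<close>.\<close>

section \<open>Lozenge tilings and perfect matchings of the unit triangles\<close>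

text \<open>The squared Vandermonde form survives a step because the ratios of the single particle
  weights on adjacent lines are the two coefficients of an antisymmetrising operator, which maps
  polynomials in the variable of one line to polynomials of no larger degree in the variable of the
  next. All constants, the total weight included, stay implicit and cancel in probabilities. The
  orthonormal polynomials are never computed either: an operator that is symmetric for
  \<open>W\<close> and does not raise degrees must have them as eigenvectors, with eigenvalues read
  off from leading coefficients. The obstacle in the limit is the jump of the indicator at the
  limiting eigenvalue. Polynomial approximation fails there, and the local error is not controlled
  uniformly in the position. It is bounded globally instead: the eigenvalues are explicit, only
  O(\<delta> / \<epsilon>) of them lie near the jump, and each eigenvector has total mass one. The
  same count, passed to the limit, bounds the integral over the slice of the limiting local
  error.\<close>

definition sh_u :: "real \<times> real \<Rightarrow> real" where "sh_u p = 2 / sqrt 3 * fst p"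
definition sh_v :: "real \<times> real \<Rightarrow> real" where "sh_v p = snd p + fst p / sqrt 3"

text \<open>These coordinates turn the lattice into the integer grid, and the three directions of
  lattice lines into constant \<open>sh_u\<close>, constant \<open>sh_v\<close> and constant
  \<open>sh_u - sh_v\<close>.\<close>

lemma sh_lattice_pt [simp]:
  "sh_u (lattice_pt t y) = of_int t" "sh_v (lattice_pt t y) = of_int y"
  by (auto simp: sh_u_def sh_v_def lattice_pt_def field_simps)

lemma sh_inj: "sh_u p = sh_u p' \<Longrightarrow> sh_v p = sh_v p' \<Longrightarrow> p = p'"
  by (auto simp: sh_u_def sh_v_def prod_eq_iff)

lemma linear_sh: "linear sh_u" "linear sh_v"
  by (auto intro!: linearI simp: sh_u_def sh_v_def field_simps)

lemma sh_simps [simp]: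
  "sh_u (p + p') = sh_u p + sh_u p'" "sh_v (p + p') = sh_v p + sh_v p'"
  "sh_u (r *\<^sub>R p) = r * sh_u p" "sh_v (r *\<^sub>R p) = r * sh_v p"
  by (auto simp: sh_u_def sh_v_def field_simps)

lemma lattice_pt_inj [simp]: "lattice_pt t y = lattice_pt t' y' \<longleftrightarrow> t = t' \<and> y = y'"
  by (metis sh_lattice_pt of_int_eq_iff)

text \<open>The diagonal of the sheared unit square with lower left corner \<open>(t, y)\<close>
  cuts it into \<open>RT t y\<close>, whose vertical side lies on line \<open>t\<close>, and
  \<open>LT t y\<close>, whose vertical side lies on line \<open>t + 1\<close>. The names tell the
  direction in which the triangle points.\<close>

datatype tri = RT int int | LT int int

fun cell :: "tri \<Rightarrow> (real \<times> real) set" where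
  "cell (RT t y) = {p. of_int t \<le> sh_u p \<and> sh_u p - of_int t \<le> sh_v p - of_int y \<and> sh_v p \<le> of_int y + 1}"
| "cell (LT t y) = {p. of_int y \<le> sh_v p \<and> sh_v p - of_int y \<le> sh_u p - of_int t \<and> sh_u p \<le> of_int t + 1}"

lemma cell_RT_hull:
  "convex hull {lattice_pt t y, lattice_pt t (y+1), lattice_pt (t+1) (y+1)} = cell (RT t y)" (is "?L = ?R")
proof
  show "?L \<subseteq> ?R"
    unfolding convex_hull_3 by (auto simp: algebra_simps)
       (smt (verit, ccfv_SIG) distrib_right mult_cancel_right1)+
  show "?R \<subseteq> ?L"
  proof
    fix p assume p: "p \<in> ?R"
    define w where "w = sh_u p - t"
    define v where "v = sh_v p - y - w"
    have "p = (1 - v - w) *\<^sub>R lattice_pt t y + v *\<^sub>R lattice_pt t (y+1) + w *\<^sub>R lattice_pt (t+1) (y+1)"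
      by (rule sh_inj) (simp_all, simp_all add: v_def w_def algebra_simps)
    moreover have "0 \<le> 1 - v - w" "0 \<le> v" "0 \<le> w" using p by (auto simp: v_def w_def)
    ultimately show "p \<in> ?L" unfolding convex_hull_3
      by (intro CollectI exI[of _ "1-v-w"] exI[of _ v] exI[of _ w]) auto
  qed
qed

lemma cell_LT_hull:
  "convex hull {lattice_pt t y, lattice_pt (t+1) y, lattice_pt (t+1) (y+1)} = cell (LT t y)" (is "?L = ?R")
proof
  show "?L \<subseteq> ?R"
    unfolding convex_hull_3 by (auto simp: algebra_simps)
       (smt (verit, ccfv_SIG) distrib_right mult_cancel_right1)+
  show "?R \<subseteq> ?L"
  proof
    fix p assume p: "p \<in> ?R"
    define w where "w = sh_v p - y"
    define v where "v = sh_u p - t - w"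
    have "p = (1 - v - w) *\<^sub>R lattice_pt t y + v *\<^sub>R lattice_pt (t+1) y + w *\<^sub>R lattice_pt (t+1) (y+1)"
      by (rule sh_inj) (simp_all, simp_all add: v_def w_def algebra_simps)
    moreover have "0 \<le> 1 - v - w" "0 \<le> v" "0 \<le> w" using p by (auto simp: v_def w_def)
    ultimately show "p \<in> ?L" unfolding convex_hull_3
      by (intro CollectI exI[of _ "1-v-w"] exI[of _ v] exI[of _ w]) auto
  qed
qed

text \<open>In the sheared differences \<open>a\<close> and \<open>b\<close> the squared distance is
  the form a^2 - ab + b^2. Four times this form is 3 a^2 + (a - 2b)^2, which confines both entries
  to -1, 0 and 1.\<close>

lemma dist_lattice_pt:
  "dist (lattice_pt t y) (lattice_pt t' y') = 1 \<longleftrightarrow>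
     (t' - t, y' - y) \<in> {(0,1),(0,-1),(1,0),(1,1),(-1,0),(-1,-1)}" (is "?L = ?R")
proof -
  define a b where "a = t' - t" and "b = y' - y"
  have "dist (lattice_pt t y) (lattice_pt t' y') = sqrt ((sqrt 3 / 2 * a)\<^sup>2 + (b - a / 2)\<^sup>2)"
    by (simp add: dist_prod_def lattice_pt_def dist_real_def a_def b_def power2_commute[of "real_of_int t"]
        flip: right_diff_distrib) (simp add: algebra_simps power2_eq_square diff_divide_distrib)
  also have "(sqrt 3 / 2 * a)\<^sup>2 + (b - a / 2)\<^sup>2 = real_of_int (a*a - a*b + b*b)"
    by (simp add: power2_eq_square field_simps)
  also have "sqrt \<dots> = 1 \<longleftrightarrow> a*a - a*b + b*b = 1"
    by (metis of_int_eq_1_iff real_sqrt_eq_1_iff)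
  also have "\<dots> \<longleftrightarrow> (a, b) \<in> {(0,1),(0,-1),(1,0),(1,1),(-1,0),(-1,-1)}"
  proof
    assume h: "a*a - a*b + b*b = 1"
    have "3*(a*a) \<le> 4" "3 * (b*b) \<le> 4"
      using h zero_le_square[of "a - 2*b"] zero_le_square[of "b - 2*a"] by (auto simp: algebra_simps)
    hence "a*a < 2*2" "b*b < 2*2" by auto
    hence "\<bar>a\<bar> < 2" "\<bar>b\<bar> < 2" by (metis abs_ge_zero abs_mult abs_numeral linorder_not_less mult_mono' abs_square_less_1 abs_le_square_iff power2_eq_square)+
    hence "a \<in> {-1,0,1}" "b \<in> {-1,0,1}" by auto
    thus "(a, b) \<in> {(0,1),(0,-1),(1,0),(1,1),(-1,0),(-1,-1)}" using h by auto
  qed auto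
  finally show ?thesis unfolding a_def b_def .
qed

text \<open>\<open>Hz t y\<close> has its vertical diagonal on line \<open>t\<close>, from
  \<open>y\<close> to \<open>y + 1\<close>. \<open>V0 t y\<close> and \<open>V1 t y\<close> cross
  the strip between lines \<open>t\<close> and \<open>t + 1\<close>: their left side is at
  \<open>y\<close>, their right side at \<open>y\<close>, respectively \<open>y + 1\<close>. These
  are the two possible steps of a path.\<close>

datatype loz = Hz int int | V0 int int | V1 int int

fun tris :: "loz \<Rightarrow> tri set" where
  "tris (Hz t y) = {LT (t-1) y, RT t y}"
| "tris (V0 t y) = {RT t y, LT t y}"
| "tris (V1 t y) = {RT t y, LT t (y+1)}"

definition shape :: "loz \<Rightarrow> (real \<times> real) set" where "shape l = (\<Union>\<tau>\<in>tris l. cell \<tau>)"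

lemma tris_inj: "tris l = tris l' \<Longrightarrow> l = l'"
  by (cases l; cases l') (auto simp: doubleton_eq_iff)

text \<open>The centroid is a test point: it is interior to its own triangle and lies in no other
  one, so it decides which triangles a union of triangles contains.\<close>

fun ctr :: "tri \<Rightarrow> real \<times> real" where
  "ctr (RT t y) = (1/3) *\<^sub>R lattice_pt t y + (1/3) *\<^sub>R lattice_pt t (y+1) + (1/3) *\<^sub>R lattice_pt (t+1) (y+1)"
| "ctr (LT t y) = (1/3) *\<^sub>R lattice_pt t y + (1/3) *\<^sub>R lattice_pt (t+1) y + (1/3) *\<^sub>R lattice_pt (t+1) (y+1)"

lemma sh_ctr:
  "sh_u (ctr (RT t y)) = t + 1/3" "sh_v (ctr (RT t y)) = y + 2/3"
  "sh_u (ctr (LT t y)) = t + 2/3" "sh_v (ctr (LT t y)) = y + 1/3"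
  by (simp_all add: field_simps)

lemma ctr_in_cell [simp]: "ctr \<tau> \<in> cell \<tau>' \<longleftrightarrow> \<tau> = \<tau>'"
proof -
  have k: "real_of_int a \<le> real_of_int b + r \<longleftrightarrow> a \<le> b" if "0 \<le> r" "r < 1" for a b :: int and r
  proof
    assume "real_of_int a \<le> real_of_int b + r"
    hence "real_of_int a < real_of_int b + 1" using that by linarith
    thus "a \<le> b" by (simp add: int_le_real_less)
  next
    assume "a \<le> b"
    hence "real_of_int a \<le> real_of_int b" by simp
    thus "real_of_int a \<le> real_of_int b + r" using that by linarith
  qed
  have r: "real_of_int a \<le> b + 1/3 \<longleftrightarrow> a \<le> b" "real_of_int a \<le> b + 2/3 \<longleftrightarrow> a \<le> b"
    "real_of_int a + 1/3 \<le> b \<longleftrightarrow> a < b" "real_of_int a + 2/3 \<le> b + 1 \<longleftrightarrow> a \<le> b"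
    "real_of_int a + 1/3 \<le> b + 1 \<longleftrightarrow> a \<le> b" for a b :: int
  proof -
    show "real_of_int a \<le> b + 1/3 \<longleftrightarrow> a \<le> b" "real_of_int a \<le> b + 2/3 \<longleftrightarrow> a \<le> b"
      by (rule k; simp)+
    have "(real_of_int a + 1/3 \<le> b) = (real_of_int a \<le> real_of_int (b - 1) + 2/3)" by auto
    also have "\<dots> = (a \<le> b - 1)" by (rule k) auto
    finally show "real_of_int a + 1/3 \<le> b \<longleftrightarrow> a < b" by simp
    have "(real_of_int a + 2/3 \<le> b + 1) = (real_of_int a \<le> real_of_int b + 1/3)" by auto
    also have "\<dots> = (a \<le> b)" by (rule k) auto
    finally show "real_of_int a + 2/3 \<le> b + 1 \<longleftrightarrow> a \<le> b" by simp
    have "(real_of_int a + 1/3 \<le> b + 1) = (real_of_int a \<le> real_of_int b + 2/3)" by auto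
    also have "\<dots> = (a \<le> b)" by (rule k) auto
    finally show "real_of_int a + 1/3 \<le> b + 1 \<longleftrightarrow> a \<le> b" by simp
  qed
  have s: "real_of_int a + 1/3 - b \<le> real_of_int c + 2/3 - d \<longleftrightarrow> a - b \<le> c - d"
    "real_of_int a + 2/3 - b \<le> real_of_int c + 1/3 - d \<longleftrightarrow> a - b < c - d" for a b c d :: int
  proof -
    have "(real_of_int a + 1/3 - b \<le> real_of_int c + 2/3 - d) = (real_of_int (a - b) \<le> real_of_int (c - d) + 1/3)" by auto
    also have "\<dots> = (a - b \<le> c - d)" by (rule k) auto
    finally show "real_of_int a + 1/3 - b \<le> real_of_int c + 2/3 - d \<longleftrightarrow> a - b \<le> c - d" .
    have "(real_of_int a + 2/3 - b \<le> real_of_int c + 1/3 - d) = (real_of_int (a - b) + 1/3 \<le> real_of_int (c - d))" by auto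
    also have "\<dots> = (a - b < c - d)" by (rule r)
    finally show "real_of_int a + 2/3 - b \<le> real_of_int c + 1/3 - d \<longleftrightarrow> a - b < c - d" .
  qed
  show ?thesis
    by (cases \<tau>; cases \<tau>') (auto simp: sh_ctr r s simp del: ctr.simps)
qed

lemma ctr_in_shape [simp]: "ctr \<tau> \<in> shape l \<longleftrightarrow> \<tau> \<in> tris l"
  by (auto simp: shape_def)

lemma shape_inj: "shape l = shape l' \<Longrightarrow> l = l'"
proof -
  assume "shape l = shape l'"
  hence "{\<tau>. ctr \<tau> \<in> shape l} = {\<tau>. ctr \<tau> \<in> shape l'}" by simp
  thus ?thesis by (intro tris_inj) auto
qed

lemma continuous_sh [continuous_intros]: "continuous_on A sh_u" "continuous_on A sh_v"
  using linear_sh by (auto intro: linear_continuous_on linear_conv_bounded_linear[THEN iffD1])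

lemma ctr_interior_cell: "ctr \<tau> \<in> interior (cell \<tau>)"
proof (cases \<tau>)
  case (RT t y)
  have "open {p. of_int t < sh_u p \<and> sh_u p - of_int t < sh_v p - of_int y \<and> sh_v p < of_int y + 1}"
    by (intro open_Collect_conj open_Collect_less continuous_intros)
  moreover have "ctr \<tau> \<in> \<dots>" using RT by (auto simp: field_simps)
  ultimately show ?thesis using RT by (intro interiorI) auto
next
  case (LT t y)
  have "open {p. of_int y < sh_v p \<and> sh_v p - of_int y < sh_u p - of_int t \<and> sh_u p < of_int t + 1}"
    by (intro open_Collect_conj open_Collect_less continuous_intros)
  moreover have "ctr \<tau> \<in> \<dots>" using LT by (auto simp: field_simps)
  ultimately show ?thesis using LT by (intro interiorI) auto
qed

lemma closed_cell: "closed (cell \<tau>)"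
  by (cases \<tau>) (auto intro!: closed_Collect_conj closed_Collect_le continuous_intros)

text \<open>A null set off which every point lies in exactly one triangle. Overlaps of interiors are
  tested at a point off \<open>grid\<close>, which every nonempty open set contains.\<close>

definition grid :: "(real \<times> real) set" where
  "grid = (\<Union>n::int. {p. sh_u p = n} \<union> {p. sh_v p = n} \<union> {p. sh_u p - sh_v p = n})"

lemma negligible_grid: "negligible grid"
proof -
  have "negligible {p. sh_u p = n}" "negligible {p. sh_v p = n}" "negligible {p. sh_u p - sh_v p = n}" for n :: real
  proof -
    have "sh_u p = (2 / sqrt 3, 0) \<bullet> p" "sh_v p = (1 / sqrt 3, 1) \<bullet> p"
        "sh_u p - sh_v p = (1 / sqrt 3, -1) \<bullet> p" for p
      by (auto simp: sh_u_def sh_v_def inner_prod_def field_simps)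
    moreover have "negligible {p. (2 / sqrt 3, 0) \<bullet> p = n}" "negligible {p. (1 / sqrt 3, 1::real) \<bullet> p = n}"
      "negligible {p. (1 / sqrt 3, -1::real) \<bullet> p = n}"
      by (rule negligible_hyperplane; simp add: zero_prod_def)+
    ultimately show "negligible {p. sh_u p = n}" "negligible {p. sh_v p = n}" "negligible {p. sh_u p - sh_v p = n}"
      by (metis (no_types, lifting) Collect_cong)+
  qed
  thus ?thesis unfolding grid_def by (intro negligible_countable_Union) (auto intro!: negligible_Un)
qed

lemma generic_cell_unique:
  assumes "p \<notin> grid" "p \<in> cell \<tau>" "p \<in> cell \<tau>'" shows "\<tau> = \<tau>'"
proof -
  have *: "sh_u p \<noteq> of_int n" "sh_v p \<noteq> of_int n" "sh_u p - sh_v p \<noteq> of_int n" for n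
    using assms(1) by (auto simp: grid_def)
  have ***: "sh_u p - of_int t \<noteq> sh_v p - of_int y" for t y using *(3)[of "t - y"] by auto
  have **: "\<tau> = (if sh_u p - \<lfloor>sh_u p\<rfloor> \<le> sh_v p - \<lfloor>sh_v p\<rfloor> then RT \<lfloor>sh_u p\<rfloor> \<lfloor>sh_v p\<rfloor> else LT \<lfloor>sh_u p\<rfloor> \<lfloor>sh_v p\<rfloor>)"
    if "p \<in> cell \<tau>" for \<tau>
  proof (cases \<tau>)
    case (RT t y)
    have "\<lfloor>sh_u p\<rfloor> = t" "\<lfloor>sh_v p\<rfloor> = y"
      using that RT *(1)[of t] *(2)[of "y+1"] ***[of t y] by (auto simp: floor_eq_iff)
    thus ?thesis using that RT by auto
  next
    case (LT t y)
    have "\<lfloor>sh_u p\<rfloor> = t" "\<lfloor>sh_v p\<rfloor> = y"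
      using that LT *(2)[of y] *(1)[of "t+1"] ***[of t y] by (auto simp: floor_eq_iff)
    thus ?thesis using that LT ***[of t y] by auto
  qed
  show ?thesis using **[OF assms(2)] **[OF assms(3)] by simp
qed

lemma generic_cell_exists:
  assumes "p \<notin> grid" shows "p \<in> cell (RT \<lfloor>sh_u p\<rfloor> \<lfloor>sh_v p\<rfloor>) \<or> p \<in> cell (LT \<lfloor>sh_u p\<rfloor> \<lfloor>sh_v p\<rfloor>)"
  by auto

lemma open_has_generic:
  assumes "open O'" "O' \<noteq> {}" shows "\<exists>p\<in>O'. p \<notin> grid"
  using assms open_not_negligible negligible_subset[OF negligible_grid] by blast

lemma shape_interior_disjoint:
  "interior (shape l) \<inter> interior (shape l') = {} \<longleftrightarrow> tris l \<inter> tris l' = {}"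
proof
  assume h: "interior (shape l) \<inter> interior (shape l') = {}"
  show "tris l \<inter> tris l' = {}"
  proof (rule ccontr)
    assume "tris l \<inter> tris l' \<noteq> {}"
    then obtain \<tau> where "\<tau> \<in> tris l" "\<tau> \<in> tris l'" by auto
    hence "interior (cell \<tau>) \<subseteq> interior (shape l)" "interior (cell \<tau>) \<subseteq> interior (shape l')"
      by (auto simp: shape_def intro!: interior_mono)
    thus False using h ctr_interior_cell[of \<tau>] by auto
  qed
next
  assume h: "tris l \<inter> tris l' = {}"
  show "interior (shape l) \<inter> interior (shape l') = {}"
  proof (rule ccontr)
    assume "interior (shape l) \<inter> interior (shape l') \<noteq> {}"
    then obtain p where p: "p \<in> interior (shape l) \<inter> interior (shape l')" "p \<notin> grid"
      using open_has_generic[OF open_Int[OF open_interior open_interior]] by blast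
    hence "p \<in> shape l" "p \<in> shape l'" using interior_subset by auto
    then obtain \<tau> \<tau>' where "\<tau> \<in> tris l" "p \<in> cell \<tau>" "\<tau>' \<in> tris l'" "p \<in> cell \<tau>'" by (auto simp: shape_def)
    thus False using generic_cell_unique[OF p(2)] h by blast
  qed
qed

section \<open>The hexagon as a union of unit triangles\<close>

definition hex_tris :: "nat \<Rightarrow> nat \<Rightarrow> nat \<Rightarrow> tri set" where
  "hex_tris a b c = {\<tau>. cell \<tau> \<subseteq> hexagon a b c}"

text \<open>For the inclusion from right to left a point is placed between a point of the lower and
  a point of the upper boundary on the same vertical line. Each of these is a convex combination of
  two vertices, chosen according to the side of \<open>b\<close>, respectively \<open>c\<close>, on
  which the abscissa lies.\<close>

lemma hexagon_eq:
  assumes "b \<ge> 1" "c \<ge> 1"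
  shows "hexagon a b c = {p. 0 \<le> sh_u p \<and> sh_u p \<le> b + c \<and> 0 \<le> sh_v p \<and> sh_v p \<le> a + c \<and>
     sh_u p - b \<le> sh_v p \<and> sh_v p \<le> sh_u p + a}" (is "_ = ?R")
proof -
  define A B C D E F where "A = lattice_pt 0 0" and "B = lattice_pt 0 a" and "C = lattice_pt c (a + c)"
    and "D = lattice_pt (b+c) (a+c)" and "E = lattice_pt (b+c) c" and "F = lattice_pt b 0"
  note defs = A_def B_def C_def D_def E_def F_def
  have hex: "hexagon a b c = convex hull {A, B, C, D, E, F}"
    unfolding hexagon_def defs lattice_pt_def by (simp add: zero_prod_def field_simps)
  show ?thesis
  proof
    have "convex {p. 0 \<le> sh_u p}" "convex {p. sh_u p \<le> b + c}" "convex {p. 0 \<le> sh_v p}" "convex {p. sh_v p \<le> a + c}"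
        "convex {p. sh_u p - b \<le> sh_v p}" "convex {p. sh_v p \<le> sh_u p + a}"
    proof -
      have *: "sh_u p = (2 / sqrt 3, 0) \<bullet> p" "sh_v p = (1 / sqrt 3, 1) \<bullet> p" for p
        by (auto simp: sh_u_def sh_v_def inner_prod_def field_simps)
      have "sh_u p - sh_v p = (1 / sqrt 3, -1) \<bullet> p" for p
        by (auto simp: sh_u_def sh_v_def inner_prod_def field_simps)
      hence **: "sh_u p - b \<le> sh_v p \<longleftrightarrow> (1 / sqrt 3, -1) \<bullet> p \<le> b" "sh_v p \<le> sh_u p + a \<longleftrightarrow> (1 / sqrt 3, -1) \<bullet> p \<ge> - real a" for p
        by (smt (verit))+
      show "convex {p. 0 \<le> sh_u p}" "convex {p. sh_u p \<le> b + c}" "convex {p. 0 \<le> sh_v p}" "convex {p. sh_v p \<le> a + c}"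
        unfolding * by (rule convex_halfspace_le convex_halfspace_ge)+
      show "convex {p. sh_u p - b \<le> sh_v p}" "convex {p. sh_v p \<le> sh_u p + a}"
        unfolding ** by (rule convex_halfspace_le convex_halfspace_ge)+
    qed
    hence "convex ?R"
      by (simp only: Collect_conj_eq) (intro convex_Int; assumption)
    thus "hexagon a b c \<subseteq> ?R" unfolding hex
      by (intro hull_minimal) (auto simp: defs)
  next
    let ?H = "convex hull {A, B, C, D, E, F}"
    have cl: "(1 - r) *\<^sub>R p + r *\<^sub>R p' \<in> ?H" if "p \<in> ?H" "p' \<in> ?H" "0 \<le> r" "r \<le> 1" for p p' r
      using convexD_alt[OF convex_convex_hull that(1,2), of r] that by simp
    have V: "A \<in> ?H" "B \<in> ?H" "C \<in> ?H" "D \<in> ?H" "E \<in> ?H" "F \<in> ?H" by (auto intro: hull_inc)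
    have lower: "\<exists>p\<in>?H. sh_u p = u \<and> sh_v p = max 0 (u - b)" if u: "0 \<le> u" "u \<le> b + c" for u :: real
    proof (cases "u \<le> b")
      case True
      have "(1 - u / b) *\<^sub>R A + (u / b) *\<^sub>R F \<in> ?H" using u True assms V by (intro cl) (auto simp: field_simps)
      thus ?thesis using u True assms by (rule_tac bexI) (auto simp: defs)
    next
      case False
      have "(1 - (u - b) / c) *\<^sub>R F + ((u - b) / c) *\<^sub>R E \<in> ?H" using u False assms V by (intro cl) (auto simp: field_simps)
      thus ?thesis using u False assms by (rule_tac bexI) (auto simp: defs field_simps)
    qed
    have upper: "\<exists>p\<in>?H. sh_u p = u \<and> sh_v p = min u c + a" if u: "0 \<le> u" "u \<le> b + c" for u :: real
    proof (cases "u \<le> c")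
      case True
      have "(1 - u / c) *\<^sub>R B + (u / c) *\<^sub>R C \<in> ?H" using u True assms V by (intro cl) (auto simp: field_simps)
      thus ?thesis using u True assms by (rule_tac bexI) (auto simp: defs field_simps)
    next
      case False
      have "(1 - (u - c) / b) *\<^sub>R C + ((u - c) / b) *\<^sub>R D \<in> ?H" using u False assms V by (intro cl) (auto simp: field_simps)
      thus ?thesis using u False assms by (rule_tac bexI) (auto simp: defs field_simps)
    qed
    show "?R \<subseteq> hexagon a b c"
    proof
      fix p assume p: "p \<in> ?R"
      obtain l where l: "l \<in> ?H" "sh_u l = sh_u p" "sh_v l = max 0 (sh_u p - b)" using lower[of "sh_u p"] p by auto
      obtain h where h: "h \<in> ?H" "sh_u h = sh_u p" "sh_v h = min (sh_u p) c + a" using upper[of "sh_u p"] p by auto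
      have le: "sh_v l \<le> sh_v p" "sh_v p \<le> sh_v h" using p l h by auto
      show "p \<in> hexagon a b c"
      proof (cases "sh_v l = sh_v h")
        case True
        hence "p = l" using le l by (intro sh_inj) auto
        thus ?thesis using l hex by simp
      next
        case False
        define r where "r = (sh_v p - sh_v l) / (sh_v h - sh_v l)"
        have r: "0 \<le> r" "r \<le> 1" using le False by (auto simp: r_def field_simps)
        have "r * (sh_v h - sh_v l) = sh_v p - sh_v l" using False by (simp add: r_def)
        hence "p = (1 - r) *\<^sub>R l + r *\<^sub>R h" using l h
          by (intro sh_inj) (simp_all, simp_all add: algebra_simps)
        thus ?thesis using cl[OF l(1) h(1) r] hex by simp
      qed
    qed
  qed
qed

text \<open>Lower ends of the unit segments of line \<open>t\<close> inside the hexagon, that is,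
  the sites shared by particles and holes.\<close>

definition rng :: "int \<Rightarrow> int \<Rightarrow> int \<Rightarrow> int \<Rightarrow> int set" where
  "rng N T S t = {max 0 (t + S - T) .. min t S + N - 1}"

context
  fixes a b c :: nat
  assumes abc: "a \<ge> 1" "b \<ge> 1" "c \<ge> 1"
begin

lemma lattice_pt_hexagon:
  "lattice_pt t y \<in> hexagon a b c \<longleftrightarrow> 0 \<le> t \<and> t \<le> b + c \<and> max 0 (t - b) \<le> y \<and> y \<le> min t c + a"
proof -
  have "real_of_int t - b \<le> y \<longleftrightarrow> t - int b \<le> y" "real_of_int y \<le> t + a \<longleftrightarrow> y \<le> t + a"
    "real_of_int t \<le> b + c \<longleftrightarrow> t \<le> b + c" "real_of_int y \<le> a + c \<longleftrightarrow> y \<le> a + c"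
    by linarith+
  thus ?thesis unfolding hexagon_eq[OF abc(2,3)] by auto
qed

lemma convex_hexagon: "convex (hexagon a b c)" by (simp add: hexagon_def)

lemma RT_hex: "RT t y \<in> hex_tris a b c \<longleftrightarrow> 0 \<le> t \<and> t < int b + int c \<and> y \<in> rng a (int b + int c) c t"
proof -
  have "RT t y \<in> hex_tris a b c \<longleftrightarrow> lattice_pt t y \<in> hexagon a b c \<and> lattice_pt t (y+1) \<in> hexagon a b c \<and> lattice_pt (t+1) (y+1) \<in> hexagon a b c"
    unfolding hex_tris_def mem_Collect_eq cell_RT_hull[symmetric] subset_hull[where S = convex, OF convex_hexagon] by simp
  thus ?thesis unfolding lattice_pt_hexagon rng_def by auto
qed

lemma LT_hex: "LT t y \<in> hex_tris a b c \<longleftrightarrow> 0 \<le> t \<and> t < int b + int c \<and> y \<in> rng a (int b + int c) c (t+1)"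
proof -
  have "LT t y \<in> hex_tris a b c \<longleftrightarrow> lattice_pt t y \<in> hexagon a b c \<and> lattice_pt (t+1) y \<in> hexagon a b c \<and> lattice_pt (t+1) (y+1) \<in> hexagon a b c"
    unfolding hex_tris_def mem_Collect_eq cell_LT_hull[symmetric] subset_hull[where S = convex, OF convex_hexagon] by simp
  thus ?thesis unfolding lattice_pt_hexagon rng_def by auto
qed

lemma finite_hex_tris: "finite (hex_tris a b c)"
proof -
  have "hex_tris a b c \<subseteq> (\<lambda>(t,y). RT t y) ` ({0..int (b+c)} \<times> {0..int (a+c)}) \<union> (\<lambda>(t,y). LT t y) ` ({0..int (b+c)} \<times> {0..int (a+c)})"
  proof
    fix \<tau> assume "\<tau> \<in> hex_tris a b c"
    thus "\<tau> \<in> (\<lambda>(t,y). RT t y) ` ({0..int (b+c)} \<times> {0..int (a+c)}) \<union> (\<lambda>(t,y). LT t y) ` ({0..int (b+c)} \<times> {0..int (a+c)})"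
      by (cases \<tau>) (force simp: RT_hex LT_hex rng_def)+
  qed
  thus ?thesis by (rule finite_subset) auto
qed

text \<open>Off \<open>grid\<close> the floors of the coordinates give the square around a point,
  and the strict inequalities make its triangle fit into the hexagon. The remaining points follow by
  density: the finite union is closed, and the hexagon is contained in the closure of its
  interior.\<close>

lemma hexagon_cells: "hexagon a b c = (\<Union>\<tau>\<in>hex_tris a b c. cell \<tau>)"
proof
  show "(\<Union>\<tau>\<in>hex_tris a b c. cell \<tau>) \<subseteq> hexagon a b c" by (auto simp: hex_tris_def)
  let ?C = "\<Union>\<tau>\<in>hex_tris a b c. cell \<tau>"
  have gen: "p \<in> ?C" if p: "p \<in> hexagon a b c" "p \<notin> grid" for p
  proof -
    have g: "sh_u p \<noteq> of_int n" "sh_v p \<noteq> of_int n" "sh_u p - sh_v p \<noteq> of_int n" for n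
      using p(2) by (auto simp: grid_def)
    define t y where "t = \<lfloor>sh_u p\<rfloor>" and "y = \<lfloor>sh_v p\<rfloor>"
    have ty: "t < sh_u p" "sh_u p < t + 1" "y < sh_v p" "sh_v p < y + 1"
      using g(1)[of t] g(2)[of y] unfolding t_def y_def by linarith+
    have ineq: "0 < sh_u p" "sh_u p < b + c" "0 < sh_v p" "sh_v p < a + c" "sh_u p - sh_v p < b" "- a < sh_u p - sh_v p"
      using p(1) g(1)[of 0] g(1)[of "b+c"] g(2)[of 0] g(2)[of "a+c"] g(3)[of b] g(3)[of "-a"]
      unfolding hexagon_eq[OF abc(2,3)] by auto
    have b1: "0 \<le> t" "t < int b + int c" "0 \<le> y" "y < a + c" using ty ineq by linarith+
    show ?thesis
    proof (cases "p \<in> cell (RT t y)")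
      case True
      hence "t - b < y + 1" "y < t + a" using ty ineq by auto
      hence "RT t y \<in> hex_tris a b c" using b1 by (auto simp: RT_hex rng_def)
      thus ?thesis using True by blast
    next
      case False
      hence F: "p \<in> cell (LT t y)" using generic_cell_exists[OF p(2)] by (auto simp: t_def y_def)
      hence "t - b < y" "y < t + 1 + a" using ty ineq by auto
      hence "LT t y \<in> hex_tris a b c" using b1 by (auto simp: LT_hex rng_def)
      thus ?thesis using F by blast
    qed
  qed
  have cl: "closed ?C" using finite_hex_tris closed_cell by auto
  have "interior (hexagon a b c) \<noteq> {}"
    using ctr_interior_cell[of "RT 0 0"] interior_mono[of "cell (RT 0 0)" "hexagon a b c"] RT_hex[of 0 0] abc
    by (auto simp: hex_tris_def rng_def)
  hence "hexagon a b c \<subseteq> closure (interior (hexagon a b c))"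
    using convex_closure_interior[OF convex_hexagon] closure_subset by auto
  also have "interior (hexagon a b c) \<subseteq> closure ?C"
  proof
    fix p assume p: "p \<in> interior (hexagon a b c)"
    show "p \<in> closure ?C"
    proof (rule closure_iff_nhds_not_empty[THEN iffD2], safe)
      fix A V assume V: "V \<subseteq> A" "open V" "p \<in> V" "?C \<inter> A = {}"
      obtain p' where "p' \<in> V \<inter> interior (hexagon a b c)" "p' \<notin> grid"
        using open_has_generic[OF open_Int[OF V(2) open_interior]] V(3) p by blast
      hence "p' \<in> ?C \<inter> A" using gen[of p'] interior_subset V by blast
      thus "False" using V by blast
    qed
  qed
  finally show "hexagon a b c \<subseteq> ?C" using closure_closed[OF cl] by (metis closure_closure closure_mono)
qed

end

section \<open>Lattice lozenges, their vertical edges and their top points\<close>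

lemma finite_rng [simp]: "finite (rng N T S t)" by (simp add: rng_def)

text \<open>The two solutions are the rotations of \<open>(d1, d2)\<close> by sixty degrees in
  either sense.\<close>

lemma common_neighbour:
  assumes "((d1::int), (d2::int)) \<in> {(0,1),(0,-1),(1,0),(1,1),(-1,0),(-1,-1)}"
    "(f1, f2) \<in> {(0,1),(0,-1),(1,0),(1,1),(-1,0),(-1,-1)}"
    "(f1 - d1, f2 - d2) \<in> {(0,1),(0,-1),(1,0),(1,1),(-1,0),(-1,-1)}"
  shows "(f1, f2) = (d1 - d2, d1) \<or> (f1, f2) = (d2, d2 - d1)"
  using assms by (elim insertE emptyE; simp; fail)

text \<open>The distinct apexes \<open>w\<close> and \<open>z\<close> must be the two common
  neighbours of the shared side, so the lozenge is determined by this side. The six directions of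
  the side give three types, since opposite directions give the same lozenge.\<close>

lemma lozenges_eq: "lozenges = range shape"
proof
  have s: "shape (Hz t y) = convex hull {lattice_pt t y, lattice_pt t (y+1), lattice_pt (t-1) y} \<union>
              convex hull {lattice_pt t y, lattice_pt t (y+1), lattice_pt (t+1) (y+1)}"
          "shape (V0 t y) = convex hull {lattice_pt t y, lattice_pt (t+1) (y+1), lattice_pt t (y+1)} \<union>
              convex hull {lattice_pt t y, lattice_pt (t+1) (y+1), lattice_pt (t+1) y}"
          "shape (V1 t y) = convex hull {lattice_pt t (y+1), lattice_pt (t+1) (y+1), lattice_pt t y} \<union>
              convex hull {lattice_pt t (y+1), lattice_pt (t+1) (y+1), lattice_pt (t+1) (y+2)}" for t y
    using cell_RT_hull[of t y] cell_LT_hull[of t y] cell_LT_hull[of "t-1" y] cell_LT_hull[of t "y+1"]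
    by (simp_all add: shape_def insert_commute Un_commute add.commute[of 2])
  show "range shape \<subseteq> lozenges"
  proof safe
    fix l show "shape l \<in> lozenges"
    proof (cases l)
      case (Hz t y)
      show ?thesis unfolding Hz lozenges_def s
        by (intro CollectI exI conjI; (rule refl)?) (auto simp: tri_lattice_def dist_lattice_pt)
    next
      case (V0 t y)
      show ?thesis unfolding V0 lozenges_def s
        by (intro CollectI exI conjI; (rule refl)?) (auto simp: tri_lattice_def dist_lattice_pt)
    next
      case (V1 t y)
      show ?thesis unfolding V1 lozenges_def s
        by (intro CollectI exI conjI; (rule refl)?) (auto simp: tri_lattice_def dist_lattice_pt)
    qed
  qed
  show "lozenges \<subseteq> range shape"
  proof
    fix L assume "L \<in> lozenges"
    then obtain u v w z where L: "L = convex hull {u, v, w} \<union> convex hull {u, v, z}"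
      and uvwz: "{u, v, w, z} \<subseteq> tri_lattice" "w \<noteq> z" "dist u v = 1"
        "dist u w = 1" "dist v w = 1" "dist u z = 1" "dist v z = 1"
      unfolding lozenges_def by blast
    obtain t y v1 v2 w1 w2 z1 z2 where e: "u = lattice_pt t y" "v = lattice_pt v1 v2" "w = lattice_pt w1 w2" "z = lattice_pt z1 z2"
      using uvwz(1) by (auto simp: tri_lattice_def)
    obtain d1 d2 where d: "v1 = t + d1" "v2 = y + d2" by (metis add_diff_cancel_left' diff_add_cancel add.commute)
    obtain f1 f2 where f: "w1 = t + f1" "w2 = y + f2" by (metis add_diff_cancel_left' diff_add_cancel add.commute)
    obtain g1 g2 where g: "z1 = t + g1" "z2 = y + g2" by (metis add_diff_cancel_left' diff_add_cancel add.commute)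
    have D: "(d1, d2) \<in> {(0,1),(0,-1),(1,0),(1,1),(-1,0),(-1,-1)}"
      "(f1, f2) \<in> {(0,1),(0,-1),(1,0),(1,1),(-1,0),(-1,-1)}" "(g1, g2) \<in> {(0,1),(0,-1),(1,0),(1,1),(-1,0),(-1,-1)}"
      "(f1 - d1, f2 - d2) \<in> {(0,1),(0,-1),(1,0),(1,1),(-1,0),(-1,-1)}"
      "(g1 - d1, g2 - d2) \<in> {(0,1),(0,-1),(1,0),(1,1),(-1,0),(-1,-1)}" "(f1,f2) \<noteq> (g1,g2)"
      using uvwz unfolding e d f g dist_lattice_pt by auto
    have cases: "(d1 = 0 \<and> d2 = 1 \<and> {(f1,f2),(g1,g2)} = {(-1,0),(1,1)}) \<or> (d1 = 0 \<and> d2 = -1 \<and> {(f1,f2),(g1,g2)} = {(-1,-1),(1,0)})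
      \<or> (d1 = 1 \<and> d2 = 0 \<and> {(f1,f2),(g1,g2)} = {(0,-1),(1,1)}) \<or> (d1 = 1 \<and> d2 = 1 \<and> {(f1,f2),(g1,g2)} = {(0,1),(1,0)})
      \<or> (d1 = -1 \<and> d2 = 0 \<and> {(f1,f2),(g1,g2)} = {(0,1),(-1,-1)}) \<or> (d1 = -1 \<and> d2 = -1 \<and> {(f1,f2),(g1,g2)} = {(-1,0),(0,-1)})"
    proof -
      have "{(f1,f2),(g1,g2)} = {(d1 - d2, d1), (d2, d2 - d1)}"
        using common_neighbour[OF D(1,2,4)] common_neighbour[OF D(1,3,5)] D(6) by auto
      then show ?thesis using D(1) by (elim insertE) (auto simp: doubleton_eq_iff)
    qed
    let ?h = "\<lambda>p. convex hull {lattice_pt t y, lattice_pt (t+d1) (y+d2), lattice_pt (t + fst p) (y + snd p)}"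
    have L': "L = \<Union> (?h ` {(f1,f2),(g1,g2)})" unfolding L e d f g by simp
    from cases show "L \<in> range shape"
    proof (elim disjE conjE)
      assume "d1 = 0" "d2 = 1" "{(f1,f2),(g1,g2)} = {(-1,0),(1,1)}"
      hence "L = shape (Hz t y)" unfolding L' s by simp
      thus ?thesis by blast
    next
      assume "d1 = 0" "d2 = -1" "{(f1,f2),(g1,g2)} = {(-1,-1),(1,0)}"
      hence "L = shape (Hz t (y-1))" unfolding L' s by (simp add: insert_commute Un_commute add.commute)
      thus ?thesis by blast
    next
      assume "d1 = 1" "d2 = 0" "{(f1,f2),(g1,g2)} = {(0,-1),(1,1)}"
      hence "L = shape (V1 t (y-1))" unfolding L' s by (simp add: insert_commute Un_commute add.commute)
      thus ?thesis by blast
    next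
      assume "d1 = 1" "d2 = 1" "{(f1,f2),(g1,g2)} = {(0,1),(1,0)}"
      hence "L = shape (V0 t y)" unfolding L' s by (simp add: insert_commute Un_commute add.commute)
      thus ?thesis by blast
    next
      assume "d1 = -1" "d2 = 0" "{(f1,f2),(g1,g2)} = {(0,1),(-1,-1)}"
      hence "L = shape (V1 (t-1) (y-1))" unfolding L' s by (simp add: insert_commute Un_commute add.commute)
      thus ?thesis by blast
    next
      assume "d1 = -1" "d2 = -1" "{(f1,f2),(g1,g2)} = {(-1,0),(0,-1)}"
      hence "L = shape (V0 (t-1) (y-1))" unfolding L' s by (simp add: insert_commute Un_commute add.commute)
      thus ?thesis by blast
    qed
  qed
qed

lemma shape_simps:
  "shape (Hz t y) = {p. of_int y \<le> sh_v p \<and> sh_v p \<le> of_int y + 1 \<and> of_int y - of_int t \<le> sh_v p - sh_u p \<and> sh_v p - sh_u p \<le> of_int y - of_int t + 1}"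
  "shape (V0 t y) = {p. of_int t \<le> sh_u p \<and> sh_u p \<le> of_int t + 1 \<and> of_int y \<le> sh_v p \<and> sh_v p \<le> of_int y + 1}"
  "shape (V1 t y) = {p. of_int t \<le> sh_u p \<and> sh_u p \<le> of_int t + 1 \<and> of_int y - of_int t \<le> sh_v p - sh_u p \<and> sh_v p - sh_u p \<le> of_int y - of_int t + 1}"
  by (auto simp: shape_def)

lemma closed_segment_vertical:
  "closed_segment (lattice_pt t y) (lattice_pt t (y+1)) = {p. sh_u p = of_int t \<and> of_int y \<le> sh_v p \<and> sh_v p \<le> of_int y + 1}" (is "?L = ?R")
proof
  show "?L \<subseteq> ?R" by (auto simp: closed_segment_def) (simp_all add: algebra_simps)
  show "?R \<subseteq> ?L"
  proof
    fix p assume p: "p \<in> ?R"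
    have "p = (1 - (sh_v p - y)) *\<^sub>R lattice_pt t y + (sh_v p - y) *\<^sub>R lattice_pt t (y+1)"
      using p by (intro sh_inj) (simp_all, simp_all add: algebra_simps)
    thus "p \<in> ?L" using p unfolding closed_segment_def
      by (intro CollectI exI[of _ "sh_v p - y"]) auto
  qed
qed

lemma sh_u_fst: "sh_u p = s \<longleftrightarrow> fst p = sqrt 3 / 2 * s"
  by (auto simp: sh_u_def field_simps)

text \<open>Each vertical side is cut out of the convex lozenge by a supporting line of constant
  \<open>sh_u\<close>. It is therefore a face, and its affine dimension is one.\<close>

lemma edge_left_right:
  assumes "l = V0 t y \<or> l = V1 t y"
  shows "closed_segment (lattice_pt t y) (lattice_pt t (y+1)) edge_of shape l"
    "l = V0 t y \<Longrightarrow> closed_segment (lattice_pt (t+1) y) (lattice_pt (t+1) (y+1)) edge_of shape l"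
    "l = V1 t y \<Longrightarrow> closed_segment (lattice_pt (t+1) (y+1)) (lattice_pt (t+1) (y+2)) edge_of shape l"
proof -
  define e1 where "e1 = (2 / sqrt 3, 0::real)"
  have in1: "e1 \<bullet> p = sh_u p" for p by (simp add: e1_def sh_u_def inner_prod_def)
  have "convex {p. of_int t \<le> sh_u p}" "convex {p. sh_u p \<le> r}"  "convex {p. of_int t \<le> sh_v p}" "convex {p. sh_v p \<le> r}"
     "convex {p. sh_v p - sh_u p \<le> r}" "convex {p. r \<le> sh_v p - sh_u p}" for t r
  proof -
    have *: "sh_u p = (2 / sqrt 3, 0) \<bullet> p" "sh_v p = (1 / sqrt 3, 1) \<bullet> p" for p
      by (auto simp: sh_u_def sh_v_def inner_prod_def field_simps)
    show "convex {p. of_int t \<le> sh_u p}" "convex {p. sh_u p \<le> r}"  "convex {p. of_int t \<le> sh_v p}" "convex {p. sh_v p \<le> r}"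
      unfolding * by (rule convex_halfspace_le convex_halfspace_ge)+
    have **: "sh_v p - sh_u p = (-1 / sqrt 3, 1) \<bullet> p" for p
      by (auto simp: sh_u_def sh_v_def inner_prod_def field_simps)
    show "convex {p. sh_v p - sh_u p \<le> r}" "convex {p. r \<le> sh_v p - sh_u p}"
      unfolding ** by (rule convex_halfspace_le convex_halfspace_ge)+
  qed note cv = this
  have cvx: "convex (shape l)"
  proof -
    have "shape (V0 t y) = {p. of_int t \<le> sh_u p} \<inter> {p. sh_u p \<le> of_int t + 1} \<inter> ({p. of_int y \<le> sh_v p} \<inter> {p. sh_v p \<le> of_int y + 1})"
      by (auto simp: shape_simps)
    moreover have "shape (V1 t y) = {p. of_int t \<le> sh_u p} \<inter> {p. sh_u p \<le> of_int t + 1} \<inter>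
        ({p. of_int y - of_int t \<le> sh_v p - sh_u p} \<inter> {p. sh_v p - sh_u p \<le> of_int y - of_int t + 1})"
      by (auto simp: shape_simps)
    moreover have "convex \<dots>" by (intro convex_Int; rule cv)
    moreover have "convex ({p. of_int t \<le> sh_u p} \<inter> {p. sh_u p \<le> of_int t + 1} \<inter> ({p. of_int y \<le> sh_v p} \<inter> {p. sh_v p \<le> of_int y + 1}))"
      by (intro convex_Int; rule cv)
    ultimately show ?thesis using assms by metis
  qed
  have ne: "aff_dim (closed_segment (lattice_pt t y) (lattice_pt t (y+1))) = 1" for t y
    by (simp add: segment_convex_hull aff_dim_convex_hull aff_dim_2)
  have left: "shape l \<inter> {p. e1 \<bullet> p = r} face_of shape l" if "r \<in> {of_int t, of_int t + 1}" for r
  proof (cases "r = of_int t")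
    case True
    have "\<And>p. p \<in> shape l \<Longrightarrow> e1 \<bullet> p \<ge> r" unfolding in1 True using assms by (elim disjE) (simp_all add: shape_simps)
    thus ?thesis by (intro face_of_Int_supporting_hyperplane_ge[OF cvx])
  next
    case False
    hence r: "r = of_int t + 1" using that by simp
    have "\<And>p. p \<in> shape l \<Longrightarrow> e1 \<bullet> p \<le> r" unfolding in1 r using assms by (elim disjE) (simp_all add: shape_simps)
    thus ?thesis by (intro face_of_Int_supporting_hyperplane_le[OF cvx])
  qed
  have "shape l \<inter> {p. e1 \<bullet> p = of_int t} = closed_segment (lattice_pt t y) (lattice_pt t (y+1))"
    unfolding in1 closed_segment_vertical using assms by (elim disjE) (auto simp: shape_simps)
  thus "closed_segment (lattice_pt t y) (lattice_pt t (y+1)) edge_of shape l"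
    using left[of "of_int t"] ne unfolding edge_of_def by simp
  show "closed_segment (lattice_pt (t+1) y) (lattice_pt (t+1) (y+1)) edge_of shape l" if "l = V0 t y"
  proof -
    have "shape l \<inter> {p. e1 \<bullet> p = of_int t + 1} = closed_segment (lattice_pt (t+1) y) (lattice_pt (t+1) (y+1))"
      unfolding in1 closed_segment_vertical that by (auto simp: shape_simps)
    thus ?thesis using left[of "of_int t + 1"] ne unfolding edge_of_def by simp
  qed
  show "closed_segment (lattice_pt (t+1) (y+1)) (lattice_pt (t+1) (y+2)) edge_of shape l" if "l = V1 t y"
  proof -
    have "shape l \<inter> {p. e1 \<bullet> p = of_int t + 1} = closed_segment (lattice_pt (t+1) (y+1)) (lattice_pt (t+1) (y+1+1))"
      unfolding in1 closed_segment_vertical that by (auto simp: shape_simps)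
    thus ?thesis using left[of "of_int t + 1"] ne[of "t+1" "y+1"] unfolding edge_of_def by (simp add: add.commute[of 2])
  qed
qed

lemma horizontal_shape: "horizontal (shape l) \<longleftrightarrow> (\<exists>t y. l = Hz t y)"
proof (cases l)
  case (Hz t y)
  have "\<not> (e edge_of shape l \<and> e \<subseteq> {p. fst p = s})" for e s
  proof
    assume e: "e edge_of shape l \<and> e \<subseteq> {p. fst p = s}"
    hence f: "e face_of shape l" "aff_dim e = 1" by (auto simp: edge_of_def)
    have "e \<noteq> {}" "\<not> (\<exists>a. e = {a})" using f(2) by auto
    then obtain p p' where p: "p \<in> e" "p' \<in> e" "p \<noteq> p'" by blast
    have u: "sh_u p = sh_u p'" using p e by (auto simp: sh_u_def)
    hence v: "sh_v p \<noteq> sh_v p'" using sh_inj p by blast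
    \<comment> \<open>The midpoint of two distinct points of \<open>Hz t y\<close> on one vertical
      line satisfies all four defining inequalities strictly. A face through such an interior point
      is the whole lozenge, which is not contained in a line.\<close>
    define m where "m = (1/2) *\<^sub>R p + (1/2) *\<^sub>R p'"
    have "convex e" using face_of_imp_convex[OF f(1)] .
    hence "m \<in> e" unfolding m_def using p by (intro convexD) auto
    have pin: "p \<in> shape l" "p' \<in> shape l" using p face_of_imp_subset[OF f(1)] by auto
    have "open {p. of_int y < sh_v p \<and> sh_v p < of_int y + 1 \<and> of_int y - of_int t < sh_v p - sh_u p \<and> sh_v p - sh_u p < of_int y - of_int t + 1}"
      by (intro open_Collect_conj open_Collect_less continuous_intros)
    moreover have "m \<in> \<dots>" using pin u v unfolding Hz shape_simps m_def by auto
    ultimately have "m \<in> interior (shape l)" by (intro interiorI) (auto simp: Hz shape_simps)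
    hence "e = shape l" using face_of_disjoint_interior[OF f(1)] \<open>m \<in> e\<close> by blast
    moreover have "lattice_pt t y \<in> shape l" "lattice_pt (t+1) (y+1) \<in> shape l" by (auto simp: Hz shape_simps)
    ultimately have "fst (lattice_pt t y) = s" "fst (lattice_pt (t+1) (y+1)) = s" using e by blast+
    hence "fst (lattice_pt t y) = fst (lattice_pt (t+1) (y+1))" by simp
    thus False by (simp add: lattice_pt_def)
  qed
  thus ?thesis using Hz by (auto simp: horizontal_def)
next
  case (V0 t y)
  have "closed_segment (lattice_pt t y) (lattice_pt t (y+1)) \<subseteq> {p. fst p = sqrt 3 / 2 * t}"
    unfolding closed_segment_vertical by (auto simp: sh_u_fst)
  thus ?thesis using edge_left_right(1)[of l t y] V0 unfolding horizontal_def by blast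
next
  case (V1 t y)
  have "closed_segment (lattice_pt t y) (lattice_pt t (y+1)) \<subseteq> {p. fst p = sqrt 3 / 2 * t}"
    unfolding closed_segment_vertical by (auto simp: sh_u_fst)
  thus ?thesis using edge_left_right(1)[of l t y] V1 unfolding horizontal_def by blast
qed

lemma vertical_edge_shape:
  assumes "\<not> horizontal (shape l)"
  shows "closed_segment (lattice_pt t y) (lattice_pt t (y+1)) edge_of shape l \<longleftrightarrow>
    l \<in> {V0 t y, V1 t y, V0 (t-1) y, V1 (t-1) (y-1)}"
proof
  assume "closed_segment (lattice_pt t y) (lattice_pt t (y+1)) edge_of shape l"
  hence "closed_segment (lattice_pt t y) (lattice_pt t (y+1)) \<subseteq> shape l"
    by (simp add: edge_of_def face_of_imp_subset)
  hence *: "lattice_pt t y \<in> shape l" "lattice_pt t (y+1) \<in> shape l" by auto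
  show "l \<in> {V0 t y, V1 t y, V0 (t-1) y, V1 (t-1) (y-1)}"
  proof (cases l)
    case (Hz t' y')
    thus ?thesis using assms horizontal_shape by blast
  next
    case (V0 t' y')
    have "t' \<le> t" "t \<le> t' + 1" "y' \<le> y" "y + 1 \<le> y' + 1" using * unfolding V0 shape_simps by simp_all
    thus ?thesis using V0 by auto
  next
    case (V1 t' y')
    have "t' \<le> t" "t \<le> t' + 1" "y' - t' \<le> y - t" "y + 1 - t\<le> y' - t' + 1" using * unfolding V1 shape_simps by simp_all
    hence "(t' = t \<and> y' = y) \<or> (t' = t - 1 \<and> y' = y - 1)" by auto
    thus ?thesis using V1 by auto
  qed
next
  assume "l \<in> {V0 t y, V1 t y, V0 (t-1) y, V1 (t-1) (y-1)}"
  thus "closed_segment (lattice_pt t y) (lattice_pt t (y+1)) edge_of shape l"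
    using edge_left_right[of l t y] edge_left_right[of l "t-1" y] edge_left_right[of l "t-1" "y-1"]
    by (auto simp: add.commute[of 1])
qed

lemma top_ordinate_Hz: "top_ordinate (shape (Hz t y)) = real_of_int y + 1 - real_of_int t / 2"
  unfolding top_ordinate_def
proof (rule cSup_eq_maximum)
  have "lattice_pt t (y+1) \<in> shape (Hz t y)" by (simp add: shape_simps)
  moreover have "snd (lattice_pt t (y+1)) = real_of_int y + 1 - real_of_int t / 2" by (simp add: lattice_pt_def)
  ultimately show "real_of_int y + 1 - real_of_int t / 2 \<in> snd ` shape (Hz t y)" by force
  fix r assume "r \<in> snd ` shape (Hz t y)"
  then obtain p where p: "p \<in> shape (Hz t y)" "r = snd p" by blast
  have "snd p = (sh_v p + (sh_v p - sh_u p)) / 2" by (simp add: sh_u_def sh_v_def field_simps)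
  also have "\<dots> \<le> (y + 1 + (y - t + 1)) / 2" using p unfolding shape_simps by simp
  finally show "r \<le> real_of_int y + 1 - real_of_int t / 2" using p by (simp add: field_simps)
qed

section \<open>Sums over interlacing steps of determinants\<close>

text \<open>Both signs of \<open>\<delta>\<close> occur: the forward recursion sums over the
  predecessors of a configuration, the backward one over its successors.\<close>

definition jumps :: "int \<Rightarrow> int set \<Rightarrow> int set \<Rightarrow> bool" where
  "jumps \<delta> X Y \<longleftrightarrow> (\<exists>s. bij_betw s X Y \<and> (\<forall>x\<in>X. s x \<in> {x, x + \<delta>}))"

abbreviation enum :: "int set \<Rightarrow> int list" where "enum \<equiv> sorted_list_of_set"

lemma jumps_sym: "jumps \<delta> X Y \<Longrightarrow> jumps (- \<delta>) Y X"
proof -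
  assume "jumps \<delta> X Y"
  then obtain s where s: "bij_betw s X Y" "\<forall>x\<in>X. s x \<in> {x, x + \<delta>}" by (auto simp: jumps_def)
  let ?r = "inv_into X s"
  have "bij_betw ?r Y X" by (rule bij_betw_inv_into[OF s(1)])
  moreover have "?r y \<in> {y, y + - \<delta>}" if y: "y \<in> Y" for y
  proof -
    have "?r y \<in> X" "s (?r y) = y"
      using y s(1) by (auto simp: bij_betw_def inv_into_into f_inv_into_f)
    thus ?thesis using s(2) by (auto simp: algebra_simps)
  qed
  ultimately show ?thesis unfolding jumps_def by blast
qed

text \<open>Moves by at most one in a common direction never reverse the order of two integers, and
  injectivity excludes a collision. The bijection therefore matches the sorted lists, which also
  makes it unique.\<close>

lemma enum_bij:
  assumes "finite X" "bij_betw s X Y" "\<forall>x\<in>X. s x \<in> {x, x + \<delta>}" "\<delta> \<in> {1, -1}"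
  shows "enum Y = map s (enum X)"
proof -
  have "finite Y" using assms bij_betw_finite by auto
  have mono: "s x < s x'" if "x \<in> X" "x' \<in> X" "x < x'" for x x'
  proof -
    have "s x = x \<or> s x = x + \<delta>" "s x' = x' \<or> s x' = x' + \<delta>" using assms(3) that(1,2) by auto
    hence "s x \<le> s x'" using that assms(4) by auto
    moreover have "s x \<noteq> s x'" using bij_betw_imp_inj_on[OF assms(2)] that by (auto dest: inj_onD)
    ultimately show ?thesis by simp
  qed
  have "sorted_wrt (<) (enum X)" using assms(1) by simp
  hence "sorted_wrt (<) (map s (enum X))"
    unfolding sorted_wrt_map by (rule sorted_wrt_mono_rel[rotated]) (use assms(1) mono in auto)
  moreover have "set (map s (enum X)) = Y" using assms by (auto simp: bij_betw_def)
  ultimately show ?thesis using \<open>finite Y\<close> assms(1,2)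
    by (intro sorted_list_of_set_unique[THEN iffD1] conjI) (auto simp: bij_betw_same_card)
qed

lemma enum_image:
  assumes "\<And>i. Suc i < n \<Longrightarrow> x i < (x (Suc i) :: int)"
  shows "enum (x ` {..<n}) = map x [0..<n]" "inj_on x {..<n}"
proof -
  have lt: "x i < x j" if "i < j" "j < n" for i j
    using that
  proof (induction j)
    case (Suc j)
    thus ?case using assms[of j] by (cases "i = j") auto
  qed simp
  show inj: "inj_on x {..<n}" by (rule linorder_inj_onI') (use lt in force)
  have "sorted_wrt (<) (map x [0..<n])" by (auto simp: sorted_wrt_iff_nth_less lt)
  thus "enum (x ` {..<n}) = map x [0..<n]" using inj
    by (intro sorted_list_of_set_unique[THEN iffD1] conjI) (auto simp: card_image)
qed

lemma enum_props:
  assumes "finite X"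
  shows "(\<lambda>i. enum X ! i) ` {..<card X} = X" "Suc i < card X \<Longrightarrow> enum X ! i < enum X ! Suc i"
    "i < card X \<Longrightarrow> enum X ! i \<in> X"
proof -
  have "(\<lambda>i. enum X ! i) ` {..<length (enum X)} = set (enum X)" by (auto simp: set_conv_nth)
  thus "(\<lambda>i. enum X ! i) ` {..<card X} = X" using assms by simp
  thus "i < card X \<Longrightarrow> enum X ! i \<in> X" by blast
  have "sorted_wrt (<) (enum X)" using assms by simp
  thus "Suc i < card X \<Longrightarrow> enum X ! i < enum X ! Suc i" using assms by (auto simp: sorted_wrt_iff_nth_less)
qed

section \<open>Determinants of functions of two indices, and Slater determinants\<close>

definition mdet :: "nat \<Rightarrow> (nat \<Rightarrow> nat \<Rightarrow> real) \<Rightarrow> real" where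
  "mdet n M = det (mat n n (\<lambda>(i,j). M i j))"

lemma mdet_leibniz: "mdet n M = (\<Sum>p | p permutes {..<n}. signof p * (\<Prod>i<n. M i (p i)))"
proof -
  have "(\<Prod>i = 0..<n. mat n n (\<lambda>(i,j). M i j) $$ (i, p i)) = (\<Prod>i<n. M i (p i))" if "p permutes {..<n}" for p
    unfolding atLeast0LessThan using permutes_in_image[OF that] by (intro prod.cong) auto
  thus ?thesis unfolding mdet_def by (subst det_def') (auto simp: atLeast0LessThan intro!: sum.cong)
qed

lemma mdet_cong: "(\<And>i j. i < n \<Longrightarrow> j < n \<Longrightarrow> M i j = M' i j) \<Longrightarrow> mdet n M = mdet n M'"
  unfolding mdet_def by (rule arg_cong[of _ _ det], rule eq_matI) auto

lemma mdet_eq_rows: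
  assumes "i < n" "j < n" "i \<noteq> j" "\<And>k. k < n \<Longrightarrow> M i k = M j k" shows "mdet n M = 0"
  unfolding mdet_def using assms by (intro det_identical_rows[of _ n i j]) auto

lemma mdet_zero_row:
  assumes "i < n" "\<And>k. k < n \<Longrightarrow> M i k = 0" shows "mdet n M = 0"
proof -
  have "(\<Prod>i<n. M i (p i)) = 0" if "p permutes {..<n}" for p
    using assms permutes_in_image[OF that, of i] by (intro prod_zero) auto
  thus ?thesis unfolding mdet_leibniz by (intro sum.neutral ballI) simp
qed

lemma mdet_mult: "mdet n (\<lambda>i j. \<Sum>k<n. M i k * M' k j) = mdet n M * mdet n M'"
proof -
  have "mat n n (\<lambda>(i,j). \<Sum>k<n. M i k * M' k j) = mat n n (\<lambda>(i,j). M i j) * mat n n (\<lambda>(i,j). M' i j)"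
    by (rule eq_matI) (auto simp: scalar_prod_def atLeast0LessThan)
  thus ?thesis unfolding mdet_def by (simp add: det_mult[of _ n])
qed

lemma mdet_scale_rows: "mdet n (\<lambda>i j. h i * M i j) = (\<Prod>i<n. h i) * mdet n M"
  by (simp add: mdet_leibniz prod.distrib sum_distrib_left algebra_simps)

lemma mdet_sum_rows:
  assumes "\<And>i. i < n \<Longrightarrow> finite (B i)"
  shows "mdet n (\<lambda>i j. \<Sum>b\<in>B i. M i b j) = (\<Sum>e\<in>PiE {..<n} B. mdet n (\<lambda>i j. M i (e i) j))"
proof -
  have "mdet n (\<lambda>i j. \<Sum>b\<in>B i. M i b j) = (\<Sum>p | p permutes {..<n}. \<Sum>e\<in>PiE {..<n} B. signof p * (\<Prod>i<n. M i (e i) (p i)))"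
    unfolding mdet_leibniz using assms by (subst prod_sum_PiE) (auto simp: sum_distrib_left)
  also have "\<dots> = (\<Sum>e\<in>PiE {..<n} B. \<Sum>p | p permutes {..<n}. signof p * (\<Prod>i<n. M i (e i) (p i)))"
    by (rule sum.swap)
  finally show ?thesis unfolding mdet_leibniz .
qed

text \<open>The Slater determinant of fermionic wave functions; listing the particles in increasing
  order fixes its sign.\<close>

definition slater :: "(nat \<Rightarrow> int \<Rightarrow> real) \<Rightarrow> int set \<Rightarrow> real" where
  "slater \<phi> X = mdet (card X) (\<lambda>i j. \<phi> j (enum X ! i))"

lemma slater_scale:
  assumes "finite X" shows "slater (\<lambda>j x. h x * \<phi> j x) X = (\<Prod>x\<in>X. h x) * slater \<phi> X"
proof -
  have "(\<Prod>i<card X. h (enum X ! i)) = (\<Prod>x\<in>X. h x)"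
  proof (rule prod.reindex_bij_betw)
    show "bij_betw (\<lambda>i. enum X ! i) {..<card X} X"
      using enum_image(2)[of "card X" "\<lambda>i. enum X ! i"] enum_props[OF assms] by (auto simp: bij_betw_def)
  qed
  thus ?thesis by (simp add: slater_def mdet_scale_rows)
qed

text \<open>Passing from powers to the polynomials \<open>p\<close> is a change of basis of the
  columns. Its determinant depends on \<open>X\<close> only through the number of particles, so it
  ends up in the normalisation.\<close>

lemma slater_poly:
  assumes "finite X" "\<And>j. j < card X \<Longrightarrow> degree (p j) \<le> j"
  shows "slater (\<lambda>j x. poly (p j) (\<sigma> x)) X = slater (\<lambda>j x. \<sigma> x ^ j) X * mdet (card X) (\<lambda>k j. coeff (p j) k)"
proof -
  have "poly (p j) z = (\<Sum>k<card X. z ^ k * coeff (p j) k)" if "j < card X" for j and z :: real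
  proof -
    have "poly (p j) z = (\<Sum>k\<le>degree (p j). z ^ k * coeff (p j) k)" by (simp add: poly_altdef mult.commute)
    also have "\<dots> = (\<Sum>k<card X. z ^ k * coeff (p j) k)"
      using assms(2)[OF that] that by (intro sum.mono_neutral_left) (auto simp: coeff_eq_0)
    finally show ?thesis .
  qed
  thus ?thesis unfolding slater_def mdet_mult[symmetric] by (intro mdet_cong) auto
qed

text \<open>A kernel vector of the matrix would be the coefficient list of a nonzero polynomial of
  degree below \<open>card X\<close> that vanishes at the \<open>card X\<close> distinct values of
  \<open>\<sigma>\<close>.\<close>

lemma slater_vandermonde_nonzero:
  assumes "finite X" "inj_on \<sigma> X"
  shows "slater (\<lambda>j x. \<sigma> x ^ j) X \<noteq> (0::real)"
proof
  define n where "n = card X"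
  assume "slater (\<lambda>j x. \<sigma> x ^ j) X = 0"
  hence "det (mat n n (\<lambda>(i,j). \<sigma> (enum X ! i) ^ j)) = 0" by (simp add: slater_def mdet_def n_def)
  hence "\<exists>v. v \<in> carrier_vec n \<and> v \<noteq> 0\<^sub>v n \<and> mat n n (\<lambda>(i,j). \<sigma> (enum X ! i) ^ j) *\<^sub>v v = 0\<^sub>v n"
    by (rule det_0_iff_vec_prod_zero_field[OF mat_carrier, THEN iffD1])
  then obtain v where v: "v \<in> carrier_vec n" "v \<noteq> 0\<^sub>v n" "mat n n (\<lambda>(i,j). \<sigma> (enum X ! i) ^ j) *\<^sub>v v = 0\<^sub>v n"
    by blast
  define p where "p = (\<Sum>j<n. Polynomial.monom (vec_index v j) j)"
  have cf: "coeff p j = (if j < n then vec_index v j else 0)" for j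
  proof -
    have "coeff p j = (\<Sum>i<n. if i = j then vec_index v i else 0)"
      unfolding p_def coeff_sum by (intro sum.cong) auto
    thus ?thesis by simp
  qed
  have "p \<noteq> 0"
  proof
    assume "p = 0"
    hence "vec_index v j = 0" if "j < n" for j using cf[of j] that by simp
    hence "v = 0\<^sub>v n" using v(1) by (intro eq_vecI) auto
    thus False using v(2) by simp
  qed
  have root: "poly p (\<sigma> x) = 0" if "x \<in> X" for x
  proof -
    have "x \<in> (\<lambda>i. enum X ! i) ` {..<n}" using enum_props(1)[OF assms(1)] that by (simp add: n_def)
    then obtain i where i: "i < n" "x = enum X ! i" by blast
    have "poly p (\<sigma> x) = vec_index (mat n n (\<lambda>(i,j). \<sigma> (enum X ! i) ^ j) *\<^sub>v v) i"
      using i v(1) by (simp add: p_def poly_sum poly_monom scalar_prod_def atLeast0LessThan mult.commute)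
    thus ?thesis using v(3) i by simp
  qed
  have "card (\<sigma> ` X) \<le> card {z. poly p z = 0}"
    using root poly_roots_finite[OF \<open>p \<noteq> 0\<close>] by (intro card_mono) auto
  also have "\<dots> \<le> degree p" by (rule card_poly_roots_bound[OF \<open>p \<noteq> 0\<close>])
  finally have "n \<le> degree p" using assms by (simp add: card_image n_def)
  hence "lead_coeff p = 0" using cf[of "degree p"] by simp
  thus False using \<open>p \<noteq> 0\<close> by simp
qed

text \<open>Multilinear expansion of the rows lets every particle stay or move independently. A
  choice that leaves \<open>R\<close> has a zero row. A choice that is not increasing makes two
  neighbours collide, since all moves have size one and the same direction, so it has two equal
  rows. The surviving choices are exactly the configurations on the left.\<close>

lemma slater_jump_sum:
  assumes fin: "finite Y" "finite R" and \<delta>: "\<delta> \<in> {1, -1}"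
    and out: "\<And>y j. y \<in> Y \<Longrightarrow> y \<notin> R \<Longrightarrow> \<phi> j y = 0" "\<And>y j. y \<in> Y \<Longrightarrow> y + \<delta> \<notin> R \<Longrightarrow> \<phi> j (y + \<delta>) = 0"
  shows "(\<Sum>X | X \<subseteq> R \<and> jumps \<delta> Y X. slater \<phi> X) = slater (\<lambda>j y. \<phi> j y + \<phi> j (y + \<delta>)) Y"
proof -
  define n where "n = card Y"
  define y where "y = (\<lambda>i. enum Y ! i)"
  define E where "E = PiE {..<n} (\<lambda>_::nat. {0, \<delta>})"
  define G where "G = {e \<in> E. (\<forall>i<n. y i + e i \<in> R) \<and> (\<forall>i. Suc i < n \<longrightarrow> y i + e i < y (Suc i) + e (Suc i))}"
  have yY: "i < n \<Longrightarrow> y i \<in> Y" "Suc i < n \<Longrightarrow> y i < y (Suc i)" for i using enum_props[OF fin(1)] by (auto simp: n_def y_def)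
  have eE: "e i = 0 \<or> e i = \<delta>" if "e \<in> E" "i < n" for e i using that by (auto simp: E_def)
  have "slater (\<lambda>j y. \<phi> j y + \<phi> j (y + \<delta>)) Y = mdet n (\<lambda>i j. \<Sum>b\<in>{0, \<delta>}. \<phi> j (y i + b))"
    using \<delta> by (auto simp: slater_def n_def y_def intro!: mdet_cong)
  also have "\<dots> = (\<Sum>e\<in>E. mdet n (\<lambda>i j. \<phi> j (y i + e i)))" unfolding E_def by (rule mdet_sum_rows) auto
  also have "\<dots> = (\<Sum>e\<in>G. mdet n (\<lambda>i j. \<phi> j (y i + e i)))"
  proof (rule sum.mono_neutral_right)
    show "finite E" by (simp add: E_def finite_PiE)
    show "G \<subseteq> E" by (auto simp: G_def)
    show "\<forall>e\<in>E - G. mdet n (\<lambda>i j. \<phi> j (y i + e i)) = 0"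
    proof
      fix e assume e: "e \<in> E - G"
      show "mdet n (\<lambda>i j. \<phi> j (y i + e i)) = 0"
      proof (cases "\<forall>i<n. y i + e i \<in> R")
        case False
        then obtain i where i: "i < n" "y i + e i \<notin> R" by blast
        have "\<phi> k (y i + e i) = 0" for k using eE[of e i] e i out[OF yY(1)[OF i(1)]] by auto
        thus ?thesis using i by (intro mdet_zero_row[of i]) auto
      next
        case True
        then obtain i where i: "Suc i < n" "\<not> y i + e i < y (Suc i) + e (Suc i)" using e by (auto simp: G_def)
        have "y i + e i = y (Suc i) + e (Suc i)"
          using eE[of e i] eE[of e "Suc i"] e i yY(2)[OF i(1)] \<delta> by auto
        thus ?thesis using i by (intro mdet_eq_rows[of i _ "Suc i"]) auto
      qed
    qed
  qed
  also have "\<dots> = (\<Sum>X | X \<subseteq> R \<and> jumps \<delta> Y X. slater \<phi> X)"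
  proof (rule sum.reindex_bij_witness[of _ "\<lambda>X. \<lambda>i\<in>{..<n}. enum X ! i - y i" "\<lambda>e. (\<lambda>i. y i + e i) ` {..<n}"])
    fix e assume e: "e \<in> G"
    let ?x = "\<lambda>i. y i + e i"
    have en: "enum (?x ` {..<n}) = map ?x [0..<n]" and inj: "inj_on ?x {..<n}"
      using enum_image[of n ?x] e by (auto simp: G_def)
    have crd: "card (?x ` {..<n}) = n" using inj by (simp add: card_image)
    show "(\<lambda>i\<in>{..<n}. enum (?x ` {..<n}) ! i - y i) = e"
    proof
      fix i show "(\<lambda>i\<in>{..<n}. enum (?x ` {..<n}) ! i - y i) i = e i"
        unfolding en using e by (cases "i < n") (auto simp: G_def E_def PiE_def extensional_def)
    qed
    show "slater \<phi> (?x ` {..<n}) = mdet n (\<lambda>i j. \<phi> j (y i + e i))"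
      unfolding slater_def crd en by (intro mdet_cong) auto
    have bij_y: "bij_betw y {..<n} Y"
      using enum_image(2)[of n y] yY enum_props(1)[OF fin(1)] by (auto simp: bij_betw_def n_def y_def)
    have "bij_betw (?x \<circ> inv_into {..<n} y) Y (?x ` {..<n})"
      by (rule bij_betw_trans[OF bij_betw_inv_into[OF bij_y]]) (use inj in \<open>simp add: bij_betw_def\<close>)
    moreover have "(?x \<circ> inv_into {..<n} y) z \<in> {z, z + \<delta>}" if z: "z \<in> Y" for z
    proof -
      have "z \<in> y ` {..<n}" using bij_betw_imp_surj_on[OF bij_y] z by simp
      then obtain i where i: "i < n" "z = y i" by blast
      hence "inv_into {..<n} y z = i" using bij_betw_imp_inj_on[OF bij_y] by simp
      thus ?thesis using i eE[of e i] e by (auto simp: G_def)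
    qed
    ultimately have "jumps \<delta> Y (?x ` {..<n})" unfolding jumps_def by blast
    thus "?x ` {..<n} \<in> {X. X \<subseteq> R \<and> jumps \<delta> Y X}" using e by (auto simp: G_def)
  next
    fix X assume "X \<in> {X. X \<subseteq> R \<and> jumps \<delta> Y X}"
    then obtain s where X: "X \<subseteq> R" and s: "bij_betw s Y X" "\<forall>x\<in>Y. s x \<in> {x, x + \<delta>}" by (auto simp: jumps_def)
    have en: "enum X = map s (enum Y)" by (rule enum_bij[OF fin(1) s \<delta>])
    have fX: "finite X" "card X = n" using X fin(2) finite_subset bij_betw_same_card[OF s(1)] by (auto simp: n_def)
    have xi: "enum X ! i = s (y i)" if "i < n" for i using that fin(1) by (simp add: en y_def n_def)
    show "(\<lambda>i. y i + (\<lambda>i\<in>{..<n}. enum X ! i - y i) i) ` {..<n} = X"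
      using enum_props(1)[OF fX(1)] fX(2) by simp
    show "(\<lambda>i\<in>{..<n}. enum X ! i - y i) \<in> G"
      unfolding G_def E_def
    proof (intro CollectI conjI allI impI PiE_I)
      fix i assume "i \<in> {..<n}"
      thus "(\<lambda>i\<in>{..<n}. enum X ! i - y i) i \<in> {0, \<delta>}" using s(2) yY(1)[of i] xi[of i] by auto
    next
      fix i assume "i < n"
      thus "y i + (\<lambda>i\<in>{..<n}. enum X ! i - y i) i \<in> R" using enum_props(3)[OF fX(1), of i] fX(2) X by auto
    next
      fix i assume "Suc i < n"
      thus "y i + (\<lambda>i\<in>{..<n}. enum X ! i - y i) i < y (Suc i) + (\<lambda>i\<in>{..<n}. enum X ! i - y i) (Suc i)"
        using enum_props(2)[OF fX(1), of i] fX(2) by auto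
    qed auto
  qed
  finally show ?thesis by simp
qed

section \<open>Matchings and families of particles\<close>

definition matchings :: "nat \<Rightarrow> nat \<Rightarrow> nat \<Rightarrow> loz set set" where
  "matchings a b c = {m. (\<forall>l\<in>m. tris l \<subseteq> hex_tris a b c) \<and> (\<forall>\<tau>\<in>hex_tris a b c. \<exists>!l. l \<in> m \<and> \<tau> \<in> tris l)}"

definition fams :: "nat \<Rightarrow> nat \<Rightarrow> nat \<Rightarrow> (nat \<Rightarrow> int set) set" where
  "fams N T S = {F \<in> (\<Pi>\<^sub>E t\<in>{..T}. Pow (rng N T S t)). F 0 = rng N T S 0 \<and> F T = rng N T S T \<and>
     (\<forall>t<T. jumps 1 (F t) (F (Suc t)))}"

lemma jumps_unique:
  assumes "finite X" "bij_betw s X Y" "\<forall>x\<in>X. s x \<in> {x, x + (1::int)}"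
    "bij_betw s' X Y" "\<forall>x\<in>X. s' x \<in> {x, x + (1::int)}" "x \<in> X"
  shows "s x = s' x"
proof -
  have "map s (sorted_list_of_set X) = map s' (sorted_list_of_set X)"
    using enum_bij[OF assms(1,2,3)] enum_bij[OF assms(1,4,5)] by simp
  thus ?thesis using assms(1,6) by (simp add: map_eq_conv)
qed

context
  fixes a b c :: nat
  assumes abc: "a \<ge> 1" "b \<ge> 1" "c \<ge> 1"
begin

text \<open>A tiling covers the centroid of every triangle of the hexagon, which provides a lozenge
  over that triangle, and disjoint interiors make it the only one. In the other direction the
  triangles of the lozenges fill the hexagon, and different lozenges share no triangle.\<close>

lemma tilings_matchings: "bij_betw ((`) shape) (matchings a b c) (lozenge_tilings a b c)"
proof (rule bij_betwI')
  fix m m' show "(shape ` m = shape ` m') = (m = m')"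
    using shape_inj by (metis inj_def inj_image_eq_iff)
next
  fix m assume m: "m \<in> matchings a b c"
  have "\<Union> (shape ` m) = (\<Union>\<tau>\<in>(\<Union>l\<in>m. tris l). cell \<tau>)" by (auto simp: shape_def)
  also have "(\<Union>l\<in>m. tris l) = hex_tris a b c" using m unfolding matchings_def by blast
  finally have u: "\<Union> (shape ` m) = hexagon a b c" using hexagon_cells[OF abc] by simp
  have "pairwise (\<lambda>L L'. interior L \<inter> interior L' = {}) (shape ` m)"
  proof (rule pairwiseI, clarify)
    fix l l' assume l: "l \<in> m" "l' \<in> m" "shape l \<noteq> shape l'"
    hence "tris l \<inter> tris l' = {}" using m unfolding matchings_def by blast
    thus "interior (shape l) \<inter> interior (shape l') = {}" by (simp add: shape_interior_disjoint)
  qed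
  thus "shape ` m \<in> lozenge_tilings a b c" using u by (auto simp: lozenge_tilings_def lozenges_eq)
next
  fix \<T> assume T: "\<T> \<in> lozenge_tilings a b c"
  define m where "m = {l. shape l \<in> \<T>}"
  have Tm: "\<T> = shape ` m" using T by (auto simp: m_def lozenge_tilings_def lozenges_eq)
  have hex: "\<Union>\<T> = hexagon a b c" using T by (auto simp: lozenge_tilings_def)
  have "m \<in> matchings a b c" unfolding matchings_def
  proof (intro CollectI conjI ballI)
    fix l assume "l \<in> m"
    hence "shape l \<subseteq> hexagon a b c" using hex by (auto simp: m_def)
    thus "tris l \<subseteq> hex_tris a b c" by (auto simp: shape_def hex_tris_def)
  next
    fix \<tau> assume "\<tau> \<in> hex_tris a b c"
    hence "ctr \<tau> \<in> \<Union>\<T>" using hex unfolding hex_tris_def by (metis ctr_in_cell mem_Collect_eq subsetD)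
    then obtain l where l: "l \<in> m" "\<tau> \<in> tris l" using Tm by auto
    show "\<exists>!l. l \<in> m \<and> \<tau> \<in> tris l"
    proof (rule ex1I)
      show "l \<in> m \<and> \<tau> \<in> tris l" using l by simp
      fix l' assume l': "l' \<in> m \<and> \<tau> \<in> tris l'"
      show "l' = l"
      proof (rule ccontr)
        assume "l' \<noteq> l"
        hence "shape l' \<noteq> shape l" using shape_inj by blast
        hence "interior (shape l') \<inter> interior (shape l) = {}"
          using T l l' unfolding lozenge_tilings_def pairwise_def m_def by blast
        thus False using shape_interior_disjoint[of l' l] l l' by blast
      qed
    qed
  qed
  thus "\<exists>m\<in>matchings a b c. \<T> = shape ` m" using Tm by blast
qed

abbreviation "TT \<equiv> b + c"
abbreviation "rn t \<equiv> rng (int a) (int (b + c)) (int c) t"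

text \<open>A site carries a particle when no horizontal lozenge is centred there. No horizontal
  lozenge sits on the first or on the last line, because one of its triangles would lie outside the
  hexagon.\<close>

definition pf :: "loz set \<Rightarrow> nat \<Rightarrow> int set" where
  "pf m = (\<lambda>t\<in>{..TT}. {y \<in> rn (int t). Hz (int t) y \<notin> m})"

lemma pf_mem: "0 \<le> t \<Longrightarrow> t < int TT \<Longrightarrow> y \<in> pf m (nat t) \<longleftrightarrow> y \<in> rn t \<and> Hz t y \<notin> m"
  by (simp add: pf_def nat_le_iff)

lemma in_tris_RT: "RT t y \<in> tris l \<longleftrightarrow> l \<in> {Hz t y, V0 t y, V1 t y}" by (cases l) auto
lemma in_tris_LT: "LT t y \<in> tris l \<longleftrightarrow> l \<in> {Hz (t+1) y, V0 t y, V1 t (y-1)}" by (cases l) auto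

lemma RT_hex': "RT t y \<in> hex_tris a b c \<longleftrightarrow> 0 \<le> t \<and> t < int TT \<and> y \<in> rn t"
  using RT_hex[OF abc, of t y] by simp
lemma LT_hex': "LT t y \<in> hex_tris a b c \<longleftrightarrow> 0 \<le> t \<and> t < int TT \<and> y \<in> rn (t + 1)"
  using LT_hex[OF abc, of t y] by simp

context
  fixes m assumes m: "m \<in> matchings a b c"
begin

lemma mD:
  "Hz t y \<in> m \<Longrightarrow> 1 \<le> t \<and> t < int TT \<and> y \<in> rn t"
  "V0 t y \<in> m \<Longrightarrow> 0 \<le> t \<and> t < int TT \<and> y \<in> rn t \<and> y \<in> rn (t+1)"
  "V1 t y \<in> m \<Longrightarrow> 0 \<le> t \<and> t < int TT \<and> y \<in> rn t \<and> y + 1 \<in> rn (t+1)"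
proof -
  have "l \<in> m \<Longrightarrow> tris l \<subseteq> hex_tris a b c" for l using m by (auto simp: matchings_def)
  from this[of "Hz t y"] this[of "V0 t y"] this[of "V1 t y"]
  show "Hz t y \<in> m \<Longrightarrow> 1 \<le> t \<and> t < int TT \<and> y \<in> rn t"
  "V0 t y \<in> m \<Longrightarrow> 0 \<le> t \<and> t < int TT \<and> y \<in> rn t \<and> y \<in> rn (t+1)"
  "V1 t y \<in> m \<Longrightarrow> 0 \<le> t \<and> t < int TT \<and> y \<in> rn t \<and> y + 1 \<in> rn (t+1)"
    by (auto simp: RT_hex' LT_hex')
qed

text \<open>The triangle to the right of a site is covered once, so the site is a hole or a path
  leaves it in exactly one of two ways. \<open>mL\<close> is the same for the triangle to the left
  of a site of line \<open>t + 1\<close>.\<close>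

lemma mR:
  assumes "0 \<le> t" "t < int TT" "y \<in> rn t"
  shows "(Hz t y \<in> m \<and> V0 t y \<notin> m \<and> V1 t y \<notin> m) \<or> (Hz t y \<notin> m \<and> V0 t y \<in> m \<and> V1 t y \<notin> m) \<or> (Hz t y \<notin> m \<and> V0 t y \<notin> m \<and> V1 t y \<in> m)"
proof -
  have "RT t y \<in> hex_tris a b c" using assms RT_hex' by simp
  hence "\<exists>!l. l \<in> m \<and> RT t y \<in> tris l" using m by (auto simp: matchings_def)
  thus ?thesis unfolding in_tris_RT by blast
qed

lemma mL:
  assumes "0 \<le> t" "t < int TT" "y \<in> rn (t+1)"
  shows "(Hz (t+1) y \<in> m \<and> V0 t y \<notin> m \<and> V1 t (y-1) \<notin> m) \<or> (Hz (t+1) y \<notin> m \<and> V0 t y \<in> m \<and> V1 t (y-1) \<notin> m) \<or> (Hz (t+1) y \<notin> m \<and> V0 t y \<notin> m \<and> V1 t (y-1) \<in> m)"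
proof -
  have "LT t y \<in> hex_tris a b c" using assms LT_hex' by simp
  hence "\<exists>!l. l \<in> m \<and> LT t y \<in> tris l" using m by (auto simp: matchings_def)
  thus ?thesis unfolding in_tris_LT by blast
qed

definition jump :: "int \<Rightarrow> int \<Rightarrow> int" where "jump t x = (if V0 t x \<in> m then x else x + 1)"

text \<open>Injectivity: if \<open>x\<close> moved up while \<open>x + 1\<close> stayed, then
  \<open>V1 t x\<close> and \<open>V0 t (x + 1)\<close> would both cover
  \<open>LT t (x + 1)\<close>. Surjectivity: the triangle to the left of a particle on the next line
  belongs to a lozenge that is not horizontal, and this lozenge starts at the predecessor.\<close>

lemma jump_bij:
  assumes "t < TT"
  shows "bij_betw (jump t) (pf m t) (pf m (Suc t))" "\<forall>x\<in>pf m t. jump t x \<in> {x, x + 1}"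
proof -
  let ?t = "int t"
  have t: "0 \<le> ?t" "?t < int TT" using assms by auto
  have X: "x \<in> pf m t \<longleftrightarrow> x \<in> rn ?t \<and> Hz ?t x \<notin> m" for x using assms by (auto simp: pf_def)
  have Y: "x \<in> pf m (Suc t) \<longleftrightarrow> x \<in> rn (?t + 1) \<and> Hz (?t + 1) x \<notin> m" for x using assms by (auto simp: pf_def add.commute)
  show "\<forall>x\<in>pf m t. jump t x \<in> {x, x + 1}" by (auto simp: jump_def)
  show "bij_betw (jump t) (pf m t) (pf m (Suc t))"
  proof (rule bij_betw_imageI)
    show "inj_on (jump t) (pf m t)"
    proof (rule inj_onI)
      fix x x' assume x: "x \<in> pf m t" "x' \<in> pf m t" "jump t x = jump t x'"
      have False if "x \<in> pf m t" "x' \<in> pf m t" "x' = x + 1" "V0 ?t x \<notin> m" "V0 ?t x' \<in> m" for x x'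
      proof -
        have "V1 ?t x \<in> m" using mR[OF t, of x] that X by blast
        moreover have "x' \<in> rn (?t + 1)" using mD(2) that by blast
        ultimately show False using mL[OF t, of x'] that by simp
      qed
      thus "x = x'" using x unfolding jump_def by (auto split: if_splits)
    qed
    show "jump t ` pf m t = pf m (Suc t)"
    proof (intro Set.set_eqI iffI)
      fix y assume "y \<in> jump t ` pf m t"
      then obtain x where x: "x \<in> pf m t" "y = jump t x" by blast
      show "y \<in> pf m (Suc t)"
      proof (cases "V0 ?t x \<in> m")
        case True
        thus ?thesis using x mD(2)[OF True] mL[OF t, of x] by (auto simp: Y jump_def)
      next
        case False
        hence V: "V1 ?t x \<in> m" using mR[OF t, of x] x X by blast
        thus ?thesis using x False mD(3)[OF V] mL[OF t, of "x+1"] by (auto simp: Y jump_def)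
      qed
    next
      fix y assume y: "y \<in> pf m (Suc t)"
      hence yr: "y \<in> rn (?t + 1)" "Hz (?t+1) y \<notin> m" by (auto simp: Y)
      show "y \<in> jump t ` pf m t"
      proof (cases "V0 ?t y \<in> m")
        case True
        thus ?thesis using mD(2)[OF True] mR[OF t, of y] by (intro image_eqI[of _ _ y]) (auto simp: X jump_def)
      next
        case False
        hence V: "V1 ?t (y-1) \<in> m" using mL[OF t yr(1)] yr by blast
        thus ?thesis using mD(3)[OF V] mR[OF t, of "y-1"] by (intro image_eqI[of _ _ "y-1"]) (auto simp: X jump_def)
      qed
    qed
  qed
qed

lemma pf_fams: "pf m \<in> fams a TT c"
proof -
  have "pf m 0 = rn 0" "pf m TT = rn TT" using mD(1) by (force simp: pf_def)+
  moreover have "pf m \<in> (\<Pi>\<^sub>E t\<in>{..TT}. Pow (rng a TT c t))" by (auto simp: pf_def)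
  moreover have "jumps 1 (pf m t) (pf m (Suc t))" if "t < TT" for t
    using jump_bij[OF that] by (auto simp: jumps_def)
  ultimately show ?thesis by (simp add: fams_def)
qed

lemma particles_pf:
  assumes "t \<le> TT" shows "particles (shape ` m) (int t) = pf m t"
proof -
  let ?t = "int t"
  have "particles (shape ` m) ?t = {y. \<exists>l\<in>m. \<not> horizontal (shape l) \<and> l \<in> {V0 ?t y, V1 ?t y, V0 (?t-1) y, V1 (?t-1) (y-1)}}"
    unfolding particles_def using vertical_edge_shape by blast
  also have "\<dots> = {y. V0 ?t y \<in> m \<or> V1 ?t y \<in> m \<or> V0 (?t-1) y \<in> m \<or> V1 (?t-1) (y-1) \<in> m}"
    by (auto simp: horizontal_shape)
  also have "\<dots> = {y \<in> rn ?t. Hz ?t y \<notin> m}"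
  proof (intro Set.set_eqI iffI; unfold mem_Collect_eq)
    fix y assume "V0 ?t y \<in> m \<or> V1 ?t y \<in> m \<or> V0 (?t-1) y \<in> m \<or> V1 (?t-1) (y-1) \<in> m"
    thus "y \<in> rn ?t \<and> Hz ?t y \<notin> m"
    proof (elim disjE)
      assume h: "V0 ?t y \<in> m" show ?thesis using mD(2)[OF h] mR[of ?t y] h by blast
    next
      assume h: "V1 ?t y \<in> m" show ?thesis using mD(3)[OF h] mR[of ?t y] h by blast
    next
      assume h: "V0 (?t-1) y \<in> m" show ?thesis using mD(2)[OF h] mL[of "?t-1" y] h by auto
    next
      assume h: "V1 (?t-1) (y-1) \<in> m" show ?thesis using mD(3)[OF h] mL[of "?t-1" y] h by auto
    qed
  next
    fix y assume h: "y \<in> rn ?t \<and> Hz ?t y \<notin> m"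
    show "V0 ?t y \<in> m \<or> V1 ?t y \<in> m \<or> V0 (?t-1) y \<in> m \<or> V1 (?t-1) (y-1) \<in> m"
    proof (cases "t < TT")
      case True thus ?thesis using mR[of ?t y] h by auto
    next
      case False
      hence "0 \<le> ?t - 1" "?t - 1 < TT" using assms abc by auto
      thus ?thesis using mL[of "?t-1" y] h by auto
    qed
  qed
  finally show ?thesis using assms by (auto simp: pf_def)
qed

lemma tiling_weight_pf:
  "tiling_weight c q \<kappa> (shape ` m) = (\<Prod>t\<in>{1..<TT}. \<Prod>y\<in>rn (int t) - pf m t.
     \<kappa>\<^sup>2 * q powr (real_of_int y + 1 - real t / 2 - (real c + 1) / 2) - q powr (- (real_of_int y + 1 - real t / 2) + (real c + 1) / 2))"
proof -
  let ?w = "\<lambda>j. \<kappa>\<^sup>2 * q powr (j - (real c + 1) / 2) - q powr (- j + (real c + 1) / 2)"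
  have e: "{L \<in> shape ` m. horizontal L} = (\<lambda>(t, y). shape (Hz (int t) y)) ` (SIGMA t:{1..<TT}. rn (int t) - pf m t)" (is "?L = ?R")
  proof
    show "?L \<subseteq> ?R"
    proof
      fix L assume "L \<in> ?L"
      then obtain l where "l \<in> m" "L = shape l" "horizontal (shape l)" by auto
      then obtain t y where l: "L = shape (Hz t y)" "Hz t y \<in> m" unfolding horizontal_shape by auto
      hence "(nat t, y) \<in> (SIGMA t:{1..<TT}. rn (int t) - pf m t)" using mD(1)[OF l(2)] by (auto simp: pf_def)
      moreover have "L = shape (Hz (int (nat t)) y)" using mD(1)[OF l(2)] l by auto
      ultimately show "L \<in> ?R" by force
    qed
    show "?R \<subseteq> ?L"
    proof
      fix L assume "L \<in> ?R"
      then obtain t y where l: "L = shape (Hz (int t) y)" "t \<in> {1..<TT}" "y \<in> rn (int t) - pf m t" by auto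
      have "Hz (int t) y \<in> m" using l(2,3) by (auto simp: pf_def)
      moreover have "horizontal (shape (Hz (int t) y))" by (simp add: horizontal_shape)
      ultimately show "L \<in> ?L" using l(1) by simp
    qed
  qed
  have inj: "inj_on (\<lambda>(t, y). shape (Hz (int t) y)) (SIGMA t:{1..<TT}. rn (int t) - pf m t)"
  proof (rule inj_onI, clarify)
    fix t y t' y' assume "shape (Hz (int t) y) = shape (Hz (int t') y')"
    from shape_inj[OF this] show "t = t' \<and> y = y'" by simp
  qed
  show ?thesis unfolding tiling_weight_def e
    by (subst prod.reindex[OF inj], subst prod.Sigma)
       (auto intro!: prod.cong arg_cong2[of _ _ _ _ "(powr)"] simp: case_prod_unfold top_ordinate_Hz)
qed

end

text \<open>The step map between two given configurations is unique, because it matches their sorted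
  lists. Hence the positions determine the lozenges of the paths as well as the horizontal
  ones.\<close>

lemma pf_inj_subset:
  assumes m: "m \<in> matchings a b c" and m': "m' \<in> matchings a b c" and eq: "pf m = pf m'"
  shows "m \<subseteq> m'"
proof
  fix l assume l: "l \<in> m"
  have fin: "finite (pf m t)" if "t < TT" for t using that by (auto simp: pf_def)
  have j: "jump m (int t) x = jump m' (int t) x" if "t < TT" "x \<in> pf m t" for t x
  proof (rule jumps_unique[OF fin[OF that(1)] jump_bij[OF m that(1)] _ _ that(2)])
    show "bij_betw (jump m' (int t)) (pf m t) (pf m (Suc t))" "\<forall>x\<in>pf m t. jump m' (int t) x \<in> {x, x + 1}"
      using jump_bij[OF m' that(1)] unfolding eq by auto
  qed
  show "l \<in> m'"
  proof (cases l)
    case (Hz t y)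
    hence h: "1 \<le> t" "t < TT" "y \<in> rn t" using mD(1)[OF m] l by auto
    hence "y \<notin> pf m (nat t)" using Hz l pf_mem[of t y m] by auto
    hence "y \<notin> pf m' (nat t)" using eq by simp
    thus ?thesis using h Hz pf_mem[of t y m'] by auto
  next
    case (V0 t y)
    hence h: "0 \<le> t" "t < TT" "y \<in> rn t" using mD(2)[OF m] l by auto
    hence y: "y \<in> pf m (nat t)" using mR[OF m h] V0 l pf_mem[of t y m] h by blast
    hence "jump m' t y = y" using j[of "nat t" y] h V0 l by (auto simp: jump_def[OF m] jump_def[OF m'])
    thus ?thesis using V0 by (auto simp: jump_def[OF m'] split: if_splits)
  next
    case (V1 t y)
    hence h: "0 \<le> t" "t < TT" "y \<in> rn t" using mD(3)[OF m] l by auto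
    hence y: "y \<in> pf m (nat t)" "V0 t y \<notin> m" using mR[OF m h] V1 l pf_mem[of t y m] h by blast+
    hence "jump m' t y = y + 1" using j[of "nat t" y] h V1 l by (auto simp: jump_def[OF m] jump_def[OF m'])
    moreover have "Hz t y \<notin> m'" using y(1) eq h pf_mem[of t y m'] by simp
    ultimately show ?thesis using V1 mR[OF m' h] by (auto simp: jump_def[OF m'] split: if_splits)
  qed
qed

lemma ex1_among_three:
  assumes "(x \<in> m \<and> y \<notin> m \<and> z \<notin> m) \<or> (x \<notin> m \<and> y \<in> m \<and> z \<notin> m) \<or> (x \<notin> m \<and> y \<notin> m \<and> z \<in> m)"
  shows "\<exists>!l. l \<in> m \<and> l \<in> {x, y, z}"
  using assms by auto

text \<open>Holes become horizontal lozenges and steps become the other two types. A triangle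
  pointing right is covered once because a particle makes exactly one step, a triangle pointing left
  because the step map is a bijection onto the next configuration.\<close>

lemma fams_pf:
  assumes F: "F \<in> fams a TT c"
  shows "\<exists>m\<in>matchings a b c. F = pf m"
proof -
  have Fsub: "F t \<subseteq> rn t" if "t \<le> TT" for t using F that by (auto simp: fams_def)
  have F0: "F 0 = rn 0" "F TT = rn TT" using F by (auto simp: fams_def)
  have "\<forall>t. t < TT \<longrightarrow> (\<exists>s. bij_betw s (F t) (F (Suc t)) \<and> (\<forall>x\<in>F t. s x \<in> {x, x + 1}))"
    using F by (auto simp: fams_def jumps_def)
  then obtain s where s: "\<And>t. t < TT \<Longrightarrow> bij_betw (s t) (F t) (F (Suc t))" "\<And>t x. t < TT \<Longrightarrow> x \<in> F t \<Longrightarrow> s t x \<in> {x, x + 1}"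
    by metis
  define m where "m = {Hz (int t) y | t y. 1 \<le> t \<and> t < TT \<and> y \<in> rn t - F t} \<union>
    {V0 (int t) y | t y. t < TT \<and> y \<in> F t \<and> s t y = y} \<union> {V1 (int t) y | t y. t < TT \<and> y \<in> F t \<and> s t y = y + 1}"
  have mH: "Hz t y \<in> m \<longleftrightarrow> 1 \<le> t \<and> t < int TT \<and> y \<in> rn t - F (nat t)" for t y
    unfolding m_def by (auto intro: exI[of _ "nat t"])
  have mV0: "V0 t y \<in> m \<longleftrightarrow> 0 \<le> t \<and> t < int TT \<and> y \<in> F (nat t) \<and> s (nat t) y = y" for t y
    unfolding m_def by (auto intro: exI[of _ "nat t"])
  have mV1: "V1 t y \<in> m \<longleftrightarrow> 0 \<le> t \<and> t < int TT \<and> y \<in> F (nat t) \<and> s (nat t) y = y + 1" for t y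
    unfolding m_def by (auto intro: exI[of _ "nat t"])
  have sF: "s t y \<in> F (Suc t)" if "t < TT" "y \<in> F t" for t y
    using s(1)[OF that(1)] that(2) by (auto simp: bij_betw_def)
  have "m \<in> matchings a b c" unfolding matchings_def
  proof (intro CollectI conjI ballI)
    fix l assume l: "l \<in> m"
    show "tris l \<subseteq> hex_tris a b c"
    proof (cases l)
      case (Hz t y)
      thus ?thesis using l by (auto simp: mH RT_hex' LT_hex')
    next
      case (V0 t y)
      hence h: "0 \<le> t" "t < int TT" "y \<in> F (nat t)" "s (nat t) y = y" using l mV0 by auto
      have n: "nat t \<le> TT" "Suc (nat t) \<le> TT" "nat t < TT" using h by auto
      have "y \<in> rn t" using Fsub[OF n(1)] h by auto
      moreover have "y \<in> F (Suc (nat t))" using sF[of "nat t" y] h by auto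
      hence "y \<in> rn (t+1)" using Fsub[OF n(2)] h by (auto simp: add.commute)
      ultimately show ?thesis using V0 h by (auto simp: RT_hex' LT_hex')
    next
      case (V1 t y)
      hence h: "0 \<le> t" "t < int TT" "y \<in> F (nat t)" "s (nat t) y = y + 1" using l mV1 by auto
      have n: "nat t \<le> TT" "Suc (nat t) \<le> TT" "nat t < TT" using h by auto
      have "y \<in> rn t" using Fsub[OF n(1)] h by auto
      moreover have "y + 1 \<in> F (Suc (nat t))" using sF[of "nat t" y] h by auto
      hence "y + 1 \<in> rn (t+1)" using Fsub[OF n(2)] h by (auto simp: add.commute)
      ultimately show ?thesis using V1 h by (auto simp: RT_hex' LT_hex')
    qed
  next
    fix \<tau> assume \<tau>: "\<tau> \<in> hex_tris a b c"
    show "\<exists>!l. l \<in> m \<and> \<tau> \<in> tris l"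
    proof (cases \<tau>)
      case (RT t y)
      hence h: "0 \<le> t" "t < int TT" "y \<in> rn t" using \<tau> RT_hex' by auto
      have "nat t < TT" using h by auto
      hence s01: "s (nat t) y = y \<or> s (nat t) y = y + 1" if "y \<in> F (nat t)" using s(2)[of "nat t" y] that by auto
      have "y \<in> F (nat t)" if "t = 0" using F0(1) h that by simp
      hence "t \<noteq> 0 \<or> y \<in> F (nat t)" by blast
      hence "1 \<le> t \<or> y \<in> F (nat t)" using h(1) by linarith
      hence "(Hz t y \<in> m \<and> V0 t y \<notin> m \<and> V1 t y \<notin> m) \<or> (Hz t y \<notin> m \<and> V0 t y \<in> m \<and> V1 t y \<notin> m)
          \<or> (Hz t y \<notin> m \<and> V0 t y \<notin> m \<and> V1 t y \<in> m)"
        unfolding mH mV0 mV1 using h s01 by (metis DiffD2 DiffI add_cancel_left_right zero_neq_one)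
      thus ?thesis unfolding RT in_tris_RT by (rule ex1_among_three)
    next
      case (LT t y)
      hence h: "0 \<le> t" "t < int TT" "y \<in> rn (t+1)" using \<tau> LT_hex' by auto
      have n: "nat (t+1) = Suc (nat t)" "nat t < TT" using h by auto
      have H1: "Hz (t+1) y \<in> m \<longleftrightarrow> t + 1 < TT \<and> y \<notin> F (Suc (nat t))" unfolding mH n using h by auto
      have A1: "V0 t y \<in> m \<longleftrightarrow> y \<in> F (nat t) \<and> s (nat t) y = y" unfolding mV0 using h by auto
      have B1: "V1 t (y-1) \<in> m \<longleftrightarrow> y - 1 \<in> F (nat t) \<and> s (nat t) (y - 1) = y" unfolding mV1 using h by auto
      have "(Hz (t+1) y \<in> m \<and> V0 t y \<notin> m \<and> V1 t (y-1) \<notin> m) \<or> (Hz (t+1) y \<notin> m \<and> V0 t y \<in> m \<and> V1 t (y-1) \<notin> m)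
          \<or> (Hz (t+1) y \<notin> m \<and> V0 t y \<notin> m \<and> V1 t (y-1) \<in> m)"
      proof (cases "y \<in> F (Suc (nat t))")
        case True
        hence "y \<in> s (nat t) ` F (nat t)" using bij_betw_imp_surj_on[OF s(1)[OF n(2)]] by simp
        then obtain x where x: "x \<in> F (nat t)" "s (nat t) x = y" by blast
        have inj: "x' = x" if "x' \<in> F (nat t)" "s (nat t) x' = y" for x'
          using bij_betw_imp_inj_on[OF s(1)[OF n(2)]] x that by (auto dest: inj_onD)
        have "x = y \<or> x = y - 1" using s(2)[OF n(2) x(1)] x(2) by auto
        thus ?thesis
        proof
          assume "x = y"
          thus ?thesis unfolding H1 A1 B1 using True x inj[of "y-1"] by auto
        next
          assume "x = y - 1"
          thus ?thesis unfolding H1 A1 B1 using True x inj[of y] by auto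
        qed
      next
        case False
        \<comment> \<open>The last line is completely filled, so a hole of line \<open>t + 1\<close>
          lies on an inner line, where \<open>m\<close> contains a horizontal lozenge for
          it.\<close>
        have "t + 1 \<noteq> int TT"
        proof
          assume tt: "t + 1 = int TT"
          hence "Suc (nat t) = TT" using h by linarith
          thus False using False F0(2) h(3) tt by simp
        qed
        hence "t + 1 < int TT" using h by linarith
        moreover have "\<not> (y \<in> F (nat t) \<and> s (nat t) y = y)" "\<not> (y - 1 \<in> F (nat t) \<and> s (nat t) (y-1) = y)"
          using sF[OF n(2)] False by metis+
        ultimately show ?thesis unfolding H1 A1 B1 using False by blast
      qed
      thus ?thesis unfolding LT in_tris_LT by (rule ex1_among_three)
    qed
  qed
  moreover have "F = pf m"
  proof
    fix t show "F t = pf m t"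
    proof (cases "t \<le> TT")
      case True
      have "F t = {y \<in> rn (int t). Hz (int t) y \<notin> m}"
      proof (cases "t = 0 \<or> t = TT")
        case True
        hence "F t = rn (int t)" using F0 by auto
        moreover have "Hz (int t) y \<notin> m" for y using True unfolding mH by auto
        ultimately show ?thesis by blast
      next
        case False
        hence "1 \<le> int t" "int t < int TT" using \<open>t \<le> TT\<close> by auto
        thus ?thesis using Fsub[OF \<open>t \<le> TT\<close>] unfolding mH by auto
      qed
      thus ?thesis using True by (simp add: pf_def)
    next
      case False thus ?thesis using F unfolding pf_def fams_def PiE_def extensional_def by simp
    qed
  qed
  ultimately show ?thesis by blast
qed

lemma pf_bij: "bij_betw pf (matchings a b c) (fams a TT c)"
proof (rule bij_betw_imageI)
  show "inj_on pf (matchings a b c)"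
  proof (rule inj_onI)
    fix m m' assume "m \<in> matchings a b c" "m' \<in> matchings a b c" "pf m = pf m'"
    thus "m = m'" using pf_inj_subset[of m m'] pf_inj_subset[of m' m] by auto
  qed
  show "pf ` matchings a b c = fams a TT c"
  proof
    show "pf ` matchings a b c \<subseteq> fams a TT c" using pf_fams by blast
    show "fams a TT c \<subseteq> pf ` matchings a b c" using fams_pf by blast
  qed
qed

theorem tilings_fams:
  shows "bij_betw (\<lambda>\<T>. \<lambda>t\<in>{..b+c}. particles \<T> (int t)) (lozenge_tilings a b c) (fams a (b+c) c)"
    and "\<T> \<in> lozenge_tilings a b c \<Longrightarrow> tiling_weight c q \<kappa> \<T> =
      (\<Prod>t\<in>{1..<b+c}. \<Prod>y\<in>rng (int a) (int (b+c)) (int c) (int t) - particles \<T> (int t).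
     \<kappa>\<^sup>2 * q powr (real_of_int y + 1 - real t / 2 - (real c + 1) / 2) - q powr (- (real_of_int y + 1 - real t / 2) + (real c + 1) / 2))"
proof -
  have ext: "pf m t = undefined" if "\<not> t \<le> TT" for m t using that by (auto simp: pf_def)
  have e: "(\<lambda>t\<in>{..b+c}. particles (shape ` m) (int t)) = pf m" if "m \<in> matchings a b c" for m
    using particles_pf[OF that] ext by (auto simp: fun_eq_iff)
  have "bij_betw ((\<lambda>\<T>. \<lambda>t\<in>{..b+c}. particles \<T> (int t)) \<circ> (`) shape) (matchings a b c) (fams a (b+c) c)"
    using pf_bij by (rule bij_betw_cong[THEN iffD1, rotated]) (simp add: e)
  thus "bij_betw (\<lambda>\<T>. \<lambda>t\<in>{..b+c}. particles \<T> (int t)) (lozenge_tilings a b c) (fams a (b+c) c)"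
    using bij_betw_comp_iff[OF tilings_matchings] by blast
  assume "\<T> \<in> lozenge_tilings a b c"
  hence "\<T> \<in> (`) shape ` matchings a b c" using bij_betw_imp_surj_on[OF tilings_matchings] by simp
  then obtain m where m: "m \<in> matchings a b c" "\<T> = shape ` m" by blast
  show "tiling_weight c q \<kappa> \<T> =
      (\<Prod>t\<in>{1..<b+c}. \<Prod>y\<in>rng (int a) (int (b+c)) (int c) (int t) - particles \<T> (int t).
     \<kappa>\<^sup>2 * q powr (real_of_int y + 1 - real t / 2 - (real c + 1) / 2) - q powr (- (real_of_int y + 1 - real t / 2) + (real c + 1) / 2))"
    unfolding m(2) tiling_weight_pf[OF m(1)]
    by (intro prod.cong refl) (auto simp: particles_pf[OF m(1)])
qed

end

section \<open>Shift operators on polynomials\<close>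

hide_const (open) Module.smult

text \<open>The operator on polynomials in \<open>z = Q + c/Q\<close> induced by the antisymmetrisation
  \<open>(U(Q) p(Q + q c/Q) - U(c/Q) p(q Q + c/Q)) / (Q - c/Q)\<close> with \<open>U(Q) = (Q - \<alpha>)(1 - c \<beta>/Q)\<close>: the values
  \<open>Q + q c/Q\<close> and \<open>q Q + c/Q\<close> have sum \<open>(1 + q) z\<close> and product \<open>q z\<^sup>2 + c (1 - q)\<^sup>2\<close>, whence the recursion.\<close>

fun shift_mono :: "real \<Rightarrow> real \<Rightarrow> real \<Rightarrow> real \<Rightarrow> nat \<Rightarrow> real poly" where
  "shift_mono q c \<alpha> \<beta> 0 = [:1 - \<alpha> * \<beta>:]"
| "shift_mono q c \<alpha> \<beta> (Suc 0) = [:(q - 1) * (\<alpha> + c * \<beta>), 1 - \<alpha> * \<beta> * q:]"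
| "shift_mono q c \<alpha> \<beta> (Suc (Suc k)) = smult (1 + q) (pCons 0 (shift_mono q c \<alpha> \<beta> (Suc k)))
     - [:c * (1 - q)\<^sup>2, 0, q:] * shift_mono q c \<alpha> \<beta> k"

definition antisym_shift :: "real \<Rightarrow> real \<Rightarrow> real \<Rightarrow> real \<Rightarrow> (real \<Rightarrow> real) \<Rightarrow> real \<Rightarrow> real" where
  "antisym_shift q c \<alpha> \<beta> f Q =
     ((Q - \<alpha>) * (1 - c * \<beta> / Q) * f (Q + q * c / Q) - (c / Q - \<alpha>) * (1 - \<beta> * Q) * f (q * Q + c / Q)) / (Q - c / Q)"

lemma shift_mono:
  assumes "Q \<noteq> 0" "Q - c / Q \<noteq> 0"
  shows "antisym_shift q c \<alpha> \<beta> (\<lambda>z. z ^ k) Q = poly (shift_mono q c \<alpha> \<beta> k) (Q + c / Q)"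
proof (induction k rule: induct_nat_012)
  case 0
  have "(Q - \<alpha>) * (1 - c * \<beta> / Q) - (c / Q - \<alpha>) * (1 - \<beta> * Q) = (1 - \<alpha> * \<beta>) * (Q - c / Q)"
    using assms(1) by (simp add: field_simps)
  thus ?case using assms by (simp add: antisym_shift_def)
next
  case 1
  have "(Q - \<alpha>) * (1 - c * \<beta> / Q) * (Q + q * c / Q) - (c / Q - \<alpha>) * (1 - \<beta> * Q) * (q * Q + c / Q)
     = ((q - 1) * (\<alpha> + c * \<beta>) + (Q + c / Q) * (1 - \<alpha> * \<beta> * q)) * (Q - c / Q)"
    using assms(1) by (simp add: field_simps)
  thus ?case using assms by (simp add: antisym_shift_def)
next
  case (ge2 k)
  define a b where "a = Q + q * c / Q" and "b = q * Q + c / Q"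
  define z where "z = Q + c / Q"
  define u v where "u = (Q - \<alpha>) * (1 - c * \<beta> / Q)" and "v = (c / Q - \<alpha>) * (1 - \<beta> * Q)"
  have ab: "a + b = (1 + q) * (Q + c / Q)" "a * b = c * (1 - q)\<^sup>2 + q * (Q + c / Q)\<^sup>2"
    using assms(1) by (simp_all add: a_def b_def field_simps power2_eq_square)
  have rec: "a ^ Suc (Suc k) = (a + b) * a ^ Suc k - a * b * a ^ k" "b ^ Suc (Suc k) = (a + b) * b ^ Suc k - a * b * b ^ k"
    by (simp_all add: algebra_simps)
  have "antisym_shift q c \<alpha> \<beta> (\<lambda>z. z ^ Suc (Suc k)) Q = (u * a ^ Suc (Suc k) - v * b ^ Suc (Suc k)) / (Q - c / Q)"
    by (simp add: antisym_shift_def u_def v_def a_def b_def)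
  also have "\<dots> = (a + b) * ((u * a ^ Suc k - v * b ^ Suc k) / (Q - c / Q)) - a * b * ((u * a ^ k - v * b ^ k) / (Q - c / Q))"
    unfolding rec by (simp add: diff_divide_distrib[symmetric] algebra_simps)
  also have "(u * a ^ Suc k - v * b ^ Suc k) / (Q - c / Q) = poly (shift_mono q c \<alpha> \<beta> (Suc k)) (Q + c / Q)"
    using ge2 by (simp add: antisym_shift_def u_def v_def a_def b_def)
  also have "(u * a ^ k - v * b ^ k) / (Q - c / Q) = poly (shift_mono q c \<alpha> \<beta> k) (Q + c / Q)"
    using ge2 by (simp add: antisym_shift_def u_def v_def a_def b_def)
  finally show ?case unfolding ab z_def[symmetric] by (simp add: power2_eq_square algebra_simps)
qed

text \<open>The top coefficients satisfy u(k+2) = (1 + q) u(k+1) - q u(k), the recursion solved by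
  the constant sequence and by q^k; the first two values select the combination.\<close>

lemma shift_mono_coeffs:
  "degree (shift_mono q c \<alpha> \<beta> k) \<le> k" "coeff (shift_mono q c \<alpha> \<beta> k) k = 1 - \<alpha> * \<beta> * q ^ k"
proof (induction q c \<alpha> \<beta> k rule: shift_mono.induct)
  case (1 q c \<alpha> \<beta>) { case 1 show ?case by simp next case 2 show ?case by simp }
next
  case (2 q c \<alpha> \<beta>) { case 1 show ?case by simp next case 2 show ?case by simp }
next
  case (3 q c \<alpha> \<beta> k)
  { case 1 show ?case
    proof (rule degree_le, intro allI impI)
      fix i assume i: "i > Suc (Suc k)"
      have "coeff (shift_mono q c \<alpha> \<beta> k) i = 0" "coeff (shift_mono q c \<alpha> \<beta> k) (i - 1) = 0"
        "coeff (shift_mono q c \<alpha> \<beta> k) (i - 2) = 0" "coeff (shift_mono q c \<alpha> \<beta> (Suc k)) (i - 1) = 0"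
        using 3(1,3) i by (auto intro!: coeff_eq_0)
      thus "coeff (shift_mono q c \<alpha> \<beta> (Suc (Suc k))) i = 0"
        using i by (cases i; cases "i - 1") (auto simp: coeff_pCons)
    qed
  next
    case 2
    have "coeff (shift_mono q c \<alpha> \<beta> k) (Suc (Suc k)) = 0" "coeff (shift_mono q c \<alpha> \<beta> k) (Suc k) = 0"
      using 3(3) by (auto intro!: coeff_eq_0)
    thus ?case unfolding shift_mono.simps by (simp add: coeff_pCons 3(2,4)) (simp add: algebra_simps)
  }
qed

definition shift_poly :: "real \<Rightarrow> real \<Rightarrow> real \<Rightarrow> real \<Rightarrow> real poly \<Rightarrow> real poly" where
  "shift_poly q c \<alpha> \<beta> p = (\<Sum>k\<le>degree p. smult (coeff p k) (shift_mono q c \<alpha> \<beta> k))"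

lemma poly_shift_poly:
  assumes "Q \<noteq> 0" "Q - c / Q \<noteq> 0"
  shows "poly (shift_poly q c \<alpha> \<beta> p) (Q + c / Q) = antisym_shift q c \<alpha> \<beta> (poly p) Q"
proof -
  have "poly (shift_poly q c \<alpha> \<beta> p) (Q + c / Q) = (\<Sum>k\<le>degree p. coeff p k * antisym_shift q c \<alpha> \<beta> (\<lambda>z. z ^ k) Q)"
    by (simp add: shift_poly_def poly_sum shift_mono[OF assms])
  also have "\<dots> = antisym_shift q c \<alpha> \<beta> (poly p) Q"
    unfolding antisym_shift_def poly_altdef sum_distrib_left sum_divide_distrib sum_subtractf[symmetric]
    by (simp add: diff_divide_distrib algebra_simps)
  finally show ?thesis .
qed

lemma shift_poly_degree: "degree (shift_poly q c \<alpha> \<beta> p) \<le> degree p"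
  unfolding shift_poly_def
  by (intro degree_sum_le) (auto intro: order.trans[OF degree_smult_le] order.trans[OF shift_mono_coeffs(1)])

text \<open>Lower powers do not reach degree \<open>n\<close>, so the top monomial alone
  contributes. The operator is thus triangular in the degree, and its diagonal later provides the
  eigenvalues.\<close>

lemma shift_poly_coeff:
  assumes "degree p \<le> n"
  shows "coeff (shift_poly q c \<alpha> \<beta> p) n = (1 - \<alpha> * \<beta> * q ^ n) * coeff p n"
proof (cases "degree p = n")
  case True
  have "coeff (shift_poly q c \<alpha> \<beta> p) n = (\<Sum>k\<le>n. coeff p k * coeff (shift_mono q c \<alpha> \<beta> k) n)"
    by (simp add: shift_poly_def coeff_sum True)
  also have "\<dots> = (\<Sum>k\<le>n. if k = n then coeff p n * (1 - \<alpha> * \<beta> * q ^ n) else 0)"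
    using shift_mono_coeffs by (intro sum.cong refl) (auto intro!: coeff_eq_0 le_neq_trans order.strict_trans1[OF shift_mono_coeffs(1)])
  finally show ?thesis by simp
next
  case False
  hence "degree p < n" using assms by simp
  moreover have "degree (shift_poly q c \<alpha> \<beta> p) < n" using shift_poly_degree[of q c \<alpha> \<beta> p] calculation by simp
  ultimately show ?thesis by (simp add: coeff_eq_0)
qed

section \<open>The law of a slice\<close>

lemma sum_PiE_Suc:
  "(\<Sum>F\<in>PiE {..Suc n} C. f F) = (\<Sum>F\<in>PiE {..n} C. \<Sum>y\<in>C (Suc n). f (F(Suc n := y)))"
proof -
  have "PiE {..Suc n} C = (\<lambda>(y, g). g(Suc n := y)) ` (C (Suc n) \<times> PiE {..n} C)"
    unfolding atMost_Suc by (rule PiE_insert_eq)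
  moreover have "inj_on (\<lambda>(y, g). g(Suc n := y)) (C (Suc n) \<times> PiE {..n} C)"
    by (rule inj_combinator) simp
  ultimately have "(\<Sum>F\<in>PiE {..Suc n} C. f F) = (\<Sum>(y, F)\<in>C (Suc n) \<times> PiE {..n} C. f (F(Suc n := y)))"
    by (simp add: sum.reindex case_prod_unfold)
  also have "\<dots> = (\<Sum>y\<in>C (Suc n). \<Sum>F\<in>PiE {..n} C. f (F(Suc n := y)))"
    by (rule sum.cartesian_product[symmetric])
  also have "\<dots> = (\<Sum>F\<in>PiE {..n} C. \<Sum>y\<in>C (Suc n). f (F(Suc n := y)))" by (rule sum.swap)
  finally show ?thesis .
qed

lemma sum_PiE_0: "(\<Sum>F\<in>PiE {..0::nat} C. f F) = (\<Sum>y\<in>C 0. f ((\<lambda>_. undefined)(0 := y)))"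
proof -
  have "PiE {..0::nat} C = (\<lambda>(y, g). g(0 := y)) ` (C 0 \<times> PiE {} C)"
    using PiE_insert_eq[of 0 "{}" C] by simp
  moreover have "inj_on (\<lambda>(y, g). g(0::nat := y)) (C 0 \<times> PiE {} C)"
    by (rule inj_combinator) simp
  ultimately have "(\<Sum>F\<in>PiE {..0} C. f F) = (\<Sum>(y, F)\<in>C 0 \<times> PiE {} C. f (F(0 := y)))"
    by (simp add: sum.reindex case_prod_unfold)
  also have "\<dots> = (\<Sum>y\<in>C 0. f ((\<lambda>_. undefined)(0 := y)))"
    unfolding sum.cartesian_product[symmetric] by (simp add: fun_upd_def)
  finally show ?thesis .
qed

lemma path_sum_end:
  fixes k :: "nat \<Rightarrow> 'a \<Rightarrow> 'a \<Rightarrow> real"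
  assumes A0: "\<And>x. x \<in> C 0 \<Longrightarrow> A 0 x = 1"
    and AS: "\<And>t y. t < T \<Longrightarrow> y \<in> C (Suc t) \<Longrightarrow> A (Suc t) y = (\<Sum>x\<in>C t. A t x * k t x y)"
    and "t \<le> T"
  shows "(\<Sum>F\<in>PiE {..t} C. (\<Prod>i<t. k i (F i) (F (Suc i))) * u (F t)) = (\<Sum>z\<in>C t. A t z * u z)"
  using \<open>t \<le> T\<close>
proof (induction t arbitrary: u)
  case 0
  show ?case unfolding sum_PiE_0 using A0 by simp
next
  case (Suc t)
  have "(\<Sum>F\<in>PiE {..Suc t} C. (\<Prod>i<Suc t. k i (F i) (F (Suc i))) * u (F (Suc t)))
      = (\<Sum>F\<in>PiE {..t} C. (\<Prod>i<t. k i (F i) (F (Suc i))) * (\<Sum>y\<in>C (Suc t). k t (F t) y * u y))"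
    unfolding sum_PiE_Suc sum_distrib_left by (intro sum.cong refl) (simp add: mult.assoc)
  also have "\<dots> = (\<Sum>z\<in>C t. \<Sum>y\<in>C (Suc t). A t z * k t z y * u y)"
    using Suc.IH[of "\<lambda>z. \<Sum>y\<in>C (Suc t). k t z y * u y"] Suc.prems by (simp add: sum_distrib_left mult.assoc)
  also have "\<dots> = (\<Sum>y\<in>C (Suc t). \<Sum>z\<in>C t. A t z * k t z y * u y)" by (rule sum.swap)
  also have "\<dots> = (\<Sum>y\<in>C (Suc t). A (Suc t) y * u y)"
    using AS[of t] Suc.prems by (intro sum.cong refl) (simp add: sum_distrib_right)
  finally show ?case .
qed

text \<open>Cutting at time \<open>t\<close> splits a path into two independent pieces:
  \<open>A\<close> sums the weights of the first pieces, \<open>B\<close> those of the second. The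
  induction lengthens the path beyond \<open>t\<close> one step at a time, with \<open>B n\<close>
  standing for the part still missing.\<close>

lemma path_sum:
  fixes k :: "nat \<Rightarrow> 'a \<Rightarrow> 'a \<Rightarrow> real"
  assumes fin: "\<And>t. finite (C t)" and A0: "\<And>x. x \<in> C 0 \<Longrightarrow> A 0 x = 1"
    and AS: "\<And>t y. t < T \<Longrightarrow> y \<in> C (Suc t) \<Longrightarrow> A (Suc t) y = (\<Sum>x\<in>C t. A t x * k t x y)"
    and BT: "\<And>x. x \<in> C T \<Longrightarrow> B T x = 1"
    and BS: "\<And>t x. t < T \<Longrightarrow> x \<in> C t \<Longrightarrow> B t x = (\<Sum>y\<in>C (Suc t). k t x y * B (Suc t) y)"
    and t: "t \<le> T" "x \<in> C t"
  shows "(\<Sum>F | F \<in> PiE {..T} C \<and> F t = x. \<Prod>i<T. k i (F i) (F (Suc i))) = A t x * B t x"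
proof -
  have "(\<Sum>F\<in>PiE {..n} C. of_bool (F t = x) * ((\<Prod>i<n. k i (F i) (F (Suc i))) * B n (F n))) = A t x * B t x"
    if "n \<le> T" "t \<le> n" for n
    using that(2,1)
  proof (induction n rule: dec_induct)
    case base
    have "(\<Sum>F\<in>PiE {..t} C. (\<Prod>i<t. k i (F i) (F (Suc i))) * (of_bool (F t = x) * B t (F t))) = (\<Sum>z\<in>C t. A t z * (of_bool (z = x) * B t z))"
      by (rule path_sum_end[where u = "\<lambda>z. of_bool (z = x) * B t z", OF A0 AS t(1)])
    also have "\<dots> = A t x * B t x"
    proof -
      have "(\<Sum>z\<in>C t. A t z * (of_bool (z = x) * B t z)) = (\<Sum>z\<in>C t. if z = x then A t z * B t z else 0)"
        by (intro sum.cong) auto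
      thus ?thesis using t(2) fin by simp
    qed
    finally show ?case by (simp add: algebra_simps)
  next
    case (step n)
    have "(\<Sum>F\<in>PiE {..Suc n} C. of_bool (F t = x) * ((\<Prod>i<Suc n. k i (F i) (F (Suc i))) * B (Suc n) (F (Suc n))))
      = (\<Sum>F\<in>PiE {..n} C. of_bool (F t = x) * ((\<Prod>i<n. k i (F i) (F (Suc i))) * (\<Sum>y\<in>C (Suc n). k n (F n) y * B (Suc n) y)))"
      unfolding sum_PiE_Suc sum_distrib_left using step(1) by (intro sum.cong refl) (simp add: mult.assoc)
    also have "\<dots> = (\<Sum>F\<in>PiE {..n} C. of_bool (F t = x) * ((\<Prod>i<n. k i (F i) (F (Suc i))) * B n (F n)))"
      using step(4) BS[of n] by (intro sum.cong refl) (auto simp: PiE_iff)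
    finally show ?case using step by simp
  qed
  from this[OF order.refl t(1)]
  have "A t x * B t x = (\<Sum>F\<in>PiE {..T} C. of_bool (F t = x) * (\<Prod>i<T. k i (F i) (F (Suc i))))"
    using BT by (auto simp: PiE_iff intro!: sum.cong)
  also have "\<dots> = (\<Sum>F | F \<in> PiE {..T} C \<and> F t = x. \<Prod>i<T. k i (F i) (F (Suc i)))"
    using fin by (intro sum.mono_neutral_cong_right) (auto intro!: finite_PiE)
  finally show ?thesis by simp
qed

lemma jumps_card: "jumps \<delta> X Y \<Longrightarrow> card Y = card X"
  by (auto simp: jumps_def dest: bij_betw_same_card)

text \<open>One step of the forward, respectively backward, partition function of nonintersecting paths maps a product of
  single particle weights and a Vandermonde determinant to a function of the same form.\<close>

lemma jump_sum_vandermonde: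
  assumes fin: "finite Y" "finite R" and \<delta>: "\<delta> \<in> {1, -1}" and N: "card Y = N"
    and out: "\<And>y. y \<in> Y \<Longrightarrow> y \<notin> R \<Longrightarrow> g y = 0" "\<And>y. y \<in> Y \<Longrightarrow> y + \<delta> \<notin> R \<Longrightarrow> g (y + \<delta>) = 0"
    and eq: "\<And>y j. y \<in> Y \<Longrightarrow> j < N \<Longrightarrow> g y * \<sigma> y ^ j + g (y + \<delta>) * \<sigma> (y + \<delta>) ^ j = h y * poly (p j) (\<tau> y)"
    and deg: "\<And>j. j < N \<Longrightarrow> degree (p j) \<le> j"
  shows "(\<Sum>X | X \<subseteq> R \<and> card X = N \<and> jumps \<delta> Y X. (\<Prod>x\<in>X. g x) * slater (\<lambda>j x. \<sigma> x ^ j) X) =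
     mdet N (\<lambda>k j. coeff (p j) k) * ((\<Prod>y\<in>Y. h y) * slater (\<lambda>j y. \<tau> y ^ j) Y)"
proof -
  have "(\<Sum>X | X \<subseteq> R \<and> card X = N \<and> jumps \<delta> Y X. (\<Prod>x\<in>X. g x) * slater (\<lambda>j x. \<sigma> x ^ j) X)
     = (\<Sum>X | X \<subseteq> R \<and> jumps \<delta> Y X. slater (\<lambda>j x. g x * \<sigma> x ^ j) X)"
    using N jumps_card finite_subset[OF _ fin(2)] by (intro sum.cong) (auto simp: slater_scale)
  also have "\<dots> = slater (\<lambda>j y. g y * \<sigma> y ^ j + g (y + \<delta>) * \<sigma> (y + \<delta>) ^ j) Y"
    using out by (intro slater_jump_sum[OF fin \<delta>]) auto
  also have "\<dots> = slater (\<lambda>j y. h y * poly (p j) (\<tau> y)) Y"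
    unfolding slater_def using enum_props(3)[OF fin(1)] eq N by (intro mdet_cong) auto
  also have "\<dots> = (\<Prod>y\<in>Y. h y) * (slater (\<lambda>j y. \<tau> y ^ j) Y * mdet N (\<lambda>k j. coeff (p j) k))"
    using deg N by (simp add: slater_scale[OF fin(1)] slater_poly[OF fin(1)])
  finally show ?thesis by simp
qed

text \<open>A particle at \<open>y\<close> on line \<open>i\<close> contributes
  \<open>1 / w i y\<close>; \<open>g\<close> and \<open>g'\<close> are the single particle weights
  of the forward and backward partition functions. The constant \<open>K\<close> is the same for all
  configurations of the slice and disappears on normalisation.\<close>

lemma slice_sum:
  fixes N T :: nat and R :: "nat \<Rightarrow> int set" and g g' w \<sigma> :: "nat \<Rightarrow> int \<Rightarrow> real"
  defines "C \<equiv> \<lambda>t. {X. X \<subseteq> R t \<and> card X = N}"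
  assumes fin: "\<And>t. finite (R t)" and ends: "card (R 0) = N" "card (R T) = N"
    and w: "\<And>t y. t \<le> T \<Longrightarrow> y \<in> R t \<Longrightarrow> w t y \<noteq> 0"
    and inj: "inj_on (\<sigma> 0) (R 0)" "inj_on (\<sigma> T) (R T)"
    and gnz: "\<And>y. y \<in> R 0 \<Longrightarrow> g 0 y \<noteq> 0" "\<And>y. y \<in> R T \<Longrightarrow> g' T y \<noteq> 0"
    and gout: "\<And>t y. t < T \<Longrightarrow> y \<in> R (Suc t) \<Longrightarrow> y \<notin> R t \<Longrightarrow> g t y = 0"
      "\<And>t y. t < T \<Longrightarrow> y \<in> R (Suc t) \<Longrightarrow> y - 1 \<notin> R t \<Longrightarrow> g t (y - 1) = 0"
    and geq: "\<And>t y j. t < T \<Longrightarrow> y \<in> R (Suc t) \<Longrightarrow> j < N \<Longrightarrow>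
        g t y * \<sigma> t y ^ j + g t (y - 1) * \<sigma> t (y - 1) ^ j = w (Suc t) y * g (Suc t) y * poly (p t j) (\<sigma> (Suc t) y)"
    and gdeg: "\<And>t j. j < N \<Longrightarrow> degree (p t j) \<le> j"
    and gout': "\<And>t y. t < T \<Longrightarrow> y \<in> R t \<Longrightarrow> y \<notin> R (Suc t) \<Longrightarrow> g' (Suc t) y = 0"
      "\<And>t y. t < T \<Longrightarrow> y \<in> R t \<Longrightarrow> y + 1 \<notin> R (Suc t) \<Longrightarrow> g' (Suc t) (y + 1) = 0"
    and geq': "\<And>t y j. t < T \<Longrightarrow> y \<in> R t \<Longrightarrow> j < N \<Longrightarrow>
        g' (Suc t) y * \<sigma> (Suc t) y ^ j + g' (Suc t) (y + 1) * \<sigma> (Suc t) (y + 1) ^ j = w t y * g' t y * poly (p' t j) (\<sigma> t y)"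
    and gdeg': "\<And>t j. j < N \<Longrightarrow> degree (p' t j) \<le> j"
    and t: "t \<le> T"
  shows "\<exists>K. \<forall>X\<in>C t. (\<Sum>F | F \<in> PiE {..T} C \<and> (\<forall>i<T. jumps 1 (F i) (F (Suc i))) \<and> F t = X. \<Prod>i\<le>T. \<Prod>y\<in>F i. 1 / w i y)
      = K * ((slater (\<lambda>j x. \<sigma> t x ^ j) X)\<^sup>2 * (\<Prod>x\<in>X. g t x * g' t x * w t x))"
proof -
  define k where "k = (\<lambda>t X Y. if jumps 1 X Y then \<Prod>y\<in>Y. 1 / w (Suc t) y else 0)"
  define A where "A = rec_nat (\<lambda>_. 1) (\<lambda>t At Y. \<Sum>X\<in>C t. At X * k t X Y)"
  define B where "B = (\<lambda>t. rec_nat (\<lambda>_. 1) (\<lambda>d Bd X. \<Sum>Y\<in>C (T - d). k (T - Suc d) X Y * Bd Y) (T - t))"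
  have finC: "finite (C t)" for t unfolding C_def by (rule finite_subset[of _ "Pow (R t)"]) (use fin in auto)
  have Cend: "C t = {R t}" if "card (R t) = N" for t
  proof -
    have "X = R t" if "X \<subseteq> R t" "card X = N" for X using card_subset_eq[OF fin that(1)] that(2) \<open>card (R t) = N\<close> by simp
    thus ?thesis unfolding C_def using that by auto
  qed
  have C0: "C 0 = {R 0}" "C T = {R T}" using Cend ends by blast+
  have CD: "X \<subseteq> R t" "card X = N" "finite X" if "X \<in> C t" for X t
    using that finite_subset[OF _ fin, of X t] unfolding C_def by auto
  have wprod: "(\<Prod>y\<in>Y. w t y) \<noteq> 0" if "Y \<in> C t" "t \<le> T" for Y t using CD[OF that(1)] w[OF that(2)] by (simp add: prod_zero_iff subset_iff)
  have A0: "A 0 x = 1" for x by (simp add: A_def)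
  have AS: "A (Suc t) Y = (\<Sum>X\<in>C t. A t X * k t X Y)" for t Y by (simp add: A_def)
  have BT: "B T x = 1" for x by (simp add: B_def)
  have BS: "B t X = (\<Sum>Y\<in>C (Suc t). k t X Y * B (Suc t) Y)" if "t < T" for t X
  proof -
    define d where "d = T - Suc t"
    have d: "T - t = Suc d" "T - Suc t = d" "T - d = Suc t" "T - Suc d = t" using that by (auto simp: d_def)
    show ?thesis unfolding B_def d by (simp add: d)
  qed
  have Aform: "\<exists>K. \<forall>X\<in>C t. A t X = K * ((\<Prod>x\<in>X. g t x) * slater (\<lambda>j x. \<sigma> t x ^ j) X)" if "t \<le> T" for t
    using that
  proof (induction t)
    case 0
    have "(\<Prod>x\<in>R 0. g 0 x) * slater (\<lambda>j x. \<sigma> 0 x ^ j) (R 0) \<noteq> 0"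
      using gnz(1) fin slater_vandermonde_nonzero[OF fin inj(1)] by auto
    thus ?case unfolding C0 A0 by (auto intro: exI[of _ "1 / ((\<Prod>x\<in>R 0. g 0 x) * slater (\<lambda>j x. \<sigma> 0 x ^ j) (R 0))"])
  next
    case (Suc t)
    then obtain K where K: "\<And>X. X \<in> C t \<Longrightarrow> A t X = K * ((\<Prod>x\<in>X. g t x) * slater (\<lambda>j x. \<sigma> t x ^ j) X)" by auto
    have tT: "t < T" using Suc.prems by simp
    have "A (Suc t) Y = K * mdet N (\<lambda>k j. coeff (p t j) k) * ((\<Prod>x\<in>Y. g (Suc t) x) * slater (\<lambda>j x. \<sigma> (Suc t) x ^ j) Y)" if Y: "Y \<in> C (Suc t)" for Y
    proof -
      have "A (Suc t) Y = (\<Sum>X | X \<in> C t \<and> jumps 1 X Y. A t X * (\<Prod>y\<in>Y. 1 / w (Suc t) y))"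
        unfolding AS k_def using finC by (intro sum.mono_neutral_cong_right) auto
      also have "{X. X \<in> C t \<and> jumps 1 X Y} = {X. X \<subseteq> R t \<and> card X = N \<and> jumps (-1) Y X}"
        unfolding C_def using jumps_sym[of 1 _ Y] jumps_sym[of "-1" Y] by auto
      also have "(\<Sum>X\<in>\<dots>. A t X * (\<Prod>y\<in>Y. 1 / w (Suc t) y))
         = (\<Prod>y\<in>Y. 1 / w (Suc t) y) * K * (\<Sum>X | X \<subseteq> R t \<and> card X = N \<and> jumps (-1) Y X. (\<Prod>x\<in>X. g t x) * slater (\<lambda>j x. \<sigma> t x ^ j) X)"
        unfolding sum_distrib_left using K by (intro sum.cong) (auto simp: C_def)
      also have "(\<Sum>X | X \<subseteq> R t \<and> card X = N \<and> jumps (-1) Y X. (\<Prod>x\<in>X. g t x) * slater (\<lambda>j x. \<sigma> t x ^ j) X)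
         = mdet N (\<lambda>k j. coeff (p t j) k) * ((\<Prod>y\<in>Y. w (Suc t) y * g (Suc t) y) * slater (\<lambda>j y. \<sigma> (Suc t) y ^ j) Y)"
        by (rule jump_sum_vandermonde) (use CD[OF Y] fin gout[OF tT] geq[OF tT] gdeg in auto)
      finally show ?thesis using wprod[OF Y Suc.prems] by (simp add: prod.distrib prod_dividef)
    qed
    thus ?case by blast
  qed
  have Bform: "\<exists>K. \<forall>X\<in>C t. B t X = K * ((\<Prod>x\<in>X. w t x * g' t x) * slater (\<lambda>j x. \<sigma> t x ^ j) X)" if "t \<le> T" for t
    using that
  proof (induction t rule: inc_induct)
    case base
    have "(\<Prod>x\<in>R T. w T x * g' T x) * slater (\<lambda>j x. \<sigma> T x ^ j) (R T) \<noteq> 0"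
      using gnz(2) w fin slater_vandermonde_nonzero[OF fin inj(2)] by auto
    thus ?case unfolding C0 BT by (auto intro: exI[of _ "1 / ((\<Prod>x\<in>R T. w T x * g' T x) * slater (\<lambda>j x. \<sigma> T x ^ j) (R T))"])
  next
    case (step t)
    then obtain K where K: "\<And>X. X \<in> C (Suc t) \<Longrightarrow> B (Suc t) X = K * ((\<Prod>x\<in>X. w (Suc t) x * g' (Suc t) x) * slater (\<lambda>j x. \<sigma> (Suc t) x ^ j) X)" by auto
    have tT: "t < T" using step by simp
    have "B t X = K * mdet N (\<lambda>k j. coeff (p' t j) k) * ((\<Prod>x\<in>X. w t x * g' t x) * slater (\<lambda>j x. \<sigma> t x ^ j) X)" if X: "X \<in> C t" for X
    proof -
      have "B t X = (\<Sum>Y | Y \<subseteq> R (Suc t) \<and> card Y = N \<and> jumps 1 X Y. (\<Prod>y\<in>Y. 1 / w (Suc t) y) * B (Suc t) Y)"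
        unfolding BS[OF tT] k_def using finC by (intro sum.mono_neutral_cong_right) (auto simp: C_def)
      also have "\<dots> = K * (\<Sum>Y | Y \<subseteq> R (Suc t) \<and> card Y = N \<and> jumps 1 X Y. (\<Prod>y\<in>Y. g' (Suc t) y) * slater (\<lambda>j x. \<sigma> (Suc t) x ^ j) Y)"
        unfolding sum_distrib_left
      proof (intro sum.cong refl)
        fix Y assume "Y \<in> {Y. Y \<subseteq> R (Suc t) \<and> card Y = N \<and> jumps 1 X Y}"
        hence Y: "Y \<in> C (Suc t)" by (simp add: C_def)
        show "(\<Prod>y\<in>Y. 1 / w (Suc t) y) * B (Suc t) Y = K * ((\<Prod>y\<in>Y. g' (Suc t) y) * slater (\<lambda>j x. \<sigma> (Suc t) x ^ j) Y)"
          using K[OF Y] wprod[OF Y] tT by (simp add: prod.distrib prod_dividef)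
      qed
      also have "(\<Sum>Y | Y \<subseteq> R (Suc t) \<and> card Y = N \<and> jumps 1 X Y. (\<Prod>y\<in>Y. g' (Suc t) y) * slater (\<lambda>j x. \<sigma> (Suc t) x ^ j) Y)
         = mdet N (\<lambda>k j. coeff (p' t j) k) * ((\<Prod>y\<in>X. w t y * g' t y) * slater (\<lambda>j y. \<sigma> t y ^ j) X)"
        by (rule jump_sum_vandermonde) (use CD[OF X] fin gout'[OF tT] geq'[OF tT] gdeg' in auto)
      finally show ?thesis by simp
    qed
    thus ?case by blast
  qed
  obtain Ka Kb where K: "\<And>X. X \<in> C t \<Longrightarrow> A t X = Ka * ((\<Prod>x\<in>X. g t x) * slater (\<lambda>j x. \<sigma> t x ^ j) X)"
    "\<And>X. X \<in> C t \<Longrightarrow> B t X = Kb * ((\<Prod>x\<in>X. w t x * g' t x) * slater (\<lambda>j x. \<sigma> t x ^ j) X)"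
    using Aform[OF t] Bform[OF t] by blast
  define c0 where "c0 = (\<Prod>y\<in>R 0. 1 / w 0 y)"
  show ?thesis
  proof (intro exI ballI)
    fix X assume X: "X \<in> C t"
    have "(\<Sum>F | F \<in> PiE {..T} C \<and> (\<forall>i<T. jumps 1 (F i) (F (Suc i))) \<and> F t = X. \<Prod>i\<le>T. \<Prod>y\<in>F i. 1 / w i y)
       = (\<Sum>F | F \<in> PiE {..T} C \<and> F t = X. c0 * (\<Prod>i<T. k i (F i) (F (Suc i))))"
    proof (intro sum.mono_neutral_cong_left)
      show "finite {F. F \<in> PiE {..T} C \<and> F t = X}"
        using finC by (intro finite_subset[OF _ finite_PiE[of "{..T}" C]]) auto
      show "\<forall>F\<in>{F. F \<in> PiE {..T} C \<and> F t = X} - {F. F \<in> PiE {..T} C \<and> (\<forall>i<T. jumps 1 (F i) (F (Suc i))) \<and> F t = X}.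
          c0 * (\<Prod>i<T. k i (F i) (F (Suc i))) = 0"
        by (auto simp: k_def)
      fix F assume F: "F \<in> {F. F \<in> PiE {..T} C \<and> (\<forall>i<T. jumps 1 (F i) (F (Suc i))) \<and> F t = X}"
      hence "F 0 \<in> C 0" by (auto simp: PiE_iff)
      hence "F 0 = R 0" using C0 by simp
      moreover have "(\<Prod>i\<le>T. \<Prod>y\<in>F i. 1 / w i y) = (\<Prod>y\<in>F 0. 1 / w 0 y) * (\<Prod>i<T. \<Prod>y\<in>F (Suc i). 1 / w (Suc i) y)"
        by (rule prod.atMost_shift)
      ultimately show "(\<Prod>i\<le>T. \<Prod>y\<in>F i. 1 / w i y) = c0 * (\<Prod>i<T. k i (F i) (F (Suc i)))"
        using F by (auto simp: c0_def k_def)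
    qed auto
    also have "\<dots> = c0 * (A t X * B t X)"
      unfolding sum_distrib_left[symmetric] using X t finC BS AS A0 BT
      by (subst path_sum[of C A T k B t X]) auto
    finally show "(\<Sum>F | F \<in> PiE {..T} C \<and> (\<forall>i<T. jumps 1 (F i) (F (Suc i))) \<and> F t = X. \<Prod>i\<le>T. \<Prod>y\<in>F i. 1 / w i y)
      = c0 * Ka * Kb * ((slater (\<lambda>j x. \<sigma> t x ^ j) X)\<^sup>2 * (\<Prod>x\<in>X. g t x * g' t x * w t x))"
      unfolding K[OF X] by (simp add: prod.distrib power2_eq_square)
  qed
qed

section \<open>Determinantal projection ensembles\<close>

lemma mdet_permute_rows:
  assumes "\<pi> permutes {..<n}" shows "mdet n (\<lambda>i j. M (\<pi> i) j) = signof \<pi> * mdet n M"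
proof -
  have p: "\<pi> permutes {0..<n}" using assms by (simp add: atLeast0LessThan)
  have "det (mat n n (\<lambda>(i,j). mat n n (\<lambda>(i,j). M i j) $$ (\<pi> i, j))) = signof \<pi> * det (mat n n (\<lambda>(i,j). M i j))"
    by (rule det_permute_rows[OF _ p]) simp
  moreover have "mat n n (\<lambda>(i,j). mat n n (\<lambda>(i,j). M i j) $$ (\<pi> i, j)) = mat n n (\<lambda>(i,j). M (\<pi> i) j)"
    using permutes_in_image[OF p] by (intro eq_matI) auto
  ultimately show ?thesis by (simp add: mdet_def)
qed

lemma mdet_transpose: "mdet n (\<lambda>i j. M j i) = mdet n M"
proof -
  have "mat n n (\<lambda>(i,j). M j i) = transpose_mat (mat n n (\<lambda>(i,j). M i j))" by (intro eq_matI) auto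
  thus ?thesis unfolding mdet_def by (simp add: det_transpose[of _ n])
qed

text \<open>After multilinear expansion only injective choices of sites survive. An injective choice
  is a set together with a permutation of its sorted elements; the sum over permutations reassembles
  the first determinant, and row permutation turns the other factor into the second.\<close>

lemma cauchy_binet:
  assumes fin: "finite \<Omega>"
  shows "mdet n (\<lambda>i j. \<Sum>x\<in>\<Omega>. a i x * b j x) = (\<Sum>X | X \<subseteq> \<Omega> \<and> card X = n. slater a X * slater b X)"
proof -
  define f where "f = (\<lambda>(X, \<pi>). \<lambda>i\<in>{..<n}. enum X ! (\<pi> i))"
  define P where "P = {X. X \<subseteq> \<Omega> \<and> card X = n}"
  define I where "I = {e \<in> PiE {..<n} (\<lambda>_. \<Omega>). inj_on e {..<n}}"
  have fX: "finite X" if "X \<in> P" for X using that finite_subset[OF _ fin] by (auto simp: P_def)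
  have bij: "bij_betw (\<lambda>i. enum X ! i) {..<n} X" if "X \<in> P" for X
    using enum_image(2)[of n "\<lambda>i. enum X ! i"] enum_props[OF fX[OF that]] that by (auto simp: bij_betw_def P_def)
  have fb: "bij_betw (f (X, \<pi>)) {..<n} X" if "X \<in> P" "\<pi> permutes {..<n}" for X \<pi>
  proof -
    have "bij_betw ((\<lambda>i. enum X ! i) \<circ> \<pi>) {..<n} X"
      by (rule bij_betw_trans[OF permutes_imp_bij[OF that(2)] bij[OF that(1)]])
    thus ?thesis by (rule bij_betw_cong[THEN iffD1, rotated]) (auto simp: f_def)
  qed
  have inj: "inj_on f (P \<times> {\<pi>. \<pi> permutes {..<n}})"
  proof (rule inj_onI, clarify)
    fix X \<pi> X' \<pi>' assume h: "X \<in> P" "\<pi> permutes {..<n}" "X' \<in> P" "\<pi>' permutes {..<n}" "f (X, \<pi>) = f (X', \<pi>')"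
    have "X = X'" using bij_betw_imp_surj_on[OF fb[OF h(1,2)]] bij_betw_imp_surj_on[OF fb[OF h(3,4)]] h(5) by simp
    moreover have "\<pi> i = \<pi>' i" for i
    proof (cases "i < n")
      case True
      have "enum X ! (\<pi> i) = enum X ! (\<pi>' i)" using fun_cong[OF h(5), of i] True \<open>X = X'\<close> by (simp add: f_def)
      thus ?thesis using bij_betw_imp_inj_on[OF bij[OF h(1)]] permutes_in_image[OF h(2), of i] permutes_in_image[OF h(4), of i] True
        by (auto dest: inj_onD)
    next
      case False thus ?thesis using permutes_not_in[OF h(2), of i] permutes_not_in[OF h(4), of i] by simp
    qed
    ultimately show "X = X' \<and> \<pi> = \<pi>'" by auto
  qed
  have img: "f ` (P \<times> {\<pi>. \<pi> permutes {..<n}}) = I"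
  proof
    show "f ` (P \<times> {\<pi>. \<pi> permutes {..<n}}) \<subseteq> I"
    proof clarify
      fix X \<pi> assume h: "X \<in> P" "\<pi> permutes {..<n}"
      have "f (X, \<pi>) i \<in> \<Omega>" if "i < n" for i using bij_betw_apply[OF fb[OF h], of i] that h(1) by (auto simp: P_def)
      thus "f (X, \<pi>) \<in> I" using bij_betw_imp_inj_on[OF fb[OF h]] by (auto simp: I_def f_def)
    qed
    show "I \<subseteq> f ` (P \<times> {\<pi>. \<pi> permutes {..<n}})"
    proof
      fix e assume e: "e \<in> I"
      define X where "X = e ` {..<n}"
      have X: "X \<in> P" using e by (auto simp: X_def P_def I_def card_image)
      have eb: "bij_betw e {..<n} X" using e by (auto simp: X_def I_def bij_betw_def)
      define \<pi> where "\<pi> = (\<lambda>i. if i < n then inv_into {..<n} (\<lambda>i. enum X ! i) (e i) else i)"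
      have "bij_betw (inv_into {..<n} (\<lambda>i. enum X ! i) \<circ> e) {..<n} {..<n}"
        by (rule bij_betw_trans[OF eb bij_betw_inv_into[OF bij[OF X]]])
      hence "bij_betw \<pi> {..<n} {..<n}" by (rule bij_betw_cong[THEN iffD1, rotated]) (auto simp: \<pi>_def)
      hence p: "\<pi> permutes {..<n}" by (rule bij_imp_permutes) (auto simp: \<pi>_def)
      have "f (X, \<pi>) = e"
      proof
        fix i show "f (X, \<pi>) i = e i"
        proof (cases "i < n")
          case True
          have "e i \<in> (\<lambda>i. enum X ! i) ` {..<n}" using bij_betw_imp_surj_on[OF bij[OF X]] True by (auto simp: X_def)
          thus ?thesis using True f_inv_into_f[of "e i" "\<lambda>i. enum X ! i" "{..<n}"] by (simp add: f_def \<pi>_def)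
        next
          case False thus ?thesis using e by (auto simp: f_def I_def PiE_def extensional_def)
        qed
      qed
      thus "e \<in> f ` (P \<times> {\<pi>. \<pi> permutes {..<n}})" using X p by (intro image_eqI[of _ _ "(X, \<pi>)"]) auto
    qed
  qed
  have "mdet n (\<lambda>i j. \<Sum>x\<in>\<Omega>. a i x * b j x) = (\<Sum>e\<in>PiE {..<n} (\<lambda>_. \<Omega>). mdet n (\<lambda>i j. a i (e i) * b j (e i)))"
    by (rule mdet_sum_rows) (rule fin)
  also have "\<dots> = (\<Sum>e\<in>I. (\<Prod>i<n. a i (e i)) * mdet n (\<lambda>i j. b j (e i)))"
  proof (rule sum.mono_neutral_cong_right)
    show "finite (PiE {..<n} (\<lambda>_. \<Omega>))" using fin by (intro finite_PiE) auto
    show "\<forall>e\<in>PiE {..<n} (\<lambda>_. \<Omega>) - I. mdet n (\<lambda>i j. a i (e i) * b j (e i)) = 0"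
    proof
      fix e assume "e \<in> PiE {..<n} (\<lambda>_. \<Omega>) - I"
      then obtain i j where "i < n" "j < n" "i \<noteq> j" "e i = e j" by (auto simp: I_def inj_on_def)
      thus "mdet n (\<lambda>i j. a i (e i) * b j (e i)) = 0"
        unfolding mdet_scale_rows by (simp add: mdet_eq_rows[of i n j])
    qed
  qed (auto simp: I_def mdet_scale_rows)
  also have "\<dots> = (\<Sum>(X, \<pi>)\<in>P \<times> {\<pi>. \<pi> permutes {..<n}}. (\<Prod>i<n. a i (f (X, \<pi>) i)) * mdet n (\<lambda>i j. b j (f (X, \<pi>) i)))"
    unfolding img[symmetric] by (subst sum.reindex[OF inj]) (simp add: case_prod_unfold)
  also have "\<dots> = (\<Sum>X\<in>P. \<Sum>\<pi> | \<pi> permutes {..<n}. (\<Prod>i<n. a i (f (X, \<pi>) i)) * mdet n (\<lambda>i j. b j (f (X, \<pi>) i)))"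
    by (rule sum.cartesian_product[symmetric])
  also have "\<dots> = (\<Sum>X\<in>P. slater a X * slater b X)"
  proof (rule sum.cong[OF refl])
    fix X assume X: "X \<in> P"
    hence c: "card X = n" by (simp add: P_def)
    have "(\<Prod>i<n. a i (f (X, \<pi>) i)) * mdet n (\<lambda>i j. b j (f (X, \<pi>) i))
        = signof \<pi> * (\<Prod>i<n. a i (enum X ! \<pi> i)) * slater b X" if p: "\<pi> permutes {..<n}" for \<pi>
    proof -
      have "mdet n (\<lambda>i j. b j (f (X, \<pi>) i)) = mdet n (\<lambda>i j. b j (enum X ! \<pi> i))"
        by (intro mdet_cong) (simp add: f_def)
      also have "\<dots> = signof \<pi> * slater b X"
        using mdet_permute_rows[OF p, of "\<lambda>i j. b j (enum X ! i)"] by (simp add: slater_def c)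
      finally show ?thesis by (simp add: f_def)
    qed
    hence "(\<Sum>\<pi> | \<pi> permutes {..<n}. (\<Prod>i<n. a i (f (X, \<pi>) i)) * mdet n (\<lambda>i j. b j (f (X, \<pi>) i)))
      = (\<Sum>\<pi> | \<pi> permutes {..<n}. signof \<pi> * (\<Prod>i<n. a i (enum X ! \<pi> i))) * slater b X"
      by (simp add: sum_distrib_right)
    also have "(\<Sum>\<pi> | \<pi> permutes {..<n}. signof \<pi> * (\<Prod>i<n. a i (enum X ! \<pi> i))) = slater a X"
      using mdet_transpose[of n "\<lambda>i j. a j (enum X ! i)"] by (simp add: slater_def c mdet_leibniz[of n "\<lambda>i j. a i (enum X ! j)"])
    finally show "(\<Sum>\<pi> | \<pi> permutes {..<n}. (\<Prod>i<n. a i (f (X, \<pi>) i)) * mdet n (\<lambda>i j. b j (f (X, \<pi>) i))) = slater a X * slater b X" .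
  qed
  finally show ?thesis by (simp add: P_def)
qed

lemma prod_indicator_at:
  fixes n :: nat
  assumes "\<pi> permutes {..<n}" "i < n"
  shows "(\<Prod>m<n. if \<pi> m = i then f m else (1::real)) = f (inv_into UNIV \<pi> i)"
proof -
  have "\<pi> m = i \<longleftrightarrow> m = inv_into UNIV \<pi> i" for m using permutes_inverses[OF assms(1)] by auto
  moreover have "inv_into UNIV \<pi> i < n" using permutes_in_image[OF permutes_inv[OF assms(1)], of i] assms(2) by simp
  ultimately show ?thesis by (simp only: prod.delta[OF finite_lessThan] lessThan_iff if_True)
qed

text \<open>In a Leibniz term every column is paired with one particle, so inserting
  \<open>f\<close> in one column and summing over the columns yields the sum of \<open>f\<close>
  over the particles. Two distinct columns yield ordered pairs of distinct particles; the diagonal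
  subtracted from the square is again the sum of \<open>f\<close>, as \<open>f\<close> takes the
  values 0 and 1.\<close>

lemma slater_insert_factors:
  assumes fin: "finite X" and n: "card X = n" and f: "\<And>x. f x \<in> {0, 1::real}"
  shows "(\<Sum>i<n. slater (\<lambda>l x. (if l = i then f x else 1) * a l x) X) = (\<Sum>x\<in>X. f x) * slater a X"
    and "(\<Sum>i<n. \<Sum>k\<in>{..<n} - {i}. slater (\<lambda>l x. (if l = i then f x else 1) * ((if l = k then f x else 1) * a l x)) X)
       = ((\<Sum>x\<in>X. f x)\<^sup>2 - (\<Sum>x\<in>X. f x)) * slater a X"
proof -
  define x where "x = (\<lambda>i. enum X ! i)"
  have "bij_betw x {..<n} X"
    using enum_image(2)[of n x] enum_props[OF fin] n by (auto simp: bij_betw_def x_def)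
  hence S: "(\<Sum>i<n. f (x i)) = (\<Sum>x\<in>X. f x)" by (rule sum.reindex_bij_betw)
  have inv: "(\<Sum>i<n. f (x (inv_into UNIV \<pi> i))) = (\<Sum>x\<in>X. f x)" if "\<pi> permutes {..<n}" for \<pi>
    unfolding S[symmetric] by (rule sum.reindex_bij_betw[OF permutes_imp_bij[OF permutes_inv[OF that]]])
  have L1: "slater (\<lambda>l x. (if l = i then f x else 1) * a l x) X = (\<Sum>\<pi> | \<pi> permutes {..<n}. f (x (inv_into UNIV \<pi> i)) * (signof \<pi> * (\<Prod>m<n. a (\<pi> m) (x m))))"
    if "i < n" for i and a :: "nat \<Rightarrow> int \<Rightarrow> real"
    unfolding slater_def n mdet_leibniz using that
    by (intro sum.cong refl) (simp add: prod.distrib x_def prod_indicator_at[where f = "\<lambda>m. f (enum X ! m)"] mult.left_commute)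
  have L2: "slater (\<lambda>l x. (if l = i then f x else 1) * ((if l = k then f x else 1) * a l x)) X =
      (\<Sum>\<pi> | \<pi> permutes {..<n}. f (x (inv_into UNIV \<pi> i)) * f (x (inv_into UNIV \<pi> k)) * (signof \<pi> * (\<Prod>m<n. a (\<pi> m) (x m))))"
    if "i < n" "k < n" for i k
    unfolding L1[OF that(1), of "\<lambda>l x. (if l = k then f x else 1) * a l x"] using that(2)
    by (intro sum.cong refl) (simp add: prod.distrib prod_indicator_at[where f = "\<lambda>m. f (x m)"] mult.left_commute)
  have sl: "slater a X = (\<Sum>\<pi> | \<pi> permutes {..<n}. signof \<pi> * (\<Prod>m<n. a (\<pi> m) (x m)))"
    by (simp add: slater_def n mdet_leibniz x_def)
  have "(\<Sum>i<n. slater (\<lambda>l x. (if l = i then f x else 1) * a l x) X)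
    = (\<Sum>\<pi> | \<pi> permutes {..<n}. \<Sum>i<n. f (x (inv_into UNIV \<pi> i)) * (signof \<pi> * (\<Prod>m<n. a (\<pi> m) (x m))))"
    by (subst sum.swap) (simp add: L1)
  also have "\<dots> = (\<Sum>x\<in>X. f x) * slater a X"
    unfolding sl sum_distrib_left by (intro sum.cong refl) (simp add: sum_distrib_right[symmetric] inv)
  finally show "(\<Sum>i<n. slater (\<lambda>l x. (if l = i then f x else 1) * a l x) X) = (\<Sum>x\<in>X. f x) * slater a X" .
  have sq: "(\<Sum>i<n. \<Sum>k\<in>{..<n} - {i}. f (x (inv_into UNIV \<pi> i)) * f (x (inv_into UNIV \<pi> k))) = (\<Sum>x\<in>X. f x)\<^sup>2 - (\<Sum>x\<in>X. f x)"
    if p: "\<pi> permutes {..<n}" for \<pi>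
  proof -
    have ff: "f z * f z = f z" for z using f[of z] by auto
    have "(\<Sum>i<n. \<Sum>k\<in>{..<n} - {i}. f (x (inv_into UNIV \<pi> i)) * f (x (inv_into UNIV \<pi> k)))
      = (\<Sum>i<n. (\<Sum>k<n. f (x (inv_into UNIV \<pi> i)) * f (x (inv_into UNIV \<pi> k))) - f (x (inv_into UNIV \<pi> i)))"
      by (intro sum.cong refl) (simp add: sum_diff1 ff)
    also have "\<dots> = (\<Sum>i<n. f (x (inv_into UNIV \<pi> i))) * (\<Sum>k<n. f (x (inv_into UNIV \<pi> k))) - (\<Sum>i<n. f (x (inv_into UNIV \<pi> i)))"
      by (simp add: sum_subtractf sum_product)
    finally show ?thesis by (simp add: inv[OF p] power2_eq_square)
  qed
  have "(\<Sum>i<n. \<Sum>k\<in>{..<n} - {i}. slater (\<lambda>l x. (if l = i then f x else 1) * ((if l = k then f x else 1) * a l x)) X)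
    = (\<Sum>i<n. \<Sum>k\<in>{..<n} - {i}. \<Sum>\<pi> | \<pi> permutes {..<n}. f (x (inv_into UNIV \<pi> i)) * f (x (inv_into UNIV \<pi> k)) * (signof \<pi> * (\<Prod>m<n. a (\<pi> m) (x m))))"
    by (intro sum.cong refl L2) auto
  also have "\<dots> = (\<Sum>i<n. \<Sum>\<pi> | \<pi> permutes {..<n}. \<Sum>k\<in>{..<n} - {i}. f (x (inv_into UNIV \<pi> i)) * f (x (inv_into UNIV \<pi> k)) * (signof \<pi> * (\<Prod>m<n. a (\<pi> m) (x m))))"
    by (intro sum.cong refl sum.swap)
  also have "\<dots> = (\<Sum>\<pi> | \<pi> permutes {..<n}. \<Sum>i<n. \<Sum>k\<in>{..<n} - {i}. f (x (inv_into UNIV \<pi> i)) * f (x (inv_into UNIV \<pi> k)) * (signof \<pi> * (\<Prod>m<n. a (\<pi> m) (x m))))"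
    by (rule sum.swap)
  also have "\<dots> = ((\<Sum>x\<in>X. f x)\<^sup>2 - (\<Sum>x\<in>X. f x)) * slater a X"
    unfolding sl sum_distrib_left by (intro sum.cong refl) (simp add: sum_distrib_right[symmetric] sq)
  finally show "(\<Sum>i<n. \<Sum>k\<in>{..<n} - {i}. slater (\<lambda>l x. (if l = i then f x else 1) * ((if l = k then f x else 1) * a l x)) X)
       = ((\<Sum>x\<in>X. f x)\<^sup>2 - (\<Sum>x\<in>X. f x)) * slater a X" .
qed

text \<open>Outside the rows \<open>i\<close> and \<open>k\<close> the matrix is the identity, so
  only permutations that fix all other indices contribute. What remains is a principal minor of
  \<open>F\<close>.\<close>

lemma mdet_identity_but:
  fixes F :: "nat \<Rightarrow> nat \<Rightarrow> real"
  assumes "i < n" "k < n"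
  shows "mdet n (\<lambda>l j. if l = i \<or> l = k then F l j else of_bool (l = j)) =
    (if i = k then F i i else F i i * F k k - F i k * F k i)"
proof -
  define M where "M = (\<lambda>l j. if l = i \<or> l = k then F l j else of_bool (l = j))"
  have sub: "{\<pi>. \<pi> permutes {i, k}} \<subseteq> {\<pi>. \<pi> permutes {..<n}}"
    using assms by (auto intro: permutes_subset)
  have z: "signof \<pi> * (\<Prod>l<n. M l (\<pi> l)) = 0" if p: "\<pi> permutes {..<n}" "\<not> \<pi> permutes {i, k}" for \<pi>
  proof -
    have "\<exists>l<n. l \<noteq> i \<and> l \<noteq> k \<and> \<pi> l \<noteq> l"
    proof (rule ccontr)
      assume "\<not> ?thesis"
      hence "\<pi> l = l" if "l \<notin> {i, k}" for l using that permutes_not_in[OF p(1), of l] by (cases "l < n") auto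
      hence "\<pi> permutes {i, k}" using p(1) unfolding permutes_def by metis
      thus False using p(2) by simp
    qed
    then obtain l where "l < n" "M l (\<pi> l) = 0" by (auto simp: M_def)
    hence "(\<Prod>l<n. M l (\<pi> l)) = 0" by (intro prod_zero) auto
    thus ?thesis by simp
  qed
  have "mdet n M = (\<Sum>\<pi> | \<pi> permutes {i, k}. signof \<pi> * (\<Prod>l<n. M l (\<pi> l)))"
    unfolding mdet_leibniz using sub z by (intro sum.mono_neutral_right) (auto simp: finite_permutations)
  also have "{\<pi>. \<pi> permutes {i, k}} = {id, Transposition.transpose i k}"
    by (auto simp: permutes_doubleton_iff)
  finally have m: "mdet n M = (\<Sum>\<pi>\<in>{id, Transposition.transpose i k}. signof \<pi> * (\<Prod>l<n. M l (\<pi> l)))" .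
  have pr: "(\<Prod>l<n. M l (\<pi> l)) = (\<Prod>l\<in>{i, k}. M l (\<pi> l))" if "\<pi> \<in> {id, Transposition.transpose i k}" for \<pi>
    using assms that by (intro prod.mono_neutral_right) (auto simp: M_def Transposition.transpose_def split: if_splits)
  show ?thesis
  proof (cases "i = k")
    case True
    thus ?thesis using m pr[of id] by (simp add: M_def)
  next
    case False
    have ne: "id \<noteq> Transposition.transpose i k"
    proof
      assume "id = Transposition.transpose i k"
      hence "id i = Transposition.transpose i k i" by simp
      thus False using False by simp
    qed
    have "mdet n M = (\<Prod>l\<in>{i, k}. M l l) - (\<Prod>l\<in>{i, k}. M l (Transposition.transpose i k l))"
      unfolding m using pr[of id] pr[of "Transposition.transpose i k"] ne False by (simp add: sign_swap_id)
    also have "\<dots> = F i i * F k k - F i k * F k i" using False by (simp add: M_def)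
    finally show ?thesis using False by (simp add: M_def)
  qed
qed

text \<open>\<open>F\<close> is the Gram matrix of \<open>p\<close> restricted to \<open>B\<close>.
  The mean is its trace. The second factorial moment is a sum of principal minors F_ii F_kk -
  F_ik^2, hence at most the squared trace. This negative correlation bounds the variance by the
  mean.\<close>

lemma projection_ensemble_moments:
  fixes p :: "nat \<Rightarrow> int \<Rightarrow> real" and W :: "int \<Rightarrow> real" and B :: "int set"
  assumes fin: "finite \<Omega>"
    and orth: "\<And>i j. i < n \<Longrightarrow> j < n \<Longrightarrow> (\<Sum>x\<in>\<Omega>. p i x * p j x * W x) = of_bool (i = j)"
  defines "M \<equiv> \<lambda>f. (\<Sum>X | X \<subseteq> \<Omega> \<and> card X = n. (slater p X)\<^sup>2 * (\<Prod>x\<in>X. W x) * f X)"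
    and "m \<equiv> (\<Sum>i<n. \<Sum>x\<in>\<Omega> \<inter> B. p i x ^ 2 * W x)"
  shows "M (\<lambda>_. 1) = 1" "M (\<lambda>X. real (card (X \<inter> B))) = m"
    "M (\<lambda>X. (real (card (X \<inter> B)))\<^sup>2) \<le> m\<^sup>2 + m"
proof -
  define f where "f = (\<lambda>x. of_bool (x \<in> B) :: real)"
  have f01: "f x \<in> {0, 1}" for x by (simp add: f_def)
  have card: "real (card (X \<inter> B)) = (\<Sum>x\<in>X. f x)" if "finite X" for X
    using that by (simp add: f_def sum.If_cases of_bool_def Int_commute)
  define F where "F = (\<lambda>i j. \<Sum>x\<in>\<Omega>. f x * (p i x * p j x * W x))"
  have Fm: "(\<Sum>i<n. F i i) = m"
  proof -
    have "F i i = (\<Sum>x\<in>\<Omega> \<inter> B. p i x ^ 2 * W x)" for i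
      unfolding F_def f_def using fin by (intro sum.mono_neutral_cong_right) (auto simp: power2_eq_square)
    thus ?thesis by (simp add: m_def)
  qed
  have fX: "finite X" if "X \<subseteq> \<Omega>" for X using that fin finite_subset by blast
  have sq: "(slater p X)\<^sup>2 * (\<Prod>x\<in>X. W x) * c = c * slater p X * slater (\<lambda>j x. W x * p j x) X" if "X \<subseteq> \<Omega>" for X c
    by (simp add: slater_scale[OF fX[OF that]] power2_eq_square)
  have Mc: "M g = (\<Sum>X | X \<subseteq> \<Omega> \<and> card X = n. g X * slater p X * slater (\<lambda>j x. W x * p j x) X)" for g
    unfolding M_def by (intro sum.cong refl sq) auto
  have "M (\<lambda>_. 1) = mdet n (\<lambda>i j. \<Sum>x\<in>\<Omega>. p i x * (W x * p j x))"
    unfolding Mc cauchy_binet[OF fin] by simp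
  also have "\<dots> = mdet n (\<lambda>i j. of_bool (i = j))" using orth by (intro mdet_cong) (simp add: ac_simps)
  also have "\<dots> = 1"
  proof -
    have "mat n n (\<lambda>(i,j). of_bool (i = j)) = (1\<^sub>m n :: real mat)" by (intro eq_matI) auto
    thus ?thesis by (simp add: mdet_def)
  qed
  finally show "M (\<lambda>_. 1) = 1" .
  have row: "(\<Sum>x\<in>\<Omega>. (if l = i then f x else 1) * p l x * (W x * p j x)) = (if l = i then F l j else of_bool (l = j))"
    if "l < n" "j < n" for l i j using orth[OF that] by (auto simp: F_def ac_simps)
  have row2: "(\<Sum>x\<in>\<Omega>. (if l = i then f x else 1) * ((if l = k then f x else 1) * p l x) * (W x * p j x)) = (if l = i \<or> l = k then F l j else of_bool (l = j))"
    if "l < n" "j < n" "i \<noteq> k" for l i j k using orth[OF that(1,2)] that(3) by (auto simp: F_def ac_simps)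
  have "M (\<lambda>X. real (card (X \<inter> B))) = (\<Sum>X | X \<subseteq> \<Omega> \<and> card X = n. \<Sum>i<n. slater (\<lambda>l x. (if l = i then f x else 1) * p l x) X * slater (\<lambda>j x. W x * p j x) X)"
    unfolding Mc using slater_insert_factors(1)[OF fX _ f01, where a = p and n = n] card[OF fX]
    by (intro sum.cong refl) (simp add: sum_distrib_right[symmetric])
  also have "\<dots> = (\<Sum>i<n. mdet n (\<lambda>l j. \<Sum>x\<in>\<Omega>. (if l = i then f x else 1) * p l x * (W x * p j x)))"
    unfolding cauchy_binet[OF fin] by (rule sum.swap)
  also have "\<dots> = (\<Sum>i<n. mdet n (\<lambda>l j. if l = i \<or> l = i then F l j else of_bool (l = j)))"
    by (intro sum.cong refl mdet_cong) (simp add: row)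
  also have "\<dots> = m" unfolding Fm[symmetric]
  proof (intro sum.cong refl)
    fix i assume "i \<in> {..<n}"
    hence "i < n" by simp
    from mdet_identity_but[OF this this, of F]
    show "mdet n (\<lambda>l j. if l = i \<or> l = i then F l j else of_bool (l = j)) = F i i" by simp
  qed
  finally show Mh: "M (\<lambda>X. real (card (X \<inter> B))) = m" .
  have "M (\<lambda>X. (real (card (X \<inter> B)))\<^sup>2 - real (card (X \<inter> B))) =
     (\<Sum>X | X \<subseteq> \<Omega> \<and> card X = n. \<Sum>i<n. \<Sum>k\<in>{..<n} - {i}. slater (\<lambda>l x. (if l = i then f x else 1) * ((if l = k then f x else 1) * p l x)) X * slater (\<lambda>j x. W x * p j x) X)"
    unfolding Mc using slater_insert_factors(2)[OF fX _ f01, where a = p and n = n] card[OF fX]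
    by (intro sum.cong refl) (simp add: sum_distrib_right[symmetric])
  also have "\<dots> = (\<Sum>i<n. \<Sum>k\<in>{..<n} - {i}. mdet n (\<lambda>l j. \<Sum>x\<in>\<Omega>. (if l = i then f x else 1) * ((if l = k then f x else 1) * p l x) * (W x * p j x)))"
    unfolding cauchy_binet[OF fin] by (subst sum.swap, intro sum.cong refl, rule sum.swap)
  also have "\<dots> = (\<Sum>i<n. \<Sum>k\<in>{..<n} - {i}. mdet n (\<lambda>l j. if l = i \<or> l = k then F l j else of_bool (l = j)))"
    by (intro sum.cong refl mdet_cong row2) auto
  also have "\<dots> = (\<Sum>i<n. \<Sum>k\<in>{..<n} - {i}. F i i * F k k - F i k * F k i)"
    by (intro sum.cong refl, subst mdet_identity_but) auto
  also have "\<dots> \<le> (\<Sum>i<n. \<Sum>k<n. F i i * F k k)"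
  proof (rule sum_mono)
    fix i assume i: "i \<in> {..<n}"
    have "F i i * F k k - F i k * F k i \<le> F i i * F k k" for k
    proof -
      have "F k i = F i k" unfolding F_def by (intro sum.cong refl) (simp only: mult.commute mult.left_commute)
      thus ?thesis by simp
    qed
    hence "(\<Sum>k\<in>{..<n} - {i}. F i i * F k k - F i k * F k i) \<le> (\<Sum>k\<in>{..<n} - {i}. F i i * F k k)"
      by (intro sum_mono)
    also have "\<dots> \<le> (\<Sum>k<n. F i i * F k k)"
    proof -
      have "0 \<le> F i i * F i i" by simp
      thus ?thesis using i by (simp add: sum_diff1)
    qed
    finally show "(\<Sum>k\<in>{..<n} - {i}. F i i * F k k - F i k * F k i) \<le> (\<Sum>k<n. F i i * F k k)" .
  qed
  also have "\<dots> = m\<^sup>2" unfolding Fm[symmetric] power2_eq_square by (rule sum_product[symmetric])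
  finally have "M (\<lambda>X. (real (card (X \<inter> B)))\<^sup>2 - real (card (X \<inter> B))) \<le> m\<^sup>2" .
  moreover have "M (\<lambda>X. (real (card (X \<inter> B)))\<^sup>2 - real (card (X \<inter> B))) = M (\<lambda>X. (real (card (X \<inter> B)))\<^sup>2) - m"
    unfolding Mh[symmetric] by (simp add: M_def sum_subtractf right_diff_distrib)
  ultimately show "M (\<lambda>X. (real (card (X \<inter> B)))\<^sup>2) \<le> m\<^sup>2 + m" by simp
qed

section \<open>The q-Racah weights\<close>

text \<open>The bound on \<open>\<kappa>\<close> makes 1 - \<kappa>^2 q^m positive for every integer
  m \<ge> -T, which covers the exponents in all weights below.\<close>

locale q_weights =
  fixes q \<kappa> :: real and N T :: int
  assumes q01: "0 < q" "q < 1" and NT: "0 < N" "0 < T" and \<kappa>T: "\<kappa>\<^sup>2 < q powi T"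
begin

definition cc :: "int \<Rightarrow> int \<Rightarrow> real" where "cc S t = \<kappa>\<^sup>2 * q powi (1 - t - S)"
definition sg :: "int \<Rightarrow> int \<Rightarrow> int \<Rightarrow> real" where "sg S t y = q powi (-y) + cc S t * q powi y"
definition wt :: "int \<Rightarrow> int \<Rightarrow> int \<Rightarrow> real" where "wt S t y = q powi (-y) - cc S t * q powi y"
definition qfact :: "int \<Rightarrow> real" where "qfact n = (\<Prod>i\<in>{1..n}. q powi (-i) - 1)"
definition ee :: "int \<Rightarrow> real" where "ee m = 1 - \<kappa>\<^sup>2 * q powi m"
definition tri_pow :: "int \<Rightarrow> real" where "tri_pow n = (\<Prod>i\<in>{1..n}. q powi (-i))"
definition ee_low :: "int \<Rightarrow> int \<Rightarrow> real" where "ee_low S m = (\<Prod>i\<in>{S + 1 - T..m}. ee (i - S))"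
definition ee_up :: "int \<Rightarrow> int \<Rightarrow> real" where "ee_up S n = (\<Prod>i\<in>{1..n}. ee (i + N - S))"

text \<open>A closed solution of the ratio relations \<open>gg_step1\<close> and
  \<open>gg_step2\<close>, that is, a forward single particle weight for \<open>slice_sum\<close>.
  Its support respects three of the bounds of a slice; the bound \<open>S + N - 1\<close> comes from
  the reflected weight \<open>gg'\<close>.\<close>

definition gg :: "int \<Rightarrow> int \<Rightarrow> int \<Rightarrow> real" where
  "gg S t y = (if 0 \<le> y \<and> y \<le> t + N - 1 \<and> t + S - T \<le> y then
     q powi ((t + N) * y) * tri_pow y * ee_low S (y - t) / (qfact y * qfact (t + N - 1 - y) * ee_up S y) else 0)"

lemma q_nz [simp]: "q \<noteq> 0" using q01 by simp

lemma powi_add: "q powi (a + b) = q powi a * q powi b" by (simp add: power_int_add)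
lemma powi_pos [simp]: "0 < q powi a" using q01 by (simp add: zero_less_power_int)
lemma powi_nz [simp]: "q powi a \<noteq> 0" using powi_pos[of a] by linarith
lemma powi_minus: "q powi (- a) = 1 / q powi a" by (simp add: power_int_minus field_simps)
lemma powi_less1: "a > 0 \<Longrightarrow> q powi a < 1"
proof -
  assume "a > 0"
  hence "q powi a = q ^ nat a" by (simp add: power_int_def)
  thus "q powi a < 1" using q01 \<open>a > 0\<close> by (simp add: power_Suc_less_one power_less_one_iff)
qed
lemma powi_le1: "a \<ge> 0 \<Longrightarrow> q powi a \<le> 1" using powi_less1[of a] by (cases "a = 0") auto
lemma powi_mono: "a \<le> b \<Longrightarrow> q powi b \<le> q powi a"
  using powi_le1[of "b - a"] mult_left_mono[of "q powi (b - a)" 1 "q powi a"] powi_pos[of a] by (simp flip: powi_add)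
lemma powi_strict_mono: "a < b \<Longrightarrow> q powi b < q powi a"
  using powi_less1[of "b - a"] mult_strict_left_mono[of "q powi (b - a)" 1 "q powi a"] by (simp flip: powi_add)

lemma kappa_powi: "m \<ge> - T \<Longrightarrow> \<kappa>\<^sup>2 * q powi m < 1"
proof -
  assume m: "m \<ge> - T"
  have "\<kappa>\<^sup>2 * q powi m < q powi T * q powi m" using \<kappa>T by (intro mult_strict_right_mono) auto
  also have "\<dots> = q powi (T + m)" by (simp add: powi_add)
  also have "\<dots> \<le> 1" using m by (intro powi_le1) simp
  finally show ?thesis .
qed

lemma ee_pos: "m \<ge> - T \<Longrightarrow> 0 < ee m" using kappa_powi[of m] by (simp add: ee_def)

lemma int_prod_last: "n \<ge> (a::int) \<Longrightarrow> (\<Prod>i\<in>{a..n}. f i) = (\<Prod>i\<in>{a..n-1}. f i) * (f n :: real)"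
proof -
  assume "n \<ge> a"
  hence "{a..n} = insert n {a..n-1}" by auto
  thus ?thesis by (simp add: mult.commute)
qed

lemma qfact_pos: "0 < qfact n"
  unfolding qfact_def using powi_strict_mono[of _ 0] by (intro prod_pos) (auto intro: powi_strict_mono[of "- _" 0, simplified])

lemma ee_low_pos: "0 < ee_low S m" unfolding ee_low_def by (intro prod_pos ballI ee_pos) auto
lemma ee_up_pos: "S < T \<Longrightarrow> 0 < ee_up S n" unfolding ee_up_def using NT by (intro prod_pos ballI ee_pos) auto
lemma tri_pow_pos: "0 < tri_pow n" unfolding tri_pow_def by (intro prod_pos) auto

lemma gg_pos:
  assumes "0 \<le> y" "y \<le> t + N - 1" "t + S - T \<le> y" "S < T"
  shows "0 < gg S t y"
  using assms qfact_pos ee_low_pos ee_up_pos tri_pow_pos by (simp add: gg_def)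

lemma cc_Suc: "cc S t = q * cc S (t + 1)"
proof -
  have "q powi (1 - t - S) = q powi (1 + (1 - (t + 1) - S))" by (simp add: algebra_simps)
  thus ?thesis unfolding cc_def powi_add by simp
qed

text \<open>Up to a common sign, the ratios here and in \<open>gg_step2\<close> are the two
  coefficients of \<open>antisym_shift\<close> at Q = q^(-y) with \<alpha> = q^(-t-N) and \<beta> =
  1. Where a predecessor drops out of the support, at \<open>y = t + N\<close> here and at
  \<open>y = 0\<close> there, the coefficient has a zero.\<close>

lemma gg_step1:
  assumes "0 \<le> y" "y \<le> t + N" "t + 1 + S - T \<le> y" "S < T"
  shows "gg S t y = gg S (t + 1) y * (q powi (-t - N) - q powi (-y)) * (1 - cc S (t + 1) * q powi y)"
proof (cases "y = t + N")
  case True thus ?thesis by (simp add: gg_def)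
next
  case False
  have a: "qfact (t + N - y) = qfact (t + N - 1 - y) * (q powi (-(t + N - y)) - 1)"
    unfolding qfact_def using False assms by (subst int_prod_last) (auto simp: algebra_simps)
  have b: "ee_low S (y - t) = ee_low S (y - t - 1) * ee (y - t - S)"
    unfolding ee_low_def using assms by (subst int_prod_last) auto
  have c: "q powi (-t - N) - q powi (-y) = q powi (-y) * (q powi (-(t + N - y)) - 1)"
    by (simp add: right_diff_distrib flip: powi_add)
  have d: "1 - cc S (t + 1) * q powi y = ee (y - t - S)"
    unfolding cc_def ee_def by (simp add: mult.assoc algebra_simps flip: powi_add)
  have e: "q powi ((t + 1 + N) * y) = q powi ((t + N) * y) * q powi y"
    by (simp add: algebra_simps flip: powi_add)
  have f: "q powi y * q powi (-y) = 1" by (simp flip: powi_add)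
  have nz: "qfact (t + N - 1 - y) \<noteq> 0" "q powi (-(t + N - y)) - 1 \<noteq> 0"
    using qfact_pos[of "t + N - 1 - y"] powi_strict_mono[of "-(t + N - y)" 0] False assms by auto
  have g1: "gg S (t+1) y = q powi ((t + N) * y) * q powi y * tri_pow y * ee_low S (y - t - 1) / (qfact y * (qfact (t + N - 1 - y) * (q powi (-(t + N - y)) - 1)) * ee_up S y)"
    using assms False unfolding gg_def e a[symmetric] by (simp add: algebra_simps)
  have g0: "gg S t y = q powi ((t + N) * y) * tri_pow y * (ee_low S (y - t - 1) * ee (y - t - S)) / (qfact y * qfact (t + N - 1 - y) * ee_up S y)"
    using assms False unfolding gg_def b[symmetric] by simp
  show ?thesis unfolding g0 g1 c d using nz f by (simp add: divide_simps)
qed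

lemma gg_step2:
  assumes "0 \<le> y" "y \<le> t + N" "t + 1 + S - T \<le> y" "S < T"
  shows "gg S t (y - 1) = gg S (t + 1) y * (q powi (-t - N) - cc S (t + 1) * q powi y) * (q powi (-y) - 1)"
proof (cases "y = 0")
  case True thus ?thesis by (simp add: gg_def)
next
  case False
  hence y: "y \<ge> 1" using assms by simp
  have a: "qfact y = qfact (y - 1) * (q powi (-y) - 1)"
    unfolding qfact_def using y by (subst int_prod_last) auto
  have b: "ee_up S y = ee_up S (y - 1) * ee (y + N - S)"
    unfolding ee_up_def using y by (subst int_prod_last) auto
  have t: "tri_pow y = tri_pow (y - 1) * q powi (-y)"
    unfolding tri_pow_def using y by (subst int_prod_last) auto
  have d: "q powi (-t - N) - cc S (t + 1) * q powi y = q powi (-t - N) * ee (y + N - S)"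
    unfolding cc_def ee_def by (simp add: right_diff_distrib mult.assoc mult.left_commute flip: powi_add) (simp add: algebra_simps)
  have e: "q powi ((t + 1 + N) * y) * q powi (-y) * q powi (-t - N) = q powi ((t + N) * (y - 1))"
    by (simp add: algebra_simps flip: powi_add)
  have nz: "qfact (y - 1) \<noteq> 0" "q powi (-y) - 1 \<noteq> 0" "ee (y + N - S) \<noteq> 0"
    using qfact_pos[of "y - 1"] powi_strict_mono[of "-y" 0] y ee_pos[of "y + N - S"] assms NT by auto
  have g1: "gg S (t+1) y = q powi ((t + 1 + N) * y) * (tri_pow (y - 1) * q powi (-y)) * ee_low S (y - t - 1) / (qfact (y - 1) * (q powi (-y) - 1) * qfact (t + N - y) * (ee_up S (y - 1) * ee (y + N - S)))"
    using assms y unfolding gg_def a[symmetric] b[symmetric] t[symmetric] by (simp add: algebra_simps)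
  have g0: "gg S t (y-1) = q powi ((t + N) * (y - 1)) * tri_pow (y - 1) * ee_low S (y - t - 1) / (qfact (y - 1) * qfact (t + N - y) * ee_up S (y - 1))"
    using assms y unfolding gg_def by (simp add: algebra_simps)
  show ?thesis unfolding g0 g1 d e[symmetric] using nz by (simp add: divide_simps)
qed

lemma wt_pos:
  assumes "0 \<le> y" "t + S - T \<le> y" shows "0 < wt S t y"
proof -
  have "cc S t * q powi y = (\<kappa>\<^sup>2 * q powi (1 - t - S + 2 * y)) * q powi (-y)"
    by (simp add: cc_def mult.assoc algebra_simps flip: powi_add)
  also have "\<dots> < 1 * q powi (-y)" using assms by (intro mult_strict_right_mono kappa_powi) auto
  finally show ?thesis by (simp add: wt_def)
qed

text \<open>The operator of slice \<open>t\<close> passes through line \<open>t + 1\<close>, also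
  for \<open>t = T\<close>. The exponent in \<open>wt_pos\<close> leaves a margin of one, so the
  weight of line \<open>t + 1\<close> is positive even at sites of line \<open>t\<close> below the
  range of line \<open>t + 1\<close>.\<close>

lemma wt_Suc_pos:
  assumes "0 \<le> y" "t + S - T \<le> y" shows "0 < wt S (t + 1) y"
proof -
  have "cc S (t+1) * q powi y = (\<kappa>\<^sup>2 * q powi (- t - S + 2 * y)) * q powi (-y)"
    by (simp add: cc_def mult.assoc algebra_simps flip: powi_add)
  also have "\<dots> < 1 * q powi (-y)" using assms by (intro mult_strict_right_mono kappa_powi) auto
  finally show ?thesis by (simp add: wt_def)
qed

definition fwd_poly :: "int \<Rightarrow> int \<Rightarrow> real poly \<Rightarrow> real poly" where
  "fwd_poly S t p = - shift_poly q (cc S (t + 1)) (q powi (-t - N)) 1 p"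

text \<open>With Q = q^(-y) and the parameter c of line \<open>t + 1\<close>, the two predecessors
  \<open>y\<close> and \<open>y - 1\<close> on line \<open>t\<close> have as values of
  \<open>sg\<close> exactly the two arguments Q + q c/Q and q Q + c/Q of
  \<open>antisym_shift\<close>, while the site itself has Q + c/Q.\<close>

lemma sg_shift:
  "sg S t y = q powi (-y) + q * cc S (t + 1) / q powi (-y)" "sg S t (y - 1) = q * q powi (-y) + cc S (t + 1) / q powi (-y)"
  "sg S (t + 1) y = q powi (-y) + cc S (t + 1) / q powi (-y)"  "wt S (t + 1) y = q powi (-y) - cc S (t + 1) / q powi (-y)"
proof -
  have a: "q powi y = 1 / q powi (-y)" by (simp add: powi_minus)
  show "sg S t y = q powi (-y) + q * cc S (t + 1) / q powi (-y)" unfolding sg_def cc_Suc[of S t] a by simp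
  show "sg S (t + 1) y = q powi (-y) + cc S (t + 1) / q powi (-y)" unfolding sg_def a by simp
  show "wt S (t + 1) y = q powi (-y) - cc S (t + 1) / q powi (-y)" unfolding wt_def a by simp
  have "q powi (-(y-1)) = q * q powi (-y)" using powi_add[of 1 "-y"] by simp
  moreover have "q * q powi (y - 1) = 1 / q powi (-y)" using powi_add[of 1 "y - 1"] by (simp add: powi_minus)
  ultimately show "sg S t (y - 1) = q * q powi (-y) + cc S (t + 1) / q powi (-y)" unfolding sg_def cc_Suc[of S t]
    by (simp add: mult.commute mult.left_commute) (simp add: mult.assoc[symmetric] mult.commute)
qed

lemma gg_forward:
  assumes "0 \<le> y" "y \<le> t + N" "t + 1 + S - T \<le> y" "S < T"
  shows "gg S t y * poly p (sg S t y) + gg S t (y - 1) * poly p (sg S t (y - 1)) =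
    wt S (t + 1) y * gg S (t + 1) y * poly (fwd_poly S t p) (sg S (t + 1) y)"
proof -
  define Q where "Q = q powi (-y)"
  define c where "c = cc S (t + 1)"
  define \<alpha> where "\<alpha> = q powi (-t - N)"
  have w: "wt S (t + 1) y = Q - c / Q" using sg_shift(4) by (simp add: Q_def c_def)
  have Q: "Q \<noteq> 0" "Q - c / Q \<noteq> 0" using wt_pos[of y "t+1" S] assms w by (auto simp: Q_def)
  have yQ: "q powi y = 1 / Q" by (simp add: Q_def powi_minus)
  have "poly (fwd_poly S t p) (sg S (t + 1) y) = - antisym_shift q c \<alpha> 1 (poly p) Q"
    using poly_shift_poly[OF Q, of q \<alpha> 1 p] by (simp add: fwd_poly_def sg_shift(3) Q_def c_def \<alpha>_def)
  also have "\<dots> = ((\<alpha> - Q) * (1 - c / Q) * poly p (sg S t y) + (\<alpha> - c / Q) * (Q - 1) * poly p (sg S t (y - 1))) / (Q - c / Q)"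
  proof -
    have *: "- (((Q - \<alpha>) * u * a - v * (1 - Q) * b) / d) = ((\<alpha> - Q) * u * a + (- v) * (Q - 1) * b) / d" for a b u v d
      by (simp add: minus_divide_left algebra_simps)
    show ?thesis
      unfolding antisym_shift_def sg_shift(1)[of S t y] sg_shift(2)[of S t y] Q_def[symmetric] c_def[symmetric] mult_1_left mult_1_right *
      by simp
  qed
  finally have "wt S (t + 1) y * gg S (t + 1) y * poly (fwd_poly S t p) (sg S (t + 1) y) =
     gg S (t + 1) y * ((\<alpha> - Q) * (1 - c / Q) * poly p (sg S t y) + (\<alpha> - c / Q) * (Q - 1) * poly p (sg S t (y - 1)))"
    using Q unfolding w by simp
  thus ?thesis unfolding gg_step1[OF assms] gg_step2[OF assms] Q_def[symmetric] c_def[symmetric] \<alpha>_def[symmetric] yQ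
    by (simp add: distrib_left mult.assoc)
qed

lemma fwd_poly_degree: "degree (fwd_poly S t p) \<le> degree p"
  unfolding fwd_poly_def degree_minus by (rule shift_poly_degree)

text \<open>Reflecting the hexagon in a vertical axis exchanges \<open>S\<close> with \<open>T - S\<close> and maps \<open>(t, y)\<close> to \<open>(T - t, y - t + T - S)\<close>.\<close>

lemma reflect:
  "sg (T - S) (T - t) (y - t + T - S) = q powi (t - T + S) * sg S t y"
  "wt (T - S) (T - t) (y - t + T - S) = q powi (t - T + S) * wt S t y"
proof -
  have "q powi (- (y - t + T - S)) = q powi (t - T + S) * q powi (-y)"
    "cc (T - S) (T - t) * q powi (y - t + T - S) = q powi (t - T + S) * (cc S t * q powi y)"
    by (simp_all add: cc_def mult.assoc mult.left_commute algebra_simps flip: powi_add)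
  thus "sg (T - S) (T - t) (y - t + T - S) = q powi (t - T + S) * sg S t y"
    "wt (T - S) (T - t) (y - t + T - S) = q powi (t - T + S) * wt S t y"
    unfolding sg_def wt_def by (simp_all add: algebra_simps)
qed

definition gg' :: "int \<Rightarrow> int \<Rightarrow> int \<Rightarrow> real" where "gg' S t y = gg (T - S) (T - t) (y - t + T - S)"

text \<open>Reflection multiplies \<open>sg\<close> by a power of \<open>q\<close> that depends on
  the line. The coefficient of the monomial cancels the factor of line \<open>t + 1\<close>, the
  inner substitution inserts that of line \<open>t\<close>, and the outer factor is the one acquired
  by \<open>wt\<close>.\<close>

definition bwd_poly :: "int \<Rightarrow> int \<Rightarrow> nat \<Rightarrow> real poly" where
  "bwd_poly S t j = Polynomial.smult (q powi (t - T + S))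
     (pcompose (fwd_poly (T - S) (T - t - 1) (Polynomial.monom (1 / (q powi (t + 1 - T + S)) ^ j) j)) [:0, q powi (t - T + S):])"

lemma gg_backward:
  assumes "0 \<le> y" "y < S + N" "t + S - T \<le> y" "0 < S"
  shows "gg' S (t + 1) y * sg S (t + 1) y ^ j + gg' S (t + 1) (y + 1) * sg S (t + 1) (y + 1) ^ j =
    wt S t y * gg' S t y * poly (bwd_poly S t j) (sg S t y)"
proof -
  define y' where "y' = y - t + T - S"
  define t' where "t' = T - t - 1"
  define b where "b = q powi (t + 1 - T + S)"
  define p where "p = Polynomial.monom (1 / b ^ j) j"
  have b0: "b \<noteq> 0" by (simp add: b_def)
  \<comment> \<open>Reflection exchanges staying and moving: on line \<open>t'\<close> the successor
    \<open>y\<close> becomes \<open>y' - 1\<close>, and \<open>y + 1\<close> becomes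
    \<open>y'\<close>.\<close>
  have e: "gg' S (t + 1) y = gg (T - S) t' (y' - 1)" "gg' S (t + 1) (y + 1) = gg (T - S) t' y'"
    "gg' S t y = gg (T - S) (t' + 1) y'"
    by (simp_all add: gg'_def t'_def y'_def algebra_simps)
  have s: "sg (T - S) t' (y' - 1) = b * sg S (t + 1) y" "sg (T - S) t' y' = b * sg S (t + 1) (y + 1)"
    "sg (T - S) (t' + 1) y' = q powi (t - T + S) * sg S t y" "wt (T - S) (t' + 1) y' = q powi (t - T + S) * wt S t y"
    using reflect(1)[of S "t + 1" y] reflect(1)[of S "t + 1" "y + 1"] reflect[of S t y]
    by (simp_all add: t'_def y'_def b_def algebra_simps)
  have P: "poly p (b * z) = z ^ j" for z using b0 by (simp add: p_def poly_monom power_mult_distrib)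
  have "gg (T - S) t' y' * poly p (sg (T - S) t' y') + gg (T - S) t' (y' - 1) * poly p (sg (T - S) t' (y' - 1)) =
    wt (T - S) (t' + 1) y' * gg (T - S) (t' + 1) y' * poly (fwd_poly (T - S) t' p) (sg (T - S) (t' + 1) y')"
    using assms by (intro gg_forward) (auto simp: t'_def y'_def)
  thus ?thesis unfolding e s P bwd_poly_def p_def[symmetric] b_def[symmetric] t'_def[symmetric]
    by (simp add: poly_pcompose algebra_simps)
qed

lemma bwd_poly_degree: "degree (bwd_poly S t j) \<le> j"
proof -
  define r where "r = fwd_poly (T - S) (T - t - 1) (Polynomial.monom (1 / (q powi (t + 1 - T + S)) ^ j) j)"
  have "degree (bwd_poly S t j) \<le> degree (pcompose r [:0, q powi (t - T + S):])"
    unfolding bwd_poly_def r_def[symmetric] by (rule degree_smult_le)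
  also have "\<dots> \<le> degree r * degree [:0, q powi (t - T + S):]" by (rule degree_pcompose_le)
  also have "\<dots> = degree r" by simp
  also have "degree r \<le> degree (Polynomial.monom (1 / (q powi (t + 1 - T + S)) ^ j) j)"
    unfolding r_def by (rule fwd_poly_degree)
  also have "\<dots> \<le> j" by (rule degree_monom_le)
  finally show ?thesis .
qed

end

section \<open>Orthonormal polynomials as eigenvectors\<close>

lemma orthonormal_polynomials:
  fixes W \<sigma> :: "int \<Rightarrow> real"
  assumes fin: "finite \<Omega>" and W: "\<And>y. y \<in> \<Omega> \<Longrightarrow> W y > 0" and inj: "inj_on \<sigma> \<Omega>"
  defines "ip \<equiv> \<lambda>p r. \<Sum>y\<in>\<Omega>. W y * poly p (\<sigma> y) * poly r (\<sigma> y)"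
  assumes m: "m \<le> card \<Omega>"
  shows "\<exists>P. (\<forall>n<m. degree (P n) = n \<and> P n \<noteq> 0) \<and> (\<forall>i<m. \<forall>j<m. ip (P i) (P j) = of_bool (i = j))"
  using m
proof (induction m)
  case (Suc m)
  then obtain P where P: "\<And>n. n < m \<Longrightarrow> degree (P n) = n" "\<And>n. n < m \<Longrightarrow> P n \<noteq> 0"
    "\<And>i j. i < m \<Longrightarrow> j < m \<Longrightarrow> ip (P i) (P j) = of_bool (i = j)" by auto
  define X where "X = Polynomial.monom (1::real) m"
  define R where "R = X - (\<Sum>j<m. Polynomial.smult (ip X (P j)) (P j))"
  have deg_sum: "coeff (\<Sum>j<m. Polynomial.smult (ip X (P j)) (P j)) k = 0" if "k \<ge> m" for k
    unfolding coeff_sum using that P(1) by (intro sum.neutral) (auto simp: coeff_eq_0)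
  have cR: "coeff R m = 1" "\<And>k. k > m \<Longrightarrow> coeff R k = 0" using deg_sum by (auto simp: R_def X_def)
  have R0: "R \<noteq> 0" using cR by auto
  have dR: "degree R = m" using cR by (intro antisym degree_le le_degree) auto
  have lin: "ip (p - p') r = ip p r - ip p' r" "ip (Polynomial.smult a p) r = a * ip p r"
    "ip (sum f A) r = (\<Sum>a\<in>A. ip (f a) r)" "ip p r = ip r p" for p p' r a and f :: "nat \<Rightarrow> real poly" and A
    by (auto simp: ip_def algebra_simps sum_subtractf sum_distrib_left sum_distrib_right poly_sum sum.swap[of _ A])
  have orth: "ip R (P i) = 0" if "i < m" for i
  proof -
    have "(\<Sum>j<m. ip X (P j) * ip (P j) (P i)) = (\<Sum>j<m. if j = i then ip X (P j) else 0)"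
      using that P(3) by (intro sum.cong) auto
    thus ?thesis using that by (simp add: R_def lin(1,2,3))
  qed
  \<comment> \<open>\<open>R\<close> is monic of degree \<open>m\<close>, so it has at most
    \<open>m\<close> zeros, fewer than the number of values of \<open>\<sigma>\<close> on
    \<open>\<Omega>\<close>. Its norm is therefore positive.\<close>
  have pos: "ip R R > 0"
  proof -
    have "\<exists>y\<in>\<Omega>. poly R (\<sigma> y) \<noteq> 0"
    proof (rule ccontr)
      assume "\<not> ?thesis"
      hence "\<sigma> ` \<Omega> \<subseteq> {z. poly R z = 0}" by auto
      hence "card (\<sigma> ` \<Omega>) \<le> card {z. poly R z = 0}" using poly_roots_finite[OF R0] by (rule card_mono[rotated])
      also have "\<dots> \<le> m" using card_poly_roots_bound[OF R0] dR by simp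
      finally show False using Suc.prems inj by (simp add: card_image)
    qed
    then obtain y where y: "y \<in> \<Omega>" "poly R (\<sigma> y) \<noteq> 0" by blast
    have "0 < W y * (poly R (\<sigma> y))\<^sup>2" using W[OF y(1)] y(2) by simp
    also have "\<dots> \<le> (\<Sum>y\<in>\<Omega>. W y * (poly R (\<sigma> y))\<^sup>2)"
      using W by (intro member_le_sum[OF y(1) _ fin]) (simp add: less_imp_le)
    finally show ?thesis by (simp add: ip_def power2_eq_square mult.assoc)
  qed
  define r where "r = 1 / sqrt (ip R R)"
  have r: "r \<noteq> 0" "r * r * ip R R = 1" using pos by (auto simp: r_def)
  define P' where "P' = P(m := Polynomial.smult r R)"
  have rr: "ip (Polynomial.smult r R) (Polynomial.smult r R) = r * r * ip R R"
    by (simp only: lin(2) lin(4)[of R "Polynomial.smult r R"] mult.assoc)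
  have r1: "ip (Polynomial.smult r R) (P i) = 0" "ip (P i) (Polynomial.smult r R) = 0" if "i < m" for i
    using orth[OF that] lin(2)[of r R "P i"] lin(4)[of "P i" "Polynomial.smult r R"] by simp_all
  show ?case
    using P r rr r1 dR R0 by (intro exI[of _ P']) (auto simp: P'_def less_Suc_eq)
qed simp

lemma polynomial_span:
  fixes P :: "nat \<Rightarrow> real poly"
  assumes "\<And>n. n < m \<Longrightarrow> degree (P n) = n \<and> P n \<noteq> 0" "\<And>k. k \<ge> m \<Longrightarrow> coeff p k = 0"
  shows "\<exists>c. p = (\<Sum>j<m. Polynomial.smult (c j) (P j))"
  using assms
proof (induction m arbitrary: p)
  case 0
  hence "p = 0" by (intro poly_eqI) simp
  thus ?case by simp
next
  case (Suc m)
  define a where "a = coeff p m / coeff (P m) m"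
  have lc: "coeff (P m) m \<noteq> 0" using Suc.prems(1)[of m] by (metis leading_coeff_0_iff lessI)
  have "coeff (p - Polynomial.smult a (P m)) k = 0" if "k \<ge> m" for k
    using that Suc.prems(1)[of m] Suc.prems(2)[of k] lc by (cases "k = m") (auto simp: a_def coeff_eq_0)
  then obtain c where c: "p - Polynomial.smult a (P m) = (\<Sum>j<m. Polynomial.smult (c j) (P j))"
    using Suc.IH[of "p - Polynomial.smult a (P m)"] Suc.prems(1) by (metis less_SucI)
  have "p = (\<Sum>j<Suc m. Polynomial.smult ((c(m := a)) j) (P j))"
    using c by (simp add: algebra_simps)
  thus ?case by blast
qed

text \<open>\<open>H\<close> is symmetric for the weighted inner product and does not raise degrees.
  So applying \<open>H - lam n\<close> to the \<open>n\<close>-th polynomial gives a polynomial of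
  degree below \<open>n\<close> that is orthogonal to all those of degree below \<open>n\<close>,
  and this vanishes on \<open>\<Omega>\<close>. Completeness follows from orthonormality because a
  one-sided inverse of a square matrix is two-sided. The zeros of \<open>dn lo\<close> and
  \<open>up hi\<close> shield \<open>\<Omega>\<close> from values outside.\<close>

lemma spectral_decomposition:
  fixes W \<sigma> up dn :: "int \<Rightarrow> real" and lo hi :: int and lam :: "nat \<Rightarrow> real" and hp :: "real poly \<Rightarrow> real poly"
  defines "\<Omega> \<equiv> {lo..hi}"
  assumes W: "\<And>y. y \<in> \<Omega> \<Longrightarrow> W y > 0" and inj: "inj_on \<sigma> \<Omega>"
    and bdry: "dn lo = 0" "up hi = 0"
    and sym: "\<And>y. lo \<le> y \<Longrightarrow> y < hi \<Longrightarrow> W y * up y = W (y + 1) * dn (y + 1)"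
    and hp: "\<And>p y. y \<in> \<Omega> \<Longrightarrow> poly (hp p) (\<sigma> y) =
        up y * (poly p (\<sigma> y) - poly p (\<sigma> (y + 1))) + dn y * (poly p (\<sigma> y) - poly p (\<sigma> (y - 1)))"
    and hdeg: "\<And>p. degree (hp p) \<le> degree p" and hcoeff: "\<And>p n. degree p \<le> n \<Longrightarrow> coeff (hp p) n = lam n * coeff p n"
    and m: "m = card \<Omega>"
  obtains P where "\<And>n. n < m \<Longrightarrow> degree (P n) = n"
    "\<And>i j. i < m \<Longrightarrow> j < m \<Longrightarrow> (\<Sum>y\<in>\<Omega>. W y * poly (P i) (\<sigma> y) * poly (P j) (\<sigma> y)) = of_bool (i = j)"
    "\<And>n y. n < m \<Longrightarrow> y \<in> \<Omega> \<Longrightarrow> up y * (poly (P n) (\<sigma> y) - poly (P n) (\<sigma> (y + 1)))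
        + dn y * (poly (P n) (\<sigma> y) - poly (P n) (\<sigma> (y - 1))) = lam n * poly (P n) (\<sigma> y)"
    "\<And>y z. y \<in> \<Omega> \<Longrightarrow> z \<in> \<Omega> \<Longrightarrow> (\<Sum>n<m. poly (P n) (\<sigma> y) * poly (P n) (\<sigma> z) * W z) = of_bool (y = z)"
proof -
  have fin: "finite \<Omega>" by (simp add: \<Omega>_def)
  define ip where "ip = (\<lambda>f g. \<Sum>y\<in>\<Omega>. W y * f y * g y)"
  define H where "H = (\<lambda>f y. up y * (f y - f (y + 1)) + dn y * (f y - f (y - 1)))"
  define ev where "ev = (\<lambda>p y. poly p (\<sigma> y))"
  have "\<exists>P. (\<forall>n<m. degree (P n) = n \<and> P n \<noteq> 0) \<and>
      (\<forall>i<m. \<forall>j<m. (\<Sum>y\<in>\<Omega>. W y * poly (P i) (\<sigma> y) * poly (P j) (\<sigma> y)) = of_bool (i = j))"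
    by (rule orthonormal_polynomials[OF fin _ inj]) (use W m in auto)
  then obtain P where P: "\<And>n. n < m \<Longrightarrow> degree (P n) = n \<and> P n \<noteq> 0" and
    orth: "\<And>i j. i < m \<Longrightarrow> j < m \<Longrightarrow> ip (ev (P i)) (ev (P j)) = of_bool (i = j)"
    unfolding ip_def ev_def by blast
  have adj: "ip (H f) g = ip f (H g)" for f g
  proof -
    have split_up: "(\<Sum>y\<in>\<Omega>. W y * up y * F y) = (\<Sum>y\<in>{lo..<hi}. W y * up y * F y)" for F
      unfolding \<Omega>_def using bdry by (intro sum.mono_neutral_right) (auto simp: not_less)
    have split_dn: "(\<Sum>y\<in>\<Omega>. W y * dn y * F y) = (\<Sum>y\<in>{lo..<hi}. W y * up y * F (y + 1))" for F
    proof -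
      have "(\<Sum>y\<in>\<Omega>. W y * dn y * F y) = (\<Sum>y\<in>{lo<..hi}. W y * dn y * F y)"
        unfolding \<Omega>_def using bdry by (intro sum.mono_neutral_right) (auto simp: not_less)
      also have "\<dots> = (\<Sum>y\<in>{lo..<hi}. W (y + 1) * dn (y + 1) * F (y + 1))"
        by (rule sum.reindex_bij_witness[of _ "\<lambda>y. y + 1" "\<lambda>y. y - 1"]) auto
      also have "\<dots> = (\<Sum>y\<in>{lo..<hi}. W y * up y * F (y + 1))"
        using sym by (intro sum.cong) auto
      finally show ?thesis .
    qed
    have "ip (H f) g = (\<Sum>y\<in>\<Omega>. W y * up y * ((f y - f (y + 1)) * g y)) + (\<Sum>y\<in>\<Omega>. W y * dn y * ((f y - f (y - 1)) * g y))"
      for f g unfolding ip_def H_def sum.distrib[symmetric] by (intro sum.cong) (auto simp: algebra_simps)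
    \<comment> \<open>A Dirichlet form, visibly symmetric in \<open>f\<close> and
      \<open>g\<close>.\<close>
    hence "ip (H f) g = (\<Sum>y\<in>{lo..<hi}. W y * up y * ((f y - f (y + 1)) * (g y - g (y + 1))))" for f g
      unfolding split_up split_dn sum.distrib[symmetric] by (simp add: algebra_simps)
    moreover have "ip f (H g) = ip (H g) f" by (simp add: ip_def mult.commute mult.left_commute)
    ultimately show ?thesis by (simp add: mult.commute mult.left_commute)
  qed
  have ip_lin: "ip (ev (\<Sum>j\<in>J. Polynomial.smult (c j) (R j))) g = (\<Sum>j\<in>J. c j * ip (ev (R j)) g)" for J c g and R :: "nat \<Rightarrow> real poly"
    unfolding ip_def ev_def poly_sum poly_smult sum_distrib_left sum_distrib_right
    by (subst sum.swap) (simp add: mult.commute mult.left_commute)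
  have ip_comm: "ip f g = ip g f" for f g by (simp add: ip_def mult.commute mult.left_commute)
  have low: "ip (ev p) (ev (P n)) = 0" if n: "n < m" and p: "\<And>k. k \<ge> n \<Longrightarrow> coeff p k = 0" for n p
  proof -
    obtain c where "p = (\<Sum>j<n. Polynomial.smult (c j) (P j))" using polynomial_span[of n P p] P n p by auto
    thus ?thesis using orth n by (simp add: ip_lin)
  qed
  have zero: "ev p y = 0" if n: "n \<le> m" and p: "\<And>k. k \<ge> n \<Longrightarrow> coeff p k = 0" and o: "\<And>j. j < n \<Longrightarrow> ip (ev p) (ev (P j)) = 0"
    and y: "y \<in> \<Omega>" for n p y
  proof -
    obtain c where c: "p = (\<Sum>j<n. Polynomial.smult (c j) (P j))" using polynomial_span[of n P p] P n p by auto
    have "ip (ev p) (ev p) = (\<Sum>j<n. c j * ip (ev (P j)) (ev p))" by (subst c) (rule ip_lin)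
    also have "\<dots> = 0" using o ip_comm by simp
    finally have "(\<Sum>y\<in>\<Omega>. W y * (ev p y * ev p y)) = 0" by (simp add: ip_def mult.assoc)
    hence "\<forall>y\<in>\<Omega>. W y * (ev p y * ev p y) = 0"
      using W by (subst (asm) sum_nonneg_eq_0_iff[OF fin]) (auto simp: less_imp_le)
    thus ?thesis using y W[OF y] by auto
  qed
  have Hev: "H (ev p) y = ev (hp p) y" if "y \<in> \<Omega>" for p y using hp[OF that] by (simp add: H_def ev_def)
  have ipHev: "ip (H (ev p)) g = ip (ev (hp p)) g" for p g unfolding ip_def using Hev by (intro sum.cong) auto
  have eig: "H (ev (P n)) y = lam n * ev (P n) y" if n: "n < m" and y: "y \<in> \<Omega>" for n y
  proof -
    define R where "R = hp (P n) - Polynomial.smult (lam n) (P n)"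
    have evR: "ev R = (\<lambda>y. ev (hp (P n)) y - lam n * ev (P n) y)" by (simp add: R_def ev_def fun_eq_iff)
    have R: "coeff R k = 0" if "k \<ge> n" for k
    proof (cases "k = n")
      case True thus ?thesis using hcoeff[of "P n" n] P[OF n] by (simp add: R_def)
    next
      case False thus ?thesis using that hdeg[of "P n"] P[OF n] by (simp add: R_def coeff_eq_0)
    qed
    have "ip (ev R) (ev (P j)) = 0" if j: "j < n" for j
    proof -
      have "ip (ev R) (ev (P j)) = ip (ev (hp (P n))) (ev (P j)) - lam n * ip (ev (P n)) (ev (P j))"
        unfolding evR ip_def by (simp add: algebra_simps sum_subtractf sum_distrib_left)
      also have "ip (ev (hp (P n))) (ev (P j)) = ip (ev (P n)) (H (ev (P j)))" by (simp add: ipHev[symmetric] adj)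
      also have "\<dots> = ip (ev (hp (P j))) (ev (P n))" using ipHev ip_comm by metis
      also have "\<dots> = 0"
        using j n P[of j] hdeg[of "P j"] by (intro low) (auto intro!: coeff_eq_0)
      finally show ?thesis using orth[of n j] j n by simp
    qed
    hence "ev R y = 0" using R n y by (intro zero[of n R]) auto
    thus ?thesis using Hev[OF y] by (simp add: evR)
  qed
  have compl: "(\<Sum>n<m. ev (P n) y * ev (P n) z * W z) = of_bool (y = z)" if yz: "y \<in> \<Omega>" "z \<in> \<Omega>" for y z
  proof -
    define A where "A = mat m m (\<lambda>(i,k). ev (P i) (lo + int k))"
    define B where "B = mat m m (\<lambda>(k,j). W (lo + int k) * ev (P j) (lo + int k))"
    have bij: "bij_betw (\<lambda>k. lo + int k) {..<m} \<Omega>"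
      by (rule bij_betwI[of _ _ _ "\<lambda>y. nat (y - lo)"]) (auto simp: m \<Omega>_def)
    have "A * B = 1\<^sub>m m"
    proof (rule eq_matI)
      fix i j assume "i < dim_row (1\<^sub>m m :: real mat)" "j < dim_col (1\<^sub>m m :: real mat)"
      hence ij: "i < m" "j < m" by auto
      have "(A * B) $$ (i, j) = (\<Sum>k<m. ev (P i) (lo + int k) * (W (lo + int k) * ev (P j) (lo + int k)))"
        using ij by (simp add: A_def B_def scalar_prod_def atLeast0LessThan)
      also have "\<dots> = (\<Sum>y\<in>\<Omega>. ev (P i) y * (W y * ev (P j) y))" by (rule sum.reindex_bij_betw[OF bij])
      also have "\<dots> = of_bool (i = j)" using orth[OF ij] by (simp add: ip_def mult.commute mult.left_commute)
      finally show "(A * B) $$ (i, j) = 1\<^sub>m m $$ (i, j)" using ij by simp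
    qed (auto simp: A_def B_def)
    hence BA: "B * A = 1\<^sub>m m" by (rule mat_mult_left_right_inverse[rotated 2]) (auto simp: A_def B_def)
    obtain k l where kl: "k < m" "l < m" "z = lo + int k" "y = lo + int l"
      using bij_betw_imp_surj_on[OF bij] yz by blast
    have "(\<Sum>n<m. ev (P n) y * ev (P n) z * W z) = (B * A) $$ (k, l)"
      using kl by (simp add: A_def B_def scalar_prod_def atLeast0LessThan mult.commute mult.left_commute)
    thus ?thesis using BA kl by auto
  qed
  show ?thesis
  proof
    show "degree (P n) = n" if "n < m" for n using P that by blast
    show "(\<Sum>y\<in>\<Omega>. W y * poly (P i) (\<sigma> y) * poly (P j) (\<sigma> y)) = of_bool (i = j)" if "i < m" "j < m" for i j
      using orth[OF that] by (simp add: ip_def ev_def)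
    show "up y * (poly (P n) (\<sigma> y) - poly (P n) (\<sigma> (y + 1))) + dn y * (poly (P n) (\<sigma> y) - poly (P n) (\<sigma> (y - 1))) = lam n * poly (P n) (\<sigma> y)"
      if "n < m" "y \<in> \<Omega>" for n y using eig[OF that] by (simp add: H_def ev_def)
    show "(\<Sum>n<m. poly (P n) (\<sigma> y) * poly (P n) (\<sigma> z) * W z) = of_bool (y = z)" if "y \<in> \<Omega>" "z \<in> \<Omega>" for y z
      using compl[OF that] by (simp add: ev_def)
  qed
qed

section \<open>The tridiagonal operator of a slice\<close>

context q_weights
begin

context
  fixes S t :: int
begin

text \<open>The parameters place the zeros of the coefficients at the possible ends of the slice.
  \<open>U1\<close> vanishes at \<open>t + N\<close> and \<open>U2\<close> at
  \<open>S + N - 1\<close>, so \<open>up\<close> vanishes at either candidate for the upper end;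
  \<open>V1\<close> vanishes at \<open>0\<close> and \<open>V2\<close> at \<open>t + S - T\<close>,
  so \<open>dn\<close> vanishes at either candidate for the lower end.\<close>

definition al1 :: real where "al1 = q powi (-t - N)"
definition al2 :: real where "al2 = q powi (1 - S - N)"
definition be2 :: real where "be2 = q powi (t + S - T)"
definition U1 :: "int \<Rightarrow> real" where "U1 y = (q powi (-y) - al1) * (1 - cc S (t + 1) * q powi y)"
definition V1 :: "int \<Rightarrow> real" where "V1 y = (cc S (t + 1) * q powi y - al1) * (1 - q powi (-y))"
definition U2 :: "int \<Rightarrow> real" where "U2 y = (q powi (-y) - al2) * (1 - cc S t * be2 * q powi y)"
definition V2 :: "int \<Rightarrow> real" where "V2 y = (cc S t * q powi y - al2) * (1 - be2 * q powi (-y))"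
definition up :: "int \<Rightarrow> real" where "up y = U2 y * U1 (y + 1) / (wt S t y * wt S (t + 1) (y + 1))"
definition dn :: "int \<Rightarrow> real" where "dn y = V2 y * V1 y / (wt S t y * wt S (t + 1) y)"
definition ev0 :: real where "ev0 = (1 - al1) * (1 - al2 * be2)"
text \<open>The first shift leads from line \<open>t\<close> to line \<open>t + 1\<close>, the
  second one back. The second uses the parameter \<open>cc S t = q * cc S (t + 1)\<close>, so it
  evaluates at \<open>q\<close> times the values of \<open>sg S (t + 1)\<close>; the substitution by
  \<open>1 / q\<close> compensates this.\<close>

definition dpoly :: "real poly \<Rightarrow> real poly" where
  "dpoly p = shift_poly q (cc S t) al2 be2 (pcompose (shift_poly q (cc S (t + 1)) al1 1 p) [:0, 1 / q:])"
definition hpoly :: "real poly \<Rightarrow> real poly" where "hpoly p = Polynomial.smult ev0 p - dpoly p"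
definition ev :: "nat \<Rightarrow> real" where "ev n = ev0 - (1 - al1 * q ^ n) * (1 - al2 * be2 * q ^ n) / q ^ n"
definition Wt :: "int \<Rightarrow> real" where "Wt y = gg S t y * gg' S t y * wt S t y"

lemma first_shift:
  assumes "wt S (t + 1) y \<noteq> 0"
  shows "poly (shift_poly q (cc S (t + 1)) al1 1 p) (sg S (t + 1) y) =
    (U1 y * poly p (sg S t y) - V1 y * poly p (sg S t (y - 1))) / wt S (t + 1) y"
proof -
  have w: "q powi (-y) - cc S (t + 1) / q powi (-y) \<noteq> 0" using assms sg_shift(4)[of S t y] by simp
  have yQ: "cc S (t + 1) * q powi y = cc S (t + 1) / q powi (-y)" by (simp add: powi_minus)
  show ?thesis
    unfolding sg_shift(3)[of S t y] poly_shift_poly[OF powi_nz w] antisym_shift_def U1_def V1_def yQ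
      sg_shift(1)[of S t y] sg_shift(2)[of S t y] sg_shift(4)[of S t y] by simp
qed

lemma second_shift:
  assumes "wt S t y \<noteq> 0"
  shows "poly (shift_poly q (cc S t) al2 be2 (pcompose r [:0, 1 / q:])) (sg S t y) =
    (U2 y * poly r (sg S (t + 1) (y + 1)) - V2 y * poly r (sg S (t + 1) y)) / wt S t y"
proof -
  have yQ: "cc S t * q powi y = cc S t / q powi (-y)" by (simp add: powi_minus)
  have w: "q powi (-y) - cc S t / q powi (-y) \<noteq> 0" using assms yQ by (simp add: wt_def)
  have s: "sg S t y = q powi (-y) + cc S t / q powi (-y)" using yQ by (simp add: sg_def)
  have "q powi (-(y+1)) * q = q powi (-y)" using powi_add[of "-(y+1)" 1] by simp
  hence a: "(q powi (-y) + q * cc S t / q powi (-y)) / q = sg S (t + 1) (y + 1)"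
    unfolding sg_def cc_Suc[of S t] using powi_add[of y 1] by (simp add: field_simps powi_minus)
  have b: "(q * q powi (-y) + cc S t / q powi (-y)) / q = sg S (t + 1) y"
    unfolding sg_def cc_Suc[of S t] by (simp add: field_simps powi_minus)
  have c: "cc S t * be2 * q powi y = cc S t * be2 / q powi (-y)" by (simp add: powi_minus)
  have P: "poly (pcompose r [:0, 1 / q:]) z = poly r (z / q)" for z by (simp add: poly_pcompose)
  show ?thesis
    unfolding s poly_shift_poly[OF powi_nz w] antisym_shift_def U2_def V2_def P a b c yQ
    by (simp add: wt_def yQ)
qed

lemma dpoly_eval:
  assumes "wt S t y \<noteq> 0" "wt S (t + 1) y \<noteq> 0" "wt S (t + 1) (y + 1) \<noteq> 0"
  shows "poly (dpoly p) (sg S t y) = up y * poly p (sg S t (y + 1)) + dn y * poly p (sg S t (y - 1))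
    - (U2 y * V1 (y + 1) / wt S (t + 1) (y + 1) + V2 y * U1 y / wt S (t + 1) y) / wt S t y * poly p (sg S t y)"
  unfolding dpoly_def second_shift[OF assms(1)] first_shift[OF assms(2)] first_shift[OF assms(3)] up_def dn_def
  using assms by (simp add: divide_simps) (simp add: algebra_simps)

lemma shift_poly_const: "shift_poly q c \<alpha> \<beta> [:a:] = [:a * (1 - \<alpha> * \<beta>):]"
  by (simp add: shift_poly_def)

text \<open>\<open>ev0\<close> is the value of \<open>dpoly\<close> on the constant 1, so
  \<open>hpoly\<close> annihilates constants. Comparing at the constant 1 identifies the diagonal
  coefficient in terms of \<open>up\<close> and \<open>dn\<close>.\<close>

lemma hpoly_eval:
  assumes "wt S t y \<noteq> 0" "wt S (t + 1) y \<noteq> 0" "wt S (t + 1) (y + 1) \<noteq> 0"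
  shows "poly (hpoly p) (sg S t y) = up y * (poly p (sg S t y) - poly p (sg S t (y + 1)))
     + dn y * (poly p (sg S t y) - poly p (sg S t (y - 1)))"
proof -
  have "dpoly [:1:] = [:ev0:]" by (simp add: dpoly_def shift_poly_const pcompose_const ev0_def)
  define X where "X = (U2 y * V1 (y + 1) / wt S (t + 1) (y + 1) + V2 y * U1 y / wt S (t + 1) y) / wt S t y"
  have e: "ev0 = up y + dn y - X"
    using dpoly_eval[OF assms, of "[:1:]"] \<open>dpoly [:1:] = [:ev0:]\<close> by (simp add: X_def)
  show ?thesis unfolding hpoly_def poly_diff poly_smult dpoly_eval[OF assms] X_def[symmetric] e by (simp add: algebra_simps)
qed

lemma dpoly_degree: "degree (dpoly p) \<le> degree p"
proof -
  have "degree (dpoly p) \<le> degree (pcompose (shift_poly q (cc S (t + 1)) al1 1 p) [:0, 1 / q:])"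
    unfolding dpoly_def by (rule shift_poly_degree)
  also have "\<dots> \<le> degree (shift_poly q (cc S (t + 1)) al1 1 p) * degree [:0, 1 / q:]" by (rule degree_pcompose_le)
  also have "\<dots> = degree (shift_poly q (cc S (t + 1)) al1 1 p)" by simp
  also have "\<dots> \<le> degree p" by (rule shift_poly_degree)
  finally show ?thesis .
qed

lemma hpoly_degree: "degree (hpoly p) \<le> degree p"
  unfolding hpoly_def using dpoly_degree[of p] degree_smult_le[of ev0 p] by (intro degree_diff_le) auto

lemma hpoly_coeff:
  assumes "degree p \<le> n" shows "coeff (hpoly p) n = ev n * coeff p n"
proof -
  have d1: "degree (shift_poly q (cc S (t + 1)) al1 1 p) \<le> n" using shift_poly_degree assms order.trans by blast
  have d2: "degree (pcompose (shift_poly q (cc S (t + 1)) al1 1 p) [:0, 1 / q:]) \<le> n"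
    using degree_pcompose_le[of "shift_poly q (cc S (t + 1)) al1 1 p" "[:0, 1 / q:]"] d1 by simp
  have "coeff (dpoly p) n = (1 - al2 * be2 * q ^ n) * ((1 / q) ^ n * ((1 - al1 * 1 * q ^ n) * coeff p n))"
    unfolding dpoly_def shift_poly_coeff[OF d2] coeff_pcompose_linear shift_poly_coeff[OF assms] by simp
  thus ?thesis by (simp add: hpoly_def ev_def field_simps)
qed

text \<open>The forward weights at \<open>y\<close> and \<open>y + 1\<close> share the successor
  \<open>y + 1\<close> on line \<open>t + 1\<close>, so their ratio is that of
  \<open>V1 (y + 1)\<close> to \<open>- U1 (y + 1)\<close>. After reflection the backward weights
  have in the same way the ratio of \<open>V2 (y + 1)\<close> to \<open>- U2 y\<close>. The two
  signs cancel in the product.\<close>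

lemma Wt_balance:
  assumes y: "0 \<le> y" "t + S - T \<le> y" "y < t + N - 1" "y < S + N - 1" and S: "0 < S" "S < T"
  shows "Wt y * up y = Wt (y + 1) * dn (y + 1)"
proof -
  define G where "G = gg S (t + 1) (y + 1)"
  have g1: "gg S t (y + 1) = - G * U1 (y + 1)"
    using gg_step1[of "y + 1" t S] y S by (simp add: G_def U1_def al1_def algebra_simps)
  have g2: "gg S t y = G * V1 (y + 1)"
    using gg_step2[of "y + 1" t S] y S by (simp add: G_def V1_def al1_def algebra_simps)
  define y' where "y' = y + 1 - t + T - S"
  define G' where "G' = gg (T - S) (T - t + 1) y'"
  have h1: "gg' S t (y + 1) = G' * (q powi (-(T - t) - N) - q powi (-y')) * (1 - cc (T - S) (T - t + 1) * q powi y')"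
    unfolding gg'_def y'_def[symmetric] G'_def using y S by (intro gg_step1) (auto simp: y'_def)
  have h2: "gg' S t y = G' * (q powi (-(T - t) - N) - cc (T - S) (T - t + 1) * q powi y') * (q powi (-y') - 1)"
    using gg_step2[of y' "T - t" "T - S"] y S unfolding gg'_def G'_def by (simp add: y'_def algebra_simps)
  have e1: "q powi (-y') = be2 * q powi (-(y+1))" unfolding be2_def y'_def by (simp add: algebra_simps flip: powi_add)
  have e2: "q powi (-(T - t) - N) = be2 * al2 / q"
  proof -
    have "q powi (-(T - t) - N) * q = be2 * al2"
      using powi_add[of "-(T - t) - N" 1] unfolding be2_def al2_def by (simp add: algebra_simps flip: powi_add)
    thus ?thesis by (simp add: field_simps)
  qed
  have e3: "cc (T - S) (T - t + 1) * q powi y' = cc S t * be2 * q powi y"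
    unfolding cc_def be2_def y'_def by (simp add: mult.assoc algebra_simps flip: powi_add)
  have e4: "q powi (-(y+1)) = q powi (-y) / q" "q powi (y + 1) = q powi y * q"
    using powi_add[of "-(y+1)" 1] powi_add[of y 1] by (auto simp: field_simps)
  have h1': "gg' S t (y + 1) = - (G' * be2 / q) * U2 y"
    unfolding h1 e1 e2 e3 e4 U2_def by (simp add: field_simps)
  have h2': "gg' S t y = (G' * be2 / q) * V2 (y + 1)"
    unfolding h2 e1 e2 e3 e4 V2_def by (simp add: field_simps)
  have cw: "wt S (t + 1) (y + 1) \<noteq> 0" "wt S t y \<noteq> 0" "wt S t (y + 1) \<noteq> 0"
    using wt_Suc_pos[of "y+1" t S] wt_pos[of y t S] wt_pos[of "y+1" t S] y by auto
  show ?thesis unfolding Wt_def up_def dn_def g1 g2 h1' h2' using cw by (simp add: field_simps)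
qed

lemma Wt_pos: assumes "0 < S" "S < T" "y \<in> rng N T S t" shows "0 < Wt y"
proof -
  have y: "0 \<le> y" "t + S - T \<le> y" "y \<le> t + N - 1" "y \<le> S + N - 1" using assms(3) by (auto simp: rng_def min_def split: if_splits)
  have "gg' S t y > 0" unfolding gg'_def using y assms(1,2) by (intro gg_pos) auto
  moreover have "gg S t y > 0" using y assms(1,2) by (intro gg_pos) auto
  ultimately show ?thesis using wt_pos[of y t S] y by (simp add: Wt_def)
qed

lemma slice_spectrum:
  assumes S: "0 < S" "S < T" and t: "0 \<le> t" "t \<le> T"
  defines "\<Omega> \<equiv> rng N T S t"
  obtains P where "\<And>n. n < card \<Omega> \<Longrightarrow> degree (P n) = n"
    "\<And>i j. i < card \<Omega> \<Longrightarrow> j < card \<Omega> \<Longrightarrow> (\<Sum>y\<in>\<Omega>. Wt y * poly (P i) (sg S t y) * poly (P j) (sg S t y)) = of_bool (i = j)"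
    "\<And>n y. n < card \<Omega> \<Longrightarrow> y \<in> \<Omega> \<Longrightarrow> up y * (poly (P n) (sg S t y) - poly (P n) (sg S t (y + 1)))
        + dn y * (poly (P n) (sg S t y) - poly (P n) (sg S t (y - 1))) = ev n * poly (P n) (sg S t y)"
    "\<And>y z. y \<in> \<Omega> \<Longrightarrow> z \<in> \<Omega> \<Longrightarrow> (\<Sum>n<card \<Omega>. poly (P n) (sg S t y) * poly (P n) (sg S t z) * Wt z) = of_bool (y = z)"
proof -
  define lo hi where "lo = max 0 (t + S - T)" and "hi = min t S + N - 1"
  have \<Omega>: "\<Omega> = {lo..hi}" by (simp add: \<Omega>_def rng_def lo_def hi_def)
  have wpos: "wt S t y > 0" "wt S (t + 1) y > 0" if "y \<ge> lo" for y
    using wt_pos[of y t S] wt_Suc_pos[of y t S] that unfolding lo_def by simp_all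
  have Wpos: "Wt y > 0" if "y \<in> {lo..hi}" for y using Wt_pos[OF S] that by (simp add: rng_def lo_def hi_def)
  have inj: "inj_on (sg S t) {lo..hi}"
  proof -
    have inc: "sg S t y < sg S t (y + 1)" if "y \<ge> lo" for y
    proof -
      have "(1 - q) * (Q - c / Q) = (Q + q * c / Q) - (q * Q + c / Q)" for Q c :: real
        by (simp add: left_diff_distrib right_diff_distrib diff_divide_distrib)
      from this[of "q powi (- (y + 1))" "cc S (t + 1)"]
      have "sg S t (y + 1) - sg S t (y + 1 - 1) = (1 - q) * wt S (t + 1) (y + 1)"
        unfolding sg_shift(1)[of S t "y + 1"] sg_shift(2)[of S t "y + 1"] sg_shift(4)[of S t "y + 1"] by (rule sym)
      moreover have "(1 - q) * wt S (t + 1) (y + 1) > 0" using wpos(2)[of "y + 1"] that q01 by simp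
      ultimately show ?thesis by (simp only: add_diff_cancel_right')
    qed
    have inc': "sg S t y < sg S t (y + 1 + int k)" if "lo \<le> y" for y k
    proof (induction k)
      case 0 show ?case using inc[OF that] by simp
    next
      case (Suc k)
      have "sg S t (y + 1 + int k) < sg S t (y + 1 + int k + 1)" using that by (intro inc) simp
      moreover have "y + 1 + int (Suc k) = y + 1 + int k + 1" by simp
      ultimately show ?case using Suc by (simp only: order.strict_trans)
    qed
    have lt: "sg S t y < sg S t z" if "lo \<le> y" "y < z" for y z
      using inc'[OF that(1), of "nat (z - y - 1)"] that(2) by simp
    show ?thesis
    proof (rule linorder_inj_onI')
      fix i j assume "i \<in> {lo..hi}" "i < j"
      thus "sg S t i \<noteq> sg S t j" using lt[of i j] by simp
    qed
  qed
  have bd: "dn lo = 0" "up hi = 0"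
  proof -
    have "be2 * q powi (-(t + S - T)) = 1" by (simp add: be2_def flip: powi_add)
    hence "V2 (t + S - T) = 0" unfolding V2_def by simp
    moreover have "V1 0 = 0" by (simp add: V1_def)
    moreover have "lo = 0 \<or> lo = t + S - T" unfolding lo_def by linarith
    ultimately show "dn lo = 0" unfolding dn_def by auto
    have u1: "U1 (t + N - 1 + 1) = 0" by (simp add: U1_def al1_def)
    have "- (S + N - 1) = 1 - S - N" by simp
    hence u2: "U2 (S + N - 1) = 0" by (simp only: U2_def al2_def) simp
    have "hi = t + N - 1 \<or> hi = S + N - 1" unfolding hi_def by linarith
    thus "up hi = 0" unfolding up_def using u1 u2 by auto
  qed
  have bal: "Wt y * up y = Wt (y + 1) * dn (y + 1)" if "lo \<le> y" "y < hi" for y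
    using that S by (intro Wt_balance) (auto simp: lo_def hi_def)
  have hev: "poly (hpoly p) (sg S t y) = up y * (poly p (sg S t y) - poly p (sg S t (y + 1))) +
        dn y * (poly p (sg S t y) - poly p (sg S t (y - 1)))" if "y \<in> {lo..hi}" for p y
  proof (rule hpoly_eval)
    have "y \<ge> lo" using that by simp
    thus "wt S t y \<noteq> 0" "wt S (t + 1) y \<noteq> 0" "wt S (t + 1) (y + 1) \<noteq> 0"
      using wpos[of y] wpos[of "y + 1"] by linarith+
  qed
  show ?thesis
    by (rule spectral_decomposition[where W = Wt and \<sigma> = "sg S t" and lo = lo and hi = hi and dn = dn and up = up
          and hp = hpoly and lam = ev, OF Wpos inj bd bal hev hpoly_degree hpoly_coeff refl])
       (assumption+ | rule that[unfolded \<Omega>])+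
qed

end

end

section \<open>Concentration of the height on a slice\<close>

lemma Suc_int: "1 + int t = int t + 1" by simp

lemma finite_fams: "finite (fams N T S)"
proof -
  have "finite (\<Pi>\<^sub>E t\<in>{..T}. Pow (rng N T S t))" by (intro finite_PiE) auto
  thus ?thesis by (rule rev_finite_subset) (auto simp: fams_def)
qed

lemma rng_ends: "S \<le> T \<Longrightarrow> card (rng (int N) (int T) (int S) 0) = N" "S \<le> T \<Longrightarrow> card (rng (int N) (int T) (int S) (int T)) = N"
  by (simp_all add: rng_def)

text \<open>Steps preserve the number of particles, and a line with exactly \<open>N\<close> sites
  admits one configuration of \<open>N\<close> particles. So the end conditions become conditions on
  cardinalities, the form used in \<open>slice_sum\<close>.\<close>

lemma fams_eq:
  assumes "S \<le> T"
  shows "fams N T S = {F \<in> PiE {..T} (\<lambda>t. {X. X \<subseteq> rng N T S t \<and> card X = N}). \<forall>i<T. jumps 1 (F i) (F (Suc i))}"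
proof (intro Set.set_eqI iffI)
  fix F assume "F \<in> fams N T S"
  hence F: "F \<in> PiE {..T} (\<lambda>t. Pow (rng N T S t))" "F 0 = rng N T S 0" "\<And>i. i < T \<Longrightarrow> jumps 1 (F i) (F (Suc i))"
    by (simp_all add: fams_def)
  have sub: "F t \<subseteq> rng N T S t" if "t \<le> T" for t using PiE_mem[OF F(1), of t] that by simp
  have "card (F t) = N" if "t \<le> T" for t
    using that
  proof (induction t)
    case 0 show ?case using F(2) rng_ends(1)[OF assms, of N] by simp
  next
    case (Suc t)
    hence "jumps 1 (F t) (F (Suc t))" by (intro F(3)) simp
    from jumps_card[OF this] Suc show ?case by simp
  qed
  hence "F t \<in> {X. X \<subseteq> rng N T S t \<and> card X = N}" if "t \<le> T" for t using sub that by simp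
  moreover have "F \<in> extensional {..T}" using F(1) by (simp add: PiE_def)
  ultimately have "F \<in> PiE {..T} (\<lambda>t. {X. X \<subseteq> rng N T S t \<and> card X = N})" unfolding PiE_def by (intro IntI Pi_I) simp_all
  thus "F \<in> {F \<in> PiE {..T} (\<lambda>t. {X. X \<subseteq> rng N T S t \<and> card X = N}). \<forall>i<T. jumps 1 (F i) (F (Suc i))}"
    using F(3) by simp
next
  fix F assume "F \<in> {F \<in> PiE {..T} (\<lambda>t. {X. X \<subseteq> rng N T S t \<and> card X = N}). \<forall>i<T. jumps 1 (F i) (F (Suc i))}"
  hence F: "F \<in> PiE {..T} (\<lambda>t. {X. X \<subseteq> rng N T S t \<and> card X = N})" "\<And>i. i < T \<Longrightarrow> jumps 1 (F i) (F (Suc i))" by simp_all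
  have sub: "F t \<subseteq> rng N T S t" "card (F t) = N" if "t \<le> T" for t using PiE_mem[OF F(1), of t] that by simp_all
  have a: "F t = rng N T S t" if "t \<le> T" "card (rng (int N) (int T) (int S) (int t)) = N" for t
    using card_subset_eq[OF _ sub(1)[OF that(1)]] sub(2)[OF that(1)] that(2) by (simp add: rng_def)
  have e: "F 0 = rng N T S 0" "F T = rng N T S T" using a[of 0] a[of T] rng_ends[OF assms, of N] by simp_all
  have "F \<in> extensional {..T}" using F(1) by (simp add: PiE_def)
  hence "F \<in> PiE {..T} (\<lambda>t. Pow (rng N T S t))" using sub(1) unfolding PiE_def by (intro IntI Pi_I) simp_all
  thus "F \<in> fams N T S" using e F(2) by (simp add: fams_def)
qed

locale q_tilings = q_weights q \<kappa> "int Nn" "int Tn" for q \<kappa> Nn Tn +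
  fixes Sn :: nat
  assumes Sn: "0 < Sn" "Sn < Tn" and \<kappa>0: "0 \<le> \<kappa>"
begin

abbreviation "tilings \<equiv> lozenge_tilings Nn (Tn - Sn) Sn"
abbreviation "R t \<equiv> rng (int Nn) (int Tn) (int Sn) t"

text \<open>Read off from the completeness relation: equal values of \<open>sg\<close> at
  \<open>y\<close> and \<open>z\<close> would make its left side agree at \<open>(y, z)\<close> and
  at \<open>(z, z)\<close>.\<close>

lemma sg_inj:
  assumes "t \<le> Tn" shows "inj_on (sg Sn t) (R t)"
proof -
  have S: "0 < int Sn" "int Sn < int Tn" and t: "0 \<le> int t" "int t \<le> int Tn" using Sn assms by simp_all
  show ?thesis
  proof (rule slice_spectrum[OF S t])
    fix P assume P: "\<And>y z. y \<in> R t \<Longrightarrow> z \<in> R t \<Longrightarrow> (\<Sum>n<card (R t). poly (P n) (sg Sn t y) * poly (P n) (sg Sn t z) * Wt Sn t z) = of_bool (y = z)"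
    show ?thesis
    proof (rule inj_onI)
      fix y z assume yz: "y \<in> R t" "z \<in> R t" "sg Sn t y = sg Sn t z"
      have "of_bool (y = z) = (of_bool (z = z) :: real)"
        unfolding P[OF yz(1,2), symmetric] P[OF yz(2,2), symmetric] yz(3) ..
      thus "y = z" by (simp add: of_bool_def split: if_splits)
    qed
  qed
qed

lemma slice_law:
  assumes t: "t \<le> Tn"
  shows "\<exists>K. \<forall>X. X \<subseteq> R t \<and> card X = Nn \<longrightarrow> (\<Sum>F | F \<in> fams Nn Tn Sn \<and> F t = X. \<Prod>i\<le>Tn. \<Prod>y\<in>F i. 1 / wt Sn i y)
      = K * ((slater (\<lambda>j x. sg Sn t x ^ j) X)\<^sup>2 * (\<Prod>x\<in>X. Wt Sn t x))"
proof -
  have "\<exists>K. \<forall>X\<in>{X. X \<subseteq> R t \<and> card X = Nn}. (\<Sum>F | F \<in> PiE {..Tn} (\<lambda>t. {X. X \<subseteq> R t \<and> card X = Nn}) \<and> (\<forall>i<Tn. jumps 1 (F i) (F (Suc i))) \<and> F t = X. \<Prod>i\<le>Tn. \<Prod>y\<in>F i. 1 / wt Sn i y)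
      = K * ((slater (\<lambda>j x. sg Sn t x ^ j) X)\<^sup>2 * (\<Prod>x\<in>X. gg Sn t x * gg' Sn t x * wt Sn t x))"
  proof (rule slice_sum[where R = "\<lambda>t. R (int t)" and w = "\<lambda>t. wt Sn (int t)" and \<sigma> = "\<lambda>t. sg Sn (int t)"
        and g = "\<lambda>t. gg Sn (int t)" and g' = "\<lambda>t. gg' Sn (int t)" and
        p = "\<lambda>t j. fwd_poly Sn (int t) (Polynomial.monom 1 j)" and p' = "\<lambda>t j. bwd_poly Sn (int t) j"])
    show "card (R (int 0)) = Nn" "card (R (int Tn)) = Nn" using rng_ends[of Sn Tn Nn] Sn by simp_all
    show "wt Sn (int t) y \<noteq> 0" if "y \<in> R (int t)" for t y
      using wt_pos[of y "int t" "int Sn"] that by (auto simp: rng_def)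
    show "inj_on (sg Sn (int 0)) (R (int 0))" "inj_on (sg Sn (int Tn)) (R (int Tn))" using sg_inj[of 0] sg_inj[of Tn] by simp_all
    show "gg Sn (int 0) y \<noteq> 0" if "y \<in> R (int 0)" for y
      using gg_pos[of y "int 0" "int Sn"] that Sn by (auto simp: rng_def)
    show "gg' Sn (int Tn) y \<noteq> 0" if "y \<in> R (int Tn)" for y
      using gg_pos[of "y - Sn" 0 "int Tn - int Sn"] that Sn by (auto simp: rng_def gg'_def)
    show "gg Sn (int t) y = 0" if "y \<in> R (int (Suc t))" "y \<notin> R (int t)" for t y
      using that by (auto simp: rng_def gg_def)
    show "gg Sn (int t) (y - 1) = 0" if "y \<in> R (int (Suc t))" "y - 1 \<notin> R (int t)" for t y
      using that by (auto simp: rng_def gg_def)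
    show "gg' Sn (int (Suc t)) y = 0" if "t < Tn" "y \<in> R (int t)" "y \<notin> R (int (Suc t))" for t y
      using that by (auto simp: rng_def gg'_def gg_def)
    show "gg' Sn (int (Suc t)) (y + 1) = 0" if "t < Tn" "y \<in> R (int t)" "y + 1 \<notin> R (int (Suc t))" for t y
      using that by (auto simp: rng_def gg'_def gg_def)
    show "gg Sn (int t) y * sg Sn (int t) y ^ j + gg Sn (int t) (y - 1) * sg Sn (int t) (y - 1) ^ j =
        wt Sn (int (Suc t)) y * gg Sn (int (Suc t)) y * poly (fwd_poly Sn (int t) (Polynomial.monom 1 j)) (sg Sn (int (Suc t)) y)"
      if "y \<in> R (int (Suc t))" for t y j
      using gg_forward[of y "int t" "int Sn" "Polynomial.monom 1 j"] that Sn by (simp add: rng_def poly_monom Suc_int min_def split: if_splits)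
    show "gg' Sn (int (Suc t)) y * sg Sn (int (Suc t)) y ^ j + gg' Sn (int (Suc t)) (y + 1) * sg Sn (int (Suc t)) (y + 1) ^ j =
        wt Sn (int t) y * gg' Sn (int t) y * poly (bwd_poly Sn (int t) j) (sg Sn (int t) y)"
      if "y \<in> R (int t)" for t y j
      using gg_backward[of y "int Sn" "int t" j] that Sn by (simp add: rng_def Suc_int min_def split: if_splits)
    show "degree (fwd_poly Sn (int t) (Polynomial.monom 1 j)) \<le> j" for t j
      using fwd_poly_degree[of "int Sn" "int t" "Polynomial.monom 1 j"] degree_monom_le[of "1::real" j] by linarith
    show "degree (bwd_poly Sn (int t) j) \<le> j" for t j by (rule bwd_poly_degree)
  qed (use t in auto)
  thus ?thesis using Sn by (simp add: fams_eq Wt_def conj_assoc)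
qed

text \<open>On one line the product over the holes is a constant divided by the product over the
  particles. The two outer lines have no holes and fixed particles, so including them changes only
  the constant. The negative sign of each hole factor is absorbed by \<open>h\<close> and thus by
  \<open>K\<close>.\<close>

lemma tiling_weight_form:
  "\<exists>K. K \<noteq> 0 \<and> (\<forall>\<T>\<in>tilings. tiling_weight Sn q \<kappa> \<T> = K * (\<Prod>t\<le>Tn. \<Prod>y\<in>particles \<T> (int t). 1 / wt Sn t y))"
proof -
  define hw where "hw = (\<lambda>(t::nat) (y::int). \<kappa>\<^sup>2 * q powr (real_of_int y + 1 - real t / 2 - (real Sn + 1) / 2) - q powr (- (real_of_int y + 1 - real t / 2) + (real Sn + 1) / 2))"
  define h where "h = (\<lambda>t::nat. - (q powr ((real t + real Sn - 1) / 2)))"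
  have hw: "hw t y = h t * wt Sn t y" for t y
  proof -
    have pw: "q powi z = q powr (of_int z)" for z using q01 by (simp add: powr_real_of_int')
    have "q powr ((real t + real Sn - 1) / 2) * q powi (-y) = q powr (- (real_of_int y + 1 - real t / 2) + (real Sn + 1) / 2)"
      unfolding pw powr_add[symmetric] by (rule arg_cong[of _ _ "(powr) q"]) (simp add: field_simps)
    moreover have "q powr ((real t + real Sn - 1) / 2) * (q powi (1 - int t - int Sn) * q powi y) = q powr (real_of_int y + 1 - real t / 2 - (real Sn + 1) / 2)"
      unfolding pw powr_add[symmetric] by (rule arg_cong[of _ _ "(powr) q"]) (simp add: field_simps)
    ultimately show ?thesis unfolding hw_def h_def wt_def cc_def by (simp add: algebra_simps)
  qed
  have h0: "h t \<noteq> 0" for t using q01 by (simp add: h_def)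
  have wt0: "wt Sn t y \<noteq> 0" if "y \<in> R (int t)" for t :: nat and y using wt_pos[of y t Sn] that by (auto simp: rng_def)
  define C where "C = (\<lambda>t. (\<Prod>y\<in>R (int t). hw t y) / h t ^ Nn)"
  have C0: "C t \<noteq> 0" for t using h0 wt0 hw by (simp add: C_def)
  define K where "K = (\<Prod>t\<in>{1..<Tn}. C t) * (\<Prod>y\<in>R 0. wt Sn 0 y) * (\<Prod>y\<in>R (int Tn). wt Sn Tn y)"
  have abc: "Nn \<ge> 1" "Tn - Sn \<ge> 1" "Sn \<ge> 1" "Tn - Sn + Sn = Tn" using NT Sn by auto
  have "tiling_weight Sn q \<kappa> \<T> = K * (\<Prod>t\<le>Tn. \<Prod>y\<in>particles \<T> (int t). 1 / wt Sn t y)" if T: "\<T> \<in> tilings" for \<T>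
  proof -
    define F where "F = (\<lambda>t\<in>{..Tn}. particles \<T> (int t))"
    have F: "F \<in> fams Nn Tn Sn"
      using bij_betw_apply[OF tilings_fams(1)[OF abc(1-3)] T] by (simp add: F_def abc(4))
    have FX: "F t \<subseteq> R (int t) \<and> card (F t) = Nn" if "t \<le> Tn" for t
      using F that Sn by (auto simp: fams_eq PiE_iff)
    have Fe: "F 0 = R 0" "F Tn = R (int Tn)" using F by (simp_all add: fams_def)
    have "tiling_weight Sn q \<kappa> \<T> = (\<Prod>t\<in>{1..<Tn}. \<Prod>y\<in>R (int t) - particles \<T> (int t). hw t y)"
      using tilings_fams(2)[OF abc(1-3) T, of q \<kappa>] by (simp add: hw_def abc(4))
    also have "\<dots> = (\<Prod>t\<in>{1..<Tn}. C t * (\<Prod>y\<in>F t. 1 / wt Sn t y))"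
    proof (rule prod.cong[OF refl])
      fix t assume "t \<in> {1..<Tn}"
      hence t: "t \<le> Tn" by simp
      have p: "particles \<T> (int t) = F t" using t by (simp add: F_def)
      have nz: "(\<Prod>y\<in>F t. hw t y) \<noteq> 0"
      proof -
        have "finite (F t)" by (rule finite_subset[OF conjunct1[OF FX[OF t]]]) (simp add: rng_def)
        moreover have "hw t y \<noteq> 0" if "y \<in> F t" for y using that FX[OF t] wt0 h0 hw by auto
        ultimately show ?thesis by simp
      qed
      have "(\<Prod>y\<in>R (int t). hw t y) = (\<Prod>y\<in>R (int t) - F t. hw t y) * (\<Prod>y\<in>F t. hw t y)"
        using FX[OF t] by (intro prod.subset_diff) auto
      hence "(\<Prod>y\<in>R (int t) - F t. hw t y) = (\<Prod>y\<in>R (int t). hw t y) / (\<Prod>y\<in>F t. hw t y)" using nz by simp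
      also have "(\<Prod>y\<in>F t. hw t y) = h t ^ Nn * (\<Prod>y\<in>F t. wt Sn t y)"
        unfolding hw prod.distrib using FX[OF t] by simp
      finally show "(\<Prod>y\<in>R (int t) - particles \<T> (int t). hw t y) = C t * (\<Prod>y\<in>F t. 1 / wt Sn t y)"
        unfolding p C_def by (simp add: prod_dividef)
    qed
    also have "\<dots> = (\<Prod>t\<in>{1..<Tn}. C t) * (\<Prod>t\<in>{1..<Tn}. \<Prod>y\<in>F t. 1 / wt Sn t y)" by (rule prod.distrib)
    also have "(\<Prod>t\<in>{1..<Tn}. \<Prod>y\<in>F t. 1 / wt Sn t y) = (\<Prod>t\<le>Tn. \<Prod>y\<in>F t. 1 / wt Sn t y) * ((\<Prod>y\<in>R 0. wt Sn 0 y) * (\<Prod>y\<in>R (int Tn). wt Sn Tn y))"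
    proof -
      have s: "{..Tn} = insert 0 (insert Tn {1..<Tn})" using NT by auto
      have "(\<Prod>t\<le>Tn. \<Prod>y\<in>F t. 1 / wt Sn t y) = (\<Prod>y\<in>R 0. 1 / wt Sn 0 y) * ((\<Prod>y\<in>R (int Tn). 1 / wt Sn Tn y) * (\<Prod>t\<in>{1..<Tn}. \<Prod>y\<in>F t. 1 / wt Sn t y))"
        unfolding s using NT Fe by simp
      moreover have "(\<Prod>y\<in>R 0. wt Sn 0 y) \<noteq> 0" "(\<Prod>y\<in>R (int Tn). wt Sn Tn y) \<noteq> 0"
        using wt0[of _ 0] wt0[of _ Tn] by auto
      ultimately show ?thesis by (simp add: prod_dividef)
    qed
    also have "(\<Prod>t\<le>Tn. \<Prod>y\<in>F t. 1 / wt Sn t y) = (\<Prod>t\<le>Tn. \<Prod>y\<in>particles \<T> (int t). 1 / wt Sn t y)"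
      by (intro prod.cong) (auto simp: F_def)
    finally show ?thesis by (simp add: K_def)
  qed
  moreover have "K \<noteq> 0" unfolding K_def using C0 wt0[of _ 0] wt0[of _ Tn] by auto
  ultimately show ?thesis by blast
qed

end

section \<open>Probabilities as ratios of sums of positive weights\<close>

lemma point_measure_ratio:
  assumes "finite A" "E \<subseteq> A" "\<And>x. x \<in> A \<Longrightarrow> w x = K * v x" "\<And>x. x \<in> A \<Longrightarrow> 0 \<le> v x" "K \<noteq> (0::real)"
  shows "measure (point_measure A (\<lambda>x. ennreal (w x / (\<Sum>x\<in>A. w x)))) E = (\<Sum>x\<in>E. v x) / (\<Sum>x\<in>A. v x)"
proof -
  have r: "w x / (\<Sum>x\<in>A. w x) = v x / (\<Sum>x\<in>A. v x)" if "x \<in> A" for x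
  proof -
    have "(\<Sum>x\<in>A. w x) = K * (\<Sum>x\<in>A. v x)" unfolding sum_distrib_left by (intro sum.cong refl assms(3))
    thus ?thesis using assms(3)[OF that] assms(5) by simp
  qed
  have nn: "0 \<le> v x / (\<Sum>x\<in>A. v x)" if "x \<in> A" for x using assms(4) that by (intro divide_nonneg_nonneg sum_nonneg) auto
  have "emeasure (point_measure A (\<lambda>x. ennreal (w x / (\<Sum>x\<in>A. w x)))) E = (\<Sum>x\<in>E. ennreal (w x / (\<Sum>x\<in>A. w x)))"
    by (rule emeasure_point_measure_finite[OF assms(1,2)])
  also have "\<dots> = (\<Sum>x\<in>E. ennreal (v x / (\<Sum>x\<in>A. v x)))" using assms(2) r by (intro sum.cong refl) auto
  also have "\<dots> = ennreal (\<Sum>x\<in>E. v x / (\<Sum>x\<in>A. v x))" using assms(2) nn by (intro sum_ennreal) auto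
  finally have "measure (point_measure A (\<lambda>x. ennreal (w x / (\<Sum>x\<in>A. w x)))) E = (\<Sum>x\<in>E. v x / (\<Sum>x\<in>A. v x))"
    unfolding measure_def using assms(2) nn by (simp add: sum_nonneg subset_iff)
  thus ?thesis by (simp add: sum_divide_distrib)
qed

context q_tilings
begin

lemma hexagon_sides: "Nn \<ge> 1" "Tn - Sn \<ge> 1" "Sn \<ge> 1" "Tn - Sn + Sn = Tn" using NT Sn by auto

lemmas tilings_bij = tilings_fams(1)[OF hexagon_sides(1-3), unfolded hexagon_sides(4)]

lemma finite_tilings: "finite tilings" using bij_betw_finite[OF tilings_bij] finite_fams by blast

lemma particles_slice:
  assumes "\<T> \<in> tilings" "t \<le> Tn" shows "particles \<T> (int t) \<subseteq> R t \<and> card (particles \<T> (int t)) = Nn"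
proof -
  have "(\<lambda>t\<in>{..Tn}. particles \<T> (int t)) \<in> fams Nn Tn Sn" using bij_betw_apply[OF tilings_bij assms(1)] by simp
  hence "(\<lambda>t\<in>{..Tn}. particles \<T> (int t)) \<in> PiE {..Tn} (\<lambda>t. {X. X \<subseteq> R t \<and> card X = Nn})"
    using Sn by (simp add: fams_eq)
  from PiE_mem[OF this, of t] show ?thesis using assms(2) by simp
qed

definition rel_weight :: "(real \<times> real) set set \<Rightarrow> real" where
  "rel_weight \<T> = (\<Prod>t\<le>Tn. \<Prod>y\<in>particles \<T> (int t). 1 / wt Sn t y)"

lemma rel_weight_pos: assumes "\<T> \<in> tilings" shows "0 < rel_weight \<T>"
  unfolding rel_weight_def
proof (intro prod_pos)
  fix t y assume "t \<in> {..Tn}" "y \<in> particles \<T> (int t)"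
  hence "y \<in> R t" using particles_slice[OF assms, of t] by auto
  thus "0 < 1 / wt Sn t y" using wt_pos[of y t Sn] by (simp add: rng_def)
qed

lemma tiling_prob:
  assumes "E \<subseteq> tilings"
  shows "measure (tiling_measure Nn (Tn - Sn) Sn q \<kappa>) E = (\<Sum>\<T>\<in>E. rel_weight \<T>) / (\<Sum>\<T>\<in>tilings. rel_weight \<T>)"
proof -
  obtain K where K: "K \<noteq> 0" "\<And>\<T>. \<T> \<in> tilings \<Longrightarrow> tiling_weight Sn q \<kappa> \<T> = K * rel_weight \<T>"
    using tiling_weight_form unfolding rel_weight_def by blast
  show ?thesis unfolding tiling_measure_def
    by (rule point_measure_ratio[OF finite_tilings assms K(2) _ K(1)]) (auto intro: less_imp_le[OF rel_weight_pos])
qed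

lemma slice_Wt_pos: "y \<in> R t \<Longrightarrow> 0 < Wt Sn t y" using Wt_pos[of "int Sn"] Sn by simp

lemma slice_card: assumes "t \<le> Tn" shows "Nn \<le> card (R t)"
  using assms Sn by (simp add: rng_def)

lemma slice_sum_rel_weight:
  assumes t: "t \<le> Tn"
  shows "\<exists>K. \<forall>f. (\<Sum>\<T>\<in>tilings. rel_weight \<T> * f (particles \<T> (int t)))
     = K * (\<Sum>X | X \<subseteq> R t \<and> card X = Nn. (slater (\<lambda>j x. sg Sn t x ^ j) X)\<^sup>2 * (\<Prod>x\<in>X. Wt Sn t x) * f X)"
proof -
  obtain K where K: "\<And>X. X \<subseteq> R t \<and> card X = Nn \<Longrightarrow> (\<Sum>F | F \<in> fams Nn Tn Sn \<and> F t = X. \<Prod>i\<le>Tn. \<Prod>y\<in>F i. 1 / wt Sn i y)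
      = K * ((slater (\<lambda>j x. sg Sn t x ^ j) X)\<^sup>2 * (\<Prod>x\<in>X. Wt Sn t x))"
    using slice_law[OF t] by blast
  define C where "C = {X. X \<subseteq> R t \<and> card X = Nn}"
  have finC: "finite C" unfolding C_def by (rule finite_subset[of _ "Pow (R t)"]) (auto simp: rng_def)
  define \<Phi> where "\<Phi> = (\<lambda>\<T>. \<lambda>t\<in>{..Tn}. particles \<T> (int t))"
  have "(\<Sum>\<T>\<in>tilings. rel_weight \<T> * f (particles \<T> (int t)))
     = K * (\<Sum>X\<in>C. (slater (\<lambda>j x. sg Sn t x ^ j) X)\<^sup>2 * (\<Prod>x\<in>X. Wt Sn t x) * f X)" for f
  proof -
    have "(\<Sum>\<T>\<in>tilings. rel_weight \<T> * f (particles \<T> (int t)))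
       = (\<Sum>\<T>\<in>tilings. (\<Prod>i\<le>Tn. \<Prod>y\<in>\<Phi> \<T> i. 1 / wt Sn i y) * f (\<Phi> \<T> t))"
      using t by (intro sum.cong refl) (simp add: rel_weight_def \<Phi>_def)
    also have "\<dots> = (\<Sum>F\<in>fams Nn Tn Sn. (\<Prod>i\<le>Tn. \<Prod>y\<in>F i. 1 / wt Sn i y) * f (F t))"
      unfolding \<Phi>_def by (rule sum.reindex_bij_betw[OF tilings_bij])
    also have "\<dots> = (\<Sum>X\<in>C. \<Sum>F | F \<in> fams Nn Tn Sn \<and> F t = X. (\<Prod>i\<le>Tn. \<Prod>y\<in>F i. 1 / wt Sn i y) * f (F t))"
    proof (rule sum.group[symmetric, OF finite_fams finC])
      show "(\<lambda>F. F t) ` fams Nn Tn Sn \<subseteq> C"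
        using t Sn by (auto simp: C_def fams_eq PiE_iff)
    qed
    also have "\<dots> = (\<Sum>X\<in>C. K * ((slater (\<lambda>j x. sg Sn t x ^ j) X)\<^sup>2 * (\<Prod>x\<in>X. Wt Sn t x) * f X))"
    proof (rule sum.cong[OF refl])
      fix X assume "X \<in> C"
      hence X: "X \<subseteq> R t \<and> card X = Nn" by (simp add: C_def)
      have "(\<Sum>F | F \<in> fams Nn Tn Sn \<and> F t = X. (\<Prod>i\<le>Tn. \<Prod>y\<in>F i. 1 / wt Sn i y) * f (F t))
         = (\<Sum>F | F \<in> fams Nn Tn Sn \<and> F t = X. \<Prod>i\<le>Tn. \<Prod>y\<in>F i. 1 / wt Sn i y) * f X"
        unfolding sum_distrib_right by (intro sum.cong) auto
      thus "(\<Sum>F | F \<in> fams Nn Tn Sn \<and> F t = X. (\<Prod>i\<le>Tn. \<Prod>y\<in>F i. 1 / wt Sn i y) * f (F t))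
         = K * ((slater (\<lambda>j x. sg Sn t x ^ j) X)\<^sup>2 * (\<Prod>x\<in>X. Wt Sn t x) * f X)"
        unfolding K[OF X] by (simp only: mult.assoc)
    qed
    finally show ?thesis unfolding sum_distrib_left .
  qed
  thus ?thesis unfolding C_def by blast
qed

text \<open>By \<open>slater_poly\<close> the orthonormal polynomials and the powers of
  \<open>sg\<close> have the same squared determinant up to the factor \<open>c\<^sup>2\<close>, so
  the slice is a projection ensemble. Its variance is at most its mean, and the mean is at most the
  number \<open>Nn\<close> of particles.\<close>

lemma slice_chebyshev:
  fixes P :: "nat \<Rightarrow> real poly" and B :: "int set"
  assumes t: "t \<le> Tn" and deg: "\<And>i. i < Nn \<Longrightarrow> degree (P i) = i"
    and orth: "\<And>i j. i < Nn \<Longrightarrow> j < Nn \<Longrightarrow> (\<Sum>y\<in>R t. poly (P i) (sg Sn t y) * poly (P j) (sg Sn t y) * Wt Sn t y) = of_bool (i = j)"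
    and d: "0 < d"
  defines "m \<equiv> (\<Sum>i<Nn. \<Sum>y\<in>R t \<inter> B. poly (P i) (sg Sn t y) ^ 2 * Wt Sn t y)"
  shows "measure (tiling_measure Nn (Tn - Sn) Sn q \<kappa>) {\<T> \<in> tilings. \<bar>real (card (particles \<T> (int t) \<inter> B)) - m\<bar> > d} \<le> real Nn / d\<^sup>2"
proof -
  define p where "p = (\<lambda>j x. poly (P j) (sg Sn t x))"
  define C where "C = {X. X \<subseteq> R t \<and> card X = Nn}"
  define M where "M = (\<lambda>f. \<Sum>X\<in>C. (slater p X)\<^sup>2 * (\<Prod>x\<in>X. Wt Sn t x) * f X)"
  have finR: "finite (R t)" by (simp add: rng_def)
  have finC: "finite C" unfolding C_def by (rule finite_subset[of _ "Pow (R t)"]) (auto simp: rng_def)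
  have M: "M (\<lambda>_. 1) = 1" "M (\<lambda>X. real (card (X \<inter> B))) = m" "M (\<lambda>X. (real (card (X \<inter> B)))\<^sup>2) \<le> m\<^sup>2 + m"
    unfolding M_def C_def m_def p_def
    by (rule projection_ensemble_moments(1)[OF finR orth] projection_ensemble_moments(2)[OF finR orth] projection_ensemble_moments(3)[OF finR orth]; assumption)+
  have M_add: "M (\<lambda>X. f X + g X) = M f + M g" "M (\<lambda>X. c * f X) = c * M f" for f g c
    unfolding M_def by (simp add: distrib_left sum.distrib) (simp add: sum_distrib_left mult_ac)
  have M_mono: "M f \<le> M g" if "\<And>X. X \<in> C \<Longrightarrow> f X \<le> g X" for f g
    unfolding M_def
  proof (intro sum_mono mult_left_mono that)
    fix X assume "X \<in> C"
    thus "0 \<le> (slater p X)\<^sup>2 * (\<Prod>x\<in>X. Wt Sn t x)"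
      by (intro mult_nonneg_nonneg prod_nonneg) (auto simp: C_def intro!: less_imp_le[OF slice_Wt_pos])
  qed
  have m_le: "m \<le> real Nn"
  proof -
    have "M (\<lambda>X. real (card (X \<inter> B))) \<le> M (\<lambda>X. real Nn * 1)"
    proof (rule M_mono)
      fix X assume "X \<in> C"
      hence "finite X" "card X = Nn" using finite_subset[OF _ finR] by (auto simp: C_def)
      thus "real (card (X \<inter> B)) \<le> real Nn * 1" using card_mono[of X "X \<inter> B"] by simp
    qed
    thus ?thesis unfolding M_add(2) M by simp
  qed
  define c where "c = mdet Nn (\<lambda>k j. coeff (P j) k)"
  have sl: "slater p X = slater (\<lambda>j x. sg Sn t x ^ j) X * c" if "X \<in> C" for X
  proof -
    have X: "finite X" "card X = Nn" using that finite_subset[OF _ finR] by (auto simp: C_def)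
    show ?thesis unfolding p_def c_def using slater_poly[OF X(1), of P "sg Sn t"] X(2) deg by simp
  qed
  have "c \<noteq> 0"
  proof
    assume "c = 0"
    hence "M (\<lambda>_. 1) = 0" unfolding M_def using sl by (intro sum.neutral) auto
    thus False using M(1) by simp
  qed
  obtain K where K: "\<And>f. (\<Sum>\<T>\<in>tilings. rel_weight \<T> * f (particles \<T> (int t)))
     = K * (\<Sum>X\<in>C. (slater (\<lambda>j x. sg Sn t x ^ j) X)\<^sup>2 * (\<Prod>x\<in>X. Wt Sn t x) * f X)"
    using slice_sum_rel_weight[OF t] unfolding C_def by blast
  have KM: "(\<Sum>\<T>\<in>tilings. rel_weight \<T> * f (particles \<T> (int t))) = K / c\<^sup>2 * M f" for f
  proof -
    have "M f = c\<^sup>2 * (\<Sum>X\<in>C. (slater (\<lambda>j x. sg Sn t x ^ j) X)\<^sup>2 * (\<Prod>x\<in>X. Wt Sn t x) * f X)"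
      unfolding M_def sum_distrib_left by (intro sum.cong refl) (simp add: sl power_mult_distrib mult_ac)
    thus ?thesis unfolding K using \<open>c \<noteq> 0\<close> by simp
  qed
  define E where "E = {\<T> \<in> tilings. \<bar>real (card (particles \<T> (int t) \<inter> B)) - m\<bar> > d}"
  define g where "g = (\<lambda>X. of_bool (\<bar>real (card (X \<inter> B)) - m\<bar> > d) :: real)"
  have E: "E \<subseteq> tilings" by (auto simp: E_def)
  have Z: "(\<Sum>\<T>\<in>tilings. rel_weight \<T>) = K / c\<^sup>2" using KM[of "\<lambda>_. 1"] M(1) by simp
  have "(\<Sum>\<T>\<in>E. rel_weight \<T>) = (\<Sum>\<T>\<in>tilings. rel_weight \<T> * g (particles \<T> (int t)))"
    by (intro sum.mono_neutral_cong_left finite_tilings) (auto simp: E_def g_def)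
  hence prob: "measure (tiling_measure Nn (Tn - Sn) Sn q \<kappa>) E = K / c\<^sup>2 * M g / (K / c\<^sup>2)"
    unfolding tiling_prob[OF E] Z KM by simp
  have "M g \<le> M (\<lambda>X. 1 / d\<^sup>2 * ((real (card (X \<inter> B)))\<^sup>2 + ((- 2 * m) * real (card (X \<inter> B)) + m\<^sup>2 * 1)))"
  proof (rule M_mono)
    fix X
    have eq: "(real (card (X \<inter> B)))\<^sup>2 + ((- 2 * m) * real (card (X \<inter> B)) + m\<^sup>2 * 1) = (real (card (X \<inter> B)) - m)\<^sup>2"
      by (simp add: power2_eq_square algebra_simps)
    show "g X \<le> 1 / d\<^sup>2 * ((real (card (X \<inter> B)))\<^sup>2 + ((- 2 * m) * real (card (X \<inter> B)) + m\<^sup>2 * 1))"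
    proof (cases "\<bar>real (card (X \<inter> B)) - m\<bar> > d")
      case True
      hence "d\<^sup>2 \<le> \<bar>real (card (X \<inter> B)) - m\<bar>\<^sup>2" using d by (intro power_mono) auto
      thus ?thesis unfolding eq using d True by (simp add: g_def)
    next
      case False thus ?thesis unfolding eq g_def by simp
    qed
  qed
  also have "\<dots> = 1 / d\<^sup>2 * (M (\<lambda>X. (real (card (X \<inter> B)))\<^sup>2) + ((- 2 * m) * m + m\<^sup>2 * 1))"
    unfolding M_add M ..
  also have "\<dots> \<le> 1 / d\<^sup>2 * real Nn"
  proof (rule mult_left_mono)
    show "M (\<lambda>X. (real (card (X \<inter> B)))\<^sup>2) + ((- 2 * m) * m + m\<^sup>2 * 1) \<le> real Nn"
      using M(3) m_le by (simp add: power2_eq_square)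
  qed simp
  finally have "M g \<le> real Nn / d\<^sup>2" by simp
  \<comment> \<open>For \<open>K = 0\<close> the quotient is 0 by the convention on division, and
    the bound holds as well.\<close>
  moreover have "K / c\<^sup>2 * M g / (K / c\<^sup>2) = (if K = 0 then 0 else M g)" using \<open>c \<noteq> 0\<close> by simp
  ultimately show ?thesis using prob unfolding E_def by (auto split: if_splits)
qed

text \<open>The interface to the asymptotic analysis: eigenvectors as functions of the site, with
  completeness, normalisation and concentration, in which polynomials and \<open>sg\<close> no
  longer appear.\<close>

definition slice_basis :: "nat \<Rightarrow> (nat \<Rightarrow> int \<Rightarrow> real) \<Rightarrow> bool" where
  "slice_basis t P \<longleftrightarrow>
     (\<forall>k y. k < card (R t) \<longrightarrow> y \<in> R t \<longrightarrow> up Sn t y * (P k y - P k (y + 1)) + dn Sn t y * (P k y - P k (y - 1)) = ev Sn t k * P k y) \<and>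
     (\<forall>y z. y \<in> R t \<longrightarrow> z \<in> R t \<longrightarrow> (\<Sum>k<card (R t). P k y * P k z * Wt Sn t z) = of_bool (y = z)) \<and>
     (\<forall>k<card (R t). (\<Sum>y\<in>R t. P k y ^ 2 * Wt Sn t y) = 1) \<and>
     (\<forall>B d. d > 0 \<longrightarrow> measure (tiling_measure Nn (Tn - Sn) Sn q \<kappa>)
        {\<T> \<in> tilings. \<bar>real (card (particles \<T> (int t) \<inter> B)) - (\<Sum>i<Nn. \<Sum>y\<in>R t \<inter> B. P i y ^ 2 * Wt Sn t y)\<bar> > d} \<le> real Nn / d\<^sup>2)"

lemma slice_basis_exists:
  assumes "t \<le> Tn" shows "\<exists>P. slice_basis t P"
proof -
  have S: "0 < int Sn" "int Sn < int Tn" and t: "0 \<le> int t" "int t \<le> int Tn" using Sn assms by simp_all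
  show ?thesis
  proof (rule slice_spectrum[OF S t])
    fix P assume P: "\<And>n. n < card (R t) \<Longrightarrow> degree (P n) = n"
      "\<And>i j. i < card (R t) \<Longrightarrow> j < card (R t) \<Longrightarrow> (\<Sum>y\<in>R t. Wt Sn t y * poly (P i) (sg Sn t y) * poly (P j) (sg Sn t y)) = of_bool (i = j)"
      "\<And>n y. n < card (R t) \<Longrightarrow> y \<in> R t \<Longrightarrow> up Sn t y * (poly (P n) (sg Sn t y) - poly (P n) (sg Sn t (y + 1)))
        + dn Sn t y * (poly (P n) (sg Sn t y) - poly (P n) (sg Sn t (y - 1))) = ev Sn t n * poly (P n) (sg Sn t y)"
      "\<And>y z. y \<in> R t \<Longrightarrow> z \<in> R t \<Longrightarrow> (\<Sum>n<card (R t). poly (P n) (sg Sn t y) * poly (P n) (sg Sn t z) * Wt Sn t z) = of_bool (y = z)"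
    have orth: "(\<Sum>y\<in>R t. poly (P i) (sg Sn t y) * poly (P j) (sg Sn t y) * Wt Sn t y) = of_bool (i = j)"
      if "i < card (R t)" "j < card (R t)" for i j using P(2)[OF that] by (simp add: mult_ac)
    have "(\<Sum>y\<in>R t. poly (P k) (sg Sn t y) ^ 2 * Wt Sn t y) = 1" if "k < card (R t)" for k
      using orth[OF that that] by (simp add: power2_eq_square)
    moreover have "measure (tiling_measure Nn (Tn - Sn) Sn q \<kappa>)
        {\<T> \<in> tilings. \<bar>real (card (particles \<T> (int t) \<inter> B)) - (\<Sum>i<Nn. \<Sum>y\<in>R t \<inter> B. poly (P i) (sg Sn t y) ^ 2 * Wt Sn t y)\<bar> > d} \<le> real Nn / d\<^sup>2"
      if "d > 0" for B d
      using slice_card[OF assms] by (intro slice_chebyshev[OF assms P(1) orth that]) simp_all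
    ultimately have "slice_basis t (\<lambda>k y. poly (P k) (sg Sn t y))"
      unfolding slice_basis_def using P(3,4) by blast
    thus ?thesis by blast
  qed
qed

end

section \<open>Local eigenvalue counts of tridiagonal operators\<close>

text \<open>The entry at offset \<open>m\<close> of the \<open>j\<close>-th power of the Toeplitz
  operator with diagonal \<open>a + b\<close>, coefficient \<open>- a\<close> towards the next site
  and \<open>- b\<close> towards the previous one. Conjugation by powers of
  \<open>sqrt (a / b)\<close> makes this operator symmetric with the symbol in the integrand; the
  prefactor undoes the conjugation.\<close>

definition cmom :: "real \<Rightarrow> real \<Rightarrow> nat \<Rightarrow> int \<Rightarrow> real" where
  "cmom a b j m = sqrt (a / b) powi m * (1 / pi * integral {0..pi} (\<lambda>\<theta>. (a + b - 2 * sqrt (a * b) * cos \<theta>) ^ j * cos (of_int m * \<theta>)))"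

lemma cmom_0: "cmom a b 0 m = of_bool (m = 0)"
proof (cases "m = 0")
  case False
  have "((\<lambda>\<theta>. cos (of_int m * \<theta>)) has_integral (sin (of_int m * pi) / of_int m - sin (of_int m * 0) / of_int m)) {0..pi}"
    using False by (intro fundamental_theorem_of_calculus)
      (auto intro!: derivative_eq_intros simp flip: has_real_derivative_iff_has_vector_derivative)
  hence "integral {0..pi} (\<lambda>\<theta>. cos (of_int m * \<theta>)) = 0"
    by (simp add: integral_unique sin_times_pi_eq_0)
  thus ?thesis using False by (simp add: cmom_def)
qed (simp add: cmom_def)

lemma cmom_Suc:
  assumes ab: "a > 0" "b > 0"
  shows "cmom a b (Suc j) m = (a + b) * cmom a b j m - a * cmom a b j (m - 1) - b * cmom a b j (m + 1)"
proof -
  define o' where "o' = sqrt (a * b)"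
  define \<rho> where "\<rho> = sqrt (a / b)"
  define f where "f = (\<lambda>\<theta>. a + b - 2 * o' * cos \<theta>)"
  define J where "J = (\<lambda>m::int. integral {0..pi} (\<lambda>\<theta>. f \<theta> ^ j * cos (of_int m * \<theta>)))"
  have \<rho>0: "\<rho> \<noteq> 0" using ab by (simp add: \<rho>_def)
  have "o' * \<rho> = sqrt (a * b * (a / b))" by (simp only: o'_def \<rho>_def real_sqrt_mult)
  also have "a * b * (a / b) = a\<^sup>2" using ab by (simp add: power2_eq_square)
  finally have rel1: "o' * \<rho> = a" using ab by simp
  have "b * \<rho> = sqrt (b\<^sup>2 * (a / b))" by (subst real_sqrt_mult) (use ab in \<open>simp add: \<rho>_def\<close>)
  also have "b\<^sup>2 * (a / b) = a * b" using ab by (simp add: power2_eq_square)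
  finally have rel2: "b * \<rho> = o'" by (simp add: o'_def)
  have int: "(\<lambda>\<theta>. f \<theta> ^ j * cos (of_int m * \<theta>)) integrable_on {0..pi}" for m
    by (intro integrable_continuous_real continuous_intros) (auto simp: f_def intro!: continuous_intros)
  have "integral {0..pi} (\<lambda>\<theta>. f \<theta> ^ Suc j * cos (of_int m * \<theta>))
      = integral {0..pi} (\<lambda>\<theta>. (a + b) * (f \<theta> ^ j * cos (of_int m * \<theta>)) - o' * (f \<theta> ^ j * cos (of_int (m - 1) * \<theta>))
          - o' * (f \<theta> ^ j * cos (of_int (m + 1) * \<theta>)))"
  proof (rule arg_cong[of _ _ "integral {0..pi}"], rule ext)
    fix \<theta> :: real
    have "2 * cos \<theta> * cos (of_int m * \<theta>) = cos (of_int (m - 1) * \<theta>) + cos (of_int (m + 1) * \<theta>)"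
      by (simp add: algebra_simps cos_add cos_diff)
    note this
    moreover have "f \<theta> ^ Suc j * cos (of_int m * \<theta>) = (a + b) * (f \<theta> ^ j * cos (of_int m * \<theta>)) - o' * (f \<theta> ^ j * (2 * cos \<theta> * cos (of_int m * \<theta>)))"
      unfolding power_Suc by (subst (1) f_def) (simp only: left_diff_distrib distrib_right mult.assoc mult.left_commute)
    ultimately show "f \<theta> ^ Suc j * cos (of_int m * \<theta>) = (a + b) * (f \<theta> ^ j * cos (of_int m * \<theta>)) - o' * (f \<theta> ^ j * cos (of_int (m - 1) * \<theta>))
          - o' * (f \<theta> ^ j * cos (of_int (m + 1) * \<theta>))"
      by (simp only: distrib_left diff_diff_add)
  qed
  also have "\<dots> = (a + b) * J m - o' * J (m - 1) - o' * J (m + 1)"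
    unfolding J_def by (intro integral_unique has_integral_diff has_integral_mult_right integrable_integral int)
  finally have "cmom a b (Suc j) m = \<rho> powi m * (1 / pi * ((a + b) * J m - o' * J (m - 1) - o' * J (m + 1)))"
    by (simp add: cmom_def f_def o'_def \<rho>_def)
  moreover have "cmom a b j m' = \<rho> powi m' * (1 / pi * J m')" for m'
    by (simp add: cmom_def f_def o'_def \<rho>_def J_def)
  moreover have "a * (\<rho> powi (m - 1) * c) = \<rho> powi m * (o' * c)" for c
  proof -
    have "\<rho> powi m = \<rho> * \<rho> powi (m - 1)" using power_int_add[of \<rho> 1 "m - 1"] \<rho>0 by simp
    thus ?thesis by (simp add: rel1[symmetric])
  qed
  moreover have "b * (\<rho> powi (m + 1) * c) = \<rho> powi m * (o' * c)" for c
  proof -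
    have "\<rho> powi (m + 1) = \<rho> powi m * \<rho>" using power_int_add[of \<rho> m 1] \<rho>0 by simp
    thus ?thesis by (simp add: rel2[symmetric])
  qed
  ultimately show ?thesis
    by (simp only: right_diff_distrib) (simp add: mult.left_commute)
qed

text \<open>A sum over sites becomes the integral of a function that is constant on cells of length
  \<open>e\<close>, to which dominated convergence applies.\<close>

lemma floor_sum_integral:
  fixes f :: "int \<Rightarrow> real"
  assumes "finite A" "e > 0"
  shows "integrable lborel (\<lambda>r. \<Sum>y\<in>A. f y * indicator {e * of_int y..<e * (of_int y + 1)} r)"
    "(\<integral>r. (\<Sum>y\<in>A. f y * indicator {e * of_int y..<e * (of_int y + 1)} r) \<partial>lborel) = e * (\<Sum>y\<in>A. f y)"
proof -
  have e: "e * of_int y \<le> e * (of_int y + 1)" for y using assms by simp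
  have i: "integrable lborel (\<lambda>r. f y * indicator {e * of_int y..<e * (of_int y + 1)} r)" for y
    using e by (intro integrable_mult_right) auto
  thus "integrable lborel (\<lambda>r. \<Sum>y\<in>A. f y * indicator {e * of_int y..<e * (of_int y + 1)} r)" by simp
  show "(\<integral>r. (\<Sum>y\<in>A. f y * indicator {e * of_int y..<e * (of_int y + 1)} r) \<partial>lborel) = e * (\<Sum>y\<in>A. f y)"
    using i e by (subst Bochner_Integration.integral_sum) (auto simp: sum_distrib_left algebra_simps)
qed

lemma floor_sum_eval:
  fixes f :: "int \<Rightarrow> real"
  assumes "finite A" "e > 0"
  shows "(\<Sum>y\<in>A. f y * indicator {e * of_int y..<e * (of_int y + 1)} r) = (if \<lfloor>r / e\<rfloor> \<in> A then f \<lfloor>r / e\<rfloor> else 0)"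
proof -
  have "r \<in> {e * of_int y..<e * (of_int y + 1)} \<longleftrightarrow> y = \<lfloor>r / e\<rfloor>" for y
    using assms(2) by (auto simp: eq_commute[of y] floor_eq_iff field_simps)
  hence "(\<Sum>y\<in>A. f y * indicator {e * of_int y..<e * (of_int y + 1)} r) = (\<Sum>y\<in>A. if y = \<lfloor>r / e\<rfloor> then f y else 0)"
    by (intro sum.cong refl) (auto simp: indicator_def)
  thus ?thesis using assms(1) by simp
qed

text \<open>The cosine decreases on the interval, so the condition selects an initial segment of
  angles. The clamped values describe the cases where it selects none or all of them.\<close>

lemma symbol_step_integral:
  assumes "s > 0" shows "((\<lambda>\<theta>. of_bool (d - 2 * s * cos \<theta> \<le> l)) has_integral arccos_clamped ((d - l) / (2 * s))) {0..pi}"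
proof -
  define u where "u = (d - l) / (2 * s)"
  have iff: "d - 2 * s * cos \<theta> \<le> l \<longleftrightarrow> u \<le> cos \<theta>" for \<theta> using assms by (simp add: u_def field_simps)
  define \<theta>0 where "\<theta>0 = arccos_clamped u"
  have \<theta>0: "0 \<le> \<theta>0" "\<theta>0 \<le> pi" by (auto simp: \<theta>0_def arccos_clamped_def arccos_lbound arccos_ubound)
  have "((\<lambda>\<theta>. 1 :: real) has_integral \<theta>0) {0..\<theta>0}" using has_integral_const_real[of "1::real" 0 \<theta>0] \<theta>0 by simp
  hence "((\<lambda>\<theta>. if \<theta> \<in> {0..\<theta>0} then 1 else 0 :: real) has_integral \<theta>0) {0..pi}"
    using \<theta>0 by (subst has_integral_restrict) auto
  thus ?thesis unfolding u_def[symmetric] \<theta>0_def[symmetric]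
  \<comment> \<open>If the level lies below the whole symbol, the two integrands differ exactly at
    the angle 0.\<close>
  proof (rule has_integral_spike[of "{0}", rotated 2])
    fix \<theta> :: real assume \<theta>: "\<theta> \<in> {0..pi} - {0}"
    have "u \<le> cos \<theta> \<longleftrightarrow> \<theta> \<le> \<theta>0"
    proof -
      consider "u > 1" | "u < - 1" | "- 1 \<le> u" "u \<le> 1" by linarith
      thus ?thesis
      proof cases
        case 1
        have "\<not> u \<le> cos \<theta>" using cos_le_one[of \<theta>] 1 by linarith
        thus ?thesis using 1 \<theta> by (simp add: \<theta>0_def arccos_clamped_def)
      next
        case 2
        have "u \<le> cos \<theta>" using cos_ge_minus_one[of \<theta>] 2 by linarith
        thus ?thesis using 2 \<theta> by (simp add: \<theta>0_def arccos_clamped_def)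
      next
        case 3
        hence "\<theta>0 = arccos u" by (simp add: \<theta>0_def arccos_clamped_def)
        moreover have "cos (arccos u) = u" using 3 by simp
        ultimately show ?thesis using cos_mono_le_eq[of \<theta>0 \<theta>] \<theta> \<theta>0 by auto
      qed
    qed
    thus "of_bool (d - 2 * s * cos \<theta> \<le> l) = (if \<theta> \<in> {0..\<theta>0} then 1 else 0 :: real)" using \<theta> by (simp add: iff)
  qed simp
qed

lemma window_count:
  assumes "e > 0" "\<delta> > 0"
  shows "e * real (card {k. k < m \<and> \<bar>e * real k - c\<bar> \<le> \<delta>}) \<le> 2 * \<delta> + e"
proof -
  define u v where "u = \<lceil>(c - \<delta>) / e\<rceil>" and "v = \<lfloor>(c + \<delta>) / e\<rfloor>"
  have "int ` {k. k < m \<and> \<bar>e * real k - c\<bar> \<le> \<delta>} \<subseteq> {u..v}"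
  proof clarify
    fix k assume "\<bar>e * real k - c\<bar> \<le> \<delta>"
    hence "(c - \<delta>) / e \<le> real k" "real k \<le> (c + \<delta>) / e" using assms by (auto simp: field_simps abs_le_iff)
    thus "int k \<in> {u..v}" by (auto simp: u_def v_def ceiling_le_iff le_floor_iff)
  qed
  hence "card (int ` {k. k < m \<and> \<bar>e * real k - c\<bar> \<le> \<delta>}) \<le> card {u..v}" by (rule card_mono[rotated]) simp
  hence "real (card {k. k < m \<and> \<bar>e * real k - c\<bar> \<le> \<delta>}) \<le> real (nat (v - u + 1))" by (simp add: card_image add.commute)
  also have "\<dots> \<le> 2 * \<delta> / e + 1"
  proof -
    have "of_int v \<le> (c + \<delta>) / e" "of_int u \<ge> (c - \<delta>) / e" by (simp_all add: u_def v_def)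
    moreover have "(c + \<delta>) / e - (c - \<delta>) / e = 2 * \<delta> / e" by (simp add: diff_divide_distrib[symmetric])
    ultimately have "of_int (v - u + 1) \<le> 2 * \<delta> / e + 1" by simp
    moreover have "0 \<le> 2 * \<delta> / e + 1" using assms by simp
    ultimately show ?thesis by (cases "v - u + 1 \<ge> 0") auto
  qed
  finally have "e * real (card {k. k < m \<and> \<bar>e * real k - c\<bar> \<le> \<delta>}) \<le> e * (2 * \<delta> / e + 1)"
    using assms by (intro mult_left_mono) auto
  thus ?thesis using assms by (simp add: distrib_left)
qed

lemma poly_approximation:
  fixes f :: "real \<Rightarrow> real"
  assumes "continuous_on {0..\<Lambda>} f" "\<delta> > 0"
  obtains p where "\<And>x. 0 \<le> x \<Longrightarrow> x \<le> \<Lambda> \<Longrightarrow> \<bar>poly p x - f x\<bar> < \<delta>"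
proof -
  obtain g where g: "real_polynomial_function g" "\<And>x. x \<in> {0..\<Lambda>} \<Longrightarrow> \<bar>f x - g x\<bar> < \<delta>"
    using Stone_Weierstrass_real_polynomial_function[of "{0..\<Lambda>}" f \<delta>] assms by auto
  obtain c n where c: "g = (\<lambda>x. \<Sum>i\<le>n. c i * x ^ i)" using g(1) unfolding real_polynomial_function_iff_sum by blast
  show ?thesis
  proof (rule that[of "\<Sum>i\<le>n. Polynomial.monom (c i) i"])
    fix x assume "0 \<le> x" "x \<le> \<Lambda>"
    thus "\<bar>poly (\<Sum>i\<le>n. Polynomial.monom (c i) i) x - f x\<bar> < \<delta>"
      using g(2)[of x] by (simp add: c poly_sum poly_monom abs_minus_commute)
  qed
qed

lemma integrable_const_Ioo: "(L::real) \<le> U \<Longrightarrow> integrable lborel (\<lambda>r. c * indicator {L<..<U} r :: real)"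
  by (intro integrable_mult_right integrable_real_indicator) (simp_all add: emeasure_lborel_Ioo)

lemma integral_const_Ioo:
  assumes "L \<le> U" shows "(\<integral>r. c * indicator {L<..<U} r \<partial>lborel) = c * (U - L :: real)"
proof -
  have "(\<integral>r. c * indicator {L<..<U} r \<partial>lborel) = c * measure lborel {L<..<U}"
    by simp
  thus ?thesis using assms by (simp add: measure_def emeasure_lborel_Ioo)
qed

lemma integral_diff_bound:
  fixes f g h k :: "real \<Rightarrow> real"
  assumes "integrable M f" "integrable M g" "integrable M h" "integrable M k"
    and b: "\<And>r. \<bar>f r - g r\<bar> \<le> h r + k r"
  shows "\<bar>integral\<^sup>L M f - integral\<^sup>L M g\<bar> \<le> integral\<^sup>L M h + integral\<^sup>L M k"
proof -
  have "\<bar>integral\<^sup>L M (\<lambda>r. f r - g r)\<bar> \<le> (\<integral>r. \<bar>f r - g r\<bar> \<partial>M)" by (rule integral_abs_bound)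
  moreover have "(\<integral>r. \<bar>f r - g r\<bar> \<partial>M) \<le> (\<integral>r. h r + k r \<partial>M)"
    using assms by (intro integral_mono integrable_abs Bochner_Integration.integrable_diff Bochner_Integration.integrable_add)
  ultimately show ?thesis using assms by (simp add: Bochner_Integration.integral_diff Bochner_Integration.integral_add)
qed

lemma floor_scaled_at_right: "((\<lambda>\<epsilon>::real. \<epsilon> * of_int \<lfloor>x / \<epsilon>\<rfloor>) \<longlongrightarrow> x) (at_right 0)"
proof -
  have "((\<lambda>\<epsilon>::real. \<epsilon> * of_int \<lfloor>x / \<epsilon>\<rfloor> - x) \<longlongrightarrow> 0) (at_right 0)"
  proof (rule Lim_null_comparison)
    show "((\<lambda>\<epsilon>::real. \<epsilon>) \<longlongrightarrow> 0) (at_right 0)" by (auto intro!: tendsto_eq_intros)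
    show "eventually (\<lambda>\<epsilon>. norm (\<epsilon> * of_int \<lfloor>x / \<epsilon>\<rfloor> - x) \<le> \<epsilon>) (at_right 0)"
      using eventually_at_right_less[of "0::real"]
    proof eventually_elim
      case (elim \<epsilon>)
      have f: "of_int \<lfloor>x / \<epsilon>\<rfloor> \<le> x / \<epsilon>" "x / \<epsilon> < of_int \<lfloor>x / \<epsilon>\<rfloor> + 1" by linarith+
      have "of_int \<lfloor>x / \<epsilon>\<rfloor> * \<epsilon> \<le> x" "x < (of_int \<lfloor>x / \<epsilon>\<rfloor> + 1) * \<epsilon>"
        using f(1)[unfolded pos_le_divide_eq[OF elim]] f(2)[unfolded pos_divide_less_eq[OF elim]] .
      thus ?case by (simp add: algebra_simps)
    qed
  qed
  thus ?thesis by (simp add: LIM_zero_iff)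
qed

lemma scaled_floor_lim:
  fixes eps :: "nat \<Rightarrow> real"
  assumes pos: "\<And>n. eps n > 0" and lim: "eps \<longlonglongrightarrow> 0"
  shows "(\<lambda>n. eps n * of_int (\<lfloor>r / eps n\<rfloor> + i)) \<longlonglongrightarrow> r"
proof -
  have "filterlim eps (at_right 0) sequentially" using pos by (intro tendsto_imp_filterlim_at_right lim) auto
  from tendsto_add[OF filterlim_compose[OF floor_scaled_at_right[of r] this] tendsto_mult_right[OF lim, of "of_int i"]]
  show ?thesis by (simp add: distrib_left)
qed

text \<open>Tridiagonal operators on about \<open>(U - L) / eps n\<close> sites whose coefficients
  converge at every interior macroscopic position, for each fixed microscopic shift
  \<open>i\<close>. The constant \<open>\<Lambda>\<close> bounds the eigenvalues as well as the
  symbol, so polynomial approximation takes place on one compact interval.\<close>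

locale weyl =
  fixes eps :: "nat \<Rightarrow> real" and lo hi :: "nat \<Rightarrow> int" and up dn W :: "nat \<Rightarrow> int \<Rightarrow> real"
    and P :: "nat \<Rightarrow> nat \<Rightarrow> int \<Rightarrow> real" and lam :: "nat \<Rightarrow> nat \<Rightarrow> real" and L U \<Lambda> :: real and a b :: "real \<Rightarrow> real"
  assumes eps_pos: "\<And>n. eps n > 0" and eps_lim: "eps \<longlonglongrightarrow> 0"
    and lo_lim: "(\<lambda>n. eps n * of_int (lo n)) \<longlonglongrightarrow> L" and hi_lim: "(\<lambda>n. eps n * of_int (hi n)) \<longlonglongrightarrow> U"
    and LU: "L < U"
    and W_pos: "\<And>n y. y \<in> {lo n..hi n} \<Longrightarrow> W n y > 0"
    and eig: "\<And>n k y. k < card {lo n..hi n} \<Longrightarrow> y \<in> {lo n..hi n} \<Longrightarrow>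
        up n y * (P n k y - P n k (y + 1)) + dn n y * (P n k y - P n k (y - 1)) = lam n k * P n k y"
    and compl: "\<And>n y z. y \<in> {lo n..hi n} \<Longrightarrow> z \<in> {lo n..hi n} \<Longrightarrow>
        (\<Sum>k<card {lo n..hi n}. P n k y * P n k z * W n z) = of_bool (y = z)"
    and norm1: "\<And>n k. k < card {lo n..hi n} \<Longrightarrow> (\<Sum>y\<in>{lo n..hi n}. P n k y ^ 2 * W n y) = 1"
    and lam_bounds: "\<And>n k. k < card {lo n..hi n} \<Longrightarrow> 0 \<le> lam n k \<and> lam n k \<le> \<Lambda>"
    and up_lim: "\<And>r i. L < r \<Longrightarrow> r < U \<Longrightarrow> (\<lambda>n. up n (\<lfloor>r / eps n\<rfloor> + i)) \<longlonglongrightarrow> a r"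
    and dn_lim: "\<And>r i. L < r \<Longrightarrow> r < U \<Longrightarrow> (\<lambda>n. dn n (\<lfloor>r / eps n\<rfloor> + i)) \<longlonglongrightarrow> b r"
    and ab: "\<And>r. L < r \<Longrightarrow> r < U \<Longrightarrow> a r > 0 \<and> b r > 0 \<and> 2 * (a r + b r) \<le> \<Lambda>"
begin

abbreviation Om :: "nat \<Rightarrow> int set" where "Om n \<equiv> {lo n..hi n}"

lemmas floor_lim = scaled_floor_lim[OF eps_pos eps_lim]

lemma less_eventually:
  fixes z w :: "nat \<Rightarrow> int"
  assumes "(\<lambda>n. eps n * of_int (z n)) \<longlonglongrightarrow> p" "(\<lambda>n. eps n * of_int (w n)) \<longlonglongrightarrow> p'" "p < p'"
  shows "eventually (\<lambda>n. z n < w n) sequentially"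
proof -
  have "(\<lambda>n. eps n * of_int (w n) - eps n * of_int (z n)) \<longlonglongrightarrow> p' - p" by (intro tendsto_intros assms)
  hence "eventually (\<lambda>n. eps n * of_int (w n) - eps n * of_int (z n) > 0) sequentially"
    using assms(3) by (intro order_tendstoD(1)) auto
  thus ?thesis
  proof eventually_elim
    case (elim n)
    hence "eps n * of_int (z n) < eps n * of_int (w n)" by simp
    thus ?case using eps_pos[of n] by simp
  qed
qed

lemma in_Om_eventually: "L < r \<Longrightarrow> r < U \<Longrightarrow> eventually (\<lambda>n. \<lfloor>r / eps n\<rfloor> + i \<in> Om n) sequentially"
  using less_eventually[OF lo_lim floor_lim[of r i]] less_eventually[OF floor_lim[of r i] hi_lim]
  by (auto elim: eventually_elim2)

text \<open>The entry at \<open>(y, z)\<close> of the \<open>j\<close>-th power of the operator,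
  expanded in eigenvectors.\<close>

definition KK :: "nat \<Rightarrow> nat \<Rightarrow> int \<Rightarrow> int \<Rightarrow> real" where
  "KK n j y z = (\<Sum>k<card (Om n). lam n k ^ j * P n k y * P n k z * W n z)"

lemma KK_Suc:
  assumes "y \<in> Om n"
  shows "KK n (Suc j) y z = (up n y + dn n y) * KK n j y z - up n y * KK n j (y + 1) z - dn n y * KK n j (y - 1) z"
proof -
  have "lam n k ^ Suc j * P n k y * P n k z * W n z = (up n y + dn n y) * (lam n k ^ j * P n k y * P n k z * W n z)
     - up n y * (lam n k ^ j * P n k (y + 1) * P n k z * W n z) - dn n y * (lam n k ^ j * P n k (y - 1) * P n k z * W n z)"
    if "k < card (Om n)" for k
  proof -
    have "lam n k ^ Suc j * P n k y * P n k z * W n z = lam n k ^ j * (lam n k * P n k y) * P n k z * W n z" by simp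
    also have "\<dots> = lam n k ^ j * (up n y * (P n k y - P n k (y + 1)) + dn n y * (P n k y - P n k (y - 1))) * P n k z * W n z"
      by (simp only: eig[OF that assms])
    finally show ?thesis by (simp add: algebra_simps)
  qed
  hence "KK n (Suc j) y z = (\<Sum>k<card (Om n). (up n y + dn n y) * (lam n k ^ j * P n k y * P n k z * W n z)
     - up n y * (lam n k ^ j * P n k (y + 1) * P n k z * W n z) - dn n y * (lam n k ^ j * P n k (y - 1) * P n k z * W n z))"
    unfolding KK_def by (intro sum.cong) auto
  thus ?thesis by (simp only: KK_def sum_subtractf sum_distrib_left)
qed

text \<open>A power of the operator sees only a bounded neighbourhood of the position, where the
  coefficients are asymptotically constant. The recursion moves the first argument by one, hence the
  induction over all \<open>i\<close> and \<open>m\<close> at once; completeness starts it.\<close>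

lemma KK_lim:
  assumes r: "L < r" "r < U"
  shows "(\<lambda>n. KK n j (\<lfloor>r / eps n\<rfloor> + i) (\<lfloor>r / eps n\<rfloor> + i + m)) \<longlonglongrightarrow> cmom (a r) (b r) j m"
proof (induction j arbitrary: i m)
  case 0
  have "eventually (\<lambda>n. KK n 0 (\<lfloor>r / eps n\<rfloor> + i) (\<lfloor>r / eps n\<rfloor> + i + m) = of_bool (m = 0)) sequentially"
    using in_Om_eventually[OF r, of i] in_Om_eventually[OF r, of "i + m"]
  proof eventually_elim
    case (elim n)
    thus ?case using compl[of "\<lfloor>r / eps n\<rfloor> + i" n "\<lfloor>r / eps n\<rfloor> + i + m"] by (simp add: KK_def add.assoc)
  qed
  thus ?case unfolding cmom_0 by (rule tendsto_eventually)
next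
  case (Suc j)
  let ?y = "\<lambda>n. \<lfloor>r / eps n\<rfloor> + i"
  have "(\<lambda>n. (up n (?y n) + dn n (?y n)) * KK n j (?y n) (?y n + m) - up n (?y n) * KK n j (?y n + 1) (?y n + m) - dn n (?y n) * KK n j (?y n - 1) (?y n + m))
     \<longlonglongrightarrow> (a r + b r) * cmom (a r) (b r) j m - a r * cmom (a r) (b r) j (m - 1) - b r * cmom (a r) (b r) j (m + 1)"
    using Suc[of i m] Suc[of "i + 1" "m - 1"] Suc[of "i - 1" "m + 1"] up_lim[OF r, of i] dn_lim[OF r, of i]
    by (intro tendsto_intros) (simp_all add: algebra_simps)
  also have "(a r + b r) * cmom (a r) (b r) j m - a r * cmom (a r) (b r) j (m - 1) - b r * cmom (a r) (b r) j (m + 1) = cmom (a r) (b r) (Suc j) m"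
    using ab[OF r] by (intro cmom_Suc[symmetric]) auto
  finally show ?case
  proof (rule Lim_transform_eventually)
    show "eventually (\<lambda>n. (up n (?y n) + dn n (?y n)) * KK n j (?y n) (?y n + m) - up n (?y n) * KK n j (?y n + 1) (?y n + m)
       - dn n (?y n) * KK n j (?y n - 1) (?y n + m) = KK n (Suc j) (?y n) (?y n + m)) sequentially"
      using in_Om_eventually[OF r, of i] by eventually_elim (simp only: KK_Suc)
  qed
qed

text \<open>The diagonal entry of \<open>g\<close> applied to the operator. By completeness the
  factors in parentheses are nonnegative and sum to one over \<open>k\<close>, so this is the mean
  of \<open>g\<close> under the local spectral measure at \<open>y\<close>.\<close>

definition GG :: "nat \<Rightarrow> real poly \<Rightarrow> int \<Rightarrow> real" where
  "GG n g y = (\<Sum>k<card (Om n). poly g (lam n k) * (P n k y ^ 2 * W n y))"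

definition symb :: "real \<Rightarrow> real \<Rightarrow> real" where "symb r \<theta> = a r + b r - 2 * sqrt (a r * b r) * cos \<theta>"

definition LL :: "real poly \<Rightarrow> real \<Rightarrow> real" where "LL g r = 1 / pi * integral {0..pi} (\<lambda>\<theta>. poly g (symb r \<theta>))"

lemma GG_lim:
  assumes r: "L < r" "r < U"
  shows "(\<lambda>n. GG n g \<lfloor>r / eps n\<rfloor>) \<longlonglongrightarrow> LL g r"
proof -
  have "GG n g y = (\<Sum>j\<le>degree g. coeff g j * KK n j y y)" for n y
    unfolding GG_def KK_def poly_altdef sum_distrib_left sum_distrib_right
    by (subst sum.swap) (simp add: power2_eq_square ac_simps)
  moreover have "(\<lambda>n. \<Sum>j\<le>degree g. coeff g j * KK n j \<lfloor>r / eps n\<rfloor> \<lfloor>r / eps n\<rfloor>) \<longlonglongrightarrow> (\<Sum>j\<le>degree g. coeff g j * cmom (a r) (b r) j 0)"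
    using KK_lim[OF r, of _ 0 0] by (intro tendsto_intros) simp
  moreover have "(\<Sum>j\<le>degree g. coeff g j * cmom (a r) (b r) j 0) = LL g r"
  proof -
    have "integral {0..pi} (\<lambda>\<theta>. poly g (symb r \<theta>)) = (\<Sum>j\<le>degree g. coeff g j * integral {0..pi} (\<lambda>\<theta>. symb r \<theta> ^ j))"
      unfolding poly_altdef
      by (intro integral_unique has_integral_sum has_integral_mult_right integrable_integral integrable_continuous_real)
         (auto simp: symb_def intro!: continuous_intros)
    thus ?thesis by (simp add: LL_def cmom_def symb_def sum_distrib_left sum_divide_distrib)
  qed
  ultimately show ?thesis by simp
qed

lemma weight_sum: "y \<in> Om n \<Longrightarrow> (\<Sum>k<card (Om n). P n k y ^ 2 * W n y) = 1"
  using compl[of y n y] by (simp add: power2_eq_square)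

lemma weight_nonneg: "y \<in> Om n \<Longrightarrow> 0 \<le> P n k y ^ 2 * W n y"
  using W_pos[of y n] by simp

lemma GG_bound:
  assumes "\<And>z. 0 \<le> z \<Longrightarrow> z \<le> \<Lambda> \<Longrightarrow> \<bar>poly g z\<bar> \<le> B" "y \<in> Om n" shows "\<bar>GG n g y\<bar> \<le> B"
proof -
  have "\<bar>GG n g y\<bar> \<le> (\<Sum>k<card (Om n). \<bar>poly g (lam n k) * (P n k y ^ 2 * W n y)\<bar>)" unfolding GG_def by (rule sum_abs)
  also have "\<dots> \<le> (\<Sum>k<card (Om n). B * (P n k y ^ 2 * W n y))"
  proof (rule sum_mono)
    fix k assume "k \<in> {..<card (Om n)}"
    hence "\<bar>poly g (lam n k)\<bar> \<le> B" using lam_bounds[of k n] by (intro assms(1)) auto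
    thus "\<bar>poly g (lam n k) * (P n k y ^ 2 * W n y)\<bar> \<le> B * (P n k y ^ 2 * W n y)"
      unfolding abs_mult[of "poly g (lam n k)"] abs_of_nonneg[OF weight_nonneg[OF assms(2)]]
      by (rule mult_right_mono[OF _ weight_nonneg[OF assms(2)]])
  qed
  also have "\<dots> = B" using weight_sum[OF assms(2)] by (simp add: sum_distrib_left[symmetric])
  finally show ?thesis .
qed

text \<open>Dominated convergence for the step functions \<open>F n\<close>: they converge by
  \<open>GG_lim\<close> at every interior position, are bounded by \<open>GG_bound\<close>, and live
  on a common bounded interval.\<close>

lemma GG_sum_lim:
  fixes g :: "real poly"
  assumes Y: "L \<le> Y" "Y \<le> U"
  defines "A \<equiv> \<lambda>n. Om n \<inter> {..\<lfloor>Y / eps n\<rfloor>}"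
  shows "integrable lborel (\<lambda>r. indicator {L<..<Y} r * LL g r)"
    "(\<lambda>n. eps n * (\<Sum>y\<in>A n. GG n g y)) \<longlonglongrightarrow> (\<integral>r. indicator {L<..<Y} r * LL g r \<partial>lborel)"
proof -
  \<comment> \<open>The two boundary points are cut out, since the local limit says nothing about
    them; they have measure zero.\<close>
  define F where "F = (\<lambda>n r. (\<Sum>y\<in>A n. GG n g y * indicator {eps n * of_int y..<eps n * (of_int y + 1)} r) * indicator (- {L, Y}) r)"
  have finA: "finite (A n)" for n by (simp add: A_def)
  have Feval: "F n r = (if \<lfloor>r / eps n\<rfloor> \<in> A n then GG n g \<lfloor>r / eps n\<rfloor> else 0) * indicator (- {L, Y}) r" for n r
    unfolding F_def floor_sum_eval[OF finA eps_pos] ..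
  have "continuous_on {0..\<Lambda>} (poly g)" by (intro continuous_intros)
  hence "bounded (poly g ` {0..\<Lambda>})" by (intro compact_imp_bounded compact_continuous_image) auto
  then obtain B where "\<forall>x\<in>{0..\<Lambda>}. \<bar>poly g x\<bar> \<le> B" by (auto simp: bounded_iff)
  hence B: "\<And>z. 0 \<le> z \<Longrightarrow> z \<le> \<Lambda> \<Longrightarrow> \<bar>poly g z\<bar> \<le> B" by auto
  define B' where "B' = max B 0"
  have B': "\<And>z. 0 \<le> z \<Longrightarrow> z \<le> \<Lambda> \<Longrightarrow> \<bar>poly g z\<bar> \<le> B'" using B by (fastforce simp: B'_def)
  have conv: "(\<lambda>n. F n r) \<longlonglongrightarrow> indicator {L<..<Y} r * LL g r" for r
  proof -
    consider "r = L \<or> r = Y" | "L < r" "r < Y" | "r < L" | "r > Y" by linarith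
    thus ?thesis
    proof cases
      case 1 thus ?thesis unfolding Feval by auto
    next
      case 2
      have "eventually (\<lambda>n. \<lfloor>r / eps n\<rfloor> \<in> Om n) sequentially" using in_Om_eventually[of r 0] 2 Y by simp
      moreover have "eventually (\<lambda>n. \<lfloor>r / eps n\<rfloor> < \<lfloor>Y / eps n\<rfloor>) sequentially"
        using less_eventually[OF floor_lim[of r 0] floor_lim[of Y 0] 2(2)] by simp
      ultimately have "eventually (\<lambda>n. GG n g \<lfloor>r / eps n\<rfloor> = F n r) sequentially"
        by eventually_elim (use 2 in \<open>simp add: Feval A_def\<close>)
      from Lim_transform_eventually[OF GG_lim this] show ?thesis using 2 Y by simp
    next
      case 3
      have "eventually (\<lambda>n. F n r = 0) sequentially"
        using less_eventually[OF floor_lim[of r 0] lo_lim 3] by eventually_elim (auto simp: Feval A_def)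
      thus ?thesis using 3 by (simp add: tendsto_eventually)
    next
      case 4
      have "eventually (\<lambda>n. F n r = 0) sequentially"
        using less_eventually[OF floor_lim[of Y 0] floor_lim[of r 0] 4] by eventually_elim (auto simp: Feval A_def)
      thus ?thesis using 4 by (simp add: tendsto_eventually)
    qed
  qed
  have meas: "F n \<in> borel_measurable lborel" for n
    unfolding F_def by measurable
  have meas_lim: "(\<lambda>r. indicator {L<..<Y} r * LL g r) \<in> borel_measurable lborel"
    using meas conv by (rule borel_measurable_LIMSEQ_real[of lborel F, rotated])
  obtain C where C: "\<And>n. \<bar>eps n * of_int (lo n)\<bar> \<le> C" using convergent_imp_bounded[OF lo_lim] by (auto simp: bounded_iff)
  obtain D where D: "\<And>n. \<bar>eps n * of_int (hi n)\<bar> \<le> D" using convergent_imp_bounded[OF hi_lim] by (auto simp: bounded_iff)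
  obtain E where E: "\<And>n. \<bar>eps n\<bar> \<le> E" using convergent_imp_bounded[OF eps_lim] by (auto simp: bounded_iff)
  define w where "w = (\<lambda>r::real. B' * indicator {-C..D+E} r)"
  have dom: "norm (F n r) \<le> w r" for n r
  proof (cases "\<lfloor>r / eps n\<rfloor> \<in> A n")
    case True
    hence y: "\<lfloor>r / eps n\<rfloor> \<in> Om n" by (simp add: A_def)
    define f where "f = real_of_int \<lfloor>r / eps n\<rfloor>"
    have f: "f \<le> r / eps n" "r / eps n \<le> f + 1" unfolding f_def by linarith+
    have "eps n * f \<le> eps n * (r / eps n)" "eps n * (r / eps n) \<le> eps n * (f + 1)"
      using eps_pos[of n] f by (auto intro!: mult_left_mono simp del: times_divide_eq_right)
    moreover have "eps n * (r / eps n) = r" using eps_pos[of n] by simp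
    ultimately have r: "eps n * of_int \<lfloor>r / eps n\<rfloor> \<le> r" "r \<le> eps n * of_int \<lfloor>r / eps n\<rfloor> + eps n"
      unfolding f_def by (simp_all only: distrib_left mult_1_right)
    have "eps n * of_int (lo n) \<le> eps n * of_int \<lfloor>r / eps n\<rfloor>" "eps n * of_int \<lfloor>r / eps n\<rfloor> \<le> eps n * of_int (hi n)"
      using y eps_pos[of n] by auto
    hence "r \<in> {-C..D+E}" using r C[of n] D[of n] E[of n] by auto
    moreover have "\<bar>GG n g \<lfloor>r / eps n\<rfloor>\<bar> \<le> B'" by (rule GG_bound[OF B' y])
    ultimately show ?thesis using True by (auto simp: Feval w_def indicator_def B'_def)
  next
    case False thus ?thesis by (simp add: Feval w_def B'_def)
  qed
  have wint: "integrable lborel w" unfolding w_def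
    by (intro integrable_mult_right integrable_real_indicator) (auto simp: emeasure_lborel_Icc_eq)
  show "integrable lborel (\<lambda>r. indicator {L<..<Y} r * LL g r)"
    by (rule integrable_dominated_convergence[where s = F, OF meas_lim meas wint]) (use conv dom in auto)
  have lim: "(\<lambda>n. integral\<^sup>L lborel (F n)) \<longlonglongrightarrow> (\<integral>r. indicator {L<..<Y} r * LL g r \<partial>lborel)"
    by (rule integral_dominated_convergence[where s = F, OF meas_lim meas wint]) (use conv dom in auto)
  have "integral\<^sup>L lborel (F n) = eps n * (\<Sum>y\<in>A n. GG n g y)" for n
  proof -
    have "integral\<^sup>L lborel (F n) = (\<integral>r. (\<Sum>y\<in>A n. GG n g y * indicator {eps n * of_int y..<eps n * (of_int y + 1)} r) \<partial>lborel)"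
    proof (rule integral_cong_AE)
      have "AE r in lborel. r \<notin> {L, Y}" by (intro AE_not_in countable_imp_null_set_lborel) auto
      thus "AE r in lborel. F n r = (\<Sum>y\<in>A n. GG n g y * indicator {eps n * of_int y..<eps n * (of_int y + 1)} r)"
        by eventually_elim (auto simp: F_def)
    qed (use meas in measurable)
    also have "\<dots> = eps n * (\<Sum>y\<in>A n. GG n g y)" by (rule floor_sum_integral(2)[OF finA eps_pos])
    finally show ?thesis .
  qed
  thus "(\<lambda>n. eps n * (\<Sum>y\<in>A n. GG n g y)) \<longlonglongrightarrow> (\<integral>r. indicator {L<..<Y} r * LL g r \<partial>lborel)"
    using lim by simp
qed

lemma card_lim: "(\<lambda>n. eps n * real (card (Om n))) \<longlonglongrightarrow> U - L"
proof -
  have "(\<lambda>n. eps n * of_int (hi n) - eps n * of_int (lo n) + eps n) \<longlonglongrightarrow> U - L + 0"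
    by (intro tendsto_intros lo_lim hi_lim eps_lim)
  moreover have "eventually (\<lambda>n. eps n * of_int (hi n) - eps n * of_int (lo n) + eps n = eps n * real (card (Om n))) sequentially"
    using less_eventually[OF lo_lim hi_lim LU] by eventually_elim (simp add: algebra_simps)
  ultimately show ?thesis using Lim_transform_eventually by fastforce
qed

lemma symb_range:
  assumes "L < r" "r < U" shows "0 \<le> symb r \<theta>" "symb r \<theta> \<le> \<Lambda>"
proof -
  have ab': "a r > 0" "b r > 0" "2 * (a r + b r) \<le> \<Lambda>" using ab[OF assms] by auto
  have am: "2 * sqrt (a r * b r) \<le> a r + b r" using arith_geo_mean_sqrt[of "a r" "b r"] ab' by simp
  define X where "X = 2 * sqrt (a r * b r)"
  have X: "0 \<le> X" using ab' by (simp add: X_def)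
  have "X * cos \<theta> \<le> X * 1" "X * (-1) \<le> X * cos \<theta>" by (intro mult_left_mono X cos_le_one cos_ge_minus_one)+
  hence c: "X * cos \<theta> \<le> X" "- X \<le> X * cos \<theta>" by simp_all
  note * = c am[folded X_def] ab'(3)
  show "0 \<le> symb r \<theta>" using * unfolding symb_def X_def[symmetric] by linarith
  have "symb r \<theta> = a r + b r - X * cos \<theta>" by (simp add: symb_def X_def)
  also have "\<dots> \<le> (a r + b r) + (a r + b r)" using c am[folded X_def] by linarith
  also have "\<dots> \<le> \<Lambda>" using ab'(3) by simp
  finally show "symb r \<theta> \<le> \<Lambda>" .
qed

theorem weyl_count:
  fixes N :: "nat \<Rightarrow> nat" and N0 ls Y :: real and \<phi> :: "real \<Rightarrow> real"
  assumes Nle: "\<And>n. N n \<le> card (Om n)" and Nlim: "(\<lambda>n. eps n * real (N n)) \<longlonglongrightarrow> N0"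
    and thr: "\<And>\<delta>. \<delta> > 0 \<Longrightarrow> \<exists>\<gamma>>0. eventually (\<lambda>n. \<forall>k<card (Om n).
        (eps n * real k < N0 - \<delta> \<longrightarrow> lam n k \<le> ls - \<gamma>) \<and> (eps n * real k > N0 + \<delta> \<longrightarrow> lam n k \<ge> ls + \<gamma>)) sequentially"
    and \<phi>_meas: "\<phi> \<in> borel_measurable borel" and \<phi>_range: "\<And>r. 0 \<le> \<phi> r \<and> \<phi> r \<le> pi"
    and \<phi>: "\<And>r. L < r \<Longrightarrow> r < U \<Longrightarrow> \<phi> r = arccos_clamped ((a r + b r - ls) / (2 * sqrt (a r * b r)))"
    and Y: "L \<le> Y" "Y \<le> U"
  shows "(\<lambda>n. eps n * (\<Sum>k<N n. \<Sum>y\<in>Om n \<inter> {..\<lfloor>Y / eps n\<rfloor>}. P n k y ^ 2 * W n y))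
      \<longlonglongrightarrow> (\<integral>r. indicator {L<..<Y} r * (\<phi> r / pi) \<partial>lborel)"
proof (rule LIMSEQ_I)
  fix \<eta> :: real assume \<eta>: "\<eta> > 0"
  \<comment> \<open>The final errors are \<delta> (U - L + 4) from the cutoff, \<delta> from the
    convergence of the sums, and \<delta> (U - L + 4) + 2 \<delta> (U - L) from the limit functions.
    Together they stay below \<eta>.\<close>
  define \<delta> where "\<delta> = \<eta> / (4 * (U - L) + 10)"
  have \<delta>: "\<delta> > 0" "\<delta> * (4 * (U - L) + 10) = \<eta>" using \<eta> LU by (auto simp: \<delta>_def)
  obtain \<gamma> where \<gamma>: "\<gamma> > 0" and thr': "eventually (\<lambda>n. \<forall>k<card (Om n).
        (eps n * real k < N0 - \<delta> \<longrightarrow> lam n k \<le> ls - \<gamma>) \<and> (eps n * real k > N0 + \<delta> \<longrightarrow> lam n k \<ge> ls + \<gamma>)) sequentially"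
    using thr[OF \<delta>(1)] by blast
  \<comment> \<open>\<open>s\<close> is a continuous version of the indicator of values up to
    \<open>ls\<close>, descending on an interval of length \<gamma>. The bump \<open>bb\<close>
    dominates the difference from that indicator and vanishes at distance at least \<gamma> from
    \<open>ls\<close>.\<close>
  define s where "s = (\<lambda>x. max 0 (min 1 (1/2 - (x - ls) / \<gamma>)))"
  define bb where "bb = (\<lambda>x. max 0 (min 1 (2 - 2 * \<bar>x - ls\<bar> / \<gamma>)))"
  have s_low: "s x = 1" if "x \<le> ls - \<gamma> / 2" for x
  proof -
    have "1/2 - (x - ls) / \<gamma> \<ge> 1" using that \<gamma> by (simp add: field_simps)
    thus ?thesis by (simp add: s_def)
  qed
  have s_high: "s x = 0" if "x \<ge> ls + \<gamma> / 2" for x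
  proof -
    have "1/2 - (x - ls) / \<gamma> \<le> 0" using that \<gamma> by (simp add: field_simps)
    moreover have "max 0 (min 1 v) = 0" if "v \<le> 0" for v :: real using that by simp
    ultimately show ?thesis unfolding s_def by blast
  qed
  have s_range: "0 \<le> s x" "s x \<le> 1" for x by (auto simp: s_def)
  have bb_range: "0 \<le> bb x" "bb x \<le> 1" for x by (auto simp: bb_def)
  have bb_near: "bb x = 1" if "\<bar>x - ls\<bar> \<le> \<gamma> / 2" for x
  proof -
    have "2 - 2 * \<bar>x - ls\<bar> / \<gamma> \<ge> 1" using that \<gamma> by (simp add: field_simps)
    thus ?thesis by (simp add: bb_def)
  qed
  have bb_far: "bb x = 0" if "\<bar>x - ls\<bar> \<ge> \<gamma>" for x
  proof -
    have "2 - 2 * \<bar>x - ls\<bar> / \<gamma> \<le> 0" using that \<gamma> by (simp add: field_simps)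
    thus ?thesis by (simp add: bb_def)
  qed
  have step: "\<bar>of_bool (x \<le> ls) - s x\<bar> \<le> bb x" for x
  proof -
    consider "\<bar>x - ls\<bar> \<le> \<gamma> / 2" | "x < ls - \<gamma> / 2" | "x > ls + \<gamma> / 2" by linarith
    thus ?thesis
    proof cases
      case 1 thus ?thesis using bb_near[OF 1] s_range[of x] by (auto simp: of_bool_def)
    next
      case 2 thus ?thesis using s_low[of x] bb_range[of x] \<gamma> by auto
    next
      case 3 thus ?thesis using s_high[of x] bb_range[of x] \<gamma> by auto
    qed
  qed
  have cs: "continuous_on {0..\<Lambda>} s" "continuous_on {0..\<Lambda>} bb"
    unfolding s_def bb_def using \<gamma> by (auto intro!: continuous_intros)
  obtain p where p: "\<And>x. 0 \<le> x \<Longrightarrow> x \<le> \<Lambda> \<Longrightarrow> \<bar>poly p x - s x\<bar> < \<delta>" using poly_approximation[OF cs(1) \<delta>(1)] by blast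
  obtain t where t: "\<And>x. 0 \<le> x \<Longrightarrow> x \<le> \<Lambda> \<Longrightarrow> \<bar>poly t x - bb x\<bar> < \<delta>" using poly_approximation[OF cs(2) \<delta>(1)] by blast
  define A where "A = (\<lambda>n Y. Om n \<inter> {..\<lfloor>Y / eps n\<rfloor>})"
  define cw where "cw = (\<lambda>n Y k. \<Sum>y\<in>A n Y. P n k y ^ 2 * W n y)"
  have cw: "0 \<le> cw n Y k" "cw n Y k \<le> 1" if "k < card (Om n)" for n Y k
  proof -
    show "0 \<le> cw n Y k" unfolding cw_def by (intro sum_nonneg weight_nonneg) (auto simp: A_def)
    have "cw n Y k \<le> (\<Sum>y\<in>Om n. P n k y ^ 2 * W n y)"
      unfolding cw_def by (intro sum_mono2 weight_nonneg) (auto simp: A_def)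
    thus "cw n Y k \<le> 1" using norm1[OF that] by simp
  qed
  have GGcw: "(\<Sum>y\<in>A n Y. GG n g y) = (\<Sum>k<card (Om n). poly g (lam n k) * cw n Y k)" for n g Y
    unfolding GG_def cw_def by (subst sum.swap) (simp add: sum_distrib_left)
  \<comment> \<open>By \<open>thr'\<close> an eigenvalue closer to \<open>ls\<close> than \<gamma>
    has its index in this window, which holds about 2 \<delta> / \<open>eps n\<close> indices by
    \<open>window_count\<close>.\<close>
  define near where "near = (\<lambda>n k. of_bool (\<bar>eps n * real k - N0\<bar> \<le> \<delta>) :: real)"
  have near_sum: "eps n * (\<Sum>k<card (Om n). \<delta> + near n k) \<le> \<delta> * (eps n * real (card (Om n))) + (2 * \<delta> + eps n)" for n
  proof -
    have "(\<Sum>k<card (Om n). near n k) = real (card {k. k < card (Om n) \<and> \<bar>eps n * real k - N0\<bar> \<le> \<delta>})"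
      unfolding near_def of_bool_def by (subst sum.If_cases) (auto intro!: arg_cong[of _ _ card])
    thus ?thesis using window_count[OF eps_pos[of n] \<delta>(1), of "card (Om n)" N0] by (simp add: sum.distrib distrib_left)
  qed
  have ev_near: "eventually (\<lambda>n. eps n * (\<Sum>k<card (Om n). \<delta> + near n k) \<le> \<delta> * (U - L + 4)) sequentially"
  proof -
    have "eventually (\<lambda>n. eps n * real (card (Om n)) < U - L + 1) sequentially" "eventually (\<lambda>n. eps n < \<delta>) sequentially"
      using order_tendstoD(2)[OF card_lim] order_tendstoD(2)[OF eps_lim \<delta>(1)] by auto
    thus ?thesis
    proof eventually_elim
      case (elim n)
      have "\<delta> * (eps n * real (card (Om n))) \<le> \<delta> * (U - L + 1)" using elim \<delta> by (intro mult_left_mono) auto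
      thus ?case using near_sum[of n] elim by (simp add: algebra_simps)
    qed
  qed
  \<comment> \<open>Replacing the cutoff of the index by \<open>p\<close> of the eigenvalue costs at
    most \<delta> per eigenvector, and one more inside the window. Each eigenvector has mass at most
    one on \<open>A n Y\<close>.\<close>
  have ev1: "eventually (\<lambda>n. \<bar>eps n * (\<Sum>k<N n. cw n Y k) - eps n * (\<Sum>y\<in>A n Y. GG n p y)\<bar> \<le> \<delta> * (U - L + 4)) sequentially"
  proof -
    have "eventually (\<lambda>n. eps n * real (N n) > N0 - \<delta>) sequentially" "eventually (\<lambda>n. eps n * real (N n) < N0 + \<delta>) sequentially"
      using order_tendstoD[OF Nlim] \<delta>(1) by auto
    thus ?thesis using thr' ev_near
    proof eventually_elim
      case (elim n)
      have "(\<Sum>k<N n. cw n Y k) = (\<Sum>k<card (Om n). of_bool (k < N n) * cw n Y k)"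
        using Nle[of n] by (intro sum.mono_neutral_cong_left) auto
      hence "(\<Sum>k<N n. cw n Y k) - (\<Sum>y\<in>A n Y. GG n p y) = (\<Sum>k<card (Om n). (of_bool (k < N n) - poly p (lam n k)) * cw n Y k)"
        unfolding GGcw by (simp add: sum_subtractf left_diff_distrib)
      also have "\<bar>\<dots>\<bar> \<le> (\<Sum>k<card (Om n). \<delta> + near n k)"
      proof (rule order.trans[OF sum_abs], rule sum_mono)
        fix k assume "k \<in> {..<card (Om n)}"
        hence k: "k < card (Om n)" by simp
        have "\<bar>of_bool (k < N n) - s (lam n k)\<bar> \<le> near n k"
        proof (cases "\<bar>eps n * real k - N0\<bar> \<le> \<delta>")
          case True thus ?thesis using s_range[of "lam n k"] by (auto simp: near_def of_bool_def)
        next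
          case False
          then consider "eps n * real k < N0 - \<delta>" | "eps n * real k > N0 + \<delta>" by linarith
          thus ?thesis
          proof cases
            case 1
            hence "eps n * real k < eps n * real (N n)" using elim(1) by linarith
            hence "k < N n" using eps_pos[of n] by simp
            moreover have "s (lam n k) = 1" using elim(3) k 1 \<gamma> by (intro s_low) force
            ultimately show ?thesis by (simp add: near_def)
          next
            case 2
            hence "eps n * real (N n) < eps n * real k" using elim(2) by linarith
            hence "\<not> k < N n" using eps_pos[of n] by simp
            moreover have "s (lam n k) = 0" using elim(3) k 2 \<gamma> by (intro s_high) force
            ultimately show ?thesis by (simp add: near_def)
          qed
        qed
        hence "\<bar>of_bool (k < N n) - poly p (lam n k)\<bar> \<le> \<delta> + near n k"
          using p[of "lam n k"] lam_bounds[OF k] by linarith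
        moreover have "\<bar>(of_bool (k < N n) - poly p (lam n k)) * cw n Y k\<bar> \<le> \<bar>of_bool (k < N n) - poly p (lam n k)\<bar> * 1"
          unfolding abs_mult using cw[OF k, of Y] by (intro mult_left_mono) auto
        ultimately show "\<bar>(of_bool (k < N n) - poly p (lam n k)) * cw n Y k\<bar> \<le> \<delta> + near n k"
          unfolding mult_1_right by (rule order.trans[rotated])
      qed
      finally have "\<bar>(\<Sum>k<N n. cw n Y k) - (\<Sum>y\<in>A n Y. GG n p y)\<bar> \<le> (\<Sum>k<card (Om n). \<delta> + near n k)" .
      hence "eps n * \<bar>(\<Sum>k<N n. cw n Y k) - (\<Sum>y\<in>A n Y. GG n p y)\<bar> \<le> eps n * (\<Sum>k<card (Om n). \<delta> + near n k)"
        using eps_pos[of n] by (intro mult_left_mono) auto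
      moreover have "eps n * \<bar>(\<Sum>k<N n. cw n Y k) - (\<Sum>y\<in>A n Y. GG n p y)\<bar> = \<bar>eps n * (\<Sum>k<N n. cw n Y k) - eps n * (\<Sum>y\<in>A n Y. GG n p y)\<bar>"
        using eps_pos[of n] by (simp add: abs_mult flip: right_diff_distrib)
      ultimately show ?case using elim(4) by linarith
    qed
  qed
  \<comment> \<open>Over the whole slice the diagonal sum of \<open>t\<close> is bounded by the
    number of indices in the window. In the limit this controls how much of the symbol, averaged
    over all positions, lies near \<open>ls\<close>.\<close>
  have tU: "(\<integral>r. indicator {L<..<U} r * LL t r \<partial>lborel) \<le> \<delta> * (U - L + 4)"
  proof (rule tendsto_upperbound[OF GG_sum_lim(2)[of U t]])
    show "eventually (\<lambda>n. eps n * (\<Sum>y\<in>Om n \<inter> {..\<lfloor>U / eps n\<rfloor>}. GG n t y) \<le> \<delta> * (U - L + 4)) sequentially"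
      using thr' ev_near
    proof eventually_elim
      case (elim n)
      have "(\<Sum>y\<in>A n U. GG n t y) \<le> (\<Sum>k<card (Om n). \<delta> + near n k)"
        unfolding GGcw
      proof (rule sum_mono)
        fix k assume "k \<in> {..<card (Om n)}"
        hence k: "k < card (Om n)" by simp
        have "bb (lam n k) \<le> near n k"
        proof (cases "\<bar>eps n * real k - N0\<bar> \<le> \<delta>")
          case True thus ?thesis using bb_range[of "lam n k"] by (auto simp: near_def of_bool_def)
        next
          case False
          hence "lam n k \<le> ls - \<gamma> \<or> lam n k \<ge> ls + \<gamma>" using elim(1) k by force
          hence "bb (lam n k) = 0" by (intro bb_far) linarith
          thus ?thesis by (simp add: near_def)
        qed
        hence "poly t (lam n k) \<le> \<delta> + near n k" using t[of "lam n k"] lam_bounds[OF k] by linarith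
        hence "poly t (lam n k) * cw n U k \<le> (\<delta> + near n k) * cw n U k" using cw[OF k] by (intro mult_right_mono) auto
        also have "\<dots> \<le> (\<delta> + near n k) * 1" using cw[OF k] \<delta> by (intro mult_left_mono) (auto simp: near_def)
        finally show "poly t (lam n k) * cw n U k \<le> \<delta> + near n k" by simp
      qed
      hence "eps n * (\<Sum>y\<in>A n U. GG n t y) \<le> eps n * (\<Sum>k<card (Om n). \<delta> + near n k)"
        using eps_pos[of n] by (intro mult_left_mono) auto
      thus ?case using elim(2) by (simp add: A_def)
    qed
  qed (use LU in auto)
  \<comment> \<open>The right side bounds the local error by the share of the symbol near
    \<open>ls\<close>. Its smallness comes from integrating over \<open>r\<close>, by
    \<open>tU\<close>.\<close>
  have point: "\<bar>LL p r - \<phi> r / pi\<bar> \<le> LL t r + 2 * \<delta>" if r: "L < r" "r < U" for r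
  proof -
    have ab': "a r > 0" "b r > 0" using ab[OF r] by auto
    have so: "sqrt (a r * b r) > 0" using ab' by simp
    have step_int: "((\<lambda>\<theta>. of_bool (symb r \<theta> \<le> ls)) has_integral \<phi> r) {0..pi}"
      unfolding \<phi>[OF r] symb_def by (rule symbol_step_integral[OF so])
    have pint: "(\<lambda>\<theta>. poly g (symb r \<theta>)) integrable_on {0..pi}" for g
      by (intro integrable_continuous_real) (auto simp: symb_def intro!: continuous_intros)
    have "((\<lambda>\<theta>. poly p (symb r \<theta>) - of_bool (symb r \<theta> \<le> ls)) has_integral (integral {0..pi} (\<lambda>\<theta>. poly p (symb r \<theta>)) - \<phi> r)) {0..pi}"
      by (intro has_integral_diff step_int integrable_integral pint)
    moreover have "((\<lambda>\<theta>. poly t (symb r \<theta>) + 2 * \<delta>) has_integral (integral {0..pi} (\<lambda>\<theta>. poly t (symb r \<theta>)) + 2 * \<delta> * pi)) {0..pi}"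
      using has_integral_const_real[of "2 * \<delta>" 0 pi] by (intro has_integral_add integrable_integral pint) (simp add: mult.commute)
    moreover have bnd: "\<bar>poly p (symb r \<theta>) - of_bool (symb r \<theta> \<le> ls)\<bar> \<le> poly t (symb r \<theta>) + 2 * \<delta>" for \<theta>
      using p[OF symb_range[OF r, of \<theta>]] t[OF symb_range[OF r, of \<theta>]] step[of "symb r \<theta>"] by linarith
    ultimately have "\<bar>integral {0..pi} (\<lambda>\<theta>. poly p (symb r \<theta>)) - \<phi> r\<bar> \<le> integral {0..pi} (\<lambda>\<theta>. poly t (symb r \<theta>)) + 2 * \<delta> * pi"
      using integral_norm_bound_integral[of "\<lambda>\<theta>. poly p (symb r \<theta>) - of_bool (symb r \<theta> \<le> ls)" "{0..pi}" "\<lambda>\<theta>. poly t (symb r \<theta>) + 2 * \<delta>"]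
      by (auto simp: integral_unique has_integral_integrable)
    hence "\<bar>integral {0..pi} (\<lambda>\<theta>. poly p (symb r \<theta>)) - \<phi> r\<bar> / pi \<le> (integral {0..pi} (\<lambda>\<theta>. poly t (symb r \<theta>)) + 2 * \<delta> * pi) / pi"
      by (intro divide_right_mono) auto
    moreover have "\<bar>LL p r - \<phi> r / pi\<bar> = \<bar>integral {0..pi} (\<lambda>\<theta>. poly p (symb r \<theta>)) - \<phi> r\<bar> / pi"
      by (simp add: LL_def abs_divide flip: diff_divide_distrib)
    ultimately show ?thesis by (simp add: LL_def add_divide_distrib)
  qed
  have \<phi>int: "integrable lborel (\<lambda>r. indicator {L<..<Y} r * (\<phi> r / pi))"
  proof (rule Bochner_Integration.integrable_bound[of lborel "\<lambda>r. indicator {L<..<Y} r * (1::real)"])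
    show "integrable lborel (\<lambda>r. indicator {L<..<Y} r * (1::real))" using Y by (simp add: emeasure_lborel_Ioo)
    show "(\<lambda>r. indicator {L<..<Y} r * (\<phi> r / pi)) \<in> borel_measurable lborel" using \<phi>_meas by measurable
    have "norm (indicator {L<..<Y} r * (\<phi> r / pi)) \<le> norm (indicator {L<..<Y} r * (1::real))" for r
      using \<phi>_range[of r] by (auto simp: indicator_def)
    thus "AE r in lborel. norm (indicator {L<..<Y} r * (\<phi> r / pi)) \<le> norm (indicator {L<..<Y} r * (1::real))" by simp
  qed
  have diff: "\<bar>(\<integral>r. indicator {L<..<Y} r * LL p r \<partial>lborel) - (\<integral>r. indicator {L<..<Y} r * (\<phi> r / pi) \<partial>lborel)\<bar> \<le> \<delta> * (U - L + 4) + 2 * \<delta> * (U - L)"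
  proof -
    have LU': "L \<le> U" using LU by simp
    note i2 = GG_sum_lim(1)[OF LU' order.refl, of t]
    have "\<bar>indicator {L<..<Y} r * LL p r - indicator {L<..<Y} r * (\<phi> r / pi)\<bar> \<le> indicator {L<..<U} r * LL t r + 2 * \<delta> * indicator {L<..<U} r" for r
    proof (cases "L < r \<and> r < U")
      case True
      hence pt: "\<bar>LL p r - \<phi> r / pi\<bar> \<le> LL t r + 2 * \<delta>" using point by blast
      moreover have "0 \<le> \<bar>LL p r - \<phi> r / pi\<bar>" by (rule abs_ge_zero)
      ultimately have "0 \<le> LL t r + 2 * \<delta>" by (rule order.trans[rotated])
      thus ?thesis using True pt by (cases "r < Y") (simp_all only: indicator_def greaterThanLessThan_iff if_True if_False simp_thms of_bool_eq mult_1_left mult_1_right mult_zero_left diff_self abs_zero)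
    next
      case False
      hence "r \<notin> {L<..<Y}" "r \<notin> {L<..<U}" using Y by auto
      thus ?thesis by simp
    qed
    from integral_diff_bound[OF GG_sum_lim(1)[OF Y, of p] \<phi>int i2 integrable_const_Ioo[OF LU', of "2 * \<delta>"] this]
    show ?thesis using tU unfolding integral_const_Ioo[OF LU'] by linarith
  qed
  have "eventually (\<lambda>n. \<bar>eps n * (\<Sum>y\<in>A n Y. GG n p y) - (\<integral>r. indicator {L<..<Y} r * LL p r \<partial>lborel)\<bar> < \<delta>) sequentially"
    using tendstoD[OF GG_sum_lim(2)[OF Y, of p] \<delta>(1)] by (simp add: dist_real_def A_def)
  hence "eventually (\<lambda>n. norm (eps n * (\<Sum>k<N n. cw n Y k) - (\<integral>r. indicator {L<..<Y} r * (\<phi> r / pi) \<partial>lborel)) < \<eta>) sequentially"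
    using ev1
  proof eventually_elim
    case (elim n)
    have "\<delta> * (U - L + 4) + \<delta> + (\<delta> * (U - L + 4) + 2 * \<delta> * (U - L)) = \<delta> * (4 * (U - L) + 10) - \<delta>"
      by (simp add: algebra_simps)
    thus ?case using elim diff \<delta> unfolding real_norm_def by linarith
  qed
  thus "\<exists>no. \<forall>n\<ge>no. norm (eps n * (\<Sum>k<N n. \<Sum>y\<in>Om n \<inter> {..\<lfloor>Y / eps n\<rfloor>}. P n k y ^ 2 * W n y) - (\<integral>r. indicator {L<..<Y} r * (\<phi> r / pi) \<partial>lborel)) < \<eta>"
    unfolding eventually_sequentially cw_def A_def .
qed

end

section \<open>Scaling limits of the parameters\<close>

context q_weights
begin

text \<open>The product of \<open>al1\<close>, \<open>al2\<close> and \<open>be2\<close> is q^(-M)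
  with M = 2N + T - 1. So the eigenvalue is the same on all slices and is symmetric under the
  exchange of k and M - k.\<close>

lemma ev_factor: "ev S t k = (1 / q ^ k - 1) * (q powi (1 - 2 * N - T) * q ^ k - 1)"
proof -
  have R: "q powi (1 - 2 * N - T) = al1 t * (al2 S * be2 S t)"
    unfolding al1_def al2_def be2_def powi_add[symmetric] by (rule arg_cong[of _ _ "power_int q"]) simp
  have "q ^ k \<noteq> 0" by simp
  thus ?thesis unfolding ev_def ev0_def R by (simp add: field_simps)
qed

lemma ev_bounds:
  assumes "int k \<le> 2 * N + T - 1"
  shows "0 \<le> ev S t k" "ev S t k \<le> q powi (1 - 2 * N - T)"
proof -
  define R where "R = q powi (1 - 2 * N - T)"
  have qk: "0 < q ^ k" "q ^ k \<le> 1" using q01 by (simp_all add: power_le_one)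
  have "R * q ^ k = q powi (1 - 2 * N - T + int k)" by (simp add: R_def powi_add)
  also have "\<dots> \<ge> q powi 0" using assms by (intro powi_mono) simp
  finally have Rk: "R * q ^ k \<ge> 1" by simp
  have ik: "1 / q ^ k \<ge> 1" using qk by simp
  show "0 \<le> ev S t k" unfolding ev_factor R_def[symmetric] using Rk ik by (intro mult_nonneg_nonneg) auto
  have "ev S t k = R + (1 - 1 / q ^ k) - R * q ^ k" unfolding ev_factor R_def[symmetric] using qk by (simp add: field_simps)
  thus "ev S t k \<le> q powi (1 - 2 * N - T)" unfolding R_def[symmetric] using ik Rk by linarith
qed

text \<open>For j < k the difference has the sign of q^(j + k - M) - 1, where M = 2N + T - 1 is the
  sum of two indices exchanged by the symmetry of the eigenvalues. The condition on
  \<open>j + k\<close> makes this factor nonnegative.\<close>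

lemma ev_mono:
  assumes "j \<le> k" "int j + int k \<le> 2 * N + T - 1"
  shows "ev S t j \<le> ev S t k"
proof -
  define R where "R = q powi (1 - 2 * N - T)"
  have p: "0 < q ^ j" "0 < q ^ k" "q ^ k \<le> q ^ j" using q01 assms(1) by (simp_all add: power_decreasing)
  have "R * (q ^ j * q ^ k) = q powi (1 - 2 * N - T + (int j + int k))" by (simp add: R_def powi_add)
  also have "\<dots> \<ge> q powi 0" using assms(2) by (intro powi_mono) simp
  finally have "R * (q ^ j * q ^ k) \<ge> 1" by simp
  hence "0 \<le> (q ^ j - q ^ k) * (R * (q ^ j * q ^ k) - 1) / (q ^ j * q ^ k)" using p by simp
  also have "\<dots> = ev S t k - ev S t j" unfolding ev_factor R_def[symmetric] using p by (simp add: field_simps)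
  finally show ?thesis by simp
qed

end

section \<open>Range and measurability of the limiting angle\<close>

lemma arccos_clamped_altdef: "arccos_clamped u = arccos (max (- 1) (min 1 u))"
  by (simp add: arccos_clamped_def max_def min_def)

lemma arccos_clamped_range: "0 \<le> arccos_clamped u \<and> arccos_clamped u \<le> pi"
  unfolding arccos_clamped_altdef by (intro conjI arccos_lbound arccos_ubound) auto

lemma shape_phi_range: "0 \<le> shape_phi N T S q k x r \<and> shape_phi N T S q k x r \<le> pi"
  using arccos_clamped_range by (simp add: shape_phi_def)

lemma arccos_clamped_measurable: "arccos_clamped \<in> borel_measurable borel"
  unfolding arccos_clamped_altdef[abs_def]
  by (intro borel_measurable_continuous_onI continuous_on_arccos continuous_intros) (auto simp: max_def)

lemma shape_phi_measurable: "shape_phi N T S q k x \<in> borel_measurable borel"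
proof -
  have "{r. (x, r) \<in> limit_hexagon N T S} = (if 0 \<le> x \<and> x \<le> T then {max 0 (x + S - T)..min x S + N} else {})"
    by (auto simp: limit_hexagon_def)
  hence s: "{r \<in> space borel. (x, r) \<in> limit_hexagon N T S} \<in> sets borel" by simp
  have "(\<lambda>r. arccos_clamped (((q powr (-N) - 1) * (1 - q powr (-N - T)) *
              (q powr (-2 * r) - k\<^sup>2 * q powr (-x - S))\<^sup>2
            + shape_A N T S q k x r + shape_B N T S q k x r)
           / (2 * sqrt (shape_A N T S q k x r * shape_B N T S q k x r)))) \<in> borel_measurable borel"
    unfolding shape_A_def shape_B_def by (rule measurable_compose[OF _ arccos_clamped_measurable]) measurable
  thus ?thesis unfolding shape_phi_def[abs_def] by (intro measurable_If s) auto
qed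

text \<open>The scaling regime along one sequence of scales \<open>e n\<close>, with
  \<open>tn n\<close> as the line under study. The assumption on \<open>q\<close> is stated for its
  logarithm divided by the scale, the quantity that governs powers with exponents of order
  \<open>1 / e n\<close>.\<close>

locale scaling =
  fixes e qn kn :: "nat \<Rightarrow> real" and Nn Tn Sn tn :: "nat \<Rightarrow> nat" and N0 T0 S0 q0 k0 x :: real
  assumes e_pos: "\<And>n. e n > 0" and e_lim: "e \<longlonglongrightarrow> 0"
    and N0: "N0 > 0" and T0: "T0 > 0" and S0: "0 < S0" "S0 < T0" and q0: "0 < q0" "q0 < 1"
    and k0: "k0 \<ge> 0" "k0\<^sup>2 * q0 powr (- T0) < 1" and x: "0 \<le> x" "x \<le> T0"
    and qt: "\<And>n. q_tilings (qn n) (kn n) (Nn n) (Tn n) (Sn n)" and tn: "\<And>n. tn n \<le> Tn n"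
    and N_lim: "(\<lambda>n. e n * real (Nn n)) \<longlonglongrightarrow> N0" and T_lim: "(\<lambda>n. e n * real (Tn n)) \<longlonglongrightarrow> T0"
    and S_lim: "(\<lambda>n. e n * real (Sn n)) \<longlonglongrightarrow> S0" and t_lim: "(\<lambda>n. e n * real (tn n)) \<longlonglongrightarrow> x"
    and k_lim: "kn \<longlonglongrightarrow> k0" and q_lim: "(\<lambda>n. ln (qn n) / e n) \<longlonglongrightarrow> ln q0"
begin

lemma qw: "q_weights (qn n) (kn n) (int (Nn n)) (int (Tn n))" using qt[of n] by (simp add: q_tilings_def)

lemma qn01: "0 < qn n" "qn n < 1" using qw[of n] by (simp_all add: q_weights_def)

lemma const_lim: "(\<lambda>n. e n * c) \<longlonglongrightarrow> 0" using tendsto_mult_right[OF e_lim, of c] by simp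

lemma powi_lim:
  assumes "(\<lambda>n. e n * of_int (z n)) \<longlonglongrightarrow> s" shows "(\<lambda>n. qn n powi z n) \<longlonglongrightarrow> q0 powr s"
proof -
  have "(\<lambda>n. exp ((e n * of_int (z n)) * (ln (qn n) / e n))) \<longlonglongrightarrow> exp (s * ln q0)"
    by (intro tendsto_intros assms q_lim)
  moreover have "exp ((e n * of_int (z n)) * (ln (qn n) / e n)) = qn n powi z n" for n
    using e_pos[of n] qn01[of n] by (simp add: powr_def flip: powr_real_of_int')
  ultimately show ?thesis using q0 by (simp add: powr_def)
qed

lemma power_lim:
  assumes "(\<lambda>n. e n * real (z n)) \<longlonglongrightarrow> s" shows "(\<lambda>n. qn n ^ z n) \<longlonglongrightarrow> q0 powr s"
  using powi_lim[of "\<lambda>n. int (z n)" s] assms by simp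

abbreviation "cN n \<equiv> int (Nn n)"
abbreviation "cT n \<equiv> int (Tn n)"
abbreviation "cS n \<equiv> int (Sn n)"
abbreviation "ct n \<equiv> int (tn n)"
abbreviation "lo n \<equiv> max 0 (ct n + cS n - cT n)"
abbreviation "hi n \<equiv> min (ct n) (cS n) + cN n - 1"
abbreviation "lam n \<equiv> q_weights.ev (qn n) (cN n) (cT n) (cS n) (ct n)"
abbreviation "upn n \<equiv> q_weights.up (qn n) (kn n) (cN n) (cT n) (cS n) (ct n)"
abbreviation "dnn n \<equiv> q_weights.dn (qn n) (kn n) (cN n) (cT n) (cS n) (ct n)"
abbreviation "Wn n \<equiv> q_weights.Wt (qn n) (kn n) (cN n) (cT n) (cS n) (ct n)"

definition "c = k0\<^sup>2 * q0 powr (- x - S0)"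
definition "a1 = q0 powr (- x - N0)"
definition "a2 = q0 powr (- S0 - N0)"
definition "be = q0 powr (x + S0 - T0)"
definition "LL0 = max 0 (x + S0 - T0)"
definition "UU0 = min x S0 + N0"
text \<open>The limit of q^(-y) times \<open>wt\<close>. Division by its square turns the two
  products of the limit shape into the limits of \<open>up\<close> and \<open>dn\<close>.\<close>

definition "D r = (q0 powr (- r))\<^sup>2 - c"
definition "aa r = shape_A N0 T0 S0 q0 k0 x r / (D r)\<^sup>2"
definition "bb r = shape_B N0 T0 S0 q0 k0 x r / (D r)\<^sup>2"

lemma add_lim:
  assumes "(\<lambda>n. e n * of_int (z n)) \<longlonglongrightarrow> s"
  shows "(\<lambda>n. e n * of_int (z n + i)) \<longlonglongrightarrow> s"
proof -
  have "(\<lambda>n. e n * of_int (z n) + e n * of_int i) \<longlonglongrightarrow> s + 0" by (intro tendsto_add assms const_lim)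
  thus ?thesis by (simp add: distrib_left)
qed

lemma lin_lims:
  "(\<lambda>n. e n * of_int (- ct n - cN n)) \<longlonglongrightarrow> - x - N0"
  "(\<lambda>n. e n * of_int (- cS n - cN n + 1)) \<longlonglongrightarrow> - S0 - N0"
  "(\<lambda>n. e n * of_int (ct n + cS n - cT n)) \<longlonglongrightarrow> x + S0 - T0"
  "(\<lambda>n. e n * of_int (- ct n - cS n + 1)) \<longlonglongrightarrow> - x - S0"
  "(\<lambda>n. e n * of_int (- ct n - cS n)) \<longlonglongrightarrow> - x - S0"
  "(\<lambda>n. e n * of_int (- 2 * cN n - cT n + 1)) \<longlonglongrightarrow> - 2 * N0 - T0"
proof -
  show "(\<lambda>n. e n * of_int (- ct n - cN n)) \<longlonglongrightarrow> - x - N0"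
    using tendsto_diff[OF tendsto_minus[OF t_lim] N_lim] by (simp add: algebra_simps)
  show "(\<lambda>n. e n * of_int (- cS n - cN n + 1)) \<longlonglongrightarrow> - S0 - N0"
    by (rule add_lim) (use tendsto_diff[OF tendsto_minus[OF S_lim] N_lim] in \<open>simp add: algebra_simps\<close>)
  show "(\<lambda>n. e n * of_int (ct n + cS n - cT n)) \<longlonglongrightarrow> x + S0 - T0"
    using tendsto_diff[OF tendsto_add[OF t_lim S_lim] T_lim] by (simp add: algebra_simps)
  show *: "(\<lambda>n. e n * of_int (- ct n - cS n)) \<longlonglongrightarrow> - x - S0"
    using tendsto_diff[OF tendsto_minus[OF t_lim] S_lim] by (simp add: algebra_simps)
  show "(\<lambda>n. e n * of_int (- ct n - cS n + 1)) \<longlonglongrightarrow> - x - S0" by (rule add_lim[OF *])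
  show "(\<lambda>n. e n * of_int (- 2 * cN n - cT n + 1)) \<longlonglongrightarrow> - 2 * N0 - T0"
    by (rule add_lim) (use tendsto_diff[OF tendsto_mult[OF tendsto_const[of "-2"] N_lim] T_lim] in \<open>simp add: algebra_simps\<close>)
qed

lemma al1_lim: "(\<lambda>n. q_weights.al1 (qn n) (cN n) (ct n)) \<longlonglongrightarrow> a1"
  unfolding q_weights.al1_def[OF qw] a1_def by (rule powi_lim[OF lin_lims(1)])

lemma al2_lim: "(\<lambda>n. q_weights.al2 (qn n) (cN n) (cS n)) \<longlonglongrightarrow> a2"
  using powi_lim[OF lin_lims(2)] unfolding q_weights.al2_def[OF qw] a2_def by (simp add: algebra_simps)

lemma be2_lim: "(\<lambda>n. q_weights.be2 (qn n) (cT n) (cS n) (ct n)) \<longlonglongrightarrow> be"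
  unfolding q_weights.be2_def[OF qw] be_def by (rule powi_lim[OF lin_lims(3)])

lemma cc_lim: "(\<lambda>n. q_weights.cc (qn n) (kn n) (cS n) (ct n)) \<longlonglongrightarrow> c" "(\<lambda>n. q_weights.cc (qn n) (kn n) (cS n) (ct n + 1)) \<longlonglongrightarrow> c"
  using tendsto_mult[OF tendsto_power[OF k_lim, of 2] powi_lim[OF lin_lims(4)]]
    tendsto_mult[OF tendsto_power[OF k_lim, of 2] powi_lim[OF lin_lims(5)]]
  unfolding q_weights.cc_def[OF qw] c_def by (simp_all add: algebra_simps)

context
  fixes z :: "nat \<Rightarrow> int" and r :: real
  assumes z: "(\<lambda>n. e n * of_int (z n)) \<longlonglongrightarrow> r"
begin

lemma z_lims: "(\<lambda>n. qn n powi z n) \<longlonglongrightarrow> 1 / q0 powr (- r)" "(\<lambda>n. qn n powi (- z n)) \<longlonglongrightarrow> q0 powr (- r)"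
proof -
  have "q0 powr r = 1 / q0 powr (- r)" by (simp add: powr_minus divide_simps)
  thus "(\<lambda>n. qn n powi z n) \<longlonglongrightarrow> 1 / q0 powr (- r)" using powi_lim[OF z] by simp
  show "(\<lambda>n. qn n powi (- z n)) \<longlonglongrightarrow> q0 powr (- r)" using tendsto_minus[OF z] by (intro powi_lim) simp
qed

lemma factor_lims:
  "(\<lambda>n. q_weights.U1 (qn n) (kn n) (cN n) (cS n) (ct n) (z n)) \<longlonglongrightarrow> (q0 powr (- r) - a1) * (1 - c * (1 / q0 powr (- r)))"
  "(\<lambda>n. q_weights.V1 (qn n) (kn n) (cN n) (cS n) (ct n) (z n)) \<longlonglongrightarrow> (c * (1 / q0 powr (- r)) - a1) * (1 - q0 powr (- r))"
  "(\<lambda>n. q_weights.U2 (qn n) (kn n) (cN n) (cT n) (cS n) (ct n) (z n)) \<longlonglongrightarrow> (q0 powr (- r) - a2) * (1 - c * be * (1 / q0 powr (- r)))"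
  "(\<lambda>n. q_weights.V2 (qn n) (kn n) (cN n) (cT n) (cS n) (ct n) (z n)) \<longlonglongrightarrow> (c * (1 / q0 powr (- r)) - a2) * (1 - be * q0 powr (- r))"
  "(\<lambda>n. q_weights.wt (qn n) (kn n) (cS n) (ct n) (z n)) \<longlonglongrightarrow> q0 powr (- r) - c * (1 / q0 powr (- r))"
  "(\<lambda>n. q_weights.wt (qn n) (kn n) (cS n) (ct n + 1) (z n)) \<longlonglongrightarrow> q0 powr (- r) - c * (1 / q0 powr (- r))"
  unfolding q_weights.U1_def[OF qw] q_weights.V1_def[OF qw] q_weights.U2_def[OF qw] q_weights.V2_def[OF qw] q_weights.wt_def[OF qw]
  by (intro tendsto_intros z_lims al1_lim al2_lim be2_lim cc_lim)+

end

text \<open>The last three identities rewrite \<open>c / Q - a2\<close>, \<open>c / Q - a1\<close>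
  and \<open>1 - be * Q\<close> as multiples of the differences that occur in
  \<open>shape_B\<close>.\<close>

lemma constants: "a1 * (a2 * be) = q0 powr (-2 * N0 - T0)" "c * be = k0\<^sup>2 * q0 powr (- T0)"
  "c = a2 * (k0\<^sup>2 * q0 powr (- x + N0))" "c = a1 * (k0\<^sup>2 * q0 powr (- S0 + N0))" "1 = be * q0 powr (- x - S0 + T0)"
proof -
  show "a1 * (a2 * be) = q0 powr (-2 * N0 - T0)"
    unfolding a1_def a2_def be_def powr_add[symmetric] by (rule arg_cong[of _ _ "(powr) q0"]) simp
  have "q0 powr (- x - S0) * q0 powr (x + S0 - T0) = q0 powr (- T0)" unfolding powr_add[symmetric] by simp
  thus "c * be = k0\<^sup>2 * q0 powr (- T0)" unfolding c_def be_def by (simp add: mult.assoc)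
  have "q0 powr (- S0 - N0) * q0 powr (- x + N0) = q0 powr (- x - S0)"
    unfolding powr_add[symmetric] by (rule arg_cong[of _ _ "(powr) q0"]) simp
  thus "c = a2 * (k0\<^sup>2 * q0 powr (- x + N0))" unfolding c_def a2_def by (simp add: mult.left_commute)
  have "q0 powr (- x - N0) * q0 powr (- S0 + N0) = q0 powr (- x - S0)"
    unfolding powr_add[symmetric] by (rule arg_cong[of _ _ "(powr) q0"]) simp
  thus "c = a1 * (k0\<^sup>2 * q0 powr (- S0 + N0))" unfolding c_def a1_def by (simp add: mult.left_commute)
  show "1 = be * q0 powr (- x - S0 + T0)" unfolding be_def powr_add[symmetric] using q0 by simp
qed

lemma antimono_powr: "u \<le> v \<Longrightarrow> q0 powr v \<le> q0 powr u" "u < v \<Longrightarrow> q0 powr v < q0 powr u"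
  using q0 by (simp_all add: powr_def mult_right_mono_neg)

lemma kap_bound: assumes "0 \<le> s" shows "k0\<^sup>2 * q0 powr (- T0 + s) < 1"
proof -
  have "q0 powr s \<le> 1" using antimono_powr(1)[of 0 s] q0 assms by simp
  hence "k0\<^sup>2 * q0 powr (- T0) * q0 powr s \<le> k0\<^sup>2 * q0 powr (- T0) * 1" by (intro mult_left_mono) auto
  thus ?thesis using k0(2) unfolding powr_add mult.assoc[symmetric] by linarith
qed

text \<open>The signs follow from the position of \<open>r\<close> relative to the sides of the
  hexagon and from c be = k0^2 q0^(-T0) < 1. The chain c \<le> c be Q \<le> c be Q^2 gives a lower
  bound for \<open>D r\<close> that does not degenerate at the ends of the slice.\<close>

lemma shape_factors:
  assumes "LL0 < r" "r < UU0"
  defines "Q \<equiv> q0 powr (- r)"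
  shows "1 < Q" "Q < a1" "Q < a2" "c * be < Q" "c \<le> c * be * Q" "0 < Q - c" "q0 powr (- x - S0 + T0) < Q"
    "k0\<^sup>2 * q0 powr (- x + N0) < Q" "k0\<^sup>2 * q0 powr (- S0 + N0) < Q" "(1 - c * be) * Q\<^sup>2 \<le> D r" "0 < D r"
    "0 \<le> c" "0 \<le> k0\<^sup>2 * q0 powr (- x + N0)" "0 \<le> k0\<^sup>2 * q0 powr (- S0 + N0)" "0 \<le> c * be" "c * be < 1"
proof -
  have r: "0 < r" "x + S0 - T0 < r" "r < x + N0" "r < S0 + N0" using assms(1,2) by (simp_all add: LL0_def UU0_def)
  show Q1: "1 < Q" unfolding Q_def using antimono_powr(2)[of "- r" 0] r q0 by simp
  show "Q < a1" "Q < a2" "q0 powr (- x - S0 + T0) < Q"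
    unfolding Q_def a1_def a2_def using r by (auto intro!: antimono_powr(2))
  show cb1: "c * be < 1" unfolding constants(2) by (rule k0(2))
  thus "c * be < Q" using Q1 by linarith
  show c0: "0 \<le> c" "0 \<le> k0\<^sup>2 * q0 powr (- x + N0)" "0 \<le> k0\<^sup>2 * q0 powr (- S0 + N0)" "0 \<le> c * be" by (simp_all add: c_def be_def)
  have bQ: "q0 powr (- x - S0 + T0) < Q" unfolding Q_def using r by (auto intro!: antimono_powr(2))
  have "c = c * be * q0 powr (- x - S0 + T0)" using constants(5) by (metis mult.assoc mult.right_neutral)
  also have "\<dots> \<le> c * be * Q" using bQ c0 by (intro mult_left_mono) auto
  finally show cbQ: "c \<le> c * be * Q" .
  have "c * be * Q < 1 * Q" using cb1 Q1 by (intro mult_strict_right_mono) auto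
  thus "0 < Q - c" using cbQ by simp
  have "k0\<^sup>2 * q0 powr (- x + N0) < 1" using kap_bound[of "T0 - x + N0"] x N0 by simp
  thus "k0\<^sup>2 * q0 powr (- x + N0) < Q" using Q1 by linarith
  have "k0\<^sup>2 * q0 powr (- S0 + N0) < 1" using kap_bound[of "T0 - S0 + N0"] S0 N0 by simp
  thus "k0\<^sup>2 * q0 powr (- S0 + N0) < Q" using Q1 by linarith
  have "c * be * Q \<le> c * be * Q * Q" using mult_left_mono[of 1 Q "c * be * Q"] Q1 c0 by simp
  hence "c \<le> c * be * Q\<^sup>2" using cbQ by (simp add: power2_eq_square mult.assoc)
  thus D: "(1 - c * be) * Q\<^sup>2 \<le> D r" by (simp add: D_def Q_def algebra_simps)
  have "0 < (1 - c * be) * Q\<^sup>2" using cb1 Q1 by simp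
  thus "0 < D r" using D by linarith
qed

lemma shape_AB:
  "shape_A N0 T0 S0 q0 k0 x r = (q0 powr (- r) - a2) * (q0 powr (- r) - c * be) * (q0 powr (- r) - a1) * (q0 powr (- r) - c)"
  "shape_B N0 T0 S0 q0 k0 x r = a1 * (a2 * be) * (q0 powr (- r) - 1) * (q0 powr (- r) - k0\<^sup>2 * q0 powr (- x + N0)) *
     (q0 powr (- r) - q0 powr (- x - S0 + T0)) * (q0 powr (- r) - k0\<^sup>2 * q0 powr (- S0 + N0))"
  unfolding constants(1,2) by (simp_all add: shape_A_def shape_B_def c_def a1_def a2_def)

lemma upn_lim:
  assumes r: "LL0 < r" "r < UU0" and z: "(\<lambda>n. e n * of_int (z n)) \<longlonglongrightarrow> r"
  shows "(\<lambda>n. upn n (z n)) \<longlonglongrightarrow> aa r"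
proof -
  define Q where "Q = q0 powr (- r)"
  note f = shape_factors[OF r, folded Q_def]
  have w: "Q - c * (1 / Q) \<noteq> 0"
  proof -
    have "Q * (Q - c * (1 / Q)) = D r" using f(1) by (simp add: D_def Q_def[symmetric] field_simps power2_eq_square)
    thus ?thesis using f(11) by auto
  qed
  have "(\<lambda>n. upn n (z n)) \<longlonglongrightarrow> (Q - a2) * (1 - c * be * (1 / Q)) * ((Q - a1) * (1 - c * (1 / Q))) / ((Q - c * (1 / Q)) * (Q - c * (1 / Q)))"
    unfolding q_weights.up_def[OF qw] using w
    by (intro tendsto_divide tendsto_mult factor_lims[OF z, folded Q_def] factor_lims[OF add_lim[OF z], folded Q_def]) auto
  also have "(Q - a2) * (1 - c * be * (1 / Q)) * ((Q - a1) * (1 - c * (1 / Q))) / ((Q - c * (1 / Q)) * (Q - c * (1 / Q)))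
     = (Q * Q * ((Q - a2) * (1 - c * be * (1 / Q)) * ((Q - a1) * (1 - c * (1 / Q))))) / (Q * Q * ((Q - c * (1 / Q)) * (Q - c * (1 / Q))))"
    using f(1) by (intro mult_divide_mult_cancel_left[symmetric]) auto
  also have "Q * Q * ((Q - c * (1 / Q)) * (Q - c * (1 / Q))) = (D r)\<^sup>2"
    using f(1) by (simp add: D_def Q_def[symmetric] field_simps power2_eq_square)
  also have "Q * Q * ((Q - a2) * (1 - c * be * (1 / Q)) * ((Q - a1) * (1 - c * (1 / Q)))) = shape_A N0 T0 S0 q0 k0 x r"
    unfolding shape_AB Q_def[symmetric] using f(1) by (simp add: field_simps)
  finally show ?thesis unfolding aa_def .
qed

lemma dnn_lim:
  assumes r: "LL0 < r" "r < UU0" and z: "(\<lambda>n. e n * of_int (z n)) \<longlonglongrightarrow> r"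
  shows "(\<lambda>n. dnn n (z n)) \<longlonglongrightarrow> bb r"
proof -
  define Q where "Q = q0 powr (- r)"
  note f = shape_factors[OF r, folded Q_def]
  have w: "Q - c * (1 / Q) \<noteq> 0"
  proof -
    have "Q * (Q - c * (1 / Q)) = D r" using f(1) by (simp add: D_def Q_def[symmetric] field_simps power2_eq_square)
    thus ?thesis using f(11) by auto
  qed
  have "(\<lambda>n. dnn n (z n)) \<longlonglongrightarrow> (c * (1 / Q) - a2) * (1 - be * Q) * ((c * (1 / Q) - a1) * (1 - Q)) / ((Q - c * (1 / Q)) * (Q - c * (1 / Q)))"
    unfolding q_weights.dn_def[OF qw] using w
    by (intro tendsto_divide tendsto_mult factor_lims[OF z, folded Q_def]) auto
  also have "(c * (1 / Q) - a2) * (1 - be * Q) * ((c * (1 / Q) - a1) * (1 - Q)) / ((Q - c * (1 / Q)) * (Q - c * (1 / Q)))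
     = (Q * Q * ((c * (1 / Q) - a2) * (1 - be * Q) * ((c * (1 / Q) - a1) * (1 - Q)))) / (Q * Q * ((Q - c * (1 / Q)) * (Q - c * (1 / Q))))"
    using f(1) by (intro mult_divide_mult_cancel_left[symmetric]) auto
  also have "Q * Q * ((Q - c * (1 / Q)) * (Q - c * (1 / Q))) = (D r)\<^sup>2"
    using f(1) by (simp add: D_def Q_def[symmetric] field_simps power2_eq_square)
  also have "Q * Q * ((c * (1 / Q) - a2) * (1 - be * Q) * ((c * (1 / Q) - a1) * (1 - Q))) = shape_B N0 T0 S0 q0 k0 x r"
  proof -
    define u v w where "u = k0\<^sup>2 * q0 powr (- x + N0)" and "v = k0\<^sup>2 * q0 powr (- S0 + N0)" and "w = q0 powr (- x - S0 + T0)"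
    have "Q * (c * (1 / Q) - a2) = a2 * (u - Q)" using f(1) constants(3)[folded u_def] by (simp add: field_simps)
    moreover have "Q * (c * (1 / Q) - a1) = a1 * (v - Q)" using f(1) constants(4)[folded v_def] by (simp add: field_simps)
    moreover have "1 - be * Q = be * (w - Q)" using constants(5)[folded w_def] by (simp add: algebra_simps)
    moreover have "Q * Q * ((c * (1 / Q) - a2) * (1 - be * Q) * ((c * (1 / Q) - a1) * (1 - Q)))
       = (Q * (c * (1 / Q) - a2)) * (1 - be * Q) * (Q * (c * (1 / Q) - a1)) * (1 - Q)" by (simp only: ac_simps)
    ultimately have "Q * Q * ((c * (1 / Q) - a2) * (1 - be * Q) * ((c * (1 / Q) - a1) * (1 - Q)))
       = (a2 * (u - Q)) * (be * (w - Q)) * (a1 * (v - Q)) * (1 - Q)" by (simp only:)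
    also have "\<dots> = a1 * (a2 * be) * (Q - 1) * (Q - u) * (Q - w) * (Q - v)" by (simp add: algebra_simps)
    finally show ?thesis unfolding shape_AB Q_def[symmetric] u_def v_def w_def .
  qed
  finally show ?thesis unfolding bb_def .
qed

text \<open>The products in the numerators are at most a constant times Q^4, and the denominator is
  at least (1 - c be)^2 Q^4. The resulting bounds are uniform in \<open>r\<close> and supply the
  constant of the locale \<open>weyl\<close>.\<close>

lemma aa_bb:
  assumes r: "LL0 < r" "r < UU0"
  shows "0 < aa r" "0 < bb r" "aa r \<le> a1 * a2 / (1 - c * be)\<^sup>2" "bb r \<le> a1 * (a2 * be) / (1 - c * be)\<^sup>2"
proof -
  define Q where "Q = q0 powr (- r)"
  note f = shape_factors[OF r, folded Q_def]
  define G where "G = 1 - c * be"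
  have G: "0 < G" using f(16) by (simp add: G_def)
  define u v w where "u = k0\<^sup>2 * q0 powr (- x + N0)" and "v = k0\<^sup>2 * q0 powr (- S0 + N0)" and "w = q0 powr (- x - S0 + T0)"
  have pos: "0 < a1" "0 < a2" "0 < be" "0 < w" using q0 by (simp_all add: a1_def a2_def be_def w_def)
  have A: "shape_A N0 T0 S0 q0 k0 x r = ((a2 - Q) * (a1 - Q)) * ((Q - c * be) * (Q - c))"
    unfolding shape_AB Q_def[symmetric] by (simp add: algebra_simps)
  have B: "shape_B N0 T0 S0 q0 k0 x r = a1 * (a2 * be) * (((Q - 1) * (Q - u)) * ((Q - w) * (Q - v)))"
    unfolding shape_AB Q_def[symmetric] u_def v_def w_def by (simp add: mult_ac)
  have A0: "0 < shape_A N0 T0 S0 q0 k0 x r" unfolding A using f by (intro mult_pos_pos) auto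
  have B0: "0 < shape_B N0 T0 S0 q0 k0 x r" unfolding B u_def v_def w_def using f pos by (intro mult_pos_pos) auto
  show "0 < aa r" "0 < bb r" using A0 B0 f(11) by (simp_all add: aa_def bb_def)
  have D2: "G\<^sup>2 * (Q * Q * (Q * Q)) \<le> (D r)\<^sup>2"
  proof -
    have "(G * Q\<^sup>2)\<^sup>2 \<le> (D r)\<^sup>2" using f(10)[folded G_def] G by (intro power_mono) auto
    thus ?thesis by (simp add: power2_eq_square mult_ac)
  qed
  have Gp: "0 < G\<^sup>2 * (Q * Q * (Q * Q))" using G f(1) by simp
  have Q1: "1 \<le> Q * Q" using mult_mono[of 1 Q 1 Q] f(1) by simp
  have "shape_A N0 T0 S0 q0 k0 x r \<le> (a2 * a1) * (Q * Q)"
    unfolding A using f pos by (intro mult_mono mult_nonneg_nonneg) auto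
  also have "\<dots> \<le> (a2 * a1) * (Q * Q * (Q * Q))"
    using Q1 pos mult_left_mono[of 1 "Q * Q" "Q * Q"] by (intro mult_left_mono) auto
  finally have "aa r \<le> (a2 * a1) * (Q * Q * (Q * Q)) / (G\<^sup>2 * (Q * Q * (Q * Q)))"
    unfolding aa_def using A0 D2 Gp pos f(1) by (intro frac_le) auto
  thus "aa r \<le> a1 * a2 / (1 - c * be)\<^sup>2" unfolding G_def[symmetric] using f(1) by (simp add: mult.commute[of a2])
  have "shape_B N0 T0 S0 q0 k0 x r \<le> a1 * (a2 * be) * (Q * Q * (Q * Q))"
    unfolding B u_def v_def w_def using f pos by (intro mult_mono mult_left_mono mult_nonneg_nonneg) auto
  hence "bb r \<le> a1 * (a2 * be) * (Q * Q * (Q * Q)) / (G\<^sup>2 * (Q * Q * (Q * Q)))"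
    unfolding bb_def using B0 D2 Gp pos f(1) by (intro frac_le) auto
  thus "bb r \<le> a1 * (a2 * be) / (1 - c * be)\<^sup>2" unfolding G_def[symmetric] using f(1) by simp
qed

text \<open>The limit of the eigenvalues with index about \<open>s / e n\<close>.\<close>

definition level :: "real \<Rightarrow> real" where "level s = (1 / q0 powr s - 1) * (q0 powr (-2 * N0 - T0) * q0 powr s - 1)"

lemma lam_lim:
  assumes "(\<lambda>n. e n * real (z n)) \<longlonglongrightarrow> s" shows "(\<lambda>n. lam n (z n)) \<longlonglongrightarrow> level s"
proof -
  have "(\<lambda>n. qn n powi (1 - 2 * cN n - cT n)) \<longlonglongrightarrow> q0 powr (-2 * N0 - T0)"
    using powi_lim[OF lin_lims(6)] by (simp add: algebra_simps)
  thus ?thesis unfolding level_def q_weights.ev_factor[OF qw] using power_lim[OF assms] q0 by (intro tendsto_intros) auto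
qed

lemma level_strict_mono:
  assumes "u < v" "u + v < 2 * N0 + T0" shows "level u < level v"
proof -
  define R where "R = q0 powr (-2 * N0 - T0)"
  have p: "0 < q0 powr u" "0 < q0 powr v" "q0 powr v < q0 powr u" using q0 assms(1) antimono_powr(2) by simp_all
  have "R * (q0 powr u * q0 powr v) = q0 powr (-2 * N0 - T0 + (u + v))" by (simp add: R_def powr_add)
  also have "\<dots> > q0 powr 0" using assms(2) by (intro antimono_powr(2)) simp
  finally have "R * (q0 powr u * q0 powr v) > 1" using q0 by simp
  hence "0 < (q0 powr u - q0 powr v) * (R * (q0 powr u * q0 powr v) - 1) / (q0 powr u * q0 powr v)" using p by simp
  also have "\<dots> = level v - level u" unfolding level_def R_def[symmetric] using p by (simp add: field_simps)
  finally show ?thesis by simp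
qed

text \<open>A slice has at most N + T / 2 sites, so any two of its indices satisfy the condition of
  \<open>ev_mono\<close>.\<close>

lemma card_bounds: "int (card {lo n..hi n}) \<le> cN n + cT n" "2 * int (card {lo n..hi n}) \<le> 2 * cN n + cT n" "Nn n \<le> card {lo n..hi n}"
proof -
  have s: "Sn n < Tn n" "0 < Sn n" using qt[of n] by (simp_all add: q_tilings_def q_tilings_axioms_def)
  have c: "int (card {lo n..hi n}) = hi n + 1 - lo n" using tn[of n] s by simp
  show "int (card {lo n..hi n}) \<le> cN n + cT n" "2 * int (card {lo n..hi n}) \<le> 2 * cN n + cT n"
    unfolding c using tn[of n] s by (simp_all add: min_def max_def)
  have "int (Nn n) \<le> int (card {lo n..hi n})" unfolding c using tn[of n] s by (simp add: min_def max_def)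
  thus "Nn n \<le> card {lo n..hi n}" by (simp only: of_nat_le_iff)
qed

text \<open>The eigenvalues increase with the index, so a uniform statement follows by comparison
  with the two indices near \<open>u / e n\<close> and \<open>v / e n\<close>, where the pointwise
  limit \<open>lam_lim\<close> applies.\<close>

lemma lam_threshold:
  assumes \<delta>: "\<delta> > 0"
  shows "\<exists>\<gamma>>0. eventually (\<lambda>n. \<forall>k<card {lo n..hi n}.
        (e n * real k < N0 - \<delta> \<longrightarrow> lam n k \<le> level N0 - \<gamma>) \<and> (e n * real k > N0 + \<delta> \<longrightarrow> lam n k \<ge> level N0 + \<gamma>)) sequentially"
proof -
  \<comment> \<open>\<open>d \<le> N0\<close> keeps \<open>u\<close> nonnegative, and
    \<open>d < T0\<close> makes \<open>N0 + v\<close> smaller than \<open>2 * N0 + T0\<close>, so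
    that \<open>level_strict_mono\<close> applies to \<open>N0\<close> and \<open>v\<close>.\<close>
  define d where "d = min \<delta> (min N0 (T0 / 2))"
  have d: "0 < d" "d \<le> \<delta>" "d \<le> N0" "d < T0" using \<delta> N0 T0 by (auto simp: d_def)
  define u v where "u = N0 - d" and "v = N0 + d"
  have l: "level u < level N0" "level N0 < level v" using d N0 T0 by (auto simp: u_def v_def intro!: level_strict_mono)
  define \<gamma> where "\<gamma> = min (level N0 - level u) (level v - level N0) / 2"
  have \<gamma>: "0 < \<gamma>" "level u < level N0 - \<gamma>" "level N0 + \<gamma> < level v" using l by (auto simp: \<gamma>_def min_def field_simps)
  have fl: "(\<lambda>n. e n * real (nat \<lfloor>s / e n\<rfloor>)) \<longlonglongrightarrow> s" if "0 \<le> s" for s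
  proof -
    have "real (nat \<lfloor>s / e n\<rfloor>) = of_int (\<lfloor>s / e n\<rfloor> + 0)" for n using that e_pos[of n] by simp
    thus ?thesis using scaled_floor_lim[OF e_pos e_lim, of s 0] by (simp only:)
  qed
  have uv0: "0 \<le> u" "0 \<le> v" using d N0 by (simp_all add: u_def v_def)
  have "eventually (\<lambda>n. lam n (nat \<lfloor>u / e n\<rfloor>) < level N0 - \<gamma>) sequentially" by (rule order_tendstoD(2)[OF lam_lim[OF fl[OF uv0(1)]] \<gamma>(2)])
  moreover have "eventually (\<lambda>n. level N0 + \<gamma> < lam n (nat \<lfloor>v / e n\<rfloor>)) sequentially" by (rule order_tendstoD(1)[OF lam_lim[OF fl[OF uv0(2)]] \<gamma>(3)])
  moreover have "eventually (\<lambda>n. e n * real (nat \<lfloor>u / e n\<rfloor>) - e n * real (Nn n) < 0) sequentially"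
    using d(1) by (intro order_tendstoD(2)[OF tendsto_diff[OF fl[OF uv0(1)] N_lim]]) (simp add: u_def)
  ultimately have "eventually (\<lambda>n. \<forall>k<card {lo n..hi n}.
        (e n * real k < N0 - \<delta> \<longrightarrow> lam n k \<le> level N0 - \<gamma>) \<and> (e n * real k > N0 + \<delta> \<longrightarrow> lam n k \<ge> level N0 + \<gamma>)) sequentially"
  proof eventually_elim
    case (elim n)
    have le: "lam n j \<le> lam n k" if "j \<le> k" "k < card {lo n..hi n}" for j k
      using that card_bounds(2)[of n] by (intro q_weights.ev_mono[OF qw]) linarith+
    have uN: "nat \<lfloor>u / e n\<rfloor> < card {lo n..hi n}"
    proof -
      have "e n * real (nat \<lfloor>u / e n\<rfloor>) < e n * real (Nn n)" using elim(3) by linarith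
      hence "nat \<lfloor>u / e n\<rfloor> < Nn n" unfolding mult_less_cancel_left_pos[OF e_pos] of_nat_less_iff .
      thus ?thesis using card_bounds(3)[of n] by (rule less_le_trans)
    qed
    show ?case
    proof (intro allI impI conjI)
      fix k assume k: "k < card {lo n..hi n}"
      { assume "e n * real k < N0 - \<delta>"
        hence "real k * e n \<le> u" using d by (simp add: u_def mult.commute)
        hence "real k \<le> u / e n" using e_pos[of n] by (simp add: pos_le_divide_eq)
        hence "k \<le> nat \<lfloor>u / e n\<rfloor>" by (simp add: le_nat_floor)
        from le[OF this uN] elim(1) show "lam n k \<le> level N0 - \<gamma>" by linarith }
      { assume "e n * real k > N0 + \<delta>"
        hence "v \<le> real k * e n" using d by (simp add: v_def mult.commute)
        hence "v / e n \<le> real k" using e_pos[of n] by (simp add: pos_divide_le_eq)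
        hence "nat \<lfloor>v / e n\<rfloor> \<le> k" by linarith
        from le[OF this k] elim(2) show "lam n k \<ge> level N0 + \<gamma>" by linarith }
    qed
  qed
  thus ?thesis using \<gamma>(1) by blast
qed

text \<open>The constant factor in the limit shape is \<open>- level N0\<close>. The rest is an
  expansion of numerator and denominator by the square of \<open>D r\<close>.\<close>

lemma phi_formula:
  assumes r: "LL0 < r" "r < UU0"
  shows "shape_phi N0 T0 S0 q0 k0 x r = arccos_clamped ((aa r + bb r - level N0) / (2 * sqrt (aa r * bb r)))"
proof -
  have h: "(x, r) \<in> limit_hexagon N0 T0 S0" using r x by (auto simp: limit_hexagon_def LL0_def UU0_def)
  define A B where "A = shape_A N0 T0 S0 q0 k0 x r" and "B = shape_B N0 T0 S0 q0 k0 x r"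
  have D: "D r > 0" by (rule shape_factors(11)[OF r])
  have D': "q0 powr (-2 * r) - k0\<^sup>2 * q0 powr (- x - S0) = D r"
    unfolding D_def c_def power2_eq_square powr_add[symmetric] by simp
  have "1 / q0 powr N0 = q0 powr (- N0)" by (simp add: powr_minus divide_simps)
  moreover have "q0 powr (-2 * N0 - T0) * q0 powr N0 = q0 powr (- N0 - T0)"
    unfolding powr_add[symmetric] by (rule arg_cong[of _ _ "(powr) q0"]) simp
  ultimately have lev: "(q0 powr (- N0) - 1) * (1 - q0 powr (- N0 - T0)) = - level N0"
    unfolding level_def by (simp add: algebra_simps)
  have s: "sqrt (aa r * bb r) = sqrt (A * B) / (D r)\<^sup>2"
  proof -
    have "aa r * bb r = A * B / ((D r)\<^sup>2)\<^sup>2" by (simp add: aa_def bb_def A_def B_def power2_eq_square)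
    thus ?thesis by (simp only: real_sqrt_divide real_sqrt_abs abs_power2)
  qed
  have "(aa r + bb r - level N0) / (2 * sqrt (aa r * bb r)) = ((D r)\<^sup>2 * (aa r + bb r - level N0)) / ((D r)\<^sup>2 * (2 * sqrt (aa r * bb r)))"
    using D by (intro mult_divide_mult_cancel_left[symmetric]) auto
  also have "(D r)\<^sup>2 * (aa r + bb r - level N0) = - level N0 * (D r)\<^sup>2 + A + B"
    using D by (simp add: aa_def bb_def A_def B_def algebra_simps)
  also have "(D r)\<^sup>2 * (2 * sqrt (aa r * bb r)) = 2 * sqrt (A * B)" unfolding s using D by simp
  finally show ?thesis unfolding shape_phi_def D' lev A_def B_def using h by simp
qed

end

section \<open>Law of large numbers along a sequence of scales\<close>

lemma (in q_tilings) tiling_prob_mono: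
  assumes "E \<subseteq> F" "F \<subseteq> tilings"
  shows "measure (tiling_measure Nn (Tn - Sn) Sn q \<kappa>) E \<le> measure (tiling_measure Nn (Tn - Sn) Sn q \<kappa>) F"
proof -
  have pos: "0 \<le> rel_weight \<T>" if "\<T> \<in> tilings" for \<T> using rel_weight_pos[OF that] by simp
  have "(\<Sum>\<T>\<in>E. rel_weight \<T>) \<le> (\<Sum>\<T>\<in>F. rel_weight \<T>)"
    using assms pos finite_subset[OF assms(2) finite_tilings] by (intro sum_mono2) auto
  moreover have "0 \<le> (\<Sum>\<T>\<in>tilings. rel_weight \<T>)" using pos by (intro sum_nonneg)
  ultimately show ?thesis unfolding tiling_prob[OF subset_trans[OF assms]] tiling_prob[OF assms(2)] by (rule divide_right_mono)
qed

context scaling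
begin

lemma rng_eq: "rng (cN n) (cT n) (cS n) (ct n) = {lo n..hi n}" by (simp add: rng_def)

lemma LU0: "LL0 < UU0"
  unfolding LL0_def UU0_def using x S0 N0 by (auto simp: max_def min_def)

lemma lo_lim: "(\<lambda>n. e n * of_int (lo n)) \<longlonglongrightarrow> LL0"
proof -
  have "(\<lambda>n. max 0 (e n * of_int (ct n + cS n - cT n))) \<longlonglongrightarrow> LL0"
    unfolding LL0_def by (intro tendsto_max tendsto_const lin_lims(3))
  moreover have "max 0 (e n * of_int (ct n + cS n - cT n)) = e n * of_int (lo n)" for n
    using e_pos[of n] unfolding of_int_max max_mult_distrib_left by (simp add: max_mult_distrib_left)
  ultimately show ?thesis by simp
qed

lemma hi_lim: "(\<lambda>n. e n * of_int (hi n)) \<longlonglongrightarrow> UU0"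
proof -
  have "(\<lambda>n. min (e n * real (tn n)) (e n * real (Sn n)) + e n * real (Nn n) + e n * (- 1)) \<longlonglongrightarrow> min x S0 + N0 + 0"
    by (intro tendsto_add tendsto_min t_lim S_lim N_lim const_lim)
  moreover have "min (e n * real (tn n)) (e n * real (Sn n)) + e n * real (Nn n) + e n * (- 1) = e n * of_int (hi n)" for n
  proof -
    have "min (e n * real (tn n)) (e n * real (Sn n)) = e n * min (real (tn n)) (real (Sn n))"
      using e_pos[of n] by (auto simp: min_def)
    thus ?thesis by (simp add: distrib_left right_diff_distrib of_int_min)
  qed
  ultimately show ?thesis by (simp add: UU0_def)
qed

lemma ev_uniform: "\<exists>K. \<forall>n k. k < card {lo n..hi n} \<longrightarrow> 0 \<le> lam n k \<and> lam n k \<le> K"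
proof -
  have "(\<lambda>n. qn n powi (1 - 2 * cN n - cT n)) \<longlonglongrightarrow> q0 powr (-2 * N0 - T0)"
    using powi_lim[OF lin_lims(6)] by (simp add: algebra_simps)
  hence "Bseq (\<lambda>n. qn n powi (1 - 2 * cN n - cT n))" by (intro convergent_imp_Bseq convergentI)
  then obtain K where K: "\<And>n. norm (qn n powi (1 - 2 * cN n - cT n)) \<le> K" by (rule BseqE) blast
  have "0 \<le> lam n k \<and> lam n k \<le> K" if "k < card {lo n..hi n}" for n k
  proof -
    have k: "int k \<le> 2 * cN n + cT n - 1" using that card_bounds(1)[of n] by linarith
    show ?thesis
    proof
      show "0 \<le> lam n k" by (rule q_weights.ev_bounds(1)[OF qw k])
      show "lam n k \<le> K" using q_weights.ev_bounds(2)[OF qw k, of "cS n" "ct n"] K[of n] unfolding real_norm_def by linarith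
    qed
  qed
  thus ?thesis by blast
qed

theorem slice_limit:
  assumes y: "LL0 \<le> y" "y \<le> UU0" and \<eta>: "\<eta> > 0"
  shows "(\<lambda>n. measure (tiling_measure (Nn n) (Tn n - Sn n) (Sn n) (qn n) (kn n))
     {\<T> \<in> lozenge_tilings (Nn n) (Tn n - Sn n) (Sn n).
        \<bar>e n * real (card (particles \<T> (ct n) \<inter> {..\<lfloor>y / e n\<rfloor>})) - (\<integral>r. indicator {LL0<..<y} r * (shape_phi N0 T0 S0 q0 k0 x r / pi) \<partial>lborel)\<bar> > \<eta>}) \<longlonglongrightarrow> 0"
proof -
  have "\<forall>n. \<exists>P. q_tilings.slice_basis (qn n) (kn n) (Nn n) (Tn n) (Sn n) (tn n) P"
    using q_tilings.slice_basis_exists[OF qt tn] by blast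
  then obtain P where P: "\<And>n. q_tilings.slice_basis (qn n) (kn n) (Nn n) (Tn n) (Sn n) (tn n) (P n)" by metis
  note basis = P[unfolded q_tilings.slice_basis_def[OF qt] rng_eq]
  obtain K where K: "\<And>n k. k < card {lo n..hi n} \<Longrightarrow> 0 \<le> lam n k \<and> lam n k \<le> K" using ev_uniform by blast
  \<comment> \<open>The maximum bounds both the eigenvalues and twice the sum of the limiting
    coefficients, the upper bound of the symbol.\<close>
  define \<Lambda> where "\<Lambda> = max K (2 * (a1 * a2 / (1 - c * be)\<^sup>2 + a1 * (a2 * be) / (1 - c * be)\<^sup>2))"
  interpret weyl e lo hi upn dnn Wn P lam LL0 UU0 \<Lambda> aa bb
  proof
    show "0 < Wn n z" if "z \<in> {lo n..hi n}" for n z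
      using q_tilings.slice_Wt_pos[OF qt, of z n "ct n"] that by (simp only: rng_eq)
    show "upn n z * (P n k z - P n k (z + 1)) + dnn n z * (P n k z - P n k (z - 1)) = lam n k * P n k z"
      if "k < card {lo n..hi n}" "z \<in> {lo n..hi n}" for n k z using basis[of n] that by blast
    show "(\<Sum>k<card {lo n..hi n}. P n k z * P n k z' * Wn n z') = of_bool (z = z')"
      if "z \<in> {lo n..hi n}" "z' \<in> {lo n..hi n}" for n z z' using basis[of n] that by blast
    show "(\<Sum>z\<in>{lo n..hi n}. P n k z ^ 2 * Wn n z) = 1" if "k < card {lo n..hi n}" for n k using basis[of n] that by blast
    show "0 \<le> lam n k \<and> lam n k \<le> \<Lambda>" if "k < card {lo n..hi n}" for n k using K[OF that] by (auto simp: \<Lambda>_def)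
    have fl: "(\<lambda>n. e n * of_int (\<lfloor>r / e n\<rfloor> + i)) \<longlonglongrightarrow> r" for r i by (rule scaled_floor_lim[OF e_pos e_lim])
    show "(\<lambda>n. upn n (\<lfloor>r / e n\<rfloor> + i)) \<longlonglongrightarrow> aa r" "(\<lambda>n. dnn n (\<lfloor>r / e n\<rfloor> + i)) \<longlonglongrightarrow> bb r"
      if "LL0 < r" "r < UU0" for r i by (rule upn_lim[OF that fl], rule dnn_lim[OF that fl])
    show "aa r > 0 \<and> bb r > 0 \<and> 2 * (aa r + bb r) \<le> \<Lambda>" if "LL0 < r" "r < UU0" for r
    proof -
      have "2 * (aa r + bb r) \<le> 2 * (a1 * a2 / (1 - c * be)\<^sup>2 + a1 * (a2 * be) / (1 - c * be)\<^sup>2)"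
        using aa_bb(3,4)[OF that] by (intro mult_left_mono add_mono) auto
      thus ?thesis using aa_bb(1,2)[OF that] by (auto simp: \<Lambda>_def)
    qed
  qed (rule e_pos e_lim lo_lim hi_lim LU0)+
  define I where "I = (\<integral>r. indicator {LL0<..<y} r * (shape_phi N0 T0 S0 q0 k0 x r / pi) \<partial>lborel)"
  define m where "m = (\<lambda>n. \<Sum>k<Nn n. \<Sum>z\<in>{lo n..hi n} \<inter> {..\<lfloor>y / e n\<rfloor>}. P n k z ^ 2 * Wn n z)"
  have "(\<lambda>n. e n * m n) \<longlonglongrightarrow> I"
    unfolding I_def m_def
    by (rule weyl_count[OF card_bounds(3) N_lim lam_threshold shape_phi_measurable shape_phi_range phi_formula y])
  hence ev: "eventually (\<lambda>n. \<bar>e n * m n - I\<bar> < \<eta> / 2) sequentially"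
    using tendstoD[of _ I sequentially "\<eta> / 2"] \<eta> by (simp add: dist_real_def)
  define Pr where "Pr = (\<lambda>n. measure (tiling_measure (Nn n) (Tn n - Sn n) (Sn n) (qn n) (kn n)))"
  define TT where "TT = (\<lambda>n. lozenge_tilings (Nn n) (Tn n - Sn n) (Sn n))"
  define X where "X = (\<lambda>n \<T>. real (card (particles \<T> (ct n) \<inter> {..\<lfloor>y / e n\<rfloor>})))"
  have bound: "Pr n {\<T> \<in> TT n. \<bar>e n * X n \<T> - I\<bar> > \<eta>} \<le> 4 / \<eta>\<^sup>2 * (e n * (e n * real (Nn n)))" if n: "\<bar>e n * m n - I\<bar> < \<eta> / 2" for n
  proof -
    \<comment> \<open>Half of \<eta> is spent on the distance of the mean from its limit. For the
      other half, deviations of size \<eta> / (2 e) have Chebyshev bound 4 e^2 N / \<eta>^2, which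
      is of order e.\<close>
    have d: "0 < \<eta> / (2 * e n)" using \<eta> e_pos[of n] by simp
    have sub: "{\<T> \<in> TT n. \<bar>e n * X n \<T> - I\<bar> > \<eta>} \<subseteq> {\<T> \<in> TT n. \<bar>X n \<T> - m n\<bar> > \<eta> / (2 * e n)}"
    proof safe
      fix \<T> assume "\<bar>e n * X n \<T> - I\<bar> > \<eta>"
      hence "\<bar>e n * X n \<T> - e n * m n\<bar> > \<eta> / 2" using n by linarith
      hence "\<eta> / 2 < \<bar>X n \<T> - m n\<bar> * e n" using e_pos[of n] by (simp add: abs_mult mult.commute flip: right_diff_distrib)
      thus "\<eta> / (2 * e n) < \<bar>X n \<T> - m n\<bar>" using e_pos[of n] by (simp add: pos_divide_less_eq mult_ac)
    qed
    have "Pr n {\<T> \<in> TT n. \<bar>e n * X n \<T> - I\<bar> > \<eta>} \<le> Pr n {\<T> \<in> TT n. \<bar>X n \<T> - m n\<bar> > \<eta> / (2 * e n)}"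
      unfolding Pr_def by (rule q_tilings.tiling_prob_mono[OF qt sub]) (auto simp: TT_def)
    also have "\<dots> \<le> real (Nn n) / (\<eta> / (2 * e n))\<^sup>2"
      using basis[of n] d unfolding Pr_def TT_def X_def m_def by blast
    also have "\<dots> = 4 / \<eta>\<^sup>2 * (e n * (e n * real (Nn n)))" using e_pos[of n] \<eta> by (simp add: field_simps power2_eq_square)
    finally show ?thesis .
  qed
  have "(\<lambda>n. 4 / \<eta>\<^sup>2 * (e n * (e n * real (Nn n)))) \<longlonglongrightarrow> 4 / \<eta>\<^sup>2 * (0 * N0)" by (intro tendsto_intros e_lim N_lim)
  hence lim: "(\<lambda>n. 4 / \<eta>\<^sup>2 * (e n * (e n * real (Nn n)))) \<longlonglongrightarrow> 0" by simp
  have "(\<lambda>n. Pr n {\<T> \<in> TT n. \<bar>e n * X n \<T> - I\<bar> > \<eta>}) \<longlonglongrightarrow> 0"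
  proof (rule tendsto_sandwich[OF _ _ tendsto_const lim])
    show "eventually (\<lambda>n. 0 \<le> Pr n {\<T> \<in> TT n. \<bar>e n * X n \<T> - I\<bar> > \<eta>}) sequentially" by (simp add: Pr_def)
    show "eventually (\<lambda>n. Pr n {\<T> \<in> TT n. \<bar>e n * X n \<T> - I\<bar> > \<eta>} \<le> 4 / \<eta>\<^sup>2 * (e n * (e n * real (Nn n)))) sequentially"
      using ev by eventually_elim (rule bound)
  qed
  thus ?thesis unfolding Pr_def TT_def X_def I_def .
qed

end

text \<open>The density vanishes below the hexagon, so the gauge integral from 0 is a Lebesgue
  integral over the part of the slice below \<open>y\<close>; the end points form a null
  set.\<close>

lemma limit_height_lborel:
  assumes y: "max 0 (x + S - T) \<le> y"
  shows "limit_height N T S q k x y = (\<integral>r. indicator {max 0 (x + S - T)<..<y} r * (shape_phi N T S q k x r / pi) \<partial>lborel)"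
proof -
  define \<phi> where "\<phi> = shape_phi N T S q k x"
  define L where "L = max 0 (x + S - T)"
  have L: "0 \<le> L" by (simp add: L_def)
  have m: "\<phi> \<in> borel_measurable borel" unfolding \<phi>_def by (rule shape_phi_measurable)
  have z: "\<phi> r = 0" if "r < L" for r using that by (auto simp: \<phi>_def shape_phi_def limit_hexagon_def L_def)
  have si: "set_integrable lborel {0..y} \<phi>"
    unfolding set_integrable_def
  proof (rule Bochner_Integration.integrable_bound[of lborel "\<lambda>r. indicator {0..y} r * pi"])
    show "integrable lborel (\<lambda>r. indicator {0..y} r * pi)"
      by (intro integrable_mult_left integrable_real_indicator) (auto simp: emeasure_lborel_Icc_eq)
    show "(\<lambda>r. indicat_real {0..y} r *\<^sub>R \<phi> r) \<in> borel_measurable lborel" using m by measurable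
    have "norm (indicat_real {0..y} r *\<^sub>R \<phi> r) \<le> norm (indicator {0..y} r * pi)" for r
      using shape_phi_range[of N T S q k x r] by (auto simp: \<phi>_def indicator_def)
    thus "AE r in lborel. norm (indicat_real {0..y} r *\<^sub>R \<phi> r) \<le> norm (indicator {0..y} r * pi)" by simp
  qed
  have "integral {0..y} \<phi> = (\<integral>r. indicator {0..y} r *\<^sub>R \<phi> r \<partial>lborel)"
    using set_borel_integral_eq_integral(2)[OF si] by (simp add: set_lebesgue_integral_def)
  also have "\<dots> = (\<integral>r. indicator {L<..<y} r * \<phi> r \<partial>lborel)"
  proof (rule integral_cong_AE)
    show "(\<lambda>r. indicat_real {0..y} r *\<^sub>R \<phi> r) \<in> borel_measurable lborel" "(\<lambda>r. indicator {L<..<y} r * \<phi> r) \<in> borel_measurable lborel"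
      using m by measurable
    have "AE r in lborel. r \<noteq> L" "AE r in lborel. r \<noteq> y" by (rule AE_lborel_singleton)+
    thus "AE r in lborel. indicat_real {0..y} r *\<^sub>R \<phi> r = indicator {L<..<y} r * \<phi> r"
    proof eventually_elim
      case (elim r)
      thus ?case using L z[of r] by (cases "r < L") (auto simp: indicator_def)
    qed
  qed
  finally have "1 / pi * integral {0..y} \<phi> = 1 / pi * (\<integral>r. indicator {L<..<y} r * \<phi> r \<partial>lborel)" by simp
  also have "\<dots> = (\<integral>r. 1 / pi * (indicator {L<..<y} r * \<phi> r) \<partial>lborel)" by (rule Bochner_Integration.integral_mult_right_zero[symmetric])
  finally show ?thesis by (simp add: limit_height_def \<phi>_def[symmetric] L_def[symmetric])
qed

section \<open>From asymptotic parameters to sequences of scales\<close>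

lemma bigo_one_scaled:
  fixes f :: "real \<Rightarrow> nat"
  assumes "(\<lambda>\<epsilon>. real (f \<epsilon>) - c / \<epsilon>) \<in> O[at_right 0](\<lambda>_. 1)"
  shows "((\<lambda>\<epsilon>. \<epsilon> * real (f \<epsilon>)) \<longlongrightarrow> c) (at_right 0)"
proof -
  obtain C where C: "eventually (\<lambda>\<epsilon>. norm (real (f \<epsilon>) - c / \<epsilon>) \<le> C * norm (1::real)) (at_right 0)"
    using assms by (elim landau_o.bigE)
  have "((\<lambda>\<epsilon>. \<epsilon> * real (f \<epsilon>) - c) \<longlongrightarrow> 0) (at_right 0)"
  proof (rule Lim_null_comparison)
    show "((\<lambda>\<epsilon>::real. \<epsilon> * C) \<longlongrightarrow> 0) (at_right 0)" by (auto intro!: tendsto_eq_intros)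
    show "eventually (\<lambda>\<epsilon>. norm (\<epsilon> * real (f \<epsilon>) - c) \<le> \<epsilon> * C) (at_right 0)"
      using C eventually_at_right_less[of 0]
    proof eventually_elim
      case (elim \<epsilon>)
      have "\<epsilon> * real (f \<epsilon>) - c = \<epsilon> * (real (f \<epsilon>) - c / \<epsilon>)" using elim(2) by (simp add: field_simps)
      thus ?case using elim by (simp add: abs_mult)
    qed
  qed
  thus ?thesis by (simp add: LIM_zero_iff)
qed

lemma bigo_id_tendsto:
  assumes "(\<lambda>\<epsilon>. f \<epsilon> - c) \<in> O[at_right 0](\<lambda>\<epsilon>. \<epsilon>)" shows "(f \<longlongrightarrow> (c::real)) (at_right 0)"
proof -
  obtain C where C: "eventually (\<lambda>\<epsilon>. norm (f \<epsilon> - c) \<le> C * norm (\<epsilon>::real)) (at_right 0)" using assms by (elim landau_o.bigE)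
  have "((\<lambda>\<epsilon>::real. C * norm \<epsilon>) \<longlongrightarrow> 0) (at_right 0)" by (auto intro!: tendsto_eq_intros)
  from Lim_null_comparison[OF C this] show ?thesis by (simp add: LIM_zero_iff)
qed

text \<open>The derivative of q0^\<epsilon> at 0 and the quadratic error give the limit of (q - 1) /
  \<epsilon>. The inequalities (q - 1) / q \<le> ln q \<le> q - 1 transfer it to the logarithm,
  because q tends to 1.\<close>

lemma ln_scaled:
  fixes q0 :: real
  assumes q0: "0 < q0" and q: "eventually (\<lambda>\<epsilon>. 0 < q \<epsilon>) (at_right 0)"
    and O: "(\<lambda>\<epsilon>. q \<epsilon> - q0 powr \<epsilon>) \<in> O[at_right 0](\<lambda>\<epsilon>. \<epsilon>\<^sup>2)"
  shows "((\<lambda>\<epsilon>. ln (q \<epsilon>) / \<epsilon>) \<longlongrightarrow> ln q0) (at_right 0)"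
proof -
  have "((\<lambda>\<epsilon>. q0 powr \<epsilon>) has_real_derivative ln q0) (at 0)"
    using q0 by (auto intro!: derivative_eq_intros)
  hence "((\<lambda>\<epsilon>. (q0 powr \<epsilon> - 1) / \<epsilon>) \<longlongrightarrow> ln q0) (at 0)" using q0 by (simp add: DERIV_def)
  hence d: "((\<lambda>\<epsilon>. (q0 powr \<epsilon> - 1) / \<epsilon>) \<longlongrightarrow> ln q0) (at_right 0)" by (rule filterlim_mono) (simp_all add: at_le)
  obtain C where C: "eventually (\<lambda>\<epsilon>. norm (q \<epsilon> - q0 powr \<epsilon>) \<le> C * norm (\<epsilon>\<^sup>2)) (at_right 0)" using O by (elim landau_o.bigE)
  have "((\<lambda>\<epsilon>. (q \<epsilon> - q0 powr \<epsilon>) / \<epsilon>) \<longlongrightarrow> 0) (at_right 0)"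
  proof (rule Lim_null_comparison)
    show "((\<lambda>\<epsilon>::real. C * \<epsilon>) \<longlongrightarrow> 0) (at_right 0)" by (auto intro!: tendsto_eq_intros)
    show "eventually (\<lambda>\<epsilon>. norm ((q \<epsilon> - q0 powr \<epsilon>) / \<epsilon>) \<le> C * \<epsilon>) (at_right 0)"
      using C eventually_at_right_less[of 0] by eventually_elim (simp add: abs_divide pos_divide_le_eq power2_eq_square mult.assoc)
  qed
  from tendsto_add[OF d this] have u: "((\<lambda>\<epsilon>. (q \<epsilon> - 1) / \<epsilon>) \<longlongrightarrow> ln q0) (at_right 0)"
    by (simp add: add_divide_distrib[symmetric])
  have "((\<lambda>\<epsilon>::real. \<epsilon>) \<longlongrightarrow> 0) (at_right 0)" by (auto intro!: tendsto_eq_intros)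
  from tendsto_add[OF tendsto_mult[OF u this] tendsto_const[of 1]]
  have "((\<lambda>\<epsilon>. (q \<epsilon> - 1) / \<epsilon> * \<epsilon> + 1) \<longlongrightarrow> 1) (at_right 0)" by simp
  hence q1: "(q \<longlongrightarrow> 1) (at_right 0)"
    by (rule Lim_transform_eventually) (use eventually_at_right_less[of 0] in eventually_elim, simp)
  have l: "((\<lambda>\<epsilon>. (q \<epsilon> - 1) / \<epsilon> / q \<epsilon>) \<longlongrightarrow> ln q0) (at_right 0)" using tendsto_divide[OF u q1] by simp
  show ?thesis
  proof (rule tendsto_sandwich[OF _ _ l u])
    show "eventually (\<lambda>\<epsilon>. (q \<epsilon> - 1) / \<epsilon> / q \<epsilon> \<le> ln (q \<epsilon>) / \<epsilon>) (at_right 0)"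
      using q eventually_at_right_less[of 0]
    proof eventually_elim
      case (elim \<epsilon>)
      have "ln (1 / q \<epsilon>) \<le> 1 / q \<epsilon> - 1" using elim by (intro ln_le_minus_one) simp
      hence "(q \<epsilon> - 1) / q \<epsilon> \<le> ln (q \<epsilon>)" using elim by (simp add: ln_div diff_divide_distrib)
      hence "(q \<epsilon> - 1) / q \<epsilon> / \<epsilon> \<le> ln (q \<epsilon>) / \<epsilon>" using elim by (intro divide_right_mono) auto
      thus ?case by (simp add: mult.commute)
    qed
    show "eventually (\<lambda>\<epsilon>. ln (q \<epsilon>) / \<epsilon> \<le> (q \<epsilon> - 1) / \<epsilon>) (at_right 0)"
      using q eventually_at_right_less[of 0]
      by eventually_elim (intro divide_right_mono ln_le_minus_one, auto)
  qed
qed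

text \<open>For integer positions the half integer threshold turns the strict inequality into
  \<open>\<le> w\<close>.\<close>

lemma height_eq:
  assumes "0 \<le> z"
  shows "height T \<T> z (of_int w + 1 / 2) = card (particles \<T> (int (nat (min z (int T)))) \<inter> {..w})"
proof -
  have "{y \<in> particles \<T> (min z (int T)). real_of_int y < of_int w + 1 / 2} = particles \<T> (min z (int T)) \<inter> {..w}"
  proof -
    have "real_of_int a < of_int w + 1 / 2 \<longleftrightarrow> a \<le> w" for a by linarith
    thus ?thesis by auto
  qed
  thus ?thesis using assms by (simp add: height_def)
qed

theorem theorem7p2p2:
  fixes N\<^sub>0 T\<^sub>0 S\<^sub>0 q\<^sub>0 k\<^sub>0 :: real
    and N T S :: "real \<Rightarrow> nat" and q \<kappa> :: "real \<Rightarrow> real"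
    and x y \<eta> :: real
  assumes "N\<^sub>0 > 0" and "T\<^sub>0 > 0" and "S\<^sub>0 > 0" and "q\<^sub>0 > 0" and "k\<^sub>0 \<ge> 0"
    and "q\<^sub>0 < 1" and "N\<^sub>0 < T\<^sub>0" and "S\<^sub>0 < T\<^sub>0" and "k\<^sub>0\<^sup>2 * q\<^sub>0 powr (- T\<^sub>0) < 1"
    and "\<And>\<epsilon>. \<epsilon> \<in> {0<..<1} \<Longrightarrow> N \<epsilon> \<ge> 1 \<and> S \<epsilon> \<ge> 1 \<and> S \<epsilon> < T \<epsilon>"
    and "\<And>\<epsilon>. \<epsilon> \<in> {0<..<1} \<Longrightarrow> 0 < q \<epsilon> \<and> q \<epsilon> < 1"
    and "\<And>\<epsilon>. \<epsilon> \<in> {0<..<1} \<Longrightarrow> 0 \<le> \<kappa> \<epsilon> \<and> \<kappa> \<epsilon> < q \<epsilon> powr ((real (T \<epsilon>) - 1) / 2)"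
    and "(\<lambda>\<epsilon>. q \<epsilon> - q\<^sub>0 powr \<epsilon>) \<in> O[at_right 0](\<lambda>\<epsilon>. \<epsilon>\<^sup>2)"
    and "(\<lambda>\<epsilon>. real (N \<epsilon>) - N\<^sub>0 / \<epsilon>) \<in> O[at_right 0](\<lambda>_. 1)"
    and "(\<lambda>\<epsilon>. real (T \<epsilon>) - T\<^sub>0 / \<epsilon>) \<in> O[at_right 0](\<lambda>_. 1)"
    and "(\<lambda>\<epsilon>. real (S \<epsilon>) - S\<^sub>0 / \<epsilon>) \<in> O[at_right 0](\<lambda>_. 1)"
    and "(\<lambda>\<epsilon>. \<kappa> \<epsilon> - k\<^sub>0) \<in> O[at_right 0](\<lambda>\<epsilon>. \<epsilon>)"
    and "(x, y) \<in> limit_hexagon N\<^sub>0 T\<^sub>0 S\<^sub>0"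
    and "\<eta> > 0"
  shows "((\<lambda>\<epsilon>. measure (tiling_measure (N \<epsilon>) (T \<epsilon> - S \<epsilon>) (S \<epsilon>) (q \<epsilon>) (\<kappa> \<epsilon>))
            {\<T> \<in> lozenge_tilings (N \<epsilon>) (T \<epsilon> - S \<epsilon>) (S \<epsilon>).
               \<bar>\<epsilon> * real (height (T \<epsilon>) \<T> \<lfloor>x / \<epsilon>\<rfloor> (real_of_int \<lfloor>y / \<epsilon>\<rfloor> + 1 / 2))
                 - limit_height N\<^sub>0 T\<^sub>0 S\<^sub>0 q\<^sub>0 k\<^sub>0 x y\<bar> > \<eta>})
          \<longlongrightarrow> 0) (at_right 0)"
proof -
  \<comment> \<open>Near the right side of the hexagon the floor may exceed \<open>T\<close>; the
    height is then read on the last line, hence the minimum.\<close>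
  define tt where "tt = (\<lambda>\<epsilon>. nat (min \<lfloor>x / \<epsilon>\<rfloor> (int (T \<epsilon>))))"
  define LL0 where "LL0 = max 0 (x + S\<^sub>0 - T\<^sub>0)"
  define UU0 where "UU0 = min x S\<^sub>0 + N\<^sub>0"
  have xy: "0 \<le> x" "x \<le> T\<^sub>0" "LL0 \<le> y" "y \<le> UU0"
    using assms(18) by (simp_all add: limit_hexagon_def LL0_def UU0_def)
  have pos: "eventually (\<lambda>\<epsilon>::real. 0 < \<epsilon>) (at_right 0)" by (rule eventually_at_right_less)
  have range: "eventually (\<lambda>\<epsilon>::real. \<epsilon> \<in> {0<..<1}) (at_right 0)" by (rule eventually_at_right_real) simp
  note limN = bigo_one_scaled[OF assms(14)] and limT = bigo_one_scaled[OF assms(15)] and limS = bigo_one_scaled[OF assms(16)]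
  note limk = bigo_id_tendsto[OF assms(17)]
  have q_pos: "eventually (\<lambda>\<epsilon>. 0 < q \<epsilon>) (at_right 0)" using range by eventually_elim (use assms(11) in blast)
  note limq = ln_scaled[OF assms(4) q_pos assms(13)]
  have limt: "((\<lambda>\<epsilon>. \<epsilon> * real (tt \<epsilon>)) \<longlongrightarrow> x) (at_right 0)"
  proof (rule Lim_transform_eventually)
    show "((\<lambda>\<epsilon>. min (\<epsilon> * of_int \<lfloor>x / \<epsilon>\<rfloor>) (\<epsilon> * real (T \<epsilon>))) \<longlongrightarrow> x) (at_right 0)"
      using tendsto_min[OF floor_scaled_at_right[of x] limT] xy by (simp add: min_def split: if_splits)
    show "eventually (\<lambda>\<epsilon>. min (\<epsilon> * of_int \<lfloor>x / \<epsilon>\<rfloor>) (\<epsilon> * real (T \<epsilon>)) = \<epsilon> * real (tt \<epsilon>)) (at_right 0)"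
      using pos
    proof eventually_elim
      case (elim \<epsilon>)
      have "0 \<le> \<lfloor>x / \<epsilon>\<rfloor>" using xy elim by simp
      hence "real (tt \<epsilon>) = min (of_int \<lfloor>x / \<epsilon>\<rfloor>) (real (T \<epsilon>))" by (simp add: tt_def of_int_min)
      thus ?case using elim by (auto simp: min_def)
    qed
  qed
  \<comment> \<open>The hypothesis at fixed \<epsilon> gives \<kappa>^2 < q^(T-1), one power of q
    short of \<open>q_weights\<close>. For small \<epsilon> the stronger bound follows from the
    strict limiting inequality k0^2 < q0^T0.\<close>
  have kq: "eventually (\<lambda>\<epsilon>. (\<kappa> \<epsilon>)\<^sup>2 < q \<epsilon> powi int (T \<epsilon>)) (at_right 0)"
  proof -
    have "((\<lambda>\<epsilon>. exp ((\<epsilon> * real (T \<epsilon>)) * (ln (q \<epsilon>) / \<epsilon>)) - (\<kappa> \<epsilon>)\<^sup>2) \<longlongrightarrow> exp (T\<^sub>0 * ln q\<^sub>0) - k\<^sub>0\<^sup>2) (at_right 0)"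
      by (intro tendsto_intros limT limq limk)
    moreover have "exp (T\<^sub>0 * ln q\<^sub>0) - k\<^sub>0\<^sup>2 > 0"
      using assms(4,9) by (simp add: powr_def exp_minus field_simps)
    ultimately have "eventually (\<lambda>\<epsilon>. 0 < exp ((\<epsilon> * real (T \<epsilon>)) * (ln (q \<epsilon>) / \<epsilon>)) - (\<kappa> \<epsilon>)\<^sup>2) (at_right 0)"
      by (rule order_tendstoD(1))
    thus ?thesis using pos q_pos
    proof eventually_elim
      case (elim \<epsilon>)
      have "exp ((\<epsilon> * real (T \<epsilon>)) * (ln (q \<epsilon>) / \<epsilon>)) = q \<epsilon> ^ T \<epsilon>"
        using elim by (simp add: powr_def flip: powr_realpow)
      thus ?case using elim(1) by simp
    qed
  qed
  have good: "eventually (\<lambda>\<epsilon>. 0 < \<epsilon> \<and> q_tilings (q \<epsilon>) (\<kappa> \<epsilon>) (N \<epsilon>) (T \<epsilon>) (S \<epsilon>)) (at_right 0)"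
    using range kq
  proof eventually_elim
    case (elim \<epsilon>)
    thus ?case using assms(10)[OF elim(1)] assms(11)[OF elim(1)] assms(12)[OF elim(1)]
      by (auto simp: q_tilings_def q_tilings_axioms_def q_weights_def)
  qed
  show ?thesis
    unfolding tendsto_at_iff_sequentially
  proof (intro allI impI)
    fix X :: "nat \<Rightarrow> real" assume X: "\<forall>i. X i \<in> {0<..} - {0}" "X \<longlonglongrightarrow> 0"
    have Xf: "filterlim X (at_right 0) sequentially"
      using X by (intro tendsto_imp_filterlim_at_right) auto
    obtain i0 where i0: "\<And>i. i \<ge> i0 \<Longrightarrow> 0 < X i \<and> q_tilings (q (X i)) (\<kappa> (X i)) (N (X i)) (T (X i)) (S (X i))"
      using filterlim_iff[THEN iffD1, OF Xf, rule_format, OF good] unfolding eventually_sequentially by blast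
    \<comment> \<open>\<open>scaling\<close> demands its assumptions at every index, so the sequence
      is shifted beyond the index from which they hold; this does not affect the limit.\<close>
    define e where "e = (\<lambda>n. X (n + i0))"
    have ef: "filterlim e (at_right 0) sequentially"
      unfolding e_def by (rule filterlim_compose[OF Xf filterlim_add_const_nat_at_top])
    have e: "0 < e n \<and> q_tilings (q (e n)) (\<kappa> (e n)) (N (e n)) (T (e n)) (S (e n))" for n unfolding e_def by (rule i0) simp
    have fl: "0 \<le> \<lfloor>x / e n\<rfloor>" for n using e[of n] xy by simp
    have sc: "scaling e (\<lambda>n. q (e n)) (\<lambda>n. \<kappa> (e n)) (\<lambda>n. N (e n)) (\<lambda>n. T (e n)) (\<lambda>n. S (e n)) (\<lambda>n. tt (e n)) N\<^sub>0 T\<^sub>0 S\<^sub>0 q\<^sub>0 k\<^sub>0 x"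
    proof (rule scaling.intro)
      show "e \<longlonglongrightarrow> 0" using X(2) unfolding e_def by (rule LIMSEQ_ignore_initial_segment)
      show "tt (e n) \<le> T (e n)" for n by (simp add: tt_def nat_le_iff)
      show "e n > 0" "q_tilings (q (e n)) (\<kappa> (e n)) (N (e n)) (T (e n)) (S (e n))" for n using e by simp_all
      show "(\<lambda>n. e n * real (N (e n))) \<longlonglongrightarrow> N\<^sub>0" by (rule filterlim_compose[OF limN ef])
      show "(\<lambda>n. e n * real (T (e n))) \<longlonglongrightarrow> T\<^sub>0" by (rule filterlim_compose[OF limT ef])
      show "(\<lambda>n. e n * real (S (e n))) \<longlonglongrightarrow> S\<^sub>0" by (rule filterlim_compose[OF limS ef])
      show "(\<lambda>n. e n * real (tt (e n))) \<longlonglongrightarrow> x" by (rule filterlim_compose[OF limt ef])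
      show "(\<lambda>n. \<kappa> (e n)) \<longlonglongrightarrow> k\<^sub>0" by (rule filterlim_compose[OF limk ef])
      show "(\<lambda>n. ln (q (e n)) / e n) \<longlonglongrightarrow> ln q\<^sub>0" by (rule filterlim_compose[OF limq ef])
    qed (use assms(1-9) xy in simp_all)
    have LU: "scaling.LL0 T\<^sub>0 S\<^sub>0 x = LL0" "scaling.UU0 N\<^sub>0 S\<^sub>0 x = UU0"
      by (simp_all add: scaling.LL0_def[OF sc] scaling.UU0_def[OF sc] LL0_def UU0_def)
    have lh: "limit_height N\<^sub>0 T\<^sub>0 S\<^sub>0 q\<^sub>0 k\<^sub>0 x y = (\<integral>r. indicator {LL0<..<y} r * (shape_phi N\<^sub>0 T\<^sub>0 S\<^sub>0 q\<^sub>0 k\<^sub>0 x r / pi) \<partial>lborel)"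
      using limit_height_lborel xy(3) unfolding LL0_def by blast
    have "(\<lambda>n. measure (tiling_measure (N (e n)) (T (e n) - S (e n)) (S (e n)) (q (e n)) (\<kappa> (e n)))
            {\<T> \<in> lozenge_tilings (N (e n)) (T (e n) - S (e n)) (S (e n)).
               \<bar>e n * real (height (T (e n)) \<T> \<lfloor>x / e n\<rfloor> (real_of_int \<lfloor>y / e n\<rfloor> + 1 / 2))
                 - limit_height N\<^sub>0 T\<^sub>0 S\<^sub>0 q\<^sub>0 k\<^sub>0 x y\<bar> > \<eta>}) \<longlonglongrightarrow> 0"
      unfolding height_eq[OF fl] lh
      using scaling.slice_limit[OF sc, unfolded LU, OF xy(3,4) assms(19)] unfolding tt_def .
    thus "((\<lambda>\<epsilon>. measure (tiling_measure (N \<epsilon>) (T \<epsilon> - S \<epsilon>) (S \<epsilon>) (q \<epsilon>) (\<kappa> \<epsilon>))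
            {\<T> \<in> lozenge_tilings (N \<epsilon>) (T \<epsilon> - S \<epsilon>) (S \<epsilon>).
               \<bar>\<epsilon> * real (height (T \<epsilon>) \<T> \<lfloor>x / \<epsilon>\<rfloor> (real_of_int \<lfloor>y / \<epsilon>\<rfloor> + 1 / 2))
                 - limit_height N\<^sub>0 T\<^sub>0 S\<^sub>0 q\<^sub>0 k\<^sub>0 x y\<bar> > \<eta>}) \<circ> X) \<longlonglongrightarrow> 0"
      unfolding comp_def e_def by (rule LIMSEQ_offset[of _ i0])
  qed
qed

end
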